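(* Let $X_n$, $D_n$, $N=N(n)$ and $B_n=\frac1N(D_n\circ X_n)(D_n\circ X_n)^*$ satisfy all the assumptions listed in the context, let $d_\epsilon\ge M_\epsilon$ be chosen for each $\epsilon>0$, and let $\widetilde d^{\,n}_{jk}$ and the probability distribution functions $F^0_{n,\epsilon}$ be defined as in the context. Then, with probability one, there exists a (random) sequence $\{\epsilon_n\}$ such that $$\lim_{n\to\infty}D(F^{B_n},F^0_{n,\epsilon_n})=0.$$
   Context: Matrices. For each positive integer $n$, $N=N(n)$ is a positive integer with $0<\liminf_n n/N\le\limsup_n n/N<\infty$. $X_n=(x^{(n)}_{jk})$ is an $n\times N$ matrix of independent complex random variables with $\mathbb E x^{(n)}_{jk}=0$ and $\mathbb E|x^{(n)}_{jk}|^2=1$. $D_n=(d^n_{jk})$ is an $n\times N$ matrix of nonrandom nonnegative real numbers. $\circ$ denotes the Hadamard (entrywise) product, $^*$ the conjugate transpose, and $B_n=\frac1N(D_n\circ X_n)(D_n\circ X_n)^*$, which is $n\times n$. $I(\cdot)$ denotes the indicator. Assumptions on $X_n$. For each $\eta>0$, $$\lim_{n\to\infty}\frac1{nN}\sum_{j=1}^n\sum_{k=1}^N\mathbb E|x^{(n)}_{jk}|^2I(|x^{(n)}_{jk}|\ge\eta\sqrt n)=0 .$$ From this one can construct, and one fixes, a sequence of positive numbers $\eta_n\downarrow0$ with $$\lim_{n\to\infty}\frac1{\eta_n^2nN}\sum_{j=1}^n\sum_{k=1}^N\mathbb E|x^{(n)}_{jk}|^2I(|x^{(n)}_{jk}|\ge\eta_n\sqrt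 n)=0 .$$ It is also assumed that there exist positive $e$ and $f$ such that for all $n$ sufficiently large (and all $j,k$) $$e<\eta_n\sqrt n\quad\text{and}\quad \mathbb E\left|x^{(n)}_{jk}I(|x^{(n)}_{jk}|\le e)-\mathbb E\big(x^{(n)}_{jk}I(|x^{(n)}_{jk}|\le e)\big)\right|^2>f .$$ Assumptions on $D_n$. Each column of $D_n$ is nonzero. For every $\epsilon>0$ there exists $M_\epsilon>0$ such that for each $n$ there exist sets $E^n_{r\epsilon}\subset\{1,\dots,n\}$ and $E^n_{c\epsilon}\subset\{1,\dots,N\}$ such that (1) $\#E^n_{r\epsilon}+\#E^n_{c\epsilon}\le\epsilon n$, where $\#$ denotes the number of elements; and (2) $d^n_{jk}\le M_\epsilon$ for all $j\in\{1,\dots,n\}\setminus E^n_{r\epsilon}$ and $k\in\{1,\dots,N\}\setminus E^n_{c\epsilon}$. Notation. $\mathbb C^+=\{z\in\mathbb C:\Im z>0\}$. For a Hermitian $n\times n$ matrix $A$, $F^A(x)=\frac1n\#\{\text{eigenvalues of }A\text{ that are }\le x\}$ (counted with multiplicity), $x\in\mathbb R$. The Stieltjes transform of a finite measure $\mu$ on $\mathbb R$ (or of its distribution function) is $m_\mu(z)=\int\frac{1}{x-z}\,d\mu(x)$, $z\in\mathbb C^+$. The distribution functions $F^0_{n,\epsilon}$. For $\epsilon>0$ and the chosen $d_\epsilon\ge M_\epsilon$, put $\widetilde d^{\,n}_{jk}=\widetilde d^{\,n\epsilon}_{jk}=d^n_{jk}I(d^n_{jk}\le d_\epsilon)$. $F^0_{n,\epsilon}$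 is the probability distribution function having Stieltjes transform $$G_n(z)=\frac1n\sum_{i=1}^n\frac{1}{\frac1N\sum_{k=1}^N\frac{(\widetilde d^{\,n}_{ik})^2}{1+\frac nN e^0_k(z)}-z},\qquad z\in\mathbb C^+,$$ where, for each $z\in\mathbb C^+$, $e^0_k=e^0_{n,k}(z)$, $k=1,\dots,N$, are unique solutions lying in $\mathbb C^+$ to the system of equations $$e^0_j(z)=\frac1n\sum_{i=1}^n\frac{(\widetilde d^{\,n}_{ij})^2}{\frac1N\sum_{k=1}^N\frac{(\widetilde d^{\,n}_{ik})^2}{1+\frac nN e^0_k(z)}-z},\qquad j=1,\dots,N.$$ Metric $D$. For distribution functions $F,G$ of sub-probability measures on $\mathbb R$, $$D(F,G)=\sum_{i=1}^\infty\left|\int f_i\,dF-\int f_i\,dG\right|2^{-i},$$ where $\{f_i\}$ is an enumeration of all continuous functions which, for some positive integer $m$ and some interval $[a,b]$ with $a,b$ rational, take the constant value $\frac1m$ on $[a,b]$, are $0$ on $(-\infty,a-\frac1m]\cup[b+\frac1m,\infty)$, and are linear on each of $[a-\frac1m,a]$ and $[b,b+\frac1m]$.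
   Formalization: A column of the truncated matrix may be zero, which forces e_j^0 = 0, so no solution with all components in C^+ exists; lying in C^+ is required only of e_j^0 for nonzero truncated columns. A zero column's component enters neither the other equations nor G_n. *)

theory Defs
  imports
    "HOL-Probability.Probability"
    "Jordan_Normal_Form.Schur_Decomposition"
begin

(* mat, vec, col and $ are those of Jordan_Normal_Form, not of HOL-Analysis. *)

no_notation vec_nth (infixl "$" 90)

definition hadamard_mat :: "'a :: times mat \<Rightarrow> 'a mat \<Rightarrow> 'a mat" where
  "hadamard_mat A B =
     Matrix.mat (dim_row A) (dim_col A) (\<lambda>(j, k). A $$ (j, k) * B $$ (j, k))"

definition sample_mat :: "real mat \<Rightarrow> complex mat \<Rightarrow> complex mat" where
  "sample_mat D X =
     (let Y = hadamard_mat (map_mat complex_of_real D) X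
      in (1 / of_nat (dim_col D)) \<cdot>\<^sub>m (Y * mat_adjoint Y))"

definition trunc_mat :: "real \<Rightarrow> real mat \<Rightarrow> real mat" where
  "trunc_mat c D = map_mat (\<lambda>x. x * of_bool (x \<le> c)) D"

(* The multiset of roots of the characteristic polynomial lists the eigenvalues with
   multiplicity. It is only meant for Hermitian A, whose eigenvalues are real. *)

definition spectral_df :: "complex mat \<Rightarrow> real \<Rightarrow> real" where
  "spectral_df A x =
     real (size {#l \<in># proots (char_poly A). Re l \<le> x#}) / real (dim_row A)"

definition stieltjes_transform :: "real measure \<Rightarrow> complex \<Rightarrow> complex" where
  "stieltjes_transform \<mu> z = (LINT x|\<mu>. 1 / (complex_of_real x - z))"

definition row_term :: "real mat \<Rightarrow> complex vec \<Rightarrow> complex \<Rightarrow> nat \<Rightarrow> complex" where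
  "row_term A e z i =
     (let n = of_nat (dim_row A); N = of_nat (dim_col A)
      in 1 / N * (\<Sum>k<dim_col A. complex_of_real ((A $$ (i, k))\<^sup>2) / (1 + n / N * e $ k)) - z)"

(* A zero column of A forces the corresponding component of e to vanish, so membership in the
   open upper half plane is only asked for the other components. A component belonging
   to a zero column occurs in no other equation. Zero columns can arise from trunc_mat even if
   the original matrix has none. *)

definition system_solution :: "real mat \<Rightarrow> complex \<Rightarrow> complex vec \<Rightarrow> bool" where
  "system_solution A z e \<longleftrightarrow>
     e \<in> carrier_vec (dim_col A) \<and>
     (\<forall>j<dim_col A. e $ j =
        1 / of_nat (dim_row A) *
          (\<Sum>i<dim_row A. complex_of_real ((A $$ (i, j))\<^sup>2) / row_term A e z i)) \<and>
     (\<forall>j<dim_col A. col A j \<noteq> 0\<^sub>v (dim_row A) \<longrightarrow> Im (e $ j) > 0)"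

definition e0 :: "real mat \<Rightarrow> complex \<Rightarrow> complex vec" where
  "e0 A z = (THE e. system_solution A z e)"

definition G0 :: "real mat \<Rightarrow> complex \<Rightarrow> complex" where
  "G0 A z = 1 / of_nat (dim_row A) * (\<Sum>i<dim_row A. 1 / row_term A (e0 A z) z i)"

definition F0 :: "real mat \<Rightarrow> real \<Rightarrow> real" where
  "F0 A = cdf (THE \<mu>. real_distribution \<mu> \<and>
                  (\<forall>z. Im z > 0 \<longrightarrow> stieltjes_transform \<mu> z = G0 A z))"

definition affine_on :: "real set \<Rightarrow> (real \<Rightarrow> real) \<Rightarrow> bool" where
  "affine_on S f \<longleftrightarrow> (\<exists>p q. \<forall>x\<in>S. f x = p * x + q)"

definition test_functions :: "(real \<Rightarrow> real) set" where
  "test_functions = {f. continuous_on UNIV f \<and>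
     (\<exists>m::nat. \<exists>a\<in>\<rat>. \<exists>b\<in>\<rat>. m \<ge> 1 \<and> a < b \<and>
        (\<forall>x\<in>{a..b}. f x = 1 / real m) \<and>
        (\<forall>x\<in>{..a - 1 / real m} \<union> {b + 1 / real m..}. f x = 0) \<and>
        affine_on {a - 1 / real m..a} f \<and> affine_on {b..b + 1 / real m} f)}"

(* The enumeration f is indexed from 1; f 0 is not used. *)

definition df_metric ::
    "(nat \<Rightarrow> real \<Rightarrow> real) \<Rightarrow> (real \<Rightarrow> real) \<Rightarrow> (real \<Rightarrow> real) \<Rightarrow> real" where
  "df_metric f F G =
     (\<Sum>i. \<bar>(LINT x|interval_measure F. f (Suc i) x) -
            (LINT x|interval_measure G. f (Suc i) x)\<bar> * (1 / 2) ^ Suc i)"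

end

theory Submission
  imports Defs "HOL-Complex_Analysis.Complex_Analysis"
begin

text \<open>Write \<open>m\<close> for the Stieltjes transform of the spectral distribution of \<open>B\<^sub>n\<close>, that is
\<open>1/n\<close> times the trace of the resolvent \<open>(B\<^sub>n - z)\<^sup>-\<^sup>1\<close>. Three ingredients carry the proof.

First, altering one column or one row of a matrix \<open>Y\<close> changes the trace of the resolvent of \<open>Y Y\<^sup>*\<close> by at
most \<open>2 / Im z\<close>, whatever the entries are (\<open>gram_perturbation_trace\<close>). So the entries of \<open>D\<^sub>n\<close> in the
\<open>\<epsilon> n\<close> exceptional rows and columns may be replaced at the cost of \<open>2 \<epsilon> / Im z\<close> in \<open>m\<close>, uniformly in
\<open>n\<close>. This allows passing from \<open>D\<^sub>n\<close> to its truncation, whose entries are bounded. The same bound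
makes \<open>m\<close> a function of independent columns with bounded differences; its fourth central moment is of order
\<open>n\<^sup>-\<^sup>2\<close>, and \<open>m - E m\<close> tends to zero almost surely (\<open>fluctuations_vanish\<close>).

Second, for a bounded profile the mean diagonal entries of the resolvent satisfy the system of equations defining
\<open>e\<^sub>k\<^sup>0\<close> up to a small error (\<open>self_consistent_equation\<close>, \<open>model_equations\<close>). Removing column \<open>k\<close> from the
resolvent makes it independent of that column, and the quadratic form of the column then concentrates around a
weighted trace (\<open>quadratic_form_concentration\<close>). The entries have only two moments; their squares are cut
at the level \<open>h sqrt n\<close>, and the Lindeberg condition controls the rest. Far from the real axis the system is a
contraction (\<open>stability\<close>), so there \<open>E m\<close> is close to \<open>G0\<close>; by Montel's theorem and the identity theorem the
convergence extends to the whole upper half plane (\<open>stieltjes_convergence_extends\<close>).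

Third, the system has exactly one solution at every \<open>z\<close>, and \<open>G0\<close> is the transform of a probability measure.
Uniqueness compares two solutions with the geometric mean of their imaginary parts
(\<open>system_solution_unique\<close>). Existence is itself obtained from random matrices: the profile is tiled into a
large one, random signs serve as entries, the mean resolvent gives approximate solutions of the original system, and
limit points of these are solutions (\<open>deterministic_limit\<close>, \<open>deterministic_equivalent\<close>).

Convergence of Stieltjes transforms is turned into convergence in the metric by smoothing the test functions with the
Poisson kernel (\<open>bump_difference_bound\<close>). Together, for each rational \<open>\<epsilon>\<close> of the form \<open>1/k\<close>, the distance between
\<open>F\<close> of \<open>B\<^sub>n\<close> and \<open>F0\<close> of the truncated profile is almost surely at most a quantity that vanishes with
\<open>\<epsilon>\<close>, plus a null sequence; choosing \<open>\<epsilon>\<^sub>n\<close> nearly optimal for each \<open>n\<close> gives the claim.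
\<close>

no_notation vec_nth (infixl "$" 90)
no_notation fps_nth (infixl "$" 75)

section \<open>Resolvents of Hermitian matrices\<close>

text \<open>An \<open>n\<close> by \<open>n\<close> matrix is a function on pairs of naturals of which only the values below \<open>n\<close>
  count. The dimension can then vary freely, and rank one changes are pointwise sums.\<close>
definition hermitian :: "nat \<Rightarrow> (nat \<Rightarrow> nat \<Rightarrow> complex) \<Rightarrow> bool" where
  "hermitian n H \<longleftrightarrow> (\<forall>i<n. \<forall>j<n. H i j = cnj (H j i))"

definition qform :: "nat \<Rightarrow> (nat \<Rightarrow> nat \<Rightarrow> complex) \<Rightarrow> (nat \<Rightarrow> complex) \<Rightarrow> complex" where
  "qform n H x = (\<Sum>i<n. \<Sum>j<n. cnj (x i) * H i j * x j)"

definition sqnorm :: "nat \<Rightarrow> (nat \<Rightarrow> complex) \<Rightarrow> real" where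
  "sqnorm n x = (\<Sum>i<n. (cmod (x i))\<^sup>2)"

definition shifted_mat :: "nat \<Rightarrow> (nat \<Rightarrow> nat \<Rightarrow> complex) \<Rightarrow> complex \<Rightarrow> complex mat" where
  "shifted_mat n H z = Matrix.mat n n (\<lambda>(i, j). H i j - (if i = j then z else 0))"

text \<open>The entries of \<open>(H - z)\<^sup>-\<^sup>1\<close> by Cramer's rule; in this form their measurability in the entries of
  \<open>H\<close> is immediate.\<close>
definition resolvent ::
    "nat \<Rightarrow> (nat \<Rightarrow> nat \<Rightarrow> complex) \<Rightarrow> complex \<Rightarrow> nat \<Rightarrow> nat \<Rightarrow> complex" where
  "resolvent n H z i j =
     adj_mat (shifted_mat n H z) $$ (i, j) / Determinant.det (shifted_mat n H z)"

lemma sqnorm_nonneg [simp]: "sqnorm n x \<ge> 0"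
  by (simp add: sqnorm_def sum_nonneg)

lemma sqnorm_cnj [simp]: "sqnorm n (\<lambda>i. cnj (x i)) = sqnorm n x"
  by (simp add: sqnorm_def)

lemma sqnorm_eq_0: "sqnorm n x = 0 \<longleftrightarrow> (\<forall>i<n. x i = 0)"
  by (auto simp: sqnorm_def sum_nonneg_eq_0_iff)

lemma complex_of_sqnorm: "complex_of_real (sqnorm n x) = (\<Sum>i<n. cnj (x i) * x i)"
  by (simp add: sqnorm_def complex_norm_square mult.commute del: of_real_power)

lemma cauchy_schwarz_complex:
  "(cmod (\<Sum>i<n. x i * y i))\<^sup>2 \<le> sqnorm n x * sqnorm n y"
proof -
  have "cmod (\<Sum>i<n. x i * y i) \<le> (\<Sum>i<n. \<bar>cmod (x i)\<bar> * \<bar>cmod (y i)\<bar>)"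
    by (rule order_trans[OF norm_sum]) (simp add: norm_mult)
  also have "\<dots> \<le> L2_set (\<lambda>i. cmod (x i)) {..<n} * L2_set (\<lambda>i. cmod (y i)) {..<n}"
    by (rule L2_set_mult_ineq)
  finally have "(cmod (\<Sum>i<n. x i * y i))\<^sup>2 \<le>
      (L2_set (\<lambda>i. cmod (x i)) {..<n} * L2_set (\<lambda>i. cmod (y i)) {..<n})\<^sup>2"
    by (intro power_mono) auto
  also have "\<dots> = sqnorm n x * sqnorm n y"
    by (simp add: power_mult_distrib L2_set_def sqnorm_def sum_nonneg)
  finally show ?thesis .
qed

lemma hermitianD: "hermitian n H \<Longrightarrow> i < n \<Longrightarrow> j < n \<Longrightarrow> cnj (H i j) = H j i"
  unfolding hermitian_def by (metis complex_cnj_cnj)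

lemma qform_real:
  assumes "hermitian n H"
  shows "cnj (qform n H x) = qform n H x"
proof -
  have "cnj (qform n H x) = (\<Sum>i<n. \<Sum>j<n. cnj (x j) * H j i * x i)"
    unfolding qform_def cnj_sum
    by (intro sum.cong refl) (use assms in \<open>auto simp: hermitianD\<close>)
  also have "\<dots> = qform n H x"
    unfolding qform_def by (rule sum.swap)
  finally show ?thesis .
qed

lemma Im_qform [simp]: "hermitian n H \<Longrightarrow> Im (qform n H x) = 0"
  using qform_real[of n H x] by (metis Im_complex_of_real Reals_cases Reals_cnj_iff)

text \<open>Pair a solution \<open>x\<close> of \<open>(H - z) x = y\<close> with \<open>y\<close>. As the form of a Hermitian matrix is real,
  the imaginary part of the pairing is \<open>Im z\<close> times the squared length of \<open>x\<close>. Invertibility off the real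
  axis and all bounds on the resolvent are read off from this.\<close>
lemma energy_identity:
  assumes H: "hermitian n H" and x: "\<And>i. i < n \<Longrightarrow> (\<Sum>j<n. H i j * x j) = z * x i + y i"
  shows "(\<Sum>i<n. cnj (y i) * x i) = qform n H x - cnj z * of_real (sqnorm n x)"
proof -
  have "qform n H x = (\<Sum>i<n. cnj (x i) * (\<Sum>j<n. H i j * x j))"
    by (simp add: qform_def sum_distrib_left mult.assoc)
  also have "\<dots> = (\<Sum>i<n. cnj (x i) * (z * x i + y i))"
    by (intro sum.cong refl) (use x in auto)
  also have "\<dots> = z * of_real (sqnorm n x) + (\<Sum>i<n. cnj (x i) * y i)"
    by (simp add: complex_of_sqnorm algebra_simps sum.distrib sum_distrib_left)
  finally have "cnj (qform n H x) = cnj (z * of_real (sqnorm n x) + (\<Sum>i<n. cnj (x i) * y i))"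
    by simp
  then show ?thesis
    unfolding qform_real[OF H] by (simp add: cnj_sum mult.commute)
qed

lemma hermitian_kernel:
  assumes H: "hermitian n H" and z: "Im z \<noteq> 0"
    and x: "\<And>i. i < n \<Longrightarrow> (\<Sum>j<n. H i j * x j) = z * x i" and "i < n"
  shows "x i = 0"
proof -
  have "0 = qform n H x - cnj z * of_real (sqnorm n x)"
    using energy_identity[OF H, of x z "\<lambda>_. 0"] x by simp
  then have "Im (qform n H x - cnj z * of_real (sqnorm n x)) = 0"
    by (metis zero_complex.simps(2))
  then have "sqnorm n x = 0"
    using z H by simp
  then show ?thesis
    using \<open>i < n\<close> by (simp add: sqnorm_eq_0)
qed

lemma det_shifted_mat:
  assumes H: "hermitian n H" and z: "Im z \<noteq> 0"
  shows "Determinant.det (shifted_mat n H z) \<noteq> 0"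
proof
  have C: "shifted_mat n H z \<in> carrier_mat n n"
    by (simp add: shifted_mat_def)
  assume "Determinant.det (shifted_mat n H z) = 0"
  then obtain v where v: "v \<in> carrier_vec n" "v \<noteq> 0\<^sub>v n"
    "shifted_mat n H z *\<^sub>v v = 0\<^sub>v n"
    using det_0_iff_vec_prod_zero[OF C] by auto
  have "v $ i = 0" if "i < n" for i
  proof (rule hermitian_kernel[OF H z _ that])
    fix i assume i: "i < n"
    have "0 = (shifted_mat n H z *\<^sub>v v) $ i"
      using v i by simp
    also have "\<dots> = (\<Sum>j<n. (H i j - (if i = j then z else 0)) * v $ j)"
      using i v(1) by (simp add: shifted_mat_def scalar_prod_def atLeast0LessThan)
    also have "\<dots> = (\<Sum>j<n. H i j * v $ j) - (\<Sum>j<n. if i = j then z * v $ j else 0)"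
      unfolding sum_subtractf[symmetric] by (intro sum.cong refl) (auto simp: left_diff_distrib)
    finally show "(\<Sum>j<n. H i j * v $ j) = z * v $ i"
      using i by simp
  qed
  then have "v = 0\<^sub>v n"
    using v(1) by (intro eq_vecI) auto
  with v show False by simp
qed

lemma resolvent_right:
  assumes H: "hermitian n H" and z: "Im z \<noteq> 0" and i: "i < n" and j: "j < n"
  shows "(\<Sum>l<n. H i l * resolvent n H z l j) = z * resolvent n H z i j + (if i = j then 1 else 0)"
proof -
  let ?A = "shifted_mat n H z"
  have C: "?A \<in> carrier_mat n n"
    by (simp add: shifted_mat_def)
  note adj = adj_mat[OF C]
  have "(?A * adj_mat ?A) $$ (i, j) = (\<Sum>l<n. ?A $$ (i, l) * adj_mat ?A $$ (l, j))"
    using C adj(1) i j by (simp add: scalar_prod_def atLeast0LessThan)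
  then have "(\<Sum>l<n. ?A $$ (i, l) * adj_mat ?A $$ (l, j)) = (if i = j then Determinant.det ?A else 0)"
    unfolding adj(2) using i j by (cases "i = j") simp_all
  then have "(\<Sum>l<n. ?A $$ (i, l) * resolvent n H z l j) = (if i = j then 1 else 0)"
    using det_shifted_mat[OF H z] by (simp add: resolvent_def sum_divide_distrib[symmetric])
  also have "(\<Sum>l<n. ?A $$ (i, l) * resolvent n H z l j) =
      (\<Sum>l<n. H i l * resolvent n H z l j) - (\<Sum>l<n. if i = l then z * resolvent n H z l j else 0)"
    unfolding sum_subtractf[symmetric] using i
    by (intro sum.cong refl) (auto simp: shifted_mat_def algebra_simps)
  finally show ?thesis using i by (simp add: algebra_simps)
qed

lemma resolvent_left:
  assumes H: "hermitian n H" and z: "Im z \<noteq> 0" and i: "i < n" and j: "j < n"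
  shows "(\<Sum>l<n. resolvent n H z i l * H l j) = z * resolvent n H z i j + (if i = j then 1 else 0)"
proof -
  let ?A = "shifted_mat n H z"
  have C: "?A \<in> carrier_mat n n"
    by (simp add: shifted_mat_def)
  note adj = adj_mat[OF C]
  have "(adj_mat ?A * ?A) $$ (i, j) = (\<Sum>l<n. adj_mat ?A $$ (i, l) * ?A $$ (l, j))"
    using C adj(1) i j by (simp add: scalar_prod_def atLeast0LessThan)
  then have "(\<Sum>l<n. adj_mat ?A $$ (i, l) * ?A $$ (l, j)) = (if i = j then Determinant.det ?A else 0)"
    unfolding adj(3) using i j by (cases "i = j") simp_all
  then have "(\<Sum>l<n. resolvent n H z i l * ?A $$ (l, j)) = (if i = j then 1 else 0)"
    using det_shifted_mat[OF H z] by (simp add: resolvent_def sum_divide_distrib[symmetric])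
  also have "(\<Sum>l<n. resolvent n H z i l * ?A $$ (l, j)) =
      (\<Sum>l<n. resolvent n H z i l * H l j) - (\<Sum>l<n. if l = j then z * resolvent n H z i l else 0)"
    unfolding sum_subtractf[symmetric] using j
    by (intro sum.cong refl) (auto simp: shifted_mat_def algebra_simps)
  finally show ?thesis using j by (simp add: algebra_simps)
qed

text \<open>\<open>rapp\<close> is the vector \<open>(H - z)\<^sup>-\<^sup>1 y\<close> and \<open>lapp\<close> the row vector \<open>y\<^sup>*
  (H - z)\<^sup>-\<^sup>1\<close>.\<close>
definition rapp :: "nat \<Rightarrow> (nat \<Rightarrow> nat \<Rightarrow> complex) \<Rightarrow> complex \<Rightarrow> (nat \<Rightarrow> complex) \<Rightarrow> nat \<Rightarrow> complex"
  where "rapp n H z y i = (\<Sum>j<n. resolvent n H z i j * y j)"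

definition lapp :: "nat \<Rightarrow> (nat \<Rightarrow> nat \<Rightarrow> complex) \<Rightarrow> complex \<Rightarrow> (nat \<Rightarrow> complex) \<Rightarrow> nat \<Rightarrow> complex"
  where "lapp n H z y j = (\<Sum>i<n. cnj (y i) * resolvent n H z i j)"

lemma rapp_eq:
  assumes H: "hermitian n H" and z: "Im z \<noteq> 0" and i: "i < n"
  shows "(\<Sum>l<n. H i l * rapp n H z y l) = z * rapp n H z y i + y i"
proof -
  have "(\<Sum>l<n. H i l * rapp n H z y l) = (\<Sum>j<n. (\<Sum>l<n. H i l * resolvent n H z l j) * y j)"
    unfolding rapp_def sum_distrib_left sum_distrib_right
    by (subst sum.swap) (simp add: mult.assoc)
  also have "\<dots> = (\<Sum>j<n. (z * resolvent n H z i j + (if i = j then 1 else 0)) * y j)"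
    by (intro sum.cong refl) (use resolvent_right[OF H z i] in auto)
  also have "\<dots> = z * rapp n H z y i + (\<Sum>j<n. if i = j then y j else 0)"
    unfolding rapp_def sum_distrib_left sum.distrib[symmetric]
    by (intro sum.cong refl) (auto simp: algebra_simps)
  finally show ?thesis using i by simp
qed

lemma rapp_unique:
  assumes H: "hermitian n H" and z: "Im z \<noteq> 0"
    and x: "\<And>i. i < n \<Longrightarrow> (\<Sum>l<n. H i l * x l) = z * x i + y i" and i: "i < n"
  shows "x i = rapp n H z y i"
proof -
  have "x i - rapp n H z y i = 0"
  proof (rule hermitian_kernel[OF H z _ i])
    fix i assume i: "i < n"
    show "(\<Sum>j<n. H i j * (x j - rapp n H z y j)) = z * (x i - rapp n H z y i)"
      using x[OF i] rapp_eq[OF H z i, of y] by (simp add: right_diff_distrib sum_subtractf)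
  qed
  then show ?thesis by simp
qed

lemma lapp_eq:
  assumes H: "hermitian n H" and z: "Im z \<noteq> 0" and i: "i < n"
  shows "(\<Sum>l<n. H i l * cnj (lapp n H z y l)) = cnj z * cnj (lapp n H z y i) + y i"
proof -
  have "(\<Sum>l<n. lapp n H z y l * H l i) = (\<Sum>j<n. cnj (y j) * (\<Sum>l<n. resolvent n H z j l * H l i))"
    unfolding lapp_def sum_distrib_left sum_distrib_right
    by (subst sum.swap) (simp add: mult.assoc)
  also have "\<dots> = (\<Sum>j<n. cnj (y j) * (z * resolvent n H z j i + (if j = i then 1 else 0)))"
    by (intro sum.cong refl) (use resolvent_left[OF H z _ i] in auto)
  also have "\<dots> = z * lapp n H z y i + (\<Sum>j<n. if j = i then cnj (y j) else 0)"
    unfolding lapp_def sum_distrib_left sum.distrib[symmetric]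
    by (intro sum.cong refl) (auto simp: algebra_simps)
  finally have "cnj (\<Sum>l<n. lapp n H z y l * H l i) = cnj (z * lapp n H z y i + cnj (y i))"
    using i by simp
  then show ?thesis
    using H i by (simp add: cnj_sum hermitianD mult.commute)
qed

definition rform :: "nat \<Rightarrow> (nat \<Rightarrow> nat \<Rightarrow> complex) \<Rightarrow> complex \<Rightarrow> (nat \<Rightarrow> complex) \<Rightarrow> complex" where
  "rform n H z y = (\<Sum>i<n. cnj (y i) * rapp n H z y i)"

lemma rform_eq_lapp: "rform n H z y = (\<Sum>j<n. lapp n H z y j * y j)"
  unfolding rform_def rapp_def lapp_def sum_distrib_left sum_distrib_right
  by (subst sum.swap) (simp add: mult.assoc)

lemma rform_energy:
  assumes H: "hermitian n H" and z: "Im z \<noteq> 0"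
  shows "rform n H z y = qform n H (rapp n H z y) - cnj z * of_real (sqnorm n (rapp n H z y))"
  unfolding rform_def by (rule energy_identity[OF H rapp_eq[OF H z]])

lemma Im_rform:
  assumes H: "hermitian n H" and z: "Im z \<noteq> 0"
  shows "Im (rform n H z y) = Im z * sqnorm n (rapp n H z y)"
  using H by (simp add: rform_energy[OF H z])

text \<open>The resolvent is a normal matrix: \<open>(H - z)\<^sup>-\<^sup>1 y\<close> and \<open>y\<^sup>* (H - z)\<^sup>-\<^sup>1\<close>
  have the same length.\<close>
lemma Im_rform':
  assumes H: "hermitian n H" and z: "Im z \<noteq> 0"
  shows "Im (rform n H z y) = Im z * sqnorm n (lapp n H z y)"
proof -
  have "(\<Sum>i<n. cnj (y i) * cnj (lapp n H z y i)) =
      qform n H (\<lambda>i. cnj (lapp n H z y i)) - cnj (cnj z) * of_real (sqnorm n (\<lambda>i. cnj (lapp n H z y i)))"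
    by (rule energy_identity[OF H lapp_eq[OF H z]])
  then have "Im (\<Sum>i<n. cnj (y i) * cnj (lapp n H z y i)) = - Im z * sqnorm n (lapp n H z y)"
    using H by simp
  moreover have "(\<Sum>i<n. cnj (y i) * cnj (lapp n H z y i)) = cnj (rform n H z y)"
    unfolding rform_eq_lapp by (simp add: cnj_sum mult.commute)
  ultimately show ?thesis by simp
qed

lemma sqnorm_rapp_le:
  assumes H: "hermitian n H" and z: "Im z > 0"
  shows "(Im z)\<^sup>2 * sqnorm n (rapp n H z y) \<le> sqnorm n y"
proof (cases "sqnorm n (rapp n H z y) = 0")
  case False
  let ?s = "sqnorm n (rapp n H z y)"
  have "(Im z * ?s)\<^sup>2 = (Im (rform n H z y))\<^sup>2"
    using Im_rform[OF H, of z y] z by simp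
  also have "\<dots> \<le> (cmod (rform n H z y))\<^sup>2"
    by (rule abs_le_square_iff[THEN iffD1]) (use abs_Im_le_cmod in auto)
  also have "\<dots> \<le> sqnorm n y * ?s"
    unfolding rform_def using cauchy_schwarz_complex[of "\<lambda>i. cnj (y i)" "rapp n H z y" n] by simp
  finally have "((Im z)\<^sup>2 * ?s) * ?s \<le> sqnorm n y * ?s"
    by (simp add: power2_eq_square algebra_simps)
  moreover have "?s > 0" using False sqnorm_nonneg[of n "rapp n H z y"] by linarith
  ultimately show ?thesis by simp
qed simp

lemma rapp_unit: "j < n \<Longrightarrow> rapp n H z (\<lambda>i. if i = j then 1 else 0) i = resolvent n H z i j"
  unfolding rapp_def by (simp add: if_distrib[of "\<lambda>a. _ * a"] cong: if_cong)

lemma rform_unit: "j < n \<Longrightarrow> rform n H z (\<lambda>i. if i = j then 1 else 0) = resolvent n H z j j"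
  unfolding rform_def by (subst rapp_unit) (auto simp: if_distrib[of cnj] if_distrib[of "\<lambda>a. a * _"] cong: if_cong)

lemma sqnorm_resolvent_col:
  assumes H: "hermitian n H" and z: "Im z > 0" and j: "j < n"
  shows "(Im z)\<^sup>2 * (\<Sum>i<n. (cmod (resolvent n H z i j))\<^sup>2) \<le> 1"
proof -
  have "sqnorm n (\<lambda>i. if i = j then 1 else 0) = 1"
    unfolding sqnorm_def using j by (simp add: if_distrib[of cmod] if_distrib[of "\<lambda>a. a\<^sup>2"] cong: if_cong)
  moreover have "sqnorm n (rapp n H z (\<lambda>i. if i = j then 1 else 0)) = (\<Sum>i<n. (cmod (resolvent n H z i j))\<^sup>2)"
    unfolding sqnorm_def rapp_unit[OF j] ..
  ultimately show ?thesis
    using sqnorm_rapp_le[OF H z, of "\<lambda>i. if i = j then 1 else 0"] by simp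
qed

lemma cmod_resolvent_le:
  assumes H: "hermitian n H" and z: "Im z > 0" and i: "i < n" and j: "j < n"
  shows "cmod (resolvent n H z i j) \<le> 1 / Im z"
proof -
  have "(cmod (resolvent n H z i j))\<^sup>2 \<le> (\<Sum>i<n. (cmod (resolvent n H z i j))\<^sup>2)"
    using i by (intro member_le_sum) auto
  then have "(Im z * cmod (resolvent n H z i j))\<^sup>2 \<le> (Im z)\<^sup>2 * (\<Sum>i<n. (cmod (resolvent n H z i j))\<^sup>2)"
    using z by (simp add: power_mult_distrib)
  also have "\<dots> \<le> 1\<^sup>2" using sqnorm_resolvent_col[OF H z j] by simp
  finally have "Im z * cmod (resolvent n H z i j) \<le> 1"
    by (rule power2_le_imp_le) simp
  then show ?thesis using z by (simp add: field_simps)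
qed

definition psd :: "nat \<Rightarrow> (nat \<Rightarrow> nat \<Rightarrow> complex) \<Rightarrow> bool" where
  "psd n H \<longleftrightarrow> hermitian n H \<and> (\<forall>x. Re (qform n H x) \<ge> 0)"

text \<open>This positivity and the next lemma keep \<open>1 + y\<^sup>* (H - z)\<^sup>-\<^sup>1 y\<close> at distance \<open>Im z /
  |z|\<close> from zero, without any bound on \<open>y\<close>.\<close>
lemma Im_mult_rform_nonneg:
  assumes "psd n H" and z: "Im z > 0"
  shows "Im (z * rform n H z y) \<ge> 0"
proof -
  have H: "hermitian n H" using assms by (simp add: psd_def)
  have "z * rform n H z y = z * qform n H (rapp n H z y) - of_real ((cmod z)\<^sup>2 * sqnorm n (rapp n H z y))"
    using z by (subst rform_energy[OF H]) (simp_all add: right_diff_distrib complex_norm_square del: of_real_power)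
  then have "Im (z * rform n H z y) = Im z * Re (qform n H (rapp n H z y))"
    using H by simp
  with assms show ?thesis by (simp add: psd_def)
qed

lemma one_plus_lower_bound:
  assumes z: "Im z > 0" and "Im (z * a) \<ge> 0"
  shows "cmod (1 + a) \<ge> Im z / cmod z"
proof -
  have "Im z \<le> Im (z * (1 + a))" using assms(2) unfolding distrib_left mult_1_right plus_complex.simps by linarith
  also have "\<dots> \<le> cmod z * cmod (1 + a)" using abs_Im_le_cmod[of "z * (1 + a)"] by (simp only: norm_mult abs_le_iff)
  finally have *: "Im z \<le> cmod z * cmod (1 + a)" .
  have "cmod z > 0" using z by auto
  then show ?thesis using * by (simp add: divide_le_eq mult.commute)
qed

lemma hermitian_rank_one: "hermitian n H \<Longrightarrow> hermitian n (\<lambda>i j. H i j + y i * cnj (y j))"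
  by (subst hermitian_def) (simp add: hermitianD mult.commute)

lemma one_plus_rform_nonzero:
  assumes H: "hermitian n H" and z: "Im z \<noteq> 0"
  shows "1 + rform n H z y \<noteq> 0"
proof
  assume eq: "1 + rform n H z y = 0"
  then have "rform n H z y = -1" by (rule minus_unique[symmetric])
  then have "sqnorm n (rapp n H z y) = 0"
    using Im_rform[OF H z, of y] z by simp
  then have "rform n H z y = 0" unfolding rform_def by (auto simp: sqnorm_eq_0 intro!: sum.neutral)
  with eq show False by simp
qed

text \<open>The Sherman-Morrison formula.\<close>
lemma rank_one_rapp:
  fixes H :: "nat \<Rightarrow> nat \<Rightarrow> complex" and y :: "nat \<Rightarrow> complex"
  assumes H: "hermitian n H" and z: "Im z \<noteq> 0" and i: "i < n"
  defines "H' \<equiv> (\<lambda>i j. H i j + y i * cnj (y j))"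
  shows "rapp n H' z y i = rapp n H z y i / (1 + rform n H z y)"
proof -
  have H': "hermitian n H'" unfolding H'_def by (rule hermitian_rank_one[OF H])
  note nz = one_plus_rform_nonzero[OF H z, of y]
  have "rapp n H z y i / (1 + rform n H z y) = rapp n H' z y i"
  proof (rule rapp_unique[OF H' z _ i])
    fix i assume i: "i < n"
    have "(\<Sum>l<n. H' i l * rapp n H z y l) = z * rapp n H z y i + y i + y i * rform n H z y"
      unfolding H'_def rform_def sum_distrib_left rapp_eq[OF H z i, symmetric]
      by (simp add: algebra_simps sum.distrib)
    then show "(\<Sum>l<n. H' i l * (rapp n H z y l / (1 + rform n H z y))) =
        z * (rapp n H z y i / (1 + rform n H z y)) + y i"
      using nz by (simp add: sum_divide_distrib[symmetric] field_simps)
  qed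
  then show ?thesis ..
qed

lemma rank_one_resolvent:
  fixes H :: "nat \<Rightarrow> nat \<Rightarrow> complex" and y :: "nat \<Rightarrow> complex"
  assumes H: "hermitian n H" and z: "Im z \<noteq> 0" and i: "i < n" and j: "j < n"
  defines "H' \<equiv> (\<lambda>i j. H i j + y i * cnj (y j))"
  shows "resolvent n H z i j - resolvent n H' z i j =
    rapp n H z y i * lapp n H z y j / (1 + rform n H z y)"
proof -
  have H': "hermitian n H'" unfolding H'_def by (rule hermitian_rank_one[OF H])
  let ?e = "\<lambda>i. if i = j then 1 else (0::complex)"
  have "resolvent n H z i j - lapp n H z y j * rapp n H' z y i = rapp n H' z ?e i"
  proof (rule rapp_unique[OF H' z _ i])
    fix i assume i: "i < n"
    have "(\<Sum>l<n. H' i l * resolvent n H z l j) = (\<Sum>l<n. H i l * resolvent n H z l j) +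
        (\<Sum>l<n. y i * (cnj (y l) * resolvent n H z l j))"
      unfolding H'_def sum.distrib[symmetric] by (intro sum.cong refl) (simp add: distrib_right)
    also have "\<dots> = z * resolvent n H z i j + ?e i + y i * lapp n H z y j"
      unfolding resolvent_right[OF H z i j] lapp_def sum_distrib_left by simp
    finally have 1: "(\<Sum>l<n. H' i l * resolvent n H z l j) = z * resolvent n H z i j + ?e i + y i * lapp n H z y j" .
    have "(\<Sum>l<n. H' i l * (lapp n H z y j * rapp n H' z y l)) = lapp n H z y j * (\<Sum>l<n. H' i l * rapp n H' z y l)"
      unfolding sum_distrib_left by (intro sum.cong refl) (simp add: mult_ac)
    also have "\<dots> = lapp n H z y j * (z * rapp n H' z y i + y i)"
      unfolding rapp_eq[OF H' z i] ..
    finally have 2: "(\<Sum>l<n. H' i l * (lapp n H z y j * rapp n H' z y l)) =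
        lapp n H z y j * (z * rapp n H' z y i + y i)" .
    have "(\<Sum>l<n. H' i l * (resolvent n H z l j - lapp n H z y j * rapp n H' z y l)) =
      (\<Sum>l<n. H' i l * resolvent n H z l j) - (\<Sum>l<n. H' i l * (lapp n H z y j * rapp n H' z y l))"
      unfolding sum_subtractf[symmetric] by (intro sum.cong refl) (rule right_diff_distrib)
    also have "\<dots> = z * (resolvent n H z i j - lapp n H z y j * rapp n H' z y i) + ?e i"
      unfolding 1 2 by (simp only: algebra_simps)
    finally show "(\<Sum>l<n. H' i l * (resolvent n H z l j - lapp n H z y j * rapp n H' z y l)) =
        z * (resolvent n H z i j - lapp n H z y j * rapp n H' z y i) + ?e i" .
  qed
  then have "resolvent n H z i j - resolvent n H' z i j = lapp n H z y j * rapp n H' z y i"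
    unfolding rapp_unit[OF j] by (simp add: diff_eq_eq eq_diff_eq add.commute)
  also have "rapp n H' z y i = rapp n H z y i / (1 + rform n H z y)"
    unfolding H'_def by (rule rank_one_rapp[OF H z i])
  finally show ?thesis by simp
qed

text \<open>The bound is uniform in \<open>y\<close> because in the Sherman-Morrison term the numerator is at most \<open>C\<close> times the
  squared length of \<open>(H - z)\<^sup>-\<^sup>1 y\<close>, while the denominator has imaginary part \<open>Im z\<close> times
  that squared length.\<close>
lemma rank_one_trace:
  fixes H :: "nat \<Rightarrow> nat \<Rightarrow> complex" and y :: "nat \<Rightarrow> complex"
  assumes H: "hermitian n H" and z: "Im z > 0" and u: "\<And>i. i < n \<Longrightarrow> cmod (u i) \<le> C" and C: "C \<ge> 0"
  defines "H' \<equiv> (\<lambda>i j. H i j + y i * cnj (y j))"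
  shows "cmod (\<Sum>i<n. u i * (resolvent n H z i i - resolvent n H' z i i)) \<le> C / Im z"
proof -
  let ?r = "rapp n H z y" and ?l = "lapp n H z y" and ?a = "rform n H z y"
  have z': "Im z \<noteq> 0" using z by simp
  have eq: "(\<Sum>i<n. u i * (resolvent n H z i i - resolvent n H' z i i)) = (\<Sum>i<n. u i * ?r i * ?l i) / (1 + ?a)"
    unfolding H'_def sum_divide_distrib
    by (intro sum.cong refl) (simp add: rank_one_resolvent[OF H z'])
  have "sqnorm n (\<lambda>i. u i * ?r i) \<le> C\<^sup>2 * sqnorm n ?r"
    unfolding sqnorm_def sum_distrib_left
    by (intro sum_mono) (use u C in \<open>auto simp: norm_mult power_mult_distrib intro!: mult_right_mono power_mono\<close>)
  then have "(cmod (\<Sum>i<n. u i * ?r i * ?l i))\<^sup>2 \<le> C\<^sup>2 * sqnorm n ?r * sqnorm n ?l"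
    using cauchy_schwarz_complex[of "\<lambda>i. u i * ?r i" ?l n] mult_right_mono[OF _ sqnorm_nonneg[of n ?l]]
    by (meson order_trans)
  moreover have "sqnorm n ?r = sqnorm n ?l"
    using Im_rform[OF H z', of y] Im_rform'[OF H z', of y] z by simp
  ultimately have "(cmod (\<Sum>i<n. u i * ?r i * ?l i))\<^sup>2 \<le> (C * sqnorm n ?r)\<^sup>2"
    by (simp add: power2_eq_square algebra_simps)
  then have 1: "cmod (\<Sum>i<n. u i * ?r i * ?l i) \<le> C * sqnorm n ?r"
    by (rule power2_le_imp_le) (use C in simp)
  have "Im z * sqnorm n ?r = Im (1 + ?a)" using Im_rform[OF H z', of y] by simp
  also have "\<dots> \<le> cmod (1 + ?a)" using abs_Im_le_cmod abs_le_D1 by blast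
  finally have 2: "Im z * sqnorm n ?r \<le> cmod (1 + ?a)" .
  have "cmod (\<Sum>i<n. u i * ?r i * ?l i) * Im z \<le> C * sqnorm n ?r * Im z"
    using 1 z by simp
  also have "\<dots> = C * (Im z * sqnorm n ?r)" by simp
  also have "\<dots> \<le> C * cmod (1 + ?a)" using 2 C by (intro mult_left_mono)
  finally show ?thesis
    unfolding eq norm_divide using z one_plus_rform_nonzero[OF H z', of y] by (simp add: field_simps)
qed

lemma resolvent_cong:
  assumes "\<And>i j. i < n \<Longrightarrow> j < n \<Longrightarrow> H i j = H' i j"
  shows "resolvent n H z i j = resolvent n H' z i j"
proof -
  have "shifted_mat n H z = shifted_mat n H' z"
    unfolding shifted_mat_def using assms by (intro eq_matI) auto
  then show ?thesis by (simp add: resolvent_def)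
qed

text \<open>A Hermitian matrix supported on row and column \<open>s\<close> has the form \<open>e b\<^sup>* + b e\<^sup>*\<close> with
  \<open>e\<close> the unit vector at \<open>s\<close> and \<open>b\<close> its column with the diagonal entry halved, and \<open>e
  b\<^sup>* + b e\<^sup>* = w w\<^sup>* - u u\<^sup>*\<close> for \<open>w, u = (e \<plusminus> b) / sqrt 2\<close>. So \<open>H + u
  u\<^sup>* = H' + w w\<^sup>*\<close>, and two rank one changes lead from \<open>H\<close> to \<open>H'\<close>.\<close>
lemma agree_off_cross_trace:
  assumes H: "hermitian n H" and H': "hermitian n H'" and z: "Im z > 0" and s: "s < n"
    and agree: "\<And>i j. i < n \<Longrightarrow> j < n \<Longrightarrow> i \<noteq> s \<Longrightarrow> j \<noteq> s \<Longrightarrow> H i j = H' i j"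
  shows "cmod (\<Sum>i<n. resolvent n H z i i - resolvent n H' z i i) \<le> 2 / Im z"
proof -
  define b where "b i = (if i = s then (H s s - H' s s) / 2 else H i s - H' i s)" for i
  define e :: "nat \<Rightarrow> complex" where "e i = (if i = s then 1 else 0)" for i
  define w where "w i = (e i + b i) / of_real (sqrt 2)" for i
  define u where "u i = (e i - b i) / of_real (sqrt 2)" for i
  define K where "K = (\<lambda>i j. H i j + u i * cnj (u j))"
  define K' where "K' = (\<lambda>i j. H' i j + w i * cnj (w j))"
  have sq: "complex_of_real (sqrt 2) * complex_of_real (sqrt 2) = 2"
    by (simp flip: of_real_mult)
  have ss: "cnj (H s s) = H s s" "cnj (H' s s) = H' s s" using H H' s by (auto simp: hermitianD)
  have w2: "w i * cnj (w j) = (e i + b i) * (cnj (e j) + cnj (b j)) / 2" for i j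
    by (simp add: w_def sq)
  have u2: "u i * cnj (u j) = (e i - b i) * (cnj (e j) - cnj (b j)) / 2" for i j
    by (simp add: u_def sq)
  have wu: "w i * cnj (w j) - u i * cnj (u j) = e i * cnj (b j) + b i * cnj (e j)" for i j
    unfolding w2 u2 by (simp add: field_simps)
  have KK: "K i j = K' i j" if "i < n" "j < n" for i j
  proof -
    have "H i j - H' i j = e i * cnj (b j) + b i * cnj (e j)"
    proof -
      have cj: "cnj (b j) = H s j - H' s j" if "j \<noteq> s"
        using that hermitianD[OF H \<open>j < n\<close> s] hermitianD[OF H' \<open>j < n\<close> s] by (simp add: b_def)
      have bs: "b s = (H s s - H' s s) / 2" "cnj (b s) = (H s s - H' s s) / 2"
        using ss by (simp_all add: b_def)
      consider "i \<noteq> s" "j \<noteq> s" | "i = s" "j \<noteq> s" | "i \<noteq> s" "j = s" | "i = s" "j = s" by blast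
      then show ?thesis
      proof cases
        case 1 then show ?thesis using agree[OF that] by (simp add: e_def)
      next
        case 2 then show ?thesis using cj by (simp add: e_def)
      next
        case 3 then show ?thesis by (simp add: e_def b_def)
      next
        case 4
        have "cnj (b s) + b s = H s s - H' s s"
          by (subst bs(2), subst bs(1)) (simp add: field_simps)
        then show ?thesis using 4 by (simp add: e_def)
      qed
    qed
    then have "K i j - K' i j = 0"
      unfolding K_def K'_def using wu[of i j] by (simp add: algebra_simps)
    then show ?thesis by simp
  qed
  have 1: "cmod (\<Sum>i<n. resolvent n H z i i - resolvent n K z i i) \<le> 1 / Im z"
    unfolding K_def using rank_one_trace[OF H z, where u="\<lambda>_. 1" and C=1 and y=u] by simp
  have 2: "cmod (\<Sum>i<n. resolvent n H' z i i - resolvent n K' z i i) \<le> 1 / Im z"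
    unfolding K'_def using rank_one_trace[OF H' z, where u="\<lambda>_. 1" and C=1 and y=w] by simp
  have "resolvent n K' z i i = resolvent n K z i i" for i
    by (rule resolvent_cong) (simp add: KK)
  then have "(\<Sum>i<n. resolvent n H z i i - resolvent n H' z i i) =
     (\<Sum>i<n. resolvent n H z i i - resolvent n K z i i) - (\<Sum>i<n. resolvent n H' z i i - resolvent n K' z i i)"
    by (simp add: sum_subtractf)
  also have "cmod \<dots> \<le> 1 / Im z + 1 / Im z"
    by (rule order_trans[OF norm_triangle_ineq4 add_mono[OF 1 2]])
  finally show ?thesis by simp
qed

section \<open>Gram matrices and the rank inequality\<close>

definition gram :: "nat set \<Rightarrow> (nat \<Rightarrow> nat \<Rightarrow> complex) \<Rightarrow> nat \<Rightarrow> nat \<Rightarrow> complex" where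
  "gram K y i j = (\<Sum>k\<in>K. y k i * cnj (y k j))"

lemma hermitian_gram [simp]: "hermitian n (gram K y)"
  by (simp add: hermitian_def gram_def mult.commute)

lemma psd_gram: "psd n (gram K y)"
proof -
  have "qform n (gram K y) x = (\<Sum>k\<in>K. (\<Sum>i<n. cnj (x i) * y k i) * (\<Sum>j<n. cnj (y k j) * x j))" for x
  proof -
    have "qform n (gram K y) x = (\<Sum>i<n. \<Sum>j<n. \<Sum>k\<in>K. (cnj (x i) * y k i) * (cnj (y k j) * x j))"
      unfolding qform_def gram_def
      by (intro sum.cong refl) (simp add: sum_distrib_left sum_distrib_right mult_ac)
    also have "\<dots> = (\<Sum>k\<in>K. \<Sum>i<n. \<Sum>j<n. (cnj (x i) * y k i) * (cnj (y k j) * x j))"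
      by (subst (2) sum.swap) (subst sum.swap, rule refl)
    finally show ?thesis by (simp add: sum_product)
  qed
  moreover have "(\<Sum>i<n. cnj (x i) * y k i) * (\<Sum>j<n. cnj (y k j) * x j) =
      of_real ((cmod (\<Sum>j<n. cnj (y k j) * x j))\<^sup>2)" for k and x :: "nat \<Rightarrow> complex"
  proof -
    have "(\<Sum>i<n. cnj (x i) * y k i) = cnj (\<Sum>j<n. cnj (y k j) * x j)"
      by (simp add: cnj_sum mult.commute)
    then show ?thesis by (simp only: complex_norm_square mult.commute)
  qed
  ultimately have "Re (qform n (gram K y) x) = (\<Sum>k\<in>K. (cmod (\<Sum>j<n. cnj (y k j) * x j))\<^sup>2)" for x
    by (simp del: of_real_power)
  then show ?thesis by (simp add: psd_def sum_nonneg)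
qed

lemma gram_remove:
  assumes "finite K" "k \<in> K"
  shows "gram K y = (\<lambda>i j. gram (K - {k}) y i j + y k i * cnj (y k j))"
  unfolding gram_def by (simp add: sum.remove[OF assms] add.commute fun_eq_iff)

lemma gram_cong:
  assumes "\<And>k i. k \<in> K \<Longrightarrow> i < n \<Longrightarrow> y k i = y' k i" "i < n" "j < n"
  shows "gram K y i j = gram K y' i j"
  unfolding gram_def by (intro sum.cong refl) (use assms in auto)

lemma resolvent_gram_cong:
  assumes "\<And>k i. k \<in> K \<Longrightarrow> i < n \<Longrightarrow> y k i = y' k i"
  shows "resolvent n (gram K y) z i j = resolvent n (gram K y') z i j"
  by (rule resolvent_cong) (rule gram_cong[OF assms])

lemma gram_remove_trace:
  assumes K: "finite K" "k \<in> K" and z: "Im z > 0" and u: "\<And>i. i < n \<Longrightarrow> cmod (u i) \<le> C" and C: "C \<ge> 0"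
  shows "cmod (\<Sum>i<n. u i * (resolvent n (gram (K - {k}) y) z i i - resolvent n (gram K y) z i i)) \<le> C / Im z"
  unfolding gram_remove[OF K, of y] by (rule rank_one_trace[OF hermitian_gram z u C])

text \<open>Both matrices are compared with the one in which column \<open>k\<close> is removed.\<close>
lemma gram_column_trace:
  assumes K: "finite K" "k \<in> K" and z: "Im z > 0" and u: "\<And>i. i < n \<Longrightarrow> cmod (u i) \<le> C" and C: "C \<ge> 0"
    and agree: "\<And>l i. l \<in> K \<Longrightarrow> l \<noteq> k \<Longrightarrow> i < n \<Longrightarrow> y l i = y' l i"
  shows "cmod (\<Sum>i<n. u i * (resolvent n (gram K y) z i i - resolvent n (gram K y') z i i)) \<le> 2 * C / Im z"
proof -
  have eq: "resolvent n (gram (K - {k}) y) z i i = resolvent n (gram (K - {k}) y') z i i" for i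
    by (rule resolvent_gram_cong) (use agree in auto)
  have "(\<Sum>i<n. u i * (resolvent n (gram K y) z i i - resolvent n (gram K y') z i i)) =
      (\<Sum>i<n. u i * (resolvent n (gram (K - {k}) y') z i i - resolvent n (gram K y') z i i)) -
      (\<Sum>i<n. u i * (resolvent n (gram (K - {k}) y) z i i - resolvent n (gram K y) z i i))"
    unfolding eq sum_subtractf[symmetric] by (intro sum.cong refl) (simp add: algebra_simps)
  also have "cmod \<dots> \<le> C / Im z + C / Im z"
    by (rule order_trans[OF norm_triangle_ineq4
          add_mono[OF gram_remove_trace[OF K z u C] gram_remove_trace[OF K z u C]]])
  finally show ?thesis by simp
qed

text \<open>Changing row \<open>s\<close> of the data changes only row and column \<open>s\<close> of the Gram matrix.\<close>
lemma gram_row_trace: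
  assumes z: "Im z > 0" and s: "s < n"
    and agree: "\<And>l i. l \<in> K \<Longrightarrow> i < n \<Longrightarrow> i \<noteq> s \<Longrightarrow> y l i = y' l i"
  shows "cmod (\<Sum>i<n. resolvent n (gram K y) z i i - resolvent n (gram K y') z i i) \<le> 2 / Im z"
proof (rule agree_off_cross_trace[OF hermitian_gram hermitian_gram z s])
  show "gram K y i j = gram K y' i j" if "i < n" "j < n" "i \<noteq> s" "j \<noteq> s" for i j
    unfolding gram_def by (intro sum.cong refl) (simp add: agree that)
qed

lemma gram_columns_trace:
  assumes z: "Im z > 0" and K: "finite K" and Ec: "finite Ec"
    and agree: "\<And>l i. l \<in> K - Ec \<Longrightarrow> i < n \<Longrightarrow> y l i = y' l i"
  shows "cmod (\<Sum>i<n. resolvent n (gram K y) z i i - resolvent n (gram K y') z i i) \<le> 2 * card Ec / Im z"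
  using Ec agree
proof (induction Ec arbitrary: y' rule: finite_induct)
  case empty
  then have "resolvent n (gram K y) z i i = resolvent n (gram K y') z i i" for i
    by (intro resolvent_gram_cong) auto
  then show ?case by simp
next
  case (insert k Ec)
  define y'' where "y'' = y'(k := y k)"
  have 1: "cmod (\<Sum>i<n. resolvent n (gram K y) z i i - resolvent n (gram K y'') z i i) \<le> 2 * card Ec / Im z"
    by (rule insert.IH) (use insert.prems in \<open>auto simp: y''_def\<close>)
  have 2: "cmod (\<Sum>i<n. resolvent n (gram K y'') z i i - resolvent n (gram K y') z i i) \<le> 2 / Im z"
  proof (cases "k \<in> K")
    case True
    have "cmod (\<Sum>i<n. 1 * (resolvent n (gram K y'') z i i - resolvent n (gram K y') z i i)) \<le> 2 * 1 / Im z"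
      by (rule gram_column_trace[OF K True z]) (auto simp: y''_def)
    then show ?thesis by simp
  next
    case False
    then have "resolvent n (gram K y'') z i i = resolvent n (gram K y') z i i" for i
      by (intro resolvent_gram_cong) (auto simp: y''_def)
    then show ?thesis using z by simp
  qed
  have "(\<Sum>i<n. resolvent n (gram K y) z i i - resolvent n (gram K y') z i i) =
     (\<Sum>i<n. resolvent n (gram K y) z i i - resolvent n (gram K y'') z i i) +
     (\<Sum>i<n. resolvent n (gram K y'') z i i - resolvent n (gram K y') z i i)"
    by (simp add: sum_subtractf)
  also have "cmod \<dots> \<le> 2 * card Ec / Im z + 2 / Im z"
    by (rule order_trans[OF norm_triangle_ineq add_mono[OF 1 2]])
  also have "\<dots> = 2 * card (insert k Ec) / Im z"
    using insert.hyps by (simp add: add_divide_distrib distrib_left)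
  finally show ?case .
qed

lemma gram_rows_trace:
  assumes z: "Im z > 0" and Er: "finite Er" "Er \<subseteq> {..<n}"
    and agree: "\<And>l i. l \<in> K \<Longrightarrow> i < n \<Longrightarrow> i \<notin> Er \<Longrightarrow> y l i = y' l i"
  shows "cmod (\<Sum>i<n. resolvent n (gram K y) z i i - resolvent n (gram K y') z i i) \<le> 2 * card Er / Im z"
  using Er agree
proof (induction Er arbitrary: y' rule: finite_induct)
  case empty
  then have "resolvent n (gram K y) z i i = resolvent n (gram K y') z i i" for i
    by (intro resolvent_gram_cong) auto
  then show ?case by simp
next
  case (insert s Er)
  define y'' where "y'' = (\<lambda>l i. if i = s then y l i else y' l i)"
  have 1: "cmod (\<Sum>i<n. resolvent n (gram K y) z i i - resolvent n (gram K y'') z i i) \<le> 2 * card Er / Im z"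
    by (rule insert.IH) (use insert.prems in \<open>auto simp: y''_def\<close>)
  have 2: "cmod (\<Sum>i<n. resolvent n (gram K y'') z i i - resolvent n (gram K y') z i i) \<le> 2 / Im z"
    by (rule gram_row_trace[OF z, of s]) (use insert.prems in \<open>auto simp: y''_def\<close>)
  have "(\<Sum>i<n. resolvent n (gram K y) z i i - resolvent n (gram K y') z i i) =
     (\<Sum>i<n. resolvent n (gram K y) z i i - resolvent n (gram K y'') z i i) +
     (\<Sum>i<n. resolvent n (gram K y'') z i i - resolvent n (gram K y') z i i)"
    by (simp add: sum_subtractf)
  also have "cmod \<dots> \<le> 2 * card Er / Im z + 2 / Im z"
    by (rule order_trans[OF norm_triangle_ineq add_mono[OF 1 2]])
  also have "\<dots> = 2 * card (insert s Er) / Im z"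
    using insert.hyps by (simp add: add_divide_distrib distrib_left)
  finally show ?case .
qed

text \<open>The rank inequality: the normalised trace does not see \<open>o(n)\<close> rows and columns, whatever their entries.\<close>
lemma gram_perturbation_trace:
  assumes z: "Im z > 0" and K: "finite K" and Ec: "finite Ec" and Er: "Er \<subseteq> {..<n}"
    and agree: "\<And>l i. l \<in> K - Ec \<Longrightarrow> i \<in> {..<n} - Er \<Longrightarrow> y l i = y' l i"
  shows "cmod (\<Sum>i<n. resolvent n (gram K y) z i i - resolvent n (gram K y') z i i) \<le>
    2 * (card Er + card Ec) / Im z"
proof -
  define y'' where "y'' = (\<lambda>l. if l \<in> Ec then y' l else y l)"
  have 1: "cmod (\<Sum>i<n. resolvent n (gram K y) z i i - resolvent n (gram K y'') z i i) \<le> 2 * card Ec / Im z"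
    by (rule gram_columns_trace[OF z K Ec]) (auto simp: y''_def)
  have 2: "cmod (\<Sum>i<n. resolvent n (gram K y'') z i i - resolvent n (gram K y') z i i) \<le> 2 * card Er / Im z"
    by (rule gram_rows_trace[OF z finite_subset[OF Er] Er]) (use agree in \<open>auto simp: y''_def\<close>)
  have "(\<Sum>i<n. resolvent n (gram K y) z i i - resolvent n (gram K y') z i i) =
     (\<Sum>i<n. resolvent n (gram K y) z i i - resolvent n (gram K y'') z i i) +
     (\<Sum>i<n. resolvent n (gram K y'') z i i - resolvent n (gram K y') z i i)"
    by (simp add: sum_subtractf)
  also have "cmod \<dots> \<le> 2 * card Ec / Im z + 2 * card Er / Im z"
    by (rule order_trans[OF norm_triangle_ineq add_mono[OF 1 2]])
  also have "\<dots> = 2 * (card Er + card Ec) / Im z"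
    by (simp add: add_divide_distrib distrib_left)
  finally show ?thesis .
qed

text \<open>Expand \<open>(H - z)\<^sup>-\<^sup>1 H = 1 + z (H - z)\<^sup>-\<^sup>1\<close> into the columns of \<open>H\<close>, and take
  column \<open>k\<close> out of the resolvent that multiplies it by the Sherman-Morrison formula. For random independent columns
  the remaining resolvent is independent of \<open>y k\<close>.\<close>
lemma gram_resolvent_identity:
  assumes K: "finite K" and z: "Im z \<noteq> 0"
  shows "(\<Sum>i<n. u i * (1 + z * resolvent n (gram K y) z i i)) =
    (\<Sum>k\<in>K. (\<Sum>i<n. cnj (y k i) * u i * rapp n (gram (K - {k}) y) z (y k) i) /
       (1 + rform n (gram (K - {k}) y) z (y k)))"
proof -
  define R where "R = resolvent n (gram K y) z"
  let ?R = R
  have "(\<Sum>i<n. u i * (1 + z * ?R i i)) = (\<Sum>i<n. u i * (\<Sum>l<n. ?R i l * gram K y l i))"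
    by (intro sum.cong refl) (simp add: R_def resolvent_left[OF hermitian_gram z] add.commute)
  also have "\<dots> = (\<Sum>i<n. \<Sum>l<n. \<Sum>k\<in>K. cnj (y k i) * u i * (?R i l * y k l))"
    unfolding gram_def by (intro sum.cong refl) (simp add: sum_distrib_left mult_ac)
  also have "\<dots> = (\<Sum>k\<in>K. \<Sum>i<n. \<Sum>l<n. cnj (y k i) * u i * (?R i l * y k l))"
    by (subst (2) sum.swap) (subst sum.swap, rule refl)
  also have "\<dots> = (\<Sum>k\<in>K. \<Sum>i<n. cnj (y k i) * u i * rapp n (gram K y) z (y k) i)"
    by (simp add: rapp_def R_def sum_distrib_left)
  also have "\<dots> = (\<Sum>k\<in>K. \<Sum>i<n. cnj (y k i) * u i *
      (rapp n (gram (K - {k}) y) z (y k) i / (1 + rform n (gram (K - {k}) y) z (y k))))"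
    by (intro sum.cong refl, subst gram_remove[OF K], assumption, subst rank_one_rapp) (auto simp: z)
  finally show ?thesis
    by (simp add: sum_divide_distrib R_def)
qed

lemma poly_pderiv_prod_linear:
  fixes A :: "'a::field multiset"
  assumes "p = (\<Prod>l\<in>#A. [:- l, 1:])" "poly p z \<noteq> 0"
  shows "poly (pderiv p) z = poly p z * (\<Sum>l\<in>#A. 1 / (z - l))"
  using assms
proof (induction A arbitrary: p)
  case empty
  then show ?case by simp
next
  case (add a A)
  define q where "q = (\<Prod>l\<in>#A. [:- l, 1:])"
  let ?q = q
  have p: "p = [:- a, 1:] * q" using add.prems(1) by (simp add: q_def)
  have nz: "z \<noteq> a" "poly ?q z \<noteq> 0" using add.prems(2) unfolding p by auto
  have alg: "(z - a) * (Q * S) + Q = ((z - a) * Q) * (1 / (z - a) + S)" for Q S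
    using nz(1) by (simp add: divide_simps) (simp add: algebra_simps)
  have "pderiv p = [:- a, 1:] * pderiv q + q"
    unfolding p pderiv_mult by (simp add: pderiv_pCons)
  then have "poly (pderiv p) z = poly ([:- a, 1:] * pderiv q + q) z"
    by (simp only:)
  also have "\<dots> = (z - a) * poly (pderiv q) z + poly q z"
    by (simp add: algebra_simps)
  also have "\<dots> = (z - a) * (poly q z * (\<Sum>l\<in>#A. 1 / (z - l))) + poly q z"
    using add.IH[OF q_def nz(2)] by simp
  also have "\<dots> = ((z - a) * poly q z) * (1 / (z - a) + (\<Sum>l\<in>#A. 1 / (z - l)))"
    by (rule alg)
  also have "(z - a) * poly q z = poly p z"
    unfolding p by (simp add: algebra_simps)
  finally show ?case by simp
qed

lemma sum_mset_reciprocal_flip: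
  fixes A :: "complex multiset"
  shows "- (\<Sum>l\<in>#A. 1 / (z - l)) = (\<Sum>l\<in>#A. 1 / (l - z))"
proof (induction A)
  case (add a A)
  have "1 / (a - z) = - (1 / (z - a))" by (metis minus_diff_eq minus_divide_right)
  with add show ?case by simp
qed simp

text \<open>Both sides are \<open>- p' / p\<close> at \<open>z\<close> for the characteristic polynomial \<open>p\<close>: its derivative is
  the sum of the characteristic polynomials of the principal submatrices of size \<open>n - 1\<close>, which are up to sign the
  diagonal numerators in Cramer's rule.\<close>
lemma resolvent_trace:
  assumes H: "hermitian n H" and z: "Im z \<noteq> 0"
  shows "(\<Sum>i<n. resolvent n H z i i) =
    (\<Sum>l\<in>#proots (char_poly (Matrix.mat n n (\<lambda>(i, j). H i j))). 1 / (l - z))"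
proof -
  let ?A = "Matrix.mat n n (\<lambda>(i, j). H i j)" and ?S = "shifted_mat n H z"
  let ?p = "char_poly ?A"
  have A: "?A \<in> carrier_mat n n" by simp
  have S: "?S \<in> carrier_mat n n" by (simp add: shifted_mat_def)
  have pz: "poly ?p z = (-1) ^ n * Determinant.det ?S"
  proof -
    have "- char_matrix ?A z = (-1) \<cdot>\<^sub>m ?S"
      unfolding char_matrix_def shifted_mat_def by (intro eq_matI) auto
    then show ?thesis
      unfolding char_poly_matrix[OF A] using S by simp
  qed
  have pzi: "poly (char_poly (mat_delete ?A i i)) z = (-1) ^ (n - 1) * Determinant.det (mat_delete ?S i i)"
    if "i < n" for i
  proof -
    have "- char_matrix (mat_delete ?A i i) z = (-1) \<cdot>\<^sub>m mat_delete ?S i i"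
      using that unfolding char_matrix_def shifted_mat_def mat_delete_def by (intro eq_matI) auto
    then show ?thesis
      unfolding char_poly_matrix[OF mat_delete_carrier[OF A]] using S by simp
  qed
  have nz: "poly ?p z \<noteq> 0" unfolding pz using det_shifted_mat[OF H z] by simp
  have monic: "coeff ?p (degree ?p) = 1" using degree_monic_char_poly[OF A] by simp
  have dec: "?p = (\<Prod>l\<in>#proots ?p. [:- l, 1:])"
    using complex_poly_decompose_multiset[of ?p] monic by simp
  have "poly (pderiv ?p) z = (\<Sum>i<n. (-1) ^ (n - 1) * Determinant.det (mat_delete ?S i i))"
    unfolding pderiv_char_poly[OF A] poly_sum by (intro sum.cong refl) (simp add: pzi)
  also have "\<dots> = - (\<Sum>i<n. (-1) ^ n * Determinant.det (mat_delete ?S i i))"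
    unfolding sum_negf[symmetric] by (intro sum.cong refl, cases n) auto
  also have "\<dots> = - (\<Sum>i<n. poly ?p z * resolvent n H z i i)"
  proof -
    have "poly ?p z * resolvent n H z i i = (-1) ^ n * Determinant.det (mat_delete ?S i i)" if "i < n" for i
      unfolding resolvent_def pz adj_mat_def using that S det_shifted_mat[OF H z]
      by (simp add: cofactor_def)
    then show ?thesis by simp
  qed
  finally have "poly ?p z * (\<Sum>l\<in>#proots ?p. 1 / (z - l)) = poly ?p z * (- (\<Sum>i<n. resolvent n H z i i))"
    using poly_pderiv_prod_linear[OF dec nz] by (simp add: sum_distrib_left)
  then have "(\<Sum>i<n. resolvent n H z i i) = - (\<Sum>l\<in>#proots ?p. 1 / (z - l))"
    using nz by (simp only: mult_cancel_left) (simp add: minus_equation_iff)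
  also have "\<dots> = (\<Sum>l\<in>#proots ?p. 1 / (l - z))"
    by (rule sum_mset_reciprocal_flip)
  finally show ?thesis .
qed

lemma hermitian_proots_real:
  assumes H: "hermitian n H" and l: "l \<in># proots (char_poly (Matrix.mat n n (\<lambda>(i, j). H i j)))"
  shows "Im l = 0"
proof (rule ccontr)
  let ?A = "Matrix.mat n n (\<lambda>(i, j). H i j)" and ?S = "shifted_mat n H l"
  assume *: "Im l \<noteq> 0"
  have A: "?A \<in> carrier_mat n n" by simp
  have S: "?S \<in> carrier_mat n n" by (simp add: shifted_mat_def)
  have "- char_matrix ?A l = (-1) \<cdot>\<^sub>m ?S"
    unfolding char_matrix_def shifted_mat_def by (intro eq_matI) auto
  then have "poly (char_poly ?A) l = (-1) ^ n * Determinant.det ?S"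
    unfolding char_poly_matrix[OF A] using S by simp
  then have "poly (char_poly ?A) l \<noteq> 0" using det_shifted_mat[OF H *] by simp
  moreover have "poly (char_poly ?A) l = 0"
    using l by (metis count_greater_zero_iff count_proots order_root proots_0 empty_iff set_mset_empty not_gr_zero)
  ultimately show False by simp
qed

lemma borel_measurable_det:
  fixes A :: "'a \<Rightarrow> complex mat"
  assumes "\<And>w. A w \<in> carrier_mat n n"
    and [measurable]: "\<And>i j. i < n \<Longrightarrow> j < n \<Longrightarrow> (\<lambda>w. A w $$ (i, j)) \<in> borel_measurable M"
  shows "(\<lambda>w. Determinant.det (A w)) \<in> borel_measurable M"
proof -
  have "(\<lambda>w. \<Sum>p\<in>{p. p permutes {0..<n}}. signof p * (\<Prod>i = 0..<n. A w $$ (i, p i))) \<in> borel_measurable M"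
    by (intro borel_measurable_sum borel_measurable_times borel_measurable_const borel_measurable_prod)
      (auto simp: permutes_in_image dest!: permutes_in_image)
  then show ?thesis by (simp add: det_def'[OF assms(1)])
qed

lemma borel_measurable_resolvent:
  assumes H: "\<And>i j. i < n \<Longrightarrow> j < n \<Longrightarrow> (\<lambda>w. H w i j) \<in> borel_measurable M" and ij: "i < n" "j < n"
  shows "(\<lambda>w. resolvent n (H w) z i j) \<in> borel_measurable M"
proof -
  let ?S = "\<lambda>w. shifted_mat n (H w) z"
  have S: "?S w \<in> carrier_mat n n" for w by (simp add: shifted_mat_def)
  have e: "(\<lambda>w. ?S w $$ (a, b)) \<in> borel_measurable M" if "a < n" "b < n" for a b
    using that H[OF that] by (simp add: shifted_mat_def)
  have "(\<lambda>w. Determinant.det (mat_delete (?S w) j i)) \<in> borel_measurable M"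
  proof (rule borel_measurable_det[OF mat_delete_carrier[OF S]])
    fix a b assume ab: "a < n - 1" "b < n - 1"
    have "(\<lambda>w. mat_delete (?S w) j i $$ (a, b)) =
        (\<lambda>w. ?S w $$ (if a < j then a else Suc a, if b < i then b else Suc b))"
      using ab S by (auto simp: mat_delete_def shifted_mat_def fun_eq_iff)
    also have "\<dots> \<in> borel_measurable M"
      by (rule e) (use ab in auto)
    finally show "(\<lambda>w. mat_delete (?S w) j i $$ (a, b)) \<in> borel_measurable M" .
  qed
  then have "(\<lambda>w. adj_mat (?S w) $$ (i, j)) \<in> borel_measurable M"
    unfolding adj_mat_def using ij by (simp add: shifted_mat_def cofactor_def)
  then show ?thesis
    unfolding resolvent_def using borel_measurable_det[OF S e] by simp
qed

section \<open>Functions with bounded differences of independent coordinates\<close>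

lemma hoeffding_centred:
  assumes "prob_space M" and [measurable]: "h \<in> borel_measurable M"
    and bound: "\<And>x. x \<in> space M \<Longrightarrow> \<bar>h x\<bar> \<le> b" and zero: "(LINT x|M. h x) = 0" and s: "s > 0"
  shows "(\<integral>\<^sup>+x. ennreal (exp (s * h x)) \<partial>M) \<le> ennreal (exp (s\<^sup>2 * b\<^sup>2 / 2))"
proof -
  interpret prob_space M by fact
  interpret interval_bounded_random_variable M h "- b" b
    using bound by unfold_locales (auto simp: abs_le_iff minus_le_iff)
  have "s\<^sup>2 * (b - - b)\<^sup>2 / 8 = s\<^sup>2 * b\<^sup>2 / 2" by (simp add: power2_eq_square)
  then show ?thesis using Hoeffdings_lemma_nn_integral_0[OF s zero] by (simp only:)
qed

lemma fun_upd_space_PiM: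
  "x \<in> space (Pi\<^sub>M I M) \<Longrightarrow> y \<in> space (M i) \<Longrightarrow> x(i := y) \<in> space (Pi\<^sub>M (insert i I) M)"
  by (auto simp: space_PiM PiE_def extensional_def)

text \<open>The method of McDiarmid: integrate out one coordinate at a time. Given the other coordinates, \<open>g\<close> deviates from its
  conditional mean by at most \<open>b\<close>, and the lemma of Hoeffding yields a factor \<open>exp (s\<^sup>2 b\<^sup>2 /
  2)\<close>; the conditional mean has again differences bounded by \<open>b\<close>.\<close>
lemma mgf_bounded_differences:
  fixes g :: "('i \<Rightarrow> 'a) \<Rightarrow> real"
  assumes M: "\<And>i. prob_space (M i)" and I: "finite I"
    and g: "g \<in> borel_measurable (Pi\<^sub>M I M)"
    and bound: "\<And>x. x \<in> space (Pi\<^sub>M I M) \<Longrightarrow> \<bar>g x\<bar> \<le> B"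
    and diff: "\<And>x i y. x \<in> space (Pi\<^sub>M I M) \<Longrightarrow> i \<in> I \<Longrightarrow> y \<in> space (M i) \<Longrightarrow> \<bar>g (x(i := y)) - g x\<bar> \<le> b"
    and s: "s > 0"
  shows "(\<integral>\<^sup>+x. ennreal (exp (s * (g x - (LINT x|Pi\<^sub>M I M. g x)))) \<partial>Pi\<^sub>M I M) \<le>
    ennreal (exp (s\<^sup>2 * card I * b\<^sup>2 / 2))"
  using I g bound diff
proof (induction I arbitrary: g rule: finite_induct)
  case empty
  interpret product_prob_space M by (rule product_prob_spaceI[OF M])
  show ?case by (simp add: PiM_empty lebesgue_integral_count_space_finite nn_integral_count_space_finite)
next
  case (insert i I)
  interpret product_prob_space M by (rule product_prob_spaceI[OF M])
  interpret PI: prob_space "Pi\<^sub>M I M" by (rule prob_space_PiM[OF M])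
  interpret QI: prob_space "Pi\<^sub>M (insert i I) M" by (rule prob_space_PiM[OF M])
  note [measurable] = insert.prems(1)
  define g1 where "g1 x = (LINT y|M i. g (x(i := y)))" for x
  define m where "m = (LINT x|Pi\<^sub>M (insert i I) M. g x)"
  have gi[measurable]: "(\<lambda>p. g ((fst p)(i := snd p))) \<in> borel_measurable (Pi\<^sub>M I M \<Otimes>\<^sub>M M i)"
    using measurable_compose[OF measurable_add_dim insert.prems(1)] by (simp add: case_prod_beta)
  have g1m[measurable]: "g1 \<in> borel_measurable (Pi\<^sub>M I M)"
    unfolding g1_def by (rule M.borel_measurable_lebesgue_integral) (simp add: case_prod_beta)
  have gx[measurable]: "(\<lambda>y. g (x(i := y))) \<in> borel_measurable (M i)" if "x \<in> space (Pi\<^sub>M I M)" for x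
    using measurable_compose[OF measurable_Pair1'[OF that] gi] by simp
  have int: "integrable (M i) (\<lambda>y. g (x(i := y)))" if "x \<in> space (Pi\<^sub>M I M)" for x
    by (rule M.integrable_const_bound[where B = B])
      (auto intro!: insert.prems(2) fun_upd_space_PiM that gx)
  have m: "m = (LINT x|Pi\<^sub>M I M. g1 x)"
    unfolding m_def g1_def
    by (rule product_integral_insert[OF insert.hyps])
      (auto intro!: QI.integrable_const_bound[where B = B] insert.prems(2))
  have "(\<integral>\<^sup>+x. ennreal (exp (s * (g x - m))) \<partial>Pi\<^sub>M (insert i I) M) =
      (\<integral>\<^sup>+x. (\<integral>\<^sup>+y. ennreal (exp (s * (g (x(i := y)) - m))) \<partial>M i) \<partial>Pi\<^sub>M I M)"
    by (rule product_nn_integral_insert[OF insert.hyps]) simp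
  also have "\<dots> \<le> (\<integral>\<^sup>+x. ennreal (exp (s\<^sup>2 * b\<^sup>2 / 2)) * ennreal (exp (s * (g1 x - m))) \<partial>Pi\<^sub>M I M)"
  proof (rule nn_integral_mono)
    fix x assume x: "x \<in> space (Pi\<^sub>M I M)"
    note [measurable] = gx[OF x]
    have dev: "\<bar>g (x(i := y)) - g1 x\<bar> \<le> b" if y: "y \<in> space (M i)" for y
    proof -
      have "g (x(i := y)) - g1 x = (LINT y'|M i. g (x(i := y)) - g (x(i := y')))"
        unfolding g1_def by (subst Bochner_Integration.integral_diff) (auto simp: int[OF x] M.prob_space)
      also have "\<bar>\<dots>\<bar> \<le> (LINT y'|M i. \<bar>g (x(i := y)) - g (x(i := y'))\<bar>)"
        by (rule integral_abs_bound)
      also have "\<dots> \<le> (LINT y'|M i. b)"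
      proof (rule integral_mono)
        fix y' assume y': "y' \<in> space (M i)"
        have "\<bar>g ((x(i := y'))(i := y)) - g (x(i := y'))\<bar> \<le> b"
          by (rule insert.prems(3)[OF fun_upd_space_PiM[OF x y'] _ y]) simp
        then show "\<bar>g (x(i := y)) - g (x(i := y'))\<bar> \<le> b" by simp
      qed (auto intro!: Bochner_Integration.integrable_diff int[OF x])
      finally show ?thesis by (simp add: M.prob_space)
    qed
    have "(\<integral>\<^sup>+y. ennreal (exp (s * (g (x(i := y)) - m))) \<partial>M i) =
        (\<integral>\<^sup>+y. ennreal (exp (s * (g1 x - m))) * ennreal (exp (s * (g (x(i := y)) - g1 x))) \<partial>M i)"
      by (intro nn_integral_cong) (simp add: ennreal_mult[symmetric] exp_add[symmetric] algebra_simps)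
    also have "\<dots> = ennreal (exp (s * (g1 x - m))) * (\<integral>\<^sup>+y. ennreal (exp (s * (g (x(i := y)) - g1 x))) \<partial>M i)"
      by (rule nn_integral_cmult) simp
    also have "\<dots> \<le> ennreal (exp (s * (g1 x - m))) * ennreal (exp (s\<^sup>2 * b\<^sup>2 / 2))"
    proof (intro mult_left_mono hoeffding_centred[OF M _ _ _ s])
      show "(LINT y|M i. g (x(i := y)) - g1 x) = 0"
        unfolding g1_def by (subst Bochner_Integration.integral_diff) (auto simp: int[OF x] M.prob_space)
    qed (auto intro: dev)
    finally show "(\<integral>\<^sup>+y. ennreal (exp (s * (g (x(i := y)) - m))) \<partial>M i) \<le>
      ennreal (exp (s\<^sup>2 * b\<^sup>2 / 2)) * ennreal (exp (s * (g1 x - m)))"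
      by (simp add: mult.commute)
  qed
  also have "\<dots> = ennreal (exp (s\<^sup>2 * b\<^sup>2 / 2)) * (\<integral>\<^sup>+x. ennreal (exp (s * (g1 x - m))) \<partial>Pi\<^sub>M I M)"
    by (rule nn_integral_cmult) simp
  also have "\<dots> \<le> ennreal (exp (s\<^sup>2 * b\<^sup>2 / 2)) * ennreal (exp (s\<^sup>2 * card I * b\<^sup>2 / 2))"
  proof (rule mult_left_mono)
    show "(\<integral>\<^sup>+x. ennreal (exp (s * (g1 x - m))) \<partial>Pi\<^sub>M I M) \<le> ennreal (exp (s\<^sup>2 * card I * b\<^sup>2 / 2))"
      unfolding m
    proof (rule insert.IH[OF g1m])
      fix x assume x: "x \<in> space (Pi\<^sub>M I M)"
      have "\<bar>g1 x\<bar> \<le> (LINT y|M i. \<bar>g (x(i := y))\<bar>)"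
        unfolding g1_def by (rule integral_abs_bound)
      also have "\<dots> \<le> (LINT y|M i. B)"
        by (rule integral_mono) (auto intro!: integrable_abs int x insert.prems(2) fun_upd_space_PiM)
      finally show "\<bar>g1 x\<bar> \<le> B" by (simp add: M.prob_space)
    next
      fix x j y assume x: "x \<in> space (Pi\<^sub>M I M)" and j: "j \<in> I" and y: "y \<in> space (M j)"
      have ij: "i \<noteq> j" using j insert.hyps by auto
      have x': "x(j := y) \<in> space (Pi\<^sub>M I M)"
        using fun_upd_space_PiM[OF x y] j by (simp add: insert_absorb)
      have "g1 (x(j := y)) - g1 x = (LINT u|M i. g ((x(j := y))(i := u)) - g (x(i := u)))"
        unfolding g1_def by (rule Bochner_Integration.integral_diff[symmetric]) (rule int[OF x'], rule int[OF x])
      also have "\<bar>\<dots>\<bar> \<le> (LINT u|M i. \<bar>g ((x(j := y))(i := u)) - g (x(i := u))\<bar>)"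
        by (rule integral_abs_bound)
      also have "\<dots> \<le> (LINT u|M i. b)"
      proof (rule integral_mono)
        fix u assume u: "u \<in> space (M i)"
        have "\<bar>g ((x(i := u))(j := y)) - g (x(i := u))\<bar> \<le> b"
          by (rule insert.prems(3)[OF fun_upd_space_PiM[OF x u] _ y]) (simp add: j)
        then show "\<bar>g ((x(j := y))(i := u)) - g (x(i := u))\<bar> \<le> b"
          using ij by (simp add: fun_upd_twist)
      qed (auto intro!: Bochner_Integration.integrable_diff integrable_abs int[OF x] int[OF x'])
      finally show "\<bar>g1 (x(j := y)) - g1 x\<bar> \<le> b" by (simp add: M.prob_space)
    qed
  qed simp
  also have "\<dots> = ennreal (exp (s\<^sup>2 * card (insert i I) * b\<^sup>2 / 2))"
    using insert.hyps by (simp add: ennreal_mult[symmetric] exp_add[symmetric] algebra_simps add_divide_distrib)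
  finally show ?case unfolding m_def .
qed

lemma abs_le_exp_sum: "\<bar>x::real\<bar> \<le> exp x + exp (- x)"
  using exp_ge_add_one_self[of x] exp_ge_add_one_self[of "- x"] exp_gt_zero[of x] exp_gt_zero[of "- x"] by linarith

lemma power4_le_exp_sum: "(x::real) ^ 4 \<le> 256 * (exp x + exp (- x))"
proof -
  have *: "y ^ 4 \<le> 256 * exp y" if "y \<ge> 0" for y :: real
  proof -
    have "(y / 4) ^ 4 \<le> (exp (y / 4)) ^ 4"
      using exp_ge_add_one_self[of "y / 4"] that by (intro power_mono) linarith+
    also have "\<dots> = exp y" by (simp add: exp_of_nat_mult[symmetric])
    finally show ?thesis by (simp add: power_divide)
  qed
  show ?thesis
  proof (cases "x \<ge> 0")
    case True
    with *[of x] show ?thesis using exp_gt_zero[of "- x"] by (simp add: distrib_left add_increasing2)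
  next
    case False
    with *[of "- x"] show ?thesis using exp_gt_zero[of x] by (simp add: distrib_left add_increasing)
  qed
qed

lemma exp_half_le_2: "exp (1 / 2 :: real) \<le> 2"
  using exp_half_le2 by simp

text \<open>The choice \<open>s = 1 / (b sqrt (card I))\<close> makes the exponential moments of \<open>\<plusminus> s (g - m)\<close> bounded
  by \<open>exp (1/2)\<close>, and exponentials dominate powers.\<close>
lemma bounded_differences_moments:
  fixes g :: "('i \<Rightarrow> 'a) \<Rightarrow> real"
  assumes M: "\<And>i. prob_space (M i)" and I: "finite I" "I \<noteq> {}"
    and g[measurable]: "g \<in> borel_measurable (Pi\<^sub>M I M)"
    and bound: "\<And>x. x \<in> space (Pi\<^sub>M I M) \<Longrightarrow> \<bar>g x\<bar> \<le> B"
    and diff: "\<And>x i y. x \<in> space (Pi\<^sub>M I M) \<Longrightarrow> i \<in> I \<Longrightarrow> y \<in> space (M i) \<Longrightarrow> \<bar>g (x(i := y)) - g x\<bar> \<le> b"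
    and b: "b > 0"
  defines "m \<equiv> (LINT x|Pi\<^sub>M I M. g x)"
  shows "(\<integral>\<^sup>+x. ennreal \<bar>g x - m\<bar> \<partial>Pi\<^sub>M I M) \<le> ennreal (4 * b * sqrt (card I))"
    and "(\<integral>\<^sup>+x. ennreal ((g x - m) ^ 4) \<partial>Pi\<^sub>M I M) \<le> ennreal (1024 * b ^ 4 * (card I)\<^sup>2)"
proof -
  let ?c = "real (card I)"
  have c: "?c > 0" using I by (simp add: card_gt_0_iff)
  define s where "s = 1 / (b * sqrt ?c)"
  have s: "s > 0" unfolding s_def using b c by simp
  have s2: "s\<^sup>2 * ?c * b\<^sup>2 / 2 = 1 / 2"
    unfolding s_def using b c by (simp add: power_divide power_mult_distrib)
  have e1: "(\<integral>\<^sup>+x. ennreal (exp (s * (g x - m))) \<partial>Pi\<^sub>M I M) \<le> ennreal 2"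
    using mgf_bounded_differences[OF M I(1) g bound diff s] exp_half_le_2 unfolding m_def s2
    by (meson ennreal_leI order_trans)
  have *: "(\<integral>\<^sup>+x. ennreal (exp (s * (- g x - (LINT x|Pi\<^sub>M I M. - g x)))) \<partial>Pi\<^sub>M I M) \<le>
      ennreal (exp (s\<^sup>2 * card I * b\<^sup>2 / 2))"
    by (rule mgf_bounded_differences[OF M I(1) _ _ _ s]) (use bound diff in \<open>auto simp: abs_minus_commute\<close>)
  have e2: "(\<integral>\<^sup>+x. ennreal (exp (- (s * (g x - m)))) \<partial>Pi\<^sub>M I M) \<le> ennreal 2"
  proof -
    have "s * (- g x - (LINT x|Pi\<^sub>M I M. - g x)) = - (s * (g x - m))" for x
      by (simp add: m_def algebra_simps)
    then show ?thesis using * exp_half_le_2 unfolding s2 by (simp only:) (meson ennreal_leI order_trans)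
  qed
  have "(\<integral>\<^sup>+x. ennreal (exp (s * (g x - m)) + exp (- (s * (g x - m)))) \<partial>Pi\<^sub>M I M) =
     (\<integral>\<^sup>+x. ennreal (exp (s * (g x - m))) \<partial>Pi\<^sub>M I M) + (\<integral>\<^sup>+x. ennreal (exp (- (s * (g x - m)))) \<partial>Pi\<^sub>M I M)"
    by (subst nn_integral_add[symmetric]) auto
  also have "\<dots> \<le> ennreal 2 + ennreal 2" by (rule add_mono[OF e1 e2])
  also have "\<dots> = ennreal 4" by (subst ennreal_plus[symmetric]) auto
  finally have e: "(\<integral>\<^sup>+x. ennreal (exp (s * (g x - m)) + exp (- (s * (g x - m)))) \<partial>Pi\<^sub>M I M) \<le> ennreal 4" .
  have *: "(\<integral>\<^sup>+x. ennreal (F x) \<partial>Pi\<^sub>M I M) \<le> ennreal (C * 4)"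
    if "\<And>x. F x \<le> C * (exp (s * (g x - m)) + exp (- (s * (g x - m))))" "C \<ge> 0" for F C
  proof -
    have "(\<integral>\<^sup>+x. ennreal (F x) \<partial>Pi\<^sub>M I M) \<le>
        (\<integral>\<^sup>+x. ennreal C * ennreal (exp (s * (g x - m)) + exp (- (s * (g x - m)))) \<partial>Pi\<^sub>M I M)"
      using that by (intro nn_integral_mono) (simp add: ennreal_mult[symmetric] ennreal_leI del: ennreal_plus)
    also have "\<dots> = ennreal C * (\<integral>\<^sup>+x. ennreal (exp (s * (g x - m)) + exp (- (s * (g x - m)))) \<partial>Pi\<^sub>M I M)"
      by (rule nn_integral_cmult) simp
    also have "\<dots> \<le> ennreal C * ennreal 4" by (rule mult_left_mono[OF e]) simp
    finally show ?thesis using that(2) by (simp add: ennreal_mult)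
  qed
  have s1: "\<bar>u\<bar> \<le> 1 / s * E" if "\<bar>s * u\<bar> \<le> E" for u E
    using that s by (simp add: abs_mult field_simps)
  have s4: "u ^ 4 \<le> 256 / s ^ 4 * E" if "(s * u) ^ 4 \<le> 256 * E" for u E
    using that s by (simp add: power_mult_distrib field_simps)
  have "(\<integral>\<^sup>+x. ennreal \<bar>g x - m\<bar> \<partial>Pi\<^sub>M I M) \<le> ennreal ((1 / s) * 4)"
  proof (rule *)
    show "\<bar>g x - m\<bar> \<le> 1 / s * (exp (s * (g x - m)) + exp (- (s * (g x - m))))" for x
      by (rule s1) (rule abs_le_exp_sum)
  qed (use s in simp)
  then show "(\<integral>\<^sup>+x. ennreal \<bar>g x - m\<bar> \<partial>Pi\<^sub>M I M) \<le> ennreal (4 * b * sqrt (card I))"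
    by (simp add: s_def mult_ac)
  have "(\<integral>\<^sup>+x. ennreal ((g x - m) ^ 4) \<partial>Pi\<^sub>M I M) \<le> ennreal ((256 / s ^ 4) * 4)"
  proof (rule *)
    show "(g x - m) ^ 4 \<le> 256 / s ^ 4 * (exp (s * (g x - m)) + exp (- (s * (g x - m))))" for x
      by (rule s4) (rule power4_le_exp_sum)
  qed (use s in simp)
  moreover have "256 / s ^ 4 * 4 = 1024 * b ^ 4 * ?c\<^sup>2"
  proof -
    have "(sqrt ?c) ^ 4 = ((sqrt ?c)\<^sup>2)\<^sup>2" by (simp only: power_mult[symmetric]) simp
    then show ?thesis by (simp add: s_def power_divide power_mult_distrib)
  qed
  ultimately show "(\<integral>\<^sup>+x. ennreal ((g x - m) ^ 4) \<partial>Pi\<^sub>M I M) \<le> ennreal (1024 * b ^ 4 * (card I)\<^sup>2)"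
    by simp
qed

lemma bounded_differences_moments_complex:
  fixes g :: "('i \<Rightarrow> 'a) \<Rightarrow> complex"
  assumes M: "\<And>i. prob_space (M i)" and I: "finite I" "I \<noteq> {}"
    and g[measurable]: "g \<in> borel_measurable (Pi\<^sub>M I M)"
    and bound: "\<And>x. x \<in> space (Pi\<^sub>M I M) \<Longrightarrow> cmod (g x) \<le> B"
    and diff: "\<And>x i y. x \<in> space (Pi\<^sub>M I M) \<Longrightarrow> i \<in> I \<Longrightarrow> y \<in> space (M i) \<Longrightarrow> cmod (g (x(i := y)) - g x) \<le> b"
    and b: "b > 0"
  defines "m \<equiv> (LINT x|Pi\<^sub>M I M. g x)"
  shows "(\<integral>\<^sup>+x. ennreal (cmod (g x - m)) \<partial>Pi\<^sub>M I M) \<le> ennreal (8 * b * sqrt (card I))"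
    and "(\<integral>\<^sup>+x. ennreal (cmod (g x - m) ^ 4) \<partial>Pi\<^sub>M I M) \<le> ennreal (4096 * b ^ 4 * (card I)\<^sup>2)"
proof -
  interpret PI: prob_space "Pi\<^sub>M I M" by (rule prob_space_PiM[OF M])
  have int: "integrable (Pi\<^sub>M I M) g"
    by (rule PI.integrable_const_bound[where B = B]) (auto intro: bound)
  have re: "Re m = (LINT x|Pi\<^sub>M I M. Re (g x))" and im: "Im m = (LINT x|Pi\<^sub>M I M. Im (g x))"
    unfolding m_def using int by auto
  have d: "\<bar>Re (g (x(i := y))) - Re (g x)\<bar> \<le> b" "\<bar>Im (g (x(i := y))) - Im (g x)\<bar> \<le> b"
    if "x \<in> space (Pi\<^sub>M I M)" "i \<in> I" "y \<in> space (M i)" for x i y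
    using diff[OF that] abs_Re_le_cmod[of "g (x(i := y)) - g x"] abs_Im_le_cmod[of "g (x(i := y)) - g x"] by auto
  have bd: "\<bar>Re (g x)\<bar> \<le> B" "\<bar>Im (g x)\<bar> \<le> B" if "x \<in> space (Pi\<^sub>M I M)" for x
    using bound[OF that] abs_Re_le_cmod[of "g x"] abs_Im_le_cmod[of "g x"] by auto
  have Rm: "(\<lambda>x. Re (g x)) \<in> borel_measurable (Pi\<^sub>M I M)" and Imm: "(\<lambda>x. Im (g x)) \<in> borel_measurable (Pi\<^sub>M I M)"
    by measurable
  note R = bounded_differences_moments[OF M I Rm bd(1) d(1) b, folded re]
  note J = bounded_differences_moments[OF M I Imm bd(2) d(2) b, folded im]
  have "(\<integral>\<^sup>+x. ennreal (cmod (g x - m)) \<partial>Pi\<^sub>M I M) \<le>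
      (\<integral>\<^sup>+x. ennreal \<bar>Re (g x) - Re m\<bar> + ennreal \<bar>Im (g x) - Im m\<bar> \<partial>Pi\<^sub>M I M)"
    using cmod_le[of "g _ - m"]
    by (intro nn_integral_mono) (simp add: ennreal_plus[symmetric] ennreal_leI del: ennreal_plus)
  also have "\<dots> = (\<integral>\<^sup>+x. ennreal \<bar>Re (g x) - Re m\<bar> \<partial>Pi\<^sub>M I M) + (\<integral>\<^sup>+x. ennreal \<bar>Im (g x) - Im m\<bar> \<partial>Pi\<^sub>M I M)"
    by (rule nn_integral_add) auto
  also have "\<dots> \<le> ennreal (4 * b * sqrt (card I)) + ennreal (4 * b * sqrt (card I))"
    by (rule add_mono[OF R(1) J(1)])
  also have "\<dots> = ennreal (8 * b * sqrt (card I))" using b by (simp add: ennreal_plus[symmetric] del: ennreal_plus)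
  finally show "(\<integral>\<^sup>+x. ennreal (cmod (g x - m)) \<partial>Pi\<^sub>M I M) \<le> ennreal (8 * b * sqrt (card I))" .
  have p4: "cmod w ^ 4 \<le> 2 * (Re w ^ 4) + 2 * (Im w ^ 4)" for w
  proof -
    have "cmod w ^ 4 = ((cmod w)\<^sup>2)\<^sup>2" by simp
    also have "\<dots> = ((Re w)\<^sup>2 + (Im w)\<^sup>2)\<^sup>2" by (simp only: cmod_power2)
    also have "\<dots> \<le> 2 * ((Re w)\<^sup>2)\<^sup>2 + 2 * ((Im w)\<^sup>2)\<^sup>2"
      using sum_squares_ge_zero[of "(Re w)\<^sup>2 - (Im w)\<^sup>2" 0] by (simp add: power2_eq_square algebra_simps)
    finally show ?thesis by simp
  qed
  have "(\<integral>\<^sup>+x. ennreal (cmod (g x - m) ^ 4) \<partial>Pi\<^sub>M I M) \<le>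
      (\<integral>\<^sup>+x. ennreal 2 * ennreal ((Re (g x) - Re m) ^ 4) + ennreal 2 * ennreal ((Im (g x) - Im m) ^ 4) \<partial>Pi\<^sub>M I M)"
  proof (rule nn_integral_mono)
    fix x
    have "ennreal 2 * ennreal a + ennreal 2 * ennreal b = ennreal (2 * a + 2 * b)" if "a \<ge> 0" "b \<ge> 0" for a b
      using that by (subst (1 2) ennreal_mult[symmetric]) (auto simp del: ennreal_plus simp: ennreal_plus[symmetric])
    from this[of "(Re (g x) - Re m) ^ 4" "(Im (g x) - Im m) ^ 4"] p4[of "g x - m"]
    show "ennreal (cmod (g x - m) ^ 4) \<le>
        ennreal 2 * ennreal ((Re (g x) - Re m) ^ 4) + ennreal 2 * ennreal ((Im (g x) - Im m) ^ 4)"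
      by (simp only: zero_le_even_power'[where n=2, simplified] minus_complex.simps) (simp add: ennreal_leI del: ennreal_plus)
  qed
  also have "\<dots> = ennreal 2 * (\<integral>\<^sup>+x. ennreal ((Re (g x) - Re m) ^ 4) \<partial>Pi\<^sub>M I M) +
      ennreal 2 * (\<integral>\<^sup>+x. ennreal ((Im (g x) - Im m) ^ 4) \<partial>Pi\<^sub>M I M)"
    by (subst nn_integral_add) (auto simp: nn_integral_cmult)
  also have "\<dots> \<le> ennreal 2 * ennreal (1024 * b ^ 4 * (card I)\<^sup>2) + ennreal 2 * ennreal (1024 * b ^ 4 * (card I)\<^sup>2)"
    by (intro add_mono mult_left_mono R(2) J(2)) auto
  also have "\<dots> = ennreal (4096 * b ^ 4 * (card I)\<^sup>2)"
    using b by (subst (1 2) ennreal_mult[symmetric]) (auto simp del: ennreal_plus simp: ennreal_plus[symmetric])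
  finally show "(\<integral>\<^sup>+x. ennreal (cmod (g x - m) ^ 4) \<partial>Pi\<^sub>M I M) \<le> ennreal (4096 * b ^ 4 * (card I)\<^sup>2)" .
qed

section \<open>Quadratic forms in independent entries\<close>

lemma nn_integral_le_sqrt:
  assumes "prob_space M" and f[measurable]: "f \<in> borel_measurable M" and S: "S > 0"
    and sq: "(\<integral>\<^sup>+x. ennreal ((f x)\<^sup>2) \<partial>M) \<le> ennreal S"
  shows "(\<integral>\<^sup>+x. ennreal (f x) \<partial>M) \<le> ennreal (sqrt S)"
proof -
  interpret prob_space M by fact
  define c where "c = 1 / (2 * sqrt S)"
  have c: "c > 0" "c * S = sqrt S / 2"
    unfolding c_def using S by (auto simp: real_div_sqrt field_simps)
  have "f x \<le> c * (f x)\<^sup>2 + sqrt S / 2" for x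
  proof -
    have "0 \<le> (f x - sqrt S)\<^sup>2" by simp
    also have "(f x - sqrt S)\<^sup>2 = (f x)\<^sup>2 + S - 2 * sqrt S * f x"
      using S by (simp add: power2_diff)
    finally have "2 * sqrt S * f x \<le> (f x)\<^sup>2 + S" by simp
    then have "c * (2 * sqrt S * f x) \<le> c * ((f x)\<^sup>2 + S)"
      using c by simp
    then show ?thesis
      using c(2) S by (simp add: distrib_left) (simp add: c_def)
  qed
  then have "(\<integral>\<^sup>+x. ennreal (f x) \<partial>M) \<le> (\<integral>\<^sup>+x. ennreal c * ennreal ((f x)\<^sup>2) + ennreal (sqrt S / 2) \<partial>M)"
    using c S by (intro nn_integral_mono)
      (simp add: ennreal_mult[symmetric] ennreal_plus[symmetric] ennreal_leI del: ennreal_plus)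
  also have "\<dots> = ennreal c * (\<integral>\<^sup>+x. ennreal ((f x)\<^sup>2) \<partial>M) + ennreal (sqrt S / 2)"
    by (subst nn_integral_add) (auto simp: nn_integral_cmult emeasure_space_1)
  also have "\<dots> \<le> ennreal c * ennreal S + ennreal (sqrt S / 2)"
    by (intro add_right_mono mult_left_mono sq) simp
  also have "\<dots> = ennreal (sqrt S)"
    using c S by (simp add: ennreal_mult[symmetric] ennreal_plus[symmetric] del: ennreal_plus)
  finally show ?thesis .
qed

lemma nn_integral_centred_shift:
  fixes \<phi> :: "'a \<Rightarrow> complex"
  assumes "prob_space M" and int: "integrable M \<phi>" and zero: "(LINT x|M. \<phi> x) = 0"
    and sq: "(\<integral>\<^sup>+x. ennreal ((cmod (\<phi> x))\<^sup>2) \<partial>M) \<le> ennreal s" and s: "s \<ge> 0"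
  shows "(\<integral>\<^sup>+x. ennreal ((cmod (A + \<phi> x))\<^sup>2) \<partial>M) \<le> ennreal ((cmod A)\<^sup>2 + s)"
proof -
  interpret prob_space M by fact
  have [measurable]: "\<phi> \<in> borel_measurable M" using int by simp
  have sqi: "integrable M (\<lambda>x. (cmod (\<phi> x))\<^sup>2)"
    by (rule integrableI_bounded) (use sq in \<open>auto simp: le_less_trans\<close>)
  have sql: "(LINT x|M. (cmod (\<phi> x))\<^sup>2) \<le> s"
    using sq s nn_integral_eq_integral[OF sqi] by simp
  define r where "r x = Re (cnj A * \<phi> x)" for x
  have eq: "(cmod (A + \<phi> x))\<^sup>2 = (cmod A)\<^sup>2 + 2 * r x + (cmod (\<phi> x))\<^sup>2" for x
    unfolding r_def by (simp only: cmod_power2) (simp add: power2_eq_square algebra_simps)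
  have i1: "integrable M (\<lambda>x. cnj A * \<phi> x)" using int by simp
  have ir: "integrable M r" unfolding r_def by (rule integrable_Re[OF i1])
  have "(LINT x|M. r x) = Re (LINT x|M. cnj A * \<phi> x)" unfolding r_def by (rule integral_Re[OF i1])
  then have r0: "(LINT x|M. r x) = 0" using zero by simp
  have "integrable M (\<lambda>x. (cmod (A + \<phi> x))\<^sup>2)"
    unfolding eq using sqi ir by simp
  then have "(\<integral>\<^sup>+x. ennreal ((cmod (A + \<phi> x))\<^sup>2) \<partial>M) = ennreal (LINT x|M. (cmod (A + \<phi> x))\<^sup>2)"
    by (rule nn_integral_eq_integral) simp
  also have "(LINT x|M. (cmod (A + \<phi> x))\<^sup>2) = (cmod A)\<^sup>2 + 2 * (LINT x|M. r x) + (LINT x|M. (cmod (\<phi> x))\<^sup>2)"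
    unfolding eq using sqi ir by (simp add: prob_space)
  also have "\<dots> \<le> (cmod A)\<^sup>2 + s"
    using r0 sql by simp
  finally show ?thesis by (simp add: ennreal_leI)
qed

lemma linear_form_second_moment:
  fixes \<nu> :: "'i \<Rightarrow> complex measure" and \<phi> :: "'i \<Rightarrow> complex \<Rightarrow> complex"
  assumes \<nu>: "\<And>i. prob_space (\<nu> i)" and sets[measurable_cong]: "\<And>i. sets (\<nu> i) = sets borel"
    and F: "finite F"
    and \<phi>[measurable]: "\<And>i. \<phi> i \<in> borel_measurable borel"
    and int: "\<And>i. i \<in> F \<Longrightarrow> integrable (\<nu> i) (\<phi> i)"
    and zero: "\<And>i. i \<in> F \<Longrightarrow> (LINT x|\<nu> i. \<phi> i x) = 0"
    and sq: "\<And>i. i \<in> F \<Longrightarrow> (\<integral>\<^sup>+x. ennreal ((cmod (\<phi> i x))\<^sup>2) \<partial>\<nu> i) \<le> ennreal s" and s: "s \<ge> 0"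
  shows "(\<integral>\<^sup>+x. ennreal ((cmod (\<Sum>i\<in>F. b i * \<phi> i (x i)))\<^sup>2) \<partial>Pi\<^sub>M F \<nu>) \<le> ennreal (s * (\<Sum>i\<in>F. (cmod (b i))\<^sup>2))"
  using F int zero sq
proof (induction F rule: finite_induct)
  case empty
  then show ?case by simp
next
  case (insert j F)
  interpret product_prob_space \<nu> by (rule product_prob_spaceI[OF \<nu>])
  interpret PF: prob_space "Pi\<^sub>M F \<nu>" by (rule prob_space_PiM[OF \<nu>])
  let ?T = "\<lambda>x. \<Sum>i\<in>F. b i * \<phi> i (x i)"
  have "(\<integral>\<^sup>+x. ennreal ((cmod (\<Sum>i\<in>insert j F. b i * \<phi> i (x i)))\<^sup>2) \<partial>Pi\<^sub>M (insert j F) \<nu>) =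
    (\<integral>\<^sup>+x. (\<integral>\<^sup>+y. ennreal ((cmod (\<Sum>i\<in>insert j F. b i * \<phi> i ((x(j := y)) i)))\<^sup>2) \<partial>\<nu> j) \<partial>Pi\<^sub>M F \<nu>)"
    by (rule product_nn_integral_insert[OF insert.hyps]) measurable
  also have "\<dots> = (\<integral>\<^sup>+x. (\<integral>\<^sup>+y. ennreal ((cmod (?T x + b j * \<phi> j y))\<^sup>2) \<partial>\<nu> j) \<partial>Pi\<^sub>M F \<nu>)"
  proof -
    have "(\<Sum>i\<in>insert j F. b i * \<phi> i ((x(j := y)) i)) = ?T x + b j * \<phi> j y" for x y
    proof -
      have "(\<Sum>i\<in>F. b i * \<phi> i ((x(j := y)) i)) = ?T x"
        using insert.hyps by (intro sum.cong refl) auto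
      then show ?thesis using insert.hyps by simp
    qed
    then show ?thesis by simp
  qed
  also have "\<dots> \<le> (\<integral>\<^sup>+x. ennreal ((cmod (?T x))\<^sup>2) + ennreal ((cmod (b j))\<^sup>2 * s) \<partial>Pi\<^sub>M F \<nu>)"
  proof (rule nn_integral_mono)
    fix x
    have "(\<integral>\<^sup>+y. ennreal ((cmod (?T x + b j * \<phi> j y))\<^sup>2) \<partial>\<nu> j) \<le> ennreal ((cmod (?T x))\<^sup>2 + (cmod (b j))\<^sup>2 * s)"
    proof (rule nn_integral_centred_shift[OF \<nu>])
      show "integrable (\<nu> j) (\<lambda>y. b j * \<phi> j y)" using insert.prems(1) by simp
      show "(LINT y|\<nu> j. b j * \<phi> j y) = 0" using insert.prems(2) by simp
      have "(\<integral>\<^sup>+y. ennreal ((cmod (b j * \<phi> j y))\<^sup>2) \<partial>\<nu> j) = ennreal ((cmod (b j))\<^sup>2) * (\<integral>\<^sup>+y. ennreal ((cmod (\<phi> j y))\<^sup>2) \<partial>\<nu> j)"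
        by (subst nn_integral_cmult[symmetric]) (auto simp: norm_mult power_mult_distrib ennreal_mult)
      also have "\<dots> \<le> ennreal ((cmod (b j))\<^sup>2) * ennreal s"
        by (intro mult_left_mono insert.prems(3)) auto
      finally show "(\<integral>\<^sup>+y. ennreal ((cmod (b j * \<phi> j y))\<^sup>2) \<partial>\<nu> j) \<le> ennreal ((cmod (b j))\<^sup>2 * s)"
        using s by (simp add: ennreal_mult)
    qed (use s in simp)
    then show "(\<integral>\<^sup>+y. ennreal ((cmod (?T x + b j * \<phi> j y))\<^sup>2) \<partial>\<nu> j) \<le> ennreal ((cmod (?T x))\<^sup>2) + ennreal ((cmod (b j))\<^sup>2 * s)"
      using s by simp
  qed
  also have "\<dots> = (\<integral>\<^sup>+x. ennreal ((cmod (?T x))\<^sup>2) \<partial>Pi\<^sub>M F \<nu>) + ennreal ((cmod (b j))\<^sup>2 * s)"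
    by (subst nn_integral_add) (auto simp: PF.emeasure_space_1)
  also have "\<dots> \<le> ennreal (s * (\<Sum>i\<in>F. (cmod (b i))\<^sup>2)) + ennreal ((cmod (b j))\<^sup>2 * s)"
    by (intro add_right_mono insert.IH insert.prems) auto
  also have "\<dots> = ennreal (s * (\<Sum>i\<in>insert j F. (cmod (b i))\<^sup>2))"
    using insert.hyps s by (simp add: ennreal_plus[symmetric] sum_nonneg algebra_simps del: ennreal_plus)
  finally show ?case .
qed

lemma borel_measurable_cnj [measurable]: "cnj \<in> borel_measurable borel"
  by (intro borel_measurable_continuous_onI continuous_intros)

lemma borel_measurable_PiM_component:
  "sets (\<nu> i) = sets borel \<Longrightarrow> i \<in> F \<Longrightarrow> (\<lambda>x. x i) \<in> borel_measurable (Pi\<^sub>M F \<nu>)"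
  using measurable_component_singleton[of i F \<nu>] measurable_cong_sets[OF refl, of "\<nu> i" borel "Pi\<^sub>M F \<nu>"]
  by simp

text \<open>A new coordinate \<open>j\<close> contributes a term linear in \<open>x j\<close> and its conjugate, with coefficients that do not
  involve \<open>x j\<close>. This term is centred given the rest, so its second moment is added to that of the rest.\<close>
lemma off_diagonal_second_moment:
  fixes \<nu> :: "'i \<Rightarrow> complex measure" and m :: "'i \<Rightarrow> 'i \<Rightarrow> complex"
  assumes \<nu>: "\<And>i. prob_space (\<nu> i)" and sets[measurable_cong]: "\<And>i. sets (\<nu> i) = sets borel"
    and F: "finite F"
    and int: "\<And>i. i \<in> F \<Longrightarrow> integrable (\<nu> i) (\<lambda>x. x)"
    and zero: "\<And>i. i \<in> F \<Longrightarrow> (LINT x|\<nu> i. x) = 0"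
    and sq: "\<And>i. i \<in> F \<Longrightarrow> (\<integral>\<^sup>+x. ennreal ((cmod x)\<^sup>2) \<partial>\<nu> i) \<le> ennreal 1"
  shows "(\<integral>\<^sup>+x. ennreal ((cmod (\<Sum>i\<in>F. \<Sum>l\<in>F - {i}. cnj (x i) * m i l * x l))\<^sup>2) \<partial>Pi\<^sub>M F \<nu>) \<le>
    ennreal (2 * (\<Sum>i\<in>F. \<Sum>l\<in>F - {i}. (cmod (m i l))\<^sup>2))"
  using F int zero sq
proof (induction F rule: finite_induct)
  case empty
  then show ?case by simp
next
  case (insert j F)
  interpret product_prob_space \<nu> by (rule product_prob_spaceI[OF \<nu>])
  interpret PF: prob_space "Pi\<^sub>M F \<nu>" by (rule prob_space_PiM[OF \<nu>])
  let ?T = "\<lambda>x. \<Sum>i\<in>F. \<Sum>l\<in>F - {i}. cnj (x i) * m i l * x l"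
  let ?u = "\<lambda>x. \<Sum>l\<in>F. m j l * x l"
  let ?t = "\<lambda>x. \<Sum>i\<in>F. m i j * cnj (x i)"
  note comp = borel_measurable_PiM_component[of \<nu>, OF sets]
  note compc = measurable_compose[OF comp borel_measurable_cnj]
  have meas: "(\<lambda>x. \<Sum>i\<in>G. \<Sum>l\<in>G - {i}. cnj (x i) * m i l * x l) \<in> borel_measurable (Pi\<^sub>M G \<nu>)" for G
    by (intro borel_measurable_sum borel_measurable_times compc comp borel_measurable_const) auto
  have meas2: "(\<lambda>x. ennreal ((cmod (\<Sum>i\<in>G. \<Sum>l\<in>G - {i}. cnj (x i) * m i l * x l))\<^sup>2)) \<in> borel_measurable (Pi\<^sub>M G \<nu>)" for G
    by (rule measurable_compose[OF meas, of "\<lambda>v. ennreal ((cmod v)\<^sup>2)"]) measurable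
  have [measurable]: "?u \<in> borel_measurable (Pi\<^sub>M F \<nu>)" "?t \<in> borel_measurable (Pi\<^sub>M F \<nu>)" "?T \<in> borel_measurable (Pi\<^sub>M F \<nu>)"
    by (intro borel_measurable_sum borel_measurable_times compc comp borel_measurable_const meas; simp)+
  have meas_enn[simp]: "(\<lambda>x. ennreal ((cmod (?T x))\<^sup>2)) \<in> borel_measurable (Pi\<^sub>M F \<nu>)"
    "(\<lambda>x. ennreal ((cmod (?u x))\<^sup>2)) \<in> borel_measurable (Pi\<^sub>M F \<nu>)"
    "(\<lambda>x. ennreal ((cmod (?t x))\<^sup>2)) \<in> borel_measurable (Pi\<^sub>M F \<nu>)"
    by measurable
  have m2: "(\<lambda>x. ennreal 2 * ennreal ((cmod (?u x))\<^sup>2)) \<in> borel_measurable (Pi\<^sub>M F \<nu>)"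
    "(\<lambda>x. ennreal 2 * ennreal ((cmod (?t x))\<^sup>2)) \<in> borel_measurable (Pi\<^sub>M F \<nu>)"
    by measurable
  have split: "(\<Sum>i\<in>insert j F. \<Sum>l\<in>insert j F - {i}. f i l) =
      (\<Sum>i\<in>F. \<Sum>l\<in>F - {i}. f i l) + (\<Sum>l\<in>F. f j l) + (\<Sum>i\<in>F. f i j)" for f :: "'i \<Rightarrow> 'i \<Rightarrow> 'b::comm_monoid_add"
  proof -
    have "(\<Sum>l\<in>insert j F - {i}. f i l) = f i j + (\<Sum>l\<in>F - {i}. f i l)" if "i \<in> F" for i
    proof -
      have "insert j F - {i} = insert j (F - {i})" using that insert.hyps by auto
      then show ?thesis using insert.hyps by simp
    qed
    moreover have "insert j F - {j} = F" using insert.hyps by auto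
    ultimately show ?thesis
      using insert.hyps by (simp add: sum.distrib add_ac)
  qed
  have "(\<integral>\<^sup>+x. ennreal ((cmod (\<Sum>i\<in>insert j F. \<Sum>l\<in>insert j F - {i}. cnj (x i) * m i l * x l))\<^sup>2) \<partial>Pi\<^sub>M (insert j F) \<nu>) =
    (\<integral>\<^sup>+x. (\<integral>\<^sup>+y. ennreal ((cmod (\<Sum>i\<in>insert j F. \<Sum>l\<in>insert j F - {i}. cnj ((x(j := y)) i) * m i l * (x(j := y)) l))\<^sup>2) \<partial>\<nu> j) \<partial>Pi\<^sub>M F \<nu>)"
    by (rule product_nn_integral_insert[OF insert.hyps]) (rule meas2)
  also have "\<dots> = (\<integral>\<^sup>+x. (\<integral>\<^sup>+y. ennreal ((cmod (?T x + (cnj y * ?u x + y * ?t x)))\<^sup>2) \<partial>\<nu> j) \<partial>Pi\<^sub>M F \<nu>)"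
  proof -
    have "(\<Sum>i\<in>insert j F. \<Sum>l\<in>insert j F - {i}. cnj ((x(j := y)) i) * m i l * (x(j := y)) l) =
      ?T x + (cnj y * ?u x + y * ?t x)" for x y
    proof -
      have "(\<Sum>i\<in>F. \<Sum>l\<in>F - {i}. cnj ((x(j := y)) i) * m i l * (x(j := y)) l) = ?T x"
        using insert.hyps by (intro sum.cong refl) auto
      moreover have "(\<Sum>l\<in>F. cnj ((x(j := y)) j) * m j l * (x(j := y)) l) = cnj y * ?u x"
        unfolding sum_distrib_left using insert.hyps by (intro sum.cong refl) auto
      moreover have "(\<Sum>i\<in>F. cnj ((x(j := y)) i) * m i j * (x(j := y)) j) = y * ?t x"
        unfolding sum_distrib_left using insert.hyps by (intro sum.cong refl) auto
      ultimately show ?thesis unfolding split by (simp only: add.assoc)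
    qed
    then show ?thesis by simp
  qed
  also have "\<dots> \<le> (\<integral>\<^sup>+x. ennreal ((cmod (?T x))\<^sup>2) + (ennreal 2 * ennreal ((cmod (?u x))\<^sup>2) + ennreal 2 * ennreal ((cmod (?t x))\<^sup>2)) \<partial>Pi\<^sub>M F \<nu>)"
  proof (rule nn_integral_mono)
    fix x
    let ?s = "2 * (cmod (?u x))\<^sup>2 + 2 * (cmod (?t x))\<^sup>2"
    have intj: "integrable (\<nu> j) (\<lambda>y. y)" "integrable (\<nu> j) (\<lambda>y. cnj y)" using insert.prems(1)[of j] by auto
    have "(\<integral>\<^sup>+y. ennreal ((cmod (?T x + (cnj y * ?u x + y * ?t x)))\<^sup>2) \<partial>\<nu> j) \<le> ennreal ((cmod (?T x))\<^sup>2 + ?s)"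
    proof (rule nn_integral_centred_shift[OF \<nu>])
      show "integrable (\<nu> j) (\<lambda>y. cnj y * ?u x + y * ?t x)"
        using intj by simp
      show "(LINT y|\<nu> j. cnj y * ?u x + y * ?t x) = 0"
        using insert.prems(2)[of j] intj by (subst Bochner_Integration.integral_add) auto
      have "(\<integral>\<^sup>+y. ennreal ((cmod (cnj y * ?u x + y * ?t x))\<^sup>2) \<partial>\<nu> j) \<le> (\<integral>\<^sup>+y. ennreal ?s * ennreal ((cmod y)\<^sup>2) \<partial>\<nu> j)"
      proof (rule nn_integral_mono)
        fix y
        have "cmod (cnj y * ?u x + y * ?t x) \<le> cmod y * (cmod (?u x) + cmod (?t x))"
          by (rule order_trans[OF norm_triangle_ineq]) (simp add: norm_mult distrib_left)
        then have "(cmod (cnj y * ?u x + y * ?t x))\<^sup>2 \<le> (cmod y * (cmod (?u x) + cmod (?t x)))\<^sup>2"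
          by (rule power_mono) simp
        also have "\<dots> = (cmod y)\<^sup>2 * (cmod (?u x) + cmod (?t x))\<^sup>2" by (simp add: power_mult_distrib)
        also have "\<dots> \<le> (cmod y)\<^sup>2 * ?s"
          using sum_squares_ge_zero[of "cmod (?u x) - cmod (?t x)" 0]
          by (intro mult_left_mono) (auto simp: power2_eq_square algebra_simps)
        finally show "ennreal ((cmod (cnj y * ?u x + y * ?t x))\<^sup>2) \<le> ennreal ?s * ennreal ((cmod y)\<^sup>2)"
          by (simp add: ennreal_mult[symmetric] ennreal_leI mult.commute del: ennreal_plus)
      qed
      also have "\<dots> = ennreal ?s * (\<integral>\<^sup>+y. ennreal ((cmod y)\<^sup>2) \<partial>\<nu> j)"
        by (rule nn_integral_cmult) measurable
      also have "\<dots> \<le> ennreal ?s * ennreal 1"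
        by (intro mult_left_mono insert.prems(3)) auto
      finally show "(\<integral>\<^sup>+y. ennreal ((cmod (cnj y * ?u x + y * ?t x))\<^sup>2) \<partial>\<nu> j) \<le> ennreal ?s" by simp
    qed simp
    also have "\<dots> = ennreal ((cmod (?T x))\<^sup>2) + (ennreal 2 * ennreal ((cmod (?u x))\<^sup>2) + ennreal 2 * ennreal ((cmod (?t x))\<^sup>2))"
      by (simp add: ennreal_mult)
    finally show "(\<integral>\<^sup>+y. ennreal ((cmod (?T x + (cnj y * ?u x + y * ?t x)))\<^sup>2) \<partial>\<nu> j) \<le> \<dots>" .
  qed
  also have "\<dots> = (\<integral>\<^sup>+x. ennreal ((cmod (?T x))\<^sup>2) \<partial>Pi\<^sub>M F \<nu>) +
      (ennreal 2 * (\<integral>\<^sup>+x. ennreal ((cmod (?u x))\<^sup>2) \<partial>Pi\<^sub>M F \<nu>) + ennreal 2 * (\<integral>\<^sup>+x. ennreal ((cmod (?t x))\<^sup>2) \<partial>Pi\<^sub>M F \<nu>))"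
    unfolding nn_integral_add[OF meas_enn(1) borel_measurable_add[OF m2]] nn_integral_add[OF m2]
      nn_integral_cmult[OF meas_enn(2)] nn_integral_cmult[OF meas_enn(3)] ..
  also have "\<dots> \<le> ennreal (2 * (\<Sum>i\<in>F. \<Sum>l\<in>F - {i}. (cmod (m i l))\<^sup>2)) +
      (ennreal 2 * ennreal (1 * (\<Sum>l\<in>F. (cmod (m j l))\<^sup>2)) + ennreal 2 * ennreal (1 * (\<Sum>i\<in>F. (cmod (m i j))\<^sup>2)))"
  proof (intro add_mono mult_left_mono insert.IH)
    show "(\<integral>\<^sup>+x. ennreal ((cmod (?u x))\<^sup>2) \<partial>Pi\<^sub>M F \<nu>) \<le> ennreal (1 * (\<Sum>l\<in>F. (cmod (m j l))\<^sup>2))"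
      by (rule linear_form_second_moment[OF \<nu> sets insert.hyps(1)]) (use insert.prems in auto)
    show "(\<integral>\<^sup>+x. ennreal ((cmod (?t x))\<^sup>2) \<partial>Pi\<^sub>M F \<nu>) \<le> ennreal (1 * (\<Sum>i\<in>F. (cmod (m i j))\<^sup>2))"
      by (rule linear_form_second_moment[OF \<nu> sets insert.hyps(1), where \<phi> = "\<lambda>_. cnj"]) (use insert.prems in \<open>auto simp: borel_measurable_cnj\<close>)
  qed (use insert.prems in auto)
  also have "\<dots> = ennreal (2 * (\<Sum>i\<in>insert j F. \<Sum>l\<in>insert j F - {i}. (cmod (m i l))\<^sup>2))"
  proof -
    have key: "ennreal (2 * a) + (ennreal 2 * ennreal (1 * b) + ennreal 2 * ennreal (1 * c)) = ennreal (2 * (a + b + c))"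
      if "a \<ge> 0" "b \<ge> 0" "c \<ge> 0" for a b c
    proof -
      have "ennreal 2 * ennreal (1 * b) = ennreal (2 * b)" "ennreal 2 * ennreal (1 * c) = ennreal (2 * c)"
        using that by (simp_all only: ennreal_mult'[symmetric] mult_1_left zero_le_numeral)
      then show ?thesis
        using that by (simp only: ennreal_plus[symmetric] add_nonneg_nonneg mult_nonneg_nonneg zero_le_numeral distrib_left add.assoc)
    qed
    then show ?thesis unfolding split by (intro key sum_nonneg zero_le_power2)
  qed
  finally show ?case .
qed

text \<open>Only second moments of the entries are at hand, so the diagonal terms \<open>|x i|\<^sup>2\<close> are cut at the level
  \<open>\<tau>\<close>. Below it, \<open>|x i|\<^sup>4 \<le> \<tau>\<^sup>2 |x i|\<^sup>2\<close> bounds the variance; above it,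
  the mean is \<open>L i\<close>. For \<open>\<tau> = h sqrt n\<close> and under a Lindeberg condition the bracket is \<open>h n +
  o(n)\<close>.\<close>
lemma quadratic_form_concentration:
  fixes \<nu> :: "nat \<Rightarrow> complex measure" and T :: "nat \<Rightarrow> nat \<Rightarrow> complex" and w L :: "nat \<Rightarrow> real"
  assumes \<nu>: "\<And>i. prob_space (\<nu> i)" and sets[measurable_cong]: "\<And>i. sets (\<nu> i) = sets borel"
    and int: "\<And>i. i < n \<Longrightarrow> integrable (\<nu> i) (\<lambda>x. x)"
    and zero: "\<And>i. i < n \<Longrightarrow> (LINT x|\<nu> i. x) = 0"
    and sq: "\<And>i. i < n \<Longrightarrow> (\<integral>\<^sup>+x. ennreal ((cmod x)\<^sup>2) \<partial>\<nu> i) = ennreal 1"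
    and L: "\<And>i. i < n \<Longrightarrow> (LINT x|\<nu> i. (cmod x)\<^sup>2 * of_bool (cmod x \<ge> \<tau>)) = L i"
    and w: "\<And>i. i < n \<Longrightarrow> \<bar>w i\<bar> \<le> W" and T: "\<And>l. l < n \<Longrightarrow> (\<Sum>i<n. (cmod (T i l))\<^sup>2) \<le> K\<^sup>2"
    and pos: "W > 0" "K > 0" "\<tau> > 0" "n > 0"
  shows "(\<integral>\<^sup>+x. ennreal (cmod ((\<Sum>i<n. \<Sum>l<n. cnj (of_real (w i) * x i) * T i l * (of_real (w l) * x l)) -
      (\<Sum>i<n. of_real ((w i)\<^sup>2) * T i i))) \<partial>Pi\<^sub>M {..<n} \<nu>) \<le>
    ennreal (W\<^sup>2 * K * (sqrt (2 * n) + \<tau> * sqrt n + 2 * (\<Sum>i<n. L i)))"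
proof -
  interpret product_prob_space \<nu> by (rule product_prob_spaceI[OF \<nu>])
  interpret PF: prob_space "Pi\<^sub>M {..<n} \<nu>" by (rule prob_space_PiM[OF \<nu>])
  (* off-diagonal part, truncated and centred diagonal, and the diagonal above the level *)
  define m where "m i l = of_real (w i) * of_real (w l) * T i l" for i l
  define t where "t x = (cmod x)\<^sup>2 * of_bool (cmod x < \<tau>)" for x :: complex
  define \<theta> where "\<theta> i x = complex_of_real (t x - (1 - L i))" for i x
  define \<rho> where "\<rho> i x = (cmod x)\<^sup>2 * of_bool (cmod x \<ge> \<tau>)" for i :: nat and x :: complex
  let ?off = "\<lambda>x. \<Sum>i<n. \<Sum>l\<in>{..<n} - {i}. cnj (x i) * m i l * x l"
  let ?mid = "\<lambda>x. \<Sum>i<n. m i i * \<theta> i (x i)"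
  let ?far = "\<lambda>x. \<Sum>i<n. cmod (m i i) * (\<rho> i (x i) + L i)"
  have sq_int: "integrable (\<nu> i) (\<lambda>x. (cmod x)\<^sup>2)" if "i < n" for i
    by (rule integrableI_bounded) (use sq[OF that] in auto)
  have sq1: "(LINT x|\<nu> i. (cmod x)\<^sup>2) = 1" if "i < n" for i
    using sq[OF that] nn_integral_eq_integral[OF sq_int[OF that]] by simp
  have rho_int: "integrable (\<nu> i) (\<rho> i)" if "i < n" for i
    unfolding \<rho>_def by (rule Bochner_Integration.integrable_bound[OF sq_int[OF that]]) (auto simp: of_bool_def)
  have L0: "L i \<ge> 0" if "i < n" for i
    unfolding L[OF that, symmetric] by (rule integral_nonneg_AE) auto
  have rho_L: "(LINT x|\<nu> i. \<rho> i x) = L i" if "i < n" for i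
    using L[OF that] by (simp add: \<rho>_def)
  have tr_int: "integrable (\<nu> i) t" if "i < n" for i
    unfolding t_def by (rule Bochner_Integration.integrable_bound[OF sq_int[OF that]]) (auto simp: of_bool_def)
  have tr: "(LINT x|\<nu> i. t x) = 1 - L i" if "i < n" for i
  proof -
    have "(LINT x|\<nu> i. t x) = (LINT x|\<nu> i. (cmod x)\<^sup>2 - \<rho> i x)"
      unfolding \<rho>_def t_def by (intro Bochner_Integration.integral_cong refl) (auto simp: of_bool_def)
    also have "\<dots> = 1 - L i"
      using Bochner_Integration.integral_diff[OF sq_int[OF that] rho_int[OF that]] sq1[OF that] rho_L[OF that] by simp
    finally show ?thesis .
  qed
  have t_meas[measurable]: "t \<in> borel_measurable borel" unfolding t_def by measurable
  have theta_meas[measurable]: "\<theta> i \<in> borel_measurable borel" for i unfolding \<theta>_def by measurable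
  have rho_meas[measurable]: "\<rho> i \<in> borel_measurable borel" for i unfolding \<rho>_def by measurable
  have theta_int: "integrable (\<nu> i) (\<theta> i)" if "i < n" for i
    unfolding \<theta>_def using tr_int[OF that] by (intro integrable_of_real Bochner_Integration.integrable_diff) auto
  have theta_zero: "(LINT x|\<nu> i. \<theta> i x) = 0" if "i < n" for i
  proof -
    have "(LINT x|\<nu> i. \<theta> i x) = of_real (LINT x|\<nu> i. t x - (1 - L i))"
      unfolding \<theta>_def by (rule integral_complex_of_real)
    also have "(LINT x|\<nu> i. t x - (1 - L i)) = 0"
      using tr_int[OF that] tr[OF that] by (simp add: M.prob_space)
    finally show ?thesis by simp
  qed
  have theta_sq: "(\<integral>\<^sup>+x. ennreal ((cmod (\<theta> i x))\<^sup>2) \<partial>\<nu> i) \<le> ennreal (\<tau>\<^sup>2)" if "i < n" for i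
  proof -
    note ti = tr_int[OF that] tr[OF that]
    have t2: "(t x)\<^sup>2 \<le> \<tau>\<^sup>2 * (cmod x)\<^sup>2" for x
    proof (cases "cmod x < \<tau>")
      case True
      then have "(cmod x)\<^sup>2 * (cmod x)\<^sup>2 \<le> \<tau>\<^sup>2 * (cmod x)\<^sup>2"
        by (intro mult_right_mono power_mono) auto
      then show ?thesis using True by (simp add: t_def power2_eq_square mult.assoc)
    qed (simp add: t_def)
    have t2i: "integrable (\<nu> i) (\<lambda>x. (t x)\<^sup>2)"
      by (rule Bochner_Integration.integrable_bound[of _ "\<lambda>x. \<tau>\<^sup>2 * (cmod x)\<^sup>2"])
        (use sq_int[OF that] t2 in auto)
    have eq: "(cmod (\<theta> i x))\<^sup>2 = (t x)\<^sup>2 - 2 * (1 - L i) * t x + (1 - L i)\<^sup>2" for x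
      unfolding \<theta>_def norm_of_real power2_abs by (simp add: power2_diff)
    have i2: "integrable (\<nu> i) (\<lambda>x. (cmod (\<theta> i x))\<^sup>2)"
      unfolding eq using t2i ti by simp
    have "(LINT x|\<nu> i. (cmod (\<theta> i x))\<^sup>2) = (LINT x|\<nu> i. (t x)\<^sup>2) - 2 * (1 - L i) * (1 - L i) + (1 - L i)\<^sup>2"
      unfolding eq using t2i ti by (simp add: M.prob_space)
    also have "\<dots> \<le> (LINT x|\<nu> i. (t x)\<^sup>2)"
      using zero_le_square[of "1 - L i"] by (simp add: power2_eq_square algebra_simps)
    also have "\<dots> \<le> (LINT x|\<nu> i. \<tau>\<^sup>2 * (cmod x)\<^sup>2)"
      by (rule integral_mono[OF t2i]) (use sq_int[OF that] t2 in auto)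
    also have "\<dots> = \<tau>\<^sup>2" using sq1[OF that] by simp
    finally show ?thesis using nn_integral_eq_integral[OF i2] by (simp add: ennreal_leI)
  qed
  have W2: "\<bar>w i * w l\<bar> \<le> W\<^sup>2" if "i < n" "l < n" for i l
    unfolding abs_mult power2_eq_square using w[OF that(1)] w[OF that(2)] pos by (intro mult_mono) auto
  have mT: "(cmod (m i l))\<^sup>2 \<le> W ^ 4 * (cmod (T i l))\<^sup>2" if "i < n" "l < n" for i l
  proof -
    have "(cmod (m i l))\<^sup>2 = (\<bar>w i * w l\<bar>)\<^sup>2 * (cmod (T i l))\<^sup>2"
      by (simp add: m_def norm_mult power_mult_distrib)
    also have "\<dots> \<le> (W\<^sup>2)\<^sup>2 * (cmod (T i l))\<^sup>2"
      using W2[OF that] by (intro mult_right_mono power_mono) auto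
    finally show ?thesis by simp
  qed
  have Tii: "cmod (T i i) \<le> K" if "i < n" for i
  proof (rule power2_le_imp_le)
    have "(cmod (T i i))\<^sup>2 \<le> (\<Sum>j<n. (cmod (T j i))\<^sup>2)" using that by (intro member_le_sum) auto
    then show "(cmod (T i i))\<^sup>2 \<le> K\<^sup>2" using T[OF that] by simp
  qed (use pos in simp)
  have mii: "cmod (m i i) \<le> W\<^sup>2 * K" if "i < n" for i
    unfolding m_def norm_mult norm_of_real using W2[OF that that] Tii[OF that] pos
    by (intro mult_mono) (auto simp: abs_mult)
  have off_sum: "(\<Sum>i<n. \<Sum>l\<in>{..<n} - {i}. (cmod (m i l))\<^sup>2) \<le> n * (W ^ 4 * K\<^sup>2)"
  proof -
    have "(\<Sum>i<n. \<Sum>l\<in>{..<n} - {i}. (cmod (m i l))\<^sup>2) \<le> (\<Sum>i<n. \<Sum>l<n. W ^ 4 * (cmod (T i l))\<^sup>2)"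
    proof (rule sum_mono)
      fix i assume i: "i \<in> {..<n}"
      have "(\<Sum>l\<in>{..<n} - {i}. (cmod (m i l))\<^sup>2) \<le> (\<Sum>l<n. (cmod (m i l))\<^sup>2)"
        by (rule sum_mono2) auto
      also have "\<dots> \<le> (\<Sum>l<n. W ^ 4 * (cmod (T i l))\<^sup>2)"
        using i by (intro sum_mono mT) auto
      finally show "(\<Sum>l\<in>{..<n} - {i}. (cmod (m i l))\<^sup>2) \<le> (\<Sum>l<n. W ^ 4 * (cmod (T i l))\<^sup>2)" .
    qed
    also have "\<dots> = (\<Sum>l<n. W ^ 4 * (\<Sum>i<n. (cmod (T i l))\<^sup>2))"
      unfolding sum_distrib_left by (rule sum.swap)
    also have "\<dots> \<le> (\<Sum>l<n. W ^ 4 * K\<^sup>2)"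
      using pos by (intro sum_mono mult_left_mono T) auto
    finally show ?thesis by simp
  qed
  note comp = borel_measurable_PiM_component[of \<nu>, OF sets]
  have offm[measurable]: "?off \<in> borel_measurable (Pi\<^sub>M {..<n} \<nu>)"
    by (intro borel_measurable_sum borel_measurable_times borel_measurable_const comp
        measurable_compose[OF comp borel_measurable_cnj]) auto
  have midm[measurable]: "?mid \<in> borel_measurable (Pi\<^sub>M {..<n} \<nu>)"
    by (intro borel_measurable_sum borel_measurable_times borel_measurable_const
        measurable_compose[OF comp theta_meas]) auto
  have farm[measurable]: "?far \<in> borel_measurable (Pi\<^sub>M {..<n} \<nu>)"
    by (intro borel_measurable_sum borel_measurable_times borel_measurable_add borel_measurable_const
        measurable_compose[OF comp rho_meas]) auto
  have off: "(\<integral>\<^sup>+x. ennreal (cmod (?off x)) \<partial>Pi\<^sub>M {..<n} \<nu>) \<le> ennreal (W\<^sup>2 * K * sqrt (2 * n))"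
  proof -
    have "(\<integral>\<^sup>+x. ennreal ((cmod (?off x))\<^sup>2) \<partial>Pi\<^sub>M {..<n} \<nu>) \<le>
        ennreal (2 * (\<Sum>i<n. \<Sum>l\<in>{..<n} - {i}. (cmod (m i l))\<^sup>2))"
      by (rule off_diagonal_second_moment[OF \<nu> sets]) (use int zero sq in auto)
    also have "\<dots> \<le> ennreal (2 * n * (W ^ 4 * K\<^sup>2))"
      using off_sum by (intro ennreal_leI) simp
    finally have "(\<integral>\<^sup>+x. ennreal (cmod (?off x)) \<partial>Pi\<^sub>M {..<n} \<nu>) \<le> ennreal (sqrt (2 * n * (W ^ 4 * K\<^sup>2)))"
      by (intro nn_integral_le_sqrt[OF PF.prob_space_axioms]) (use pos in auto)
    also have "sqrt (2 * n * (W ^ 4 * K\<^sup>2)) = W\<^sup>2 * K * sqrt (2 * n)"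
    proof -
      have "W ^ 4 * K\<^sup>2 = (W\<^sup>2 * K)\<^sup>2" by (simp add: power_mult_distrib)
      then show ?thesis using pos by (simp add: real_sqrt_mult)
    qed
    finally show ?thesis .
  qed
  have mid: "(\<integral>\<^sup>+x. ennreal (cmod (?mid x)) \<partial>Pi\<^sub>M {..<n} \<nu>) \<le> ennreal (W\<^sup>2 * K * (\<tau> * sqrt n))"
  proof -
    have "(\<integral>\<^sup>+x. ennreal ((cmod (?mid x))\<^sup>2) \<partial>Pi\<^sub>M {..<n} \<nu>) \<le>
        ennreal (\<tau>\<^sup>2 * (\<Sum>i<n. (cmod (m i i))\<^sup>2))"
      by (rule linear_form_second_moment[OF \<nu> sets]) (use theta_int theta_zero theta_sq in auto)
    also have "\<dots> \<le> ennreal (\<tau>\<^sup>2 * (n * (W\<^sup>2 * K)\<^sup>2))"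
    proof (intro ennreal_leI mult_left_mono)
      have "(\<Sum>i<n. (cmod (m i i))\<^sup>2) \<le> (\<Sum>i<n. (W\<^sup>2 * K)\<^sup>2)"
        by (intro sum_mono power_mono mii) auto
      then show "(\<Sum>i<n. (cmod (m i i))\<^sup>2) \<le> n * (W\<^sup>2 * K)\<^sup>2" by simp
    qed simp
    finally have "(\<integral>\<^sup>+x. ennreal (cmod (?mid x)) \<partial>Pi\<^sub>M {..<n} \<nu>) \<le> ennreal (sqrt (\<tau>\<^sup>2 * (n * (W\<^sup>2 * K)\<^sup>2)))"
      by (intro nn_integral_le_sqrt[OF PF.prob_space_axioms]) (use pos in auto)
    also have "sqrt (\<tau>\<^sup>2 * (n * (W\<^sup>2 * K)\<^sup>2)) = W\<^sup>2 * K * (\<tau> * sqrt n)"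
      using pos by (simp add: real_sqrt_mult)
    finally show ?thesis .
  qed
  have far: "(\<integral>\<^sup>+x. ennreal (?far x) \<partial>Pi\<^sub>M {..<n} \<nu>) \<le> ennreal (W\<^sup>2 * K * (2 * (\<Sum>i<n. L i)))"
  proof -
    have far1: "(\<integral>\<^sup>+x. ennreal (\<rho> i (x i)) \<partial>Pi\<^sub>M {..<n} \<nu>) = ennreal (L i)" if "i < n" for i
    proof -
      have "(\<integral>\<^sup>+x. ennreal (\<rho> i (x i)) \<partial>Pi\<^sub>M {..<n} \<nu>) = (\<integral>\<^sup>+y. ennreal (\<rho> i y) \<partial>distr (Pi\<^sub>M {..<n} \<nu>) (\<nu> i) (\<lambda>x. x i))"
        using that by (subst nn_integral_distr) auto
      also have "\<dots> = (\<integral>\<^sup>+y. ennreal (\<rho> i y) \<partial>\<nu> i)"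
        using distr_PiM_component[of "{..<n}" \<nu> i] \<nu> that by simp
      also have "\<dots> = ennreal (LINT y|\<nu> i. \<rho> i y)"
        by (rule nn_integral_eq_integral[OF rho_int[OF that]]) (simp add: \<rho>_def)
      finally show ?thesis using L[OF that] by (simp add: \<rho>_def)
    qed
    have rho0: "\<rho> i y \<ge> 0" for i y by (simp add: \<rho>_def)
    have cm[measurable]: "(\<lambda>x. \<rho> i (x i)) \<in> borel_measurable (Pi\<^sub>M {..<n} \<nu>)" if "i < n" for i
      using measurable_compose[OF comp rho_meas] that by simp
    have "(\<integral>\<^sup>+x. ennreal (?far x) \<partial>Pi\<^sub>M {..<n} \<nu>) =
        (\<integral>\<^sup>+x. (\<Sum>i<n. ennreal (cmod (m i i)) * (ennreal (\<rho> i (x i)) + ennreal (L i))) \<partial>Pi\<^sub>M {..<n} \<nu>)"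
    proof (rule nn_integral_cong)
      fix x
      have "ennreal (?far x) = (\<Sum>i<n. ennreal (cmod (m i i) * (\<rho> i (x i) + L i)))"
        by (rule sum_ennreal[symmetric]) (use L0 rho0 in \<open>auto intro!: mult_nonneg_nonneg add_nonneg_nonneg\<close>)
      also have "\<dots> = (\<Sum>i<n. ennreal (cmod (m i i)) * (ennreal (\<rho> i (x i)) + ennreal (L i)))"
        by (intro sum.cong refl) (use L0 rho0 in \<open>simp add: ennreal_mult\<close>)
      finally show "ennreal (?far x) = (\<Sum>i<n. ennreal (cmod (m i i)) * (ennreal (\<rho> i (x i)) + ennreal (L i)))" .
    qed
    also have "\<dots> = (\<Sum>i<n. \<integral>\<^sup>+x. ennreal (cmod (m i i)) * (ennreal (\<rho> i (x i)) + ennreal (L i)) \<partial>Pi\<^sub>M {..<n} \<nu>)"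
      by (rule nn_integral_sum) simp
    also have "\<dots> = (\<Sum>i<n. ennreal (cmod (m i i)) * (ennreal (L i) + ennreal (L i)))"
      by (intro sum.cong refl) (simp add: nn_integral_cmult nn_integral_add far1 PF.emeasure_space_1)
    also have "\<dots> = ennreal (\<Sum>i<n. cmod (m i i) * (2 * L i))"
    proof -
      have "(\<Sum>i<n. ennreal (cmod (m i i)) * (ennreal (L i) + ennreal (L i))) = (\<Sum>i<n. ennreal (cmod (m i i) * (2 * L i)))"
        by (intro sum.cong refl) (use L0 in \<open>simp add: ennreal_mult[symmetric] ennreal_plus[symmetric] del: ennreal_plus\<close>)
      also have "\<dots> = ennreal (\<Sum>i<n. cmod (m i i) * (2 * L i))"
        by (rule sum_ennreal) (use L0 in auto)
      finally show ?thesis .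
    qed
    also have "\<dots> \<le> ennreal (\<Sum>i<n. (W\<^sup>2 * K) * (2 * L i))"
      using L0 mii by (intro ennreal_leI sum_mono mult_right_mono) auto
    finally show ?thesis by (simp add: sum_distrib_left)
  qed
  have "cmod ((\<Sum>i<n. \<Sum>l<n. cnj (of_real (w i) * x i) * T i l * (of_real (w l) * x l)) -
      (\<Sum>i<n. of_real ((w i)\<^sup>2) * T i i)) \<le> cmod (?off x) + (cmod (?mid x) + ?far x)" for x
  proof -
    have "(\<Sum>l<n. cnj (of_real (w i) * x i) * T i l * (of_real (w l) * x l)) =
        m i i * of_real ((cmod (x i))\<^sup>2) + (\<Sum>l\<in>{..<n} - {i}. cnj (x i) * m i l * x l)" if "i < n" for i
    proof -
      have "(\<Sum>l<n. cnj (of_real (w i) * x i) * T i l * (of_real (w l) * x l)) = (\<Sum>l<n. cnj (x i) * m i l * x l)"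
        by (intro sum.cong refl) (simp add: m_def mult_ac)
      also have "\<dots> = cnj (x i) * m i i * x i + (\<Sum>l\<in>{..<n} - {i}. cnj (x i) * m i l * x l)"
        using that by (intro sum.remove) auto
      also have "cnj (x i) * m i i * x i = m i i * of_real ((cmod (x i))\<^sup>2)"
        by (simp only: complex_norm_square) (simp add: mult_ac)
      finally show ?thesis .
    qed
    then have s1: "(\<Sum>i<n. \<Sum>l<n. cnj (of_real (w i) * x i) * T i l * (of_real (w l) * x l)) =
        (\<Sum>i<n. m i i * of_real ((cmod (x i))\<^sup>2)) + ?off x"
      unfolding sum.distrib[symmetric] by (intro sum.cong refl) auto
    have s2: "m i i * of_real ((cmod (x i))\<^sup>2) - of_real ((w i)\<^sup>2) * T i i =
        m i i * \<theta> i (x i) + m i i * of_real (\<rho> i (x i) - L i)" for i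
    proof -
      have "(cmod (x i))\<^sup>2 = (cmod (x i))\<^sup>2 * of_bool (cmod (x i) < \<tau>) + \<rho> i (x i)"
        by (auto simp: \<rho>_def of_bool_def)
      then have *: "\<theta> i (x i) + of_real (\<rho> i (x i) - L i) = of_real ((cmod (x i))\<^sup>2) - 1"
      proof -
        have "\<theta> i (x i) + of_real (\<rho> i (x i) - L i) =
            of_real ((cmod (x i))\<^sup>2 * of_bool (cmod (x i) < \<tau>) - (1 - L i) + (\<rho> i (x i) - L i))"
          unfolding \<theta>_def t_def by (simp only: of_real_add)
        also have "(cmod (x i))\<^sup>2 * of_bool (cmod (x i) < \<tau>) - (1 - L i) + (\<rho> i (x i) - L i) = (cmod (x i))\<^sup>2 - 1"
          using \<open>(cmod (x i))\<^sup>2 = _\<close> by linarith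
        finally show ?thesis by (simp only: of_real_diff of_real_1)
      qed
      have "m i i * \<theta> i (x i) + m i i * of_real (\<rho> i (x i) - L i) = m i i * (\<theta> i (x i) + of_real (\<rho> i (x i) - L i))"
        by (simp add: distrib_left)
      also have "\<dots> = m i i * of_real ((cmod (x i))\<^sup>2) - of_real ((w i)\<^sup>2) * T i i"
        unfolding * by (simp add: m_def power2_eq_square right_diff_distrib)
      finally show ?thesis ..
    qed
    have "(\<Sum>i<n. \<Sum>l<n. cnj (of_real (w i) * x i) * T i l * (of_real (w l) * x l)) -
      (\<Sum>i<n. of_real ((w i)\<^sup>2) * T i i) = ?off x + (?mid x + (\<Sum>i<n. m i i * of_real (\<rho> i (x i) - L i)))"
    proof -
      have "(\<Sum>i<n. m i i * of_real ((cmod (x i))\<^sup>2)) - (\<Sum>i<n. of_real ((w i)\<^sup>2) * T i i) =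
          (\<Sum>i<n. m i i * \<theta> i (x i) + m i i * of_real (\<rho> i (x i) - L i))"
        unfolding sum_subtractf[symmetric] by (intro sum.cong refl s2)
      also have "\<dots> = ?mid x + (\<Sum>i<n. m i i * of_real (\<rho> i (x i) - L i))"
        by (rule sum.distrib)
      finally show ?thesis unfolding s1 by (simp only: algebra_simps)
    qed
    moreover have "cmod (\<Sum>i<n. m i i * of_real (\<rho> i (x i) - L i)) \<le> ?far x"
    proof (rule sum_norm_le)
      fix i assume "i \<in> {..<n}"
      then have "\<bar>\<rho> i (x i) - L i\<bar> \<le> \<rho> i (x i) + L i"
        using L0[of i] by (simp add: \<rho>_def abs_le_iff)
      then show "cmod (m i i * of_real (\<rho> i (x i) - L i)) \<le> cmod (m i i) * (\<rho> i (x i) + L i)"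
        by (simp only: norm_mult norm_of_real) (intro mult_left_mono, auto)
    qed
    ultimately show ?thesis
      using norm_triangle_ineq[of "?off x" "?mid x + (\<Sum>i<n. m i i * of_real (\<rho> i (x i) - L i))"]
        norm_triangle_ineq[of "?mid x" "\<Sum>i<n. m i i * of_real (\<rho> i (x i) - L i)"] by simp
  qed
  moreover have far0: "?far x \<ge> 0" for x
    using L0 by (intro sum_nonneg mult_nonneg_nonneg add_nonneg_nonneg) (auto simp: \<rho>_def)
  ultimately have "(\<integral>\<^sup>+x. ennreal (cmod ((\<Sum>i<n. \<Sum>l<n. cnj (of_real (w i) * x i) * T i l * (of_real (w l) * x l)) -
      (\<Sum>i<n. of_real ((w i)\<^sup>2) * T i i))) \<partial>Pi\<^sub>M {..<n} \<nu>) \<le>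
    (\<integral>\<^sup>+x. ennreal (cmod (?off x)) + (ennreal (cmod (?mid x)) + ennreal (?far x)) \<partial>Pi\<^sub>M {..<n} \<nu>)"
    by (intro nn_integral_mono) (simp only: ennreal_plus[symmetric] add_nonneg_nonneg norm_ge_zero ennreal_leI)
  also have "\<dots> = (\<integral>\<^sup>+x. ennreal (cmod (?off x)) \<partial>Pi\<^sub>M {..<n} \<nu>) +
      ((\<integral>\<^sup>+x. ennreal (cmod (?mid x)) \<partial>Pi\<^sub>M {..<n} \<nu>) + (\<integral>\<^sup>+x. ennreal (?far x) \<partial>Pi\<^sub>M {..<n} \<nu>))"
  proof -
    have m1: "(\<lambda>x. ennreal (cmod (?off x))) \<in> borel_measurable (Pi\<^sub>M {..<n} \<nu>)" using offm by measurable
    have m2: "(\<lambda>x. ennreal (cmod (?mid x))) \<in> borel_measurable (Pi\<^sub>M {..<n} \<nu>)" using midm by measurable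
    have m3: "(\<lambda>x. ennreal (?far x)) \<in> borel_measurable (Pi\<^sub>M {..<n} \<nu>)" using farm by measurable
    show ?thesis
      unfolding nn_integral_add[OF m1 borel_measurable_add[OF m2 m3]] nn_integral_add[OF m2 m3] ..
  qed
  also have "\<dots> \<le> ennreal (W\<^sup>2 * K * sqrt (2 * n)) + (ennreal (W\<^sup>2 * K * (\<tau> * sqrt n)) + ennreal (W\<^sup>2 * K * (2 * (\<Sum>i<n. L i))))"
    by (intro add_mono off mid far)
  also have "\<dots> = ennreal (W\<^sup>2 * K * (sqrt (2 * n) + \<tau> * sqrt n + 2 * (\<Sum>i<n. L i)))"
  proof -
    have "sum L {..<n} \<ge> 0" using L0 by (intro sum_nonneg) auto
    then show ?thesis
      using pos by (simp add: ennreal_plus[symmetric] distrib_left add.assoc del: ennreal_plus)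
  qed
  finally show ?thesis .
qed

section \<open>The self-consistent equation for the mean resolvent\<close>

text \<open>The data are \<open>N\<close> independent columns with independent entries, \<open>w k i\<close> being the deterministic weight of
  entry \<open>i\<close> of column \<open>k\<close>. Below, \<open>mq i\<close> is the mean of a diagonal resolvent entry,
  \<open>\<theta> k\<close> the value around which the quadratic form of column \<open>k\<close> concentrates, and \<open>1 / r
  i\<close> the value predicted for \<open>mq i\<close>.\<close>
locale column_model =
  fixes n N :: nat and w :: "nat \<Rightarrow> nat \<Rightarrow> real" and \<nu> :: "nat \<Rightarrow> nat \<Rightarrow> complex measure"
    and W :: real and z :: complex
  assumes \<nu>: "\<And>k i. prob_space (\<nu> k i)" and sets_\<nu>: "\<And>k i. sets (\<nu> k i) = sets borel"
    and n: "n > 0" and N: "N > 0" and z: "Im z > 0"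
    and W: "W > 0" "\<And>k i. k < N \<Longrightarrow> i < n \<Longrightarrow> \<bar>w k i\<bar> \<le> W"
begin

definition C :: "nat \<Rightarrow> (nat \<Rightarrow> complex) measure" where "C k = Pi\<^sub>M {..<n} (\<nu> k)"
definition "P = Pi\<^sub>M {..<N} C"
definition yv :: "(nat \<Rightarrow> nat \<Rightarrow> complex) \<Rightarrow> nat \<Rightarrow> nat \<Rightarrow> complex" where "yv c k i = complex_of_real (w k i) * c k i"
definition "Q c = resolvent n (gram {..<N} (yv c)) z"
definition "mq i = (LINT c|P. Q c i i)"
definition "\<theta> k = (\<Sum>i<n. complex_of_real ((w k i)\<^sup>2) * mq i)"
definition "r i = (\<Sum>k<N. complex_of_real ((w k i)\<^sup>2) / (1 + \<theta> k)) - z"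

lemma prob_C: "prob_space (C k)"
  unfolding C_def by (rule prob_space_PiM[OF \<nu>])

lemma prob_P: "prob_space P"
  unfolding P_def by (rule prob_space_PiM[OF prob_C])

lemma coord_measurable: "k \<in> J \<Longrightarrow> i < n \<Longrightarrow> (\<lambda>c. c k i) \<in> borel_measurable (Pi\<^sub>M J C)"
proof -
  assume k: "k \<in> J" and i: "i < n"
  have 1: "(\<lambda>c. c k) \<in> measurable (Pi\<^sub>M J C) (C k)"
    using k by (rule measurable_component_singleton)
  have 2: "(\<lambda>x. x i) \<in> borel_measurable (C k)"
    unfolding C_def using i by (intro borel_measurable_PiM_component sets_\<nu>) auto
  show ?thesis using measurable_compose[OF 1 2] .
qed

lemma yv_measurable: "k \<in> J \<Longrightarrow> i < n \<Longrightarrow> (\<lambda>c. yv c k i) \<in> borel_measurable (Pi\<^sub>M J C)"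
  unfolding yv_def by (intro borel_measurable_times borel_measurable_const coord_measurable)

lemma resolvent_measurable:
  assumes "K \<subseteq> J" "i < n" "j < n"
  shows "(\<lambda>c. resolvent n (gram K (yv c)) z i j) \<in> borel_measurable (Pi\<^sub>M J C)"
proof (rule borel_measurable_resolvent[OF _ assms(2,3)])
  fix a b assume "a < n" "b < n"
  then show "(\<lambda>c. gram K (yv c) a b) \<in> borel_measurable (Pi\<^sub>M J C)"
    unfolding gram_def using assms(1)
    by (intro borel_measurable_sum borel_measurable_times yv_measurable
        measurable_compose[OF yv_measurable borel_measurable_cnj]) auto
qed

lemma Q_measurable: "i < n \<Longrightarrow> j < n \<Longrightarrow> (\<lambda>c. Q c i j) \<in> borel_measurable P"
  unfolding Q_def P_def by (rule resolvent_measurable) auto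

lemma Q_bound: "i < n \<Longrightarrow> j < n \<Longrightarrow> cmod (Q c i j) \<le> 1 / Im z"
  unfolding Q_def by (rule cmod_resolvent_le[OF hermitian_gram z])

lemma Q_integrable: "i < n \<Longrightarrow> j < n \<Longrightarrow> integrable P (\<lambda>c. Q c i j)"
  by (rule finite_measure.integrable_const_bound[OF prob_space.finite_measure[OF prob_P], where B = "1 / Im z"])
    (auto intro: Q_bound Q_measurable)

lemma mq_bound: "i < n \<Longrightarrow> cmod (mq i) \<le> 1 / Im z"
proof -
  assume i: "i < n"
  interpret prob_space P by (rule prob_P)
  have "cmod (mq i) \<le> (LINT c|P. cmod (Q c i i))" unfolding mq_def by (rule integral_norm_bound)
  also have "\<dots> \<le> (LINT c|P. 1 / Im z)"
    by (rule integral_mono) (use i Q_bound Q_integrable in auto)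
  finally show ?thesis by (simp add: prob_space)
qed

lemma Im_z_mq: "i < n \<Longrightarrow> Im (z * mq i) \<ge> 0"
proof -
  assume i: "i < n"
  have int: "integrable P (\<lambda>c. z * Q c i i)" using Q_integrable[OF i i] by simp
  have eq: "z * mq i = (LINT c|P. z * Q c i i)" unfolding mq_def by simp
  have "Im (z * mq i) = (LINT c|P. Im (z * Q c i i))" unfolding eq by (rule integral_Im[OF int, symmetric])
  also have "\<dots> \<ge> 0"
  proof (rule integral_nonneg_AE, rule AE_I2)
    fix c
    show "0 \<le> Im (z * Q c i i)"
      unfolding Q_def rform_unit[OF i, symmetric] by (rule Im_mult_rform_nonneg[OF psd_gram z])
  qed
  finally show ?thesis .
qed

lemma Im_z_\<theta>: "Im (z * \<theta> k) \<ge> 0"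
proof -
  have "z * \<theta> k = (\<Sum>i<n. complex_of_real ((w k i)\<^sup>2) * (z * mq i))"
    unfolding \<theta>_def sum_distrib_left by (intro sum.cong refl) (simp add: mult_ac)
  then have "Im (z * \<theta> k) = (\<Sum>i<n. (w k i)\<^sup>2 * Im (z * mq i))"
    by (simp only: Im_sum Im_complex_of_real Re_complex_of_real times_complex.simps mult_zero_left add_0_right)
  also have "\<dots> \<ge> 0" by (intro sum_nonneg mult_nonneg_nonneg Im_z_mq) auto
  finally show ?thesis .
qed

lemma one_plus_\<theta>: "cmod (1 + \<theta> k) \<ge> Im z / cmod z"
  by (rule one_plus_lower_bound[OF z Im_z_\<theta>])

lemma z_pos: "cmod z > 0" using z by auto

lemma trace_difference:
  assumes U: "\<And>i. i < n \<Longrightarrow> cmod (U i) \<le> B" "B \<ge> 0" and k: "k < N"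
  shows "cmod ((\<Sum>i<n. U i * Q (c(k := y)) i i) - (\<Sum>i<n. U i * Q c i i)) \<le> 2 * B / Im z"
proof -
  have "cmod (\<Sum>i<n. U i * (Q (c(k := y)) i i - Q c i i)) \<le> 2 * B / Im z"
    unfolding Q_def by (rule gram_column_trace[OF _ _ z U, of "{..<N}" k]) (auto simp: k yv_def)
  then show ?thesis by (simp add: right_diff_distrib sum_subtractf)
qed

text \<open>Replacing one column changes the weighted trace by a bounded amount, so the bounded difference inequality applies with the columns
  as coordinates.\<close>
lemma trace_moments:
  assumes U: "\<And>i. i < n \<Longrightarrow> cmod (U i) \<le> B" "B > 0"
  shows "(\<integral>\<^sup>+c. ennreal (cmod ((\<Sum>i<n. U i * Q c i i) - (\<Sum>i<n. U i * mq i))) \<partial>P) \<le> ennreal (16 * B / Im z * sqrt N)"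
    and "(\<integral>\<^sup>+c. ennreal (cmod ((\<Sum>i<n. U i * Q c i i) - (\<Sum>i<n. U i * mq i)) ^ 4) \<partial>P) \<le>
      ennreal (4096 * (2 * B / Im z) ^ 4 * N\<^sup>2)"
proof -
  let ?g = "\<lambda>c. \<Sum>i<n. U i * Q c i i"
  have E: "(LINT c|P. ?g c) = (\<Sum>i<n. U i * mq i)"
    unfolding mq_def by (subst Bochner_Integration.integral_sum) (auto intro: Q_integrable)
  have m: "?g \<in> borel_measurable (Pi\<^sub>M {..<N} C)"
    unfolding P_def[symmetric] by (intro borel_measurable_sum borel_measurable_times borel_measurable_const Q_measurable) auto
  have b: "cmod (?g c) \<le> (\<Sum>i<n. B * (1 / Im z))" for c
  proof (rule sum_norm_le)
    fix i assume "i \<in> {..<n}"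
    then show "cmod (U i * Q c i i) \<le> B * (1 / Im z)"
      unfolding norm_mult using U z Q_bound by (intro mult_mono) auto
  qed
  have d: "cmod (?g (c(k := y)) - ?g c) \<le> 2 * B / Im z" if "k \<in> {..<N}" for c k y
    by (rule trace_difference) (use U that in auto)
  have pos: "2 * B / Im z > 0" using U z by simp
  have ne: "{..<N} \<noteq> {}" using N by auto
  have fin: "finite {..<N}" by simp
  note mom = bounded_differences_moments_complex[OF prob_C fin ne m _ _ pos, folded P_def, unfolded E]
  show "(\<integral>\<^sup>+c. ennreal (cmod (?g c - (\<Sum>i<n. U i * mq i))) \<partial>P) \<le> ennreal (16 * B / Im z * sqrt N)"
    using mom(1)[OF b d] by (simp add: mult_ac)
  show "(\<integral>\<^sup>+c. ennreal (cmod (?g c - (\<Sum>i<n. U i * mq i)) ^ 4) \<partial>P) \<le>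
      ennreal (4096 * (2 * B / Im z) ^ 4 * N\<^sup>2)"
    using mom(2)[OF b d] by simp
qed

lemma conditional_bound:
  assumes k: "k < N" and F: "F \<in> borel_measurable P"
    and b: "\<And>c. (\<integral>\<^sup>+y. F (c(k := y)) \<partial>C k) \<le> B"
  shows "(\<integral>\<^sup>+c. F c \<partial>P) \<le> B"
proof -
  interpret product_prob_space C by (rule product_prob_spaceI[OF prob_C])
  let ?I = "{..<N} - {k}"
  interpret PI: prob_space "Pi\<^sub>M ?I C" by (rule prob_space_PiM[OF prob_C])
  have ins: "{..<N} = insert k ?I" using k by auto
  have "(\<integral>\<^sup>+c. F c \<partial>P) = (\<integral>\<^sup>+c. F c \<partial>Pi\<^sub>M (insert k ?I) C)"
    unfolding P_def using ins by simp
  also have "\<dots> = (\<integral>\<^sup>+c. (\<integral>\<^sup>+y. F (c(k := y)) \<partial>C k) \<partial>Pi\<^sub>M ?I C)"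
    by (rule product_nn_integral_insert) (use F ins in \<open>auto simp: P_def\<close>)
  also have "\<dots> \<le> (\<integral>\<^sup>+c. B \<partial>Pi\<^sub>M ?I C)"
    by (intro nn_integral_mono b)
  finally show ?thesis by (simp add: PI.emeasure_space_1)
qed

text \<open>The numerator \<open>y\<^sub>k\<^sup>* diag(u) (H\<^sub>k - z)\<^sup>-\<^sup>1 y\<^sub>k\<close> in the column identity, where
  \<open>H\<^sub>k\<close> lacks column \<open>k\<close>.\<close>
definition "form u k c = (\<Sum>i<n. cnj (yv c k i) * u i * rapp n (gram ({..<N} - {k}) (yv c)) z (yv c k) i)"

lemma form_one: "form (\<lambda>_. 1) k c = rform n (gram ({..<N} - {k}) (yv c)) z (yv c k)"
  unfolding form_def rform_def by simp

lemma form_measurable: "k < N \<Longrightarrow> (\<lambda>c. form u k c) \<in> borel_measurable P"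
  unfolding form_def rapp_def P_def
  by (intro borel_measurable_sum borel_measurable_times borel_measurable_const resolvent_measurable
      yv_measurable measurable_compose[OF yv_measurable borel_measurable_cnj]) auto

lemma one_plus_form: "cmod (1 + form (\<lambda>_. 1) k c) \<ge> Im z / cmod z"
  unfolding form_one by (intro one_plus_lower_bound[OF z] Im_mult_rform_nonneg[OF psd_gram z])

end

locale centred_column_model = column_model +
  fixes \<tau> :: real and L :: "nat \<Rightarrow> nat \<Rightarrow> real"
  assumes int: "\<And>k i. k < N \<Longrightarrow> i < n \<Longrightarrow> integrable (\<nu> k i) (\<lambda>x. x)"
    and zero: "\<And>k i. k < N \<Longrightarrow> i < n \<Longrightarrow> (LINT x|\<nu> k i. x) = 0"
    and sq: "\<And>k i. k < N \<Longrightarrow> i < n \<Longrightarrow> (\<integral>\<^sup>+x. ennreal ((cmod x)\<^sup>2) \<partial>\<nu> k i) = ennreal 1"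
    and L: "\<And>k i. k < N \<Longrightarrow> i < n \<Longrightarrow> (LINT x|\<nu> k i. (cmod x)\<^sup>2 * of_bool (cmod x \<ge> \<tau>)) = L k i"
    and \<tau>: "\<tau> > 0"
begin

text \<open>The bracket of the quadratic form bound, plus \<open>1\<close> for removing one column and \<open>16 sqrt N\<close> for the
  fluctuation of the trace.\<close>
definition "err k = sqrt (2 * n) + \<tau> * sqrt n + 2 * (\<Sum>i<n. L k i) + 1 + 16 * sqrt N"

lemma L_nonneg: "k < N \<Longrightarrow> i < n \<Longrightarrow> L k i \<ge> 0"
  by (subst L[symmetric]) (auto intro!: integral_nonneg_AE)

text \<open>Three replacements: the quadratic form by the weighted trace of the resolvent without column \<open>k\<close>, which is
  independent of that column; then by the trace of the full resolvent; then by its mean.\<close>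
lemma form_deviation:
  assumes k: "k < N" and u: "\<And>i. i < n \<Longrightarrow> cmod (u i) \<le> U" and U: "U > 0"
  shows "(\<integral>\<^sup>+c. ennreal (cmod (form u k c - (\<Sum>i<n. of_real ((w k i)\<^sup>2) * u i * mq i))) \<partial>P) \<le>
    ennreal (W\<^sup>2 * U / Im z * err k)"
proof -
  define R where "R c = resolvent n (gram ({..<N} - {k}) (yv c)) z" for c
  let ?d = "\<lambda>i. complex_of_real ((w k i)\<^sup>2) * u i"
  let ?a = "\<lambda>c. cmod (form u k c - (\<Sum>i<n. ?d i * R c i i))"
  let ?b = "\<lambda>c. cmod ((\<Sum>i<n. ?d i * Q c i i) - (\<Sum>i<n. ?d i * mq i))"
  have d: "cmod (?d i) \<le> W\<^sup>2 * U" if "i < n" for i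
  proof -
    have "(w k i)\<^sup>2 \<le> W\<^sup>2"
      using W(2)[OF k that] W(1) by (intro abs_le_square_iff[THEN iffD1]) auto
    then show ?thesis using u[OF that] U
      unfolding norm_mult norm_of_real by (intro mult_mono) auto
  qed
  have WU: "W\<^sup>2 * U > 0" using W U by simp
  have K: "U / Im z > 0" using U z by simp
  have Rm: "(\<lambda>c. R c i j) \<in> borel_measurable P" if "i < n" "j < n" for i j
    unfolding R_def P_def by (rule resolvent_measurable) (use that in auto)
  have dRm: "(\<lambda>c. \<Sum>i<n. ?d i * R c i i) \<in> borel_measurable P"
    by (intro borel_measurable_sum borel_measurable_times borel_measurable_const Rm) auto
  have dQm: "(\<lambda>c. \<Sum>i<n. ?d i * Q c i i) \<in> borel_measurable P"
    by (intro borel_measurable_sum borel_measurable_times borel_measurable_const Q_measurable) auto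
  have am: "(\<lambda>c. ennreal (?a c)) \<in> borel_measurable P"
    using form_measurable[OF k, of u] dRm by measurable
  have bm: "(\<lambda>c. ennreal (?b c)) \<in> borel_measurable P" using dQm by measurable
  have a: "(\<integral>\<^sup>+c. ennreal (?a c) \<partial>P) \<le> ennreal (W\<^sup>2 * (U / Im z) * (sqrt (2 * n) + \<tau> * sqrt n + 2 * (\<Sum>i<n. L k i)))"
  proof (rule conditional_bound[OF k am])
    fix c
    define T where "T i l = u i * R c i l" for i l
    have Rc: "R (c(k := y)) i j = R c i j" for y i j
      unfolding R_def by (rule resolvent_gram_cong) (auto simp: yv_def)
    have fc: "form u k (c(k := y)) = (\<Sum>i<n. \<Sum>l<n. cnj (of_real (w k i) * y i) * T i l * (of_real (w k l) * y l))" for y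
      unfolding form_def rapp_def R_def[symmetric] Rc T_def yv_def sum_distrib_left
      by (intro sum.cong refl) (simp add: mult_ac)
    have dc: "(\<Sum>i<n. ?d i * R (c(k := y)) i i) = (\<Sum>i<n. of_real ((w k i)\<^sup>2) * T i i)" for y
      unfolding Rc T_def by (simp add: mult.assoc)
    have T: "(\<Sum>i<n. (cmod (T i l))\<^sup>2) \<le> (U / Im z)\<^sup>2" if "l < n" for l
    proof -
      have "(\<Sum>i<n. (cmod (T i l))\<^sup>2) \<le> (\<Sum>i<n. U\<^sup>2 * (cmod (R c i l))\<^sup>2)"
        unfolding T_def norm_mult power_mult_distrib
        by (intro sum_mono mult_right_mono power_mono u) auto
      also have "\<dots> = U\<^sup>2 * (\<Sum>i<n. (cmod (R c i l))\<^sup>2)" by (simp add: sum_distrib_left)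
      also have "(\<Sum>i<n. (cmod (R c i l))\<^sup>2) \<le> 1 / (Im z)\<^sup>2"
        using sqnorm_resolvent_col[OF hermitian_gram z that] z unfolding R_def by (simp add: field_simps)
      finally show ?thesis by (simp add: power_divide mult_left_mono)
    qed
    show "(\<integral>\<^sup>+y. ennreal (?a (c(k := y))) \<partial>C k) \<le> ennreal (W\<^sup>2 * (U / Im z) * (sqrt (2 * n) + \<tau> * sqrt n + 2 * (\<Sum>i<n. L k i)))"
      unfolding fc dc C_def
      by (rule quadratic_form_concentration[OF \<nu> sets_\<nu> _ _ _ _ _ T W(1) K \<tau> n])
        (use k int zero sq L W(2) in auto)
  qed
  have b: "(\<integral>\<^sup>+c. ennreal (?b c) \<partial>P) \<le> ennreal (16 * (W\<^sup>2 * U) / Im z * sqrt N)"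
    by (rule trace_moments(1)[OF d WU])
  have "cmod (form u k c - (\<Sum>i<n. ?d i * mq i)) \<le> ?a c + (W\<^sup>2 * U / Im z + ?b c)" for c
  proof -
    have "cmod ((\<Sum>i<n. ?d i * R c i i) - (\<Sum>i<n. ?d i * Q c i i)) \<le> W\<^sup>2 * U / Im z"
      unfolding sum_subtractf[symmetric] right_diff_distrib[symmetric] R_def Q_def
      by (rule gram_remove_trace[OF _ _ z d]) (use k WU in auto)
    moreover have "form u k c - (\<Sum>i<n. ?d i * mq i) = (form u k c - (\<Sum>i<n. ?d i * R c i i)) +
      (((\<Sum>i<n. ?d i * R c i i) - (\<Sum>i<n. ?d i * Q c i i)) + ((\<Sum>i<n. ?d i * Q c i i) - (\<Sum>i<n. ?d i * mq i)))"
      by (simp only: algebra_simps)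
    ultimately show ?thesis by (smt (verit) norm_triangle_ineq)
  qed
  then have "(\<integral>\<^sup>+c. ennreal (cmod (form u k c - (\<Sum>i<n. ?d i * mq i))) \<partial>P) \<le>
      (\<integral>\<^sup>+c. ennreal (?a c) + (ennreal (W\<^sup>2 * U / Im z) + ennreal (?b c)) \<partial>P)"
    using WU z by (intro nn_integral_mono) (simp add: ennreal_plus[symmetric] ennreal_leI del: ennreal_plus)
  also have "\<dots> = (\<integral>\<^sup>+c. ennreal (?a c) \<partial>P) + (ennreal (W\<^sup>2 * U / Im z) + (\<integral>\<^sup>+c. ennreal (?b c) \<partial>P))"
    unfolding nn_integral_add[OF am borel_measurable_add[OF borel_measurable_const bm]]
      nn_integral_add[OF borel_measurable_const bm]
    by (simp add: prob_space.emeasure_space_1[OF prob_P])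
  also have "\<dots> \<le> ennreal (W\<^sup>2 * (U / Im z) * (sqrt (2 * n) + \<tau> * sqrt n + 2 * (\<Sum>i<n. L k i))) +
      (ennreal (W\<^sup>2 * U / Im z) + ennreal (16 * (W\<^sup>2 * U) / Im z * sqrt N))"
    by (intro add_mono add_left_mono a b)
  also have "\<dots> = ennreal (W\<^sup>2 * U / Im z * err k)"
  proof -
    define X where "X = sqrt (2 * n) + \<tau> * sqrt n + 2 * (\<Sum>i<n. L k i)"
    have X: "X \<ge> 0" unfolding X_def using \<tau> L_nonneg[OF k] by (intro add_nonneg_nonneg mult_nonneg_nonneg sum_nonneg) auto
    have V: "W\<^sup>2 * U / Im z \<ge> 0" using WU z by simp
    have "W\<^sup>2 * (U / Im z) * X + (W\<^sup>2 * U / Im z + 16 * (W\<^sup>2 * U) / Im z * sqrt N) = W\<^sup>2 * U / Im z * (X + 1 + 16 * sqrt N)"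
      by (simp add: algebra_simps add_divide_distrib)
    note eq = this
    have "W\<^sup>2 * (U / Im z) * X \<ge> 0" "16 * (W\<^sup>2 * U) / Im z * sqrt N \<ge> 0"
      using X WU z U by auto
    then have "ennreal (W\<^sup>2 * (U / Im z) * X) + (ennreal (W\<^sup>2 * U / Im z) + ennreal (16 * (W\<^sup>2 * U) / Im z * sqrt N)) =
      ennreal (W\<^sup>2 * (U / Im z) * X + (W\<^sup>2 * U / Im z + 16 * (W\<^sup>2 * U) / Im z * sqrt N))"
      using V by (simp only: ennreal_plus add_nonneg_nonneg)
    then show ?thesis unfolding err_def X_def[symmetric] eq .
  qed
  finally show ?thesis by simp
qed

lemma err_nonneg: "k < N \<Longrightarrow> err k \<ge> 0"
  unfolding err_def using \<tau> L_nonneg by (intro add_nonneg_nonneg mult_nonneg_nonneg sum_nonneg) auto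

text \<open>In the column identity both quadratic forms are replaced by their predictions. All denominators stay above \<open>Im z /
  |z|\<close>, so the errors add up linearly. The weights \<open>u\<close> are free, as the system needs a different average for
  each column.\<close>
lemma self_consistent_equation:
  assumes u: "\<And>i. i < n \<Longrightarrow> cmod (u i) \<le> U" and U: "U > 0"
  shows "cmod (\<Sum>i<n. u i * (r i * mq i - 1)) \<le>
    U * (W\<^sup>2 / Im z) * (cmod z / Im z + n * W\<^sup>2 / Im z * (cmod z / Im z)\<^sup>2) * (\<Sum>k<N. err k)"
proof -
  interpret prob_space P by (rule prob_P)
  let ?V = "cmod z / Im z"
  have V: "?V > 0" using z z_pos by simp
  (* X is the ratio in the column identity, b / (1 + \<theta>) its prediction *)
  define b where "b k = (\<Sum>i<n. complex_of_real ((w k i)\<^sup>2) * u i * mq i)" for k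
  define X where "X k c = form u k c / (1 + form (\<lambda>_. 1) k c)" for k c
  have b_bound: "cmod (b k) \<le> n * W\<^sup>2 * U / Im z" if k: "k < N" for k
  proof -
    have "cmod (b k) \<le> (\<Sum>i<n. W\<^sup>2 * U * (1 / Im z))"
      unfolding b_def
    proof (rule sum_norm_le)
      fix i assume "i \<in> {..<n}"
      then have i: "i < n" by simp
      have "(w k i)\<^sup>2 \<le> W\<^sup>2"
        using W(2)[OF k i] W(1) by (intro abs_le_square_iff[THEN iffD1]) auto
      then show "cmod (complex_of_real ((w k i)\<^sup>2) * u i * mq i) \<le> W\<^sup>2 * U * (1 / Im z)"
        unfolding norm_mult norm_of_real using u[OF i] mq_bound[OF i] U by (intro mult_mono) auto
    qed
    then show ?thesis by (simp add: mult.assoc)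
  qed
  have inv: "cmod (1 / x) \<le> ?V" if "cmod x \<ge> Im z / cmod z" for x
  proof -
    have "cmod x > 0" using that z z_pos by (smt (verit) divide_pos_pos)
    then show ?thesis using that z z_pos by (simp add: norm_divide field_simps)
  qed
  have X_dev: "(\<integral>\<^sup>+c. ennreal (cmod (X k c - b k / (1 + \<theta> k))) \<partial>P) \<le>
      ennreal ((?V + n * W\<^sup>2 / Im z * ?V\<^sup>2) * (U * (W\<^sup>2 / Im z) * err k))" if k: "k < N" for k
  proof -
    let ?f = "\<lambda>c. cmod (form u k c - b k)" and ?g = "\<lambda>c. cmod (form (\<lambda>_. 1) k c - \<theta> k)"
    have fm: "(\<lambda>c. ennreal (?f c)) \<in> borel_measurable P" using form_measurable[OF k, of u] by measurable
    have gm: "(\<lambda>c. ennreal (?g c)) \<in> borel_measurable P" using form_measurable[OF k, of "\<lambda>_. 1"] by measurable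
    have f: "(\<integral>\<^sup>+c. ennreal (?f c) \<partial>P) \<le> ennreal (W\<^sup>2 * U / Im z * err k)"
      unfolding b_def by (rule form_deviation[OF k u U])
    have g: "(\<integral>\<^sup>+c. ennreal (?g c) \<partial>P) \<le> ennreal (W\<^sup>2 * 1 / Im z * err k)"
      using form_deviation[OF k, of "\<lambda>_. 1" 1] unfolding \<theta>_def by simp
    have "cmod (X k c - b k / (1 + \<theta> k)) \<le> ?V * ?f c + (n * W\<^sup>2 * U / Im z * ?V\<^sup>2) * ?g c" for c
    proof -
      let ?s = "1 + form (\<lambda>_. 1) k c" and ?t = "1 + \<theta> k"
      have s: "cmod ?s \<ge> Im z / cmod z" by (rule one_plus_form)
      have t: "cmod ?t \<ge> Im z / cmod z" by (rule one_plus_\<theta>)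
      have nz: "?s \<noteq> 0" "?t \<noteq> 0" using s t z z_pos by (smt (verit) divide_pos_pos norm_zero)+
      have "X k c - b k / ?t = (1 / ?s) * (form u k c - b k) - b k * ((1 / ?s) * (1 / ?t)) * (form (\<lambda>_. 1) k c - \<theta> k)"
        unfolding X_def using nz by (simp add: divide_simps) (simp add: algebra_simps)
      also have "cmod \<dots> \<le> cmod (1 / ?s) * ?f c + cmod (b k) * (cmod (1 / ?s) * cmod (1 / ?t)) * ?g c"
        by (rule order_trans[OF norm_triangle_ineq4]) (simp only: norm_mult order_refl)
      also have "\<dots> \<le> ?V * ?f c + (n * W\<^sup>2 * U / Im z) * (?V * ?V) * ?g c"
        using inv[OF s] inv[OF t] b_bound[OF k] V U z by (intro add_mono mult_mono) auto
      finally show ?thesis by (simp only: power2_eq_square)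
    qed
    then have "(\<integral>\<^sup>+c. ennreal (cmod (X k c - b k / (1 + \<theta> k))) \<partial>P) \<le>
        (\<integral>\<^sup>+c. ennreal ?V * ennreal (?f c) + ennreal (n * W\<^sup>2 * U / Im z * ?V\<^sup>2) * ennreal (?g c) \<partial>P)"
      using V U z by (intro nn_integral_mono)
        (simp add: ennreal_plus[symmetric] ennreal_mult[symmetric] ennreal_leI del: ennreal_plus)
    also have "\<dots> = ennreal ?V * (\<integral>\<^sup>+c. ennreal (?f c) \<partial>P) + ennreal (n * W\<^sup>2 * U / Im z * ?V\<^sup>2) * (\<integral>\<^sup>+c. ennreal (?g c) \<partial>P)"
      unfolding nn_integral_cmult[OF fm, symmetric] nn_integral_cmult[OF gm, symmetric]
      by (rule nn_integral_add) (use fm gm in measurable)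
    also have "\<dots> \<le> ennreal ?V * ennreal (W\<^sup>2 * U / Im z * err k) + ennreal (n * W\<^sup>2 * U / Im z * ?V\<^sup>2) * ennreal (W\<^sup>2 * 1 / Im z * err k)"
      by (intro add_mono mult_left_mono f g) auto
    also have "\<dots> = ennreal (?V * (W\<^sup>2 * U / Im z * err k) + (n * W\<^sup>2 * U / Im z * ?V\<^sup>2) * (W\<^sup>2 * 1 / Im z * err k))"
      using V U z err_nonneg[OF k] by (simp add: ennreal_plus[symmetric] ennreal_mult[symmetric] del: ennreal_plus)
    also have "?V * (W\<^sup>2 * U / Im z * err k) + (n * W\<^sup>2 * U / Im z * ?V\<^sup>2) * (W\<^sup>2 * 1 / Im z * err k) =
        (?V + n * W\<^sup>2 / Im z * ?V\<^sup>2) * (U * (W\<^sup>2 / Im z) * err k)"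
      by (simp add: algebra_simps)
    finally show ?thesis .
  qed
  have Xm: "X k \<in> borel_measurable P" if "k < N" for k
    unfolding X_def using form_measurable[OF that] by (intro borel_measurable_divide borel_measurable_add) auto
  have X_int: "integrable P (X k)" if "k < N" for k
  proof -
    have "integrable P (\<lambda>c. X k c - b k / (1 + \<theta> k))"
      by (rule integrableI_bounded) (use Xm[OF that] X_dev[OF that] in \<open>auto simp: le_less_trans\<close>)
    from Bochner_Integration.integrable_add[OF this integrable_const[of "b k / (1 + \<theta> k)"]] show ?thesis by simp
  qed
  have EX: "cmod ((LINT c|P. X k c) - b k / (1 + \<theta> k)) \<le> (?V + n * W\<^sup>2 / Im z * ?V\<^sup>2) * (U * (W\<^sup>2 / Im z) * err k)"
    if k: "k < N" for k
  proof -
    have i: "integrable P (\<lambda>c. X k c - b k / (1 + \<theta> k))" using X_int[OF k] by simp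
    have "(LINT c|P. X k c) - b k / (1 + \<theta> k) = (LINT c|P. X k c - b k / (1 + \<theta> k))"
      using X_int[OF k] by (simp add: prob_space)
    then have "ennreal (cmod ((LINT c|P. X k c) - b k / (1 + \<theta> k))) \<le> (\<integral>\<^sup>+c. ennreal (cmod (X k c - b k / (1 + \<theta> k))) \<partial>P)"
      using integral_norm_bound_ennreal[OF i] by simp
    also note X_dev[OF k]
    finally show ?thesis
      using V U z err_nonneg[OF k] by (subst (asm) ennreal_le_iff) auto
  qed
  have "(\<Sum>i<n. u i * (1 + z * mq i)) = (LINT c|P. (\<Sum>i<n. u i * (1 + z * Q c i i)))"
  proof -
    have qi: "integrable P (\<lambda>c. z * Q c i i)" if "i < n" for i
      using Q_integrable[OF that that] by simp
    have 1: "(LINT c|P. u i * (1 + z * Q c i i)) = u i * (1 + z * mq i)" if "i < n" for i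
      using Bochner_Integration.integral_add[OF integrable_const[of 1] qi[OF that]] by (simp add: prob_space mq_def)
    have 2: "integrable P (\<lambda>c. u i * (1 + z * Q c i i))" if "i < n" for i
      by (intro integrable_mult_right Bochner_Integration.integrable_add integrable_const qi that)
    have "(LINT c|P. (\<Sum>i<n. u i * (1 + z * Q c i i))) = (\<Sum>i<n. LINT c|P. u i * (1 + z * Q c i i))"
      by (rule Bochner_Integration.integral_sum) (use 2 in auto)
    also have "\<dots> = (\<Sum>i<n. u i * (1 + z * mq i))"
      by (intro sum.cong refl 1) simp
    finally show ?thesis ..
  qed
  also have "\<dots> = (LINT c|P. (\<Sum>k<N. X k c))"
    unfolding Q_def X_def form_one unfolding form_def
    by (intro Bochner_Integration.integral_cong refl gram_resolvent_identity) (use z in auto)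
  also have "\<dots> = (\<Sum>k<N. LINT c|P. X k c)"
    by (rule Bochner_Integration.integral_sum) (use X_int in auto)
  finally have id: "(\<Sum>i<n. u i * (1 + z * mq i)) = (\<Sum>k<N. LINT c|P. X k c)" .
  have "(\<Sum>k<N. b k / (1 + \<theta> k)) = (\<Sum>i<n. u i * ((\<Sum>k<N. complex_of_real ((w k i)\<^sup>2) / (1 + \<theta> k)) * mq i))"
    unfolding b_def sum_divide_distrib sum_distrib_left sum_distrib_right
    by (subst sum.swap) (intro sum.cong refl, simp add: mult_ac)
  note id2 = this
  have "(\<Sum>i<n. u i * (r i * mq i - 1)) = (\<Sum>k<N. b k / (1 + \<theta> k)) - (\<Sum>i<n. u i * (1 + z * mq i))"
    unfolding r_def id2 sum_subtractf[symmetric] by (intro sum.cong refl) (simp only: algebra_simps)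
  also have "\<dots> = - (\<Sum>k<N. (LINT c|P. X k c) - b k / (1 + \<theta> k))"
    unfolding id by (simp add: sum_subtractf)
  also have "cmod \<dots> \<le> (\<Sum>k<N. (?V + n * W\<^sup>2 / Im z * ?V\<^sup>2) * (U * (W\<^sup>2 / Im z) * err k))"
    unfolding norm_minus_cancel by (rule sum_norm_le) (use EX in auto)
  also have "\<dots> = U * (W\<^sup>2 / Im z) * (?V + n * W\<^sup>2 / Im z * ?V\<^sup>2) * (\<Sum>k<N. err k)"
    unfolding sum_distrib_left by (intro sum.cong refl) (simp only: mult_ac)
  finally show ?thesis .
qed

end

section \<open>Measures and their Stieltjes transforms\<close>

text \<open>What the comparison of measures through their Stieltjes transforms uses of the test functions of the metric.\<close>
definition bump :: "real \<Rightarrow> (real \<Rightarrow> real) \<Rightarrow> bool" where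
  "bump K f \<longleftrightarrow> (\<forall>x. \<bar>f x\<bar> \<le> 1) \<and> (\<forall>x y. \<bar>f x - f y\<bar> \<le> \<bar>x - y\<bar>) \<and> (\<forall>x. \<bar>x\<bar> > K \<longrightarrow> f x = 0)"

definition "cauchy s = inverse (1 + s\<^sup>2)" for s :: real
definition "cauchy_mass = (LINT s|lborel. cauchy s)"

lemma cauchy_integrable: "integrable lborel cauchy"
  using integrable_inverse_1_plus_square
  unfolding cauchy_def set_integrable_def einterval_def by simp

lemma cauchy_pos: "cauchy s > 0"
  unfolding cauchy_def by (simp add: add_pos_nonneg)

lemma cauchy_mass_pos: "cauchy_mass > 0"
proof -
  have "cauchy_mass \<noteq> 0"
  proof
    assume "cauchy_mass = 0"
    then have "AE s in lborel. cauchy s = 0"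
      unfolding cauchy_mass_def using cauchy_integrable cauchy_pos
      by (subst (asm) integral_nonneg_eq_0_iff_AE) (auto intro: less_imp_le)
    then have "AE s in (lborel :: real measure). False"
      by eventually_elim (use cauchy_pos in \<open>simp add: less_le\<close>)
    then show False by (simp add: AE_iff_null null_sets_def)
  qed
  moreover have "cauchy_mass \<ge> 0"
    unfolding cauchy_mass_def using cauchy_pos by (intro integral_nonneg_AE) (auto intro: less_imp_le)
  ultimately show ?thesis by simp
qed

text \<open>Half of a uniform bound for the error made when a bump is smoothed with the Poisson kernel of width \<open>y\<close>.\<close>
definition "cauchy_defect y = (LINT s|lborel. min 1 (y * \<bar>s\<bar>) * cauchy s)" for y :: real

lemma cauchy_defect_integrable: "y > 0 \<Longrightarrow> integrable lborel (\<lambda>s. min 1 (y * \<bar>s\<bar>) * cauchy s)"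
  by (rule Bochner_Integration.integrable_bound[OF cauchy_integrable])
    (auto simp: cauchy_pos less_imp_le abs_mult cauchy_def intro!: mult_left_le_one_le AE_I2)

lemma cauchy_defect_tendsto: "(\<lambda>k. cauchy_defect (1 / real (Suc k))) \<longlonglongrightarrow> 0"
proof -
  have "(\<lambda>k. LINT s|lborel. min 1 (1 / real (Suc k) * \<bar>s\<bar>) * cauchy s) \<longlonglongrightarrow> (LINT s|(lborel :: real measure). 0)"
  proof (rule integral_dominated_convergence[where w = cauchy])
    show "AE s in lborel. (\<lambda>k. min 1 (1 / real (Suc k) * \<bar>s\<bar>) * cauchy s) \<longlonglongrightarrow> 0"
    proof (rule AE_I2)
      fix s :: real
      have "(\<lambda>k. 1 / real (Suc k) * \<bar>s\<bar>) \<longlonglongrightarrow> 0 * \<bar>s\<bar>"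
        by (intro tendsto_mult tendsto_const) (use LIMSEQ_inverse_real_of_nat in \<open>simp add: inverse_eq_divide\<close>)
      then have "(\<lambda>k. min 1 (1 / real (Suc k) * \<bar>s\<bar>) * cauchy s) \<longlonglongrightarrow> min 1 0 * cauchy s"
        by (intro tendsto_mult tendsto_min tendsto_const) simp
      then show "(\<lambda>k. min 1 (1 / real (Suc k) * \<bar>s\<bar>) * cauchy s) \<longlonglongrightarrow> 0" by simp
    qed
    show "AE s in lborel. norm (min 1 (1 / real (Suc k) * \<bar>s\<bar>) * cauchy s) \<le> cauchy s" for k
    proof (rule AE_I2)
      fix s :: real
      have "0 \<le> min 1 (1 / real (Suc k) * \<bar>s\<bar>)" "min 1 (1 / real (Suc k) * \<bar>s\<bar>) \<le> 1" by auto
      then show "norm (min 1 (1 / real (Suc k) * \<bar>s\<bar>) * cauchy s) \<le> cauchy s"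
        using cauchy_pos[of s] mult_left_le_one_le[of "cauchy s" "min 1 (1 / real (Suc k) * \<bar>s\<bar>)"]
        unfolding real_norm_def abs_mult by (simp only: abs_of_nonneg less_imp_le)
    qed
  qed (auto simp: cauchy_integrable cauchy_def)
  then show ?thesis unfolding cauchy_defect_def by simp
qed

lemma bump_measurable: "bump K f \<Longrightarrow> f \<in> borel_measurable borel"
proof -
  assume "bump K f"
  then have "1-lipschitz_on UNIV f" unfolding bump_def by (intro lipschitz_onI) (auto simp: dist_real_def)
  then show ?thesis by (intro borel_measurable_continuous_onI lipschitz_on_continuous_on)
qed

lemma bump_integrable:
  assumes f: "bump K f" shows "integrable lborel f"
proof -
  have "integrable lborel (\<lambda>x. indicator {- K..K} x :: real)"
    by (rule integrable_real_indicator) (auto simp: emeasure_lborel_Icc_eq)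
  then show ?thesis
    by (rule Bochner_Integration.integrable_bound)
      (use f bump_measurable[OF f] in \<open>auto simp: bump_def indicator_def abs_le_iff intro!: AE_I2\<close>)
qed

lemma resolvent_kernel_bound: "Im z > 0 \<Longrightarrow> cmod (1 / (complex_of_real x - z)) \<le> 1 / Im z"
proof -
  assume z: "Im z > 0"
  have "Im z \<le> cmod (complex_of_real x - z)"
    using abs_Im_le_cmod[of "complex_of_real x - z"] z by simp
  then show ?thesis using z by (simp add: norm_divide frac_le)
qed

lemma resolvent_kernel_measurable [measurable]:
  "(\<lambda>x. 1 / (complex_of_real x - z)) \<in> borel_measurable borel"
  by measurable

lemma (in real_distribution) resolvent_kernel_integrable:
  "Im z > 0 \<Longrightarrow> integrable M (\<lambda>x. 1 / (complex_of_real x - z))"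
  by (rule integrable_const_bound[where B = "1 / Im z"]) (auto intro: resolvent_kernel_bound)

lemma stieltjes_bound:
  assumes "real_distribution \<mu>" "Im z > 0"
  shows "cmod (stieltjes_transform \<mu> z) \<le> 1 / Im z"
proof -
  interpret real_distribution \<mu> by fact
  have "cmod (stieltjes_transform \<mu> z) \<le> (LINT x|\<mu>. cmod (1 / (complex_of_real x - z)))"
    unfolding stieltjes_transform_def by (rule integral_norm_bound)
  also have "\<dots> \<le> (LINT x|\<mu>. 1 / Im z)"
    by (rule integral_mono) (use assms resolvent_kernel_integrable resolvent_kernel_bound in auto)
  finally show ?thesis using prob_space by simp
qed

lemma Im_resolvent_kernel: "Im (1 / (complex_of_real x - Complex t y)) = y / ((x - t)\<^sup>2 + y\<^sup>2)"
  by (simp add: Im_divide power2_eq_square)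

text \<open>On the line of height \<open>y\<close> the imaginary part of the transform is the measure smoothed with a Poisson kernel; Fubini
  moves the smoothing to \<open>f\<close>.\<close>
lemma smoothing_identity:
  assumes \<mu>: "real_distribution \<mu>" and f: "bump K f" and y: "y > 0"
  shows "(LINT x|\<mu>. (LINT s|lborel. f (x + y * s) * cauchy s)) =
    (LINT t|lborel. f t * Im (stieltjes_transform \<mu> (Complex t y)))"
proof -
  interpret real_distribution \<mu> by fact
  interpret pair_sigma_finite \<mu> lborel ..
  note [measurable] = bump_measurable[OF f]
  let ?k = "\<lambda>x t. f t * (y / ((x - t)\<^sup>2 + y\<^sup>2))"
  have pos: "(x - t)\<^sup>2 + y\<^sup>2 > 0" for x t using y by (simp add: add_nonneg_pos)
  have kb: "y / ((x - t)\<^sup>2 + y\<^sup>2) \<le> 1 / y" "y / ((x - t)\<^sup>2 + y\<^sup>2) \<ge> 0" for x t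
    using y pos[of x t] by (auto simp: divide_simps power2_eq_square)
  have fi: "integrable lborel (\<lambda>t. \<bar>f t\<bar>)" using bump_integrable[OF f] by simp
  have kb2: "norm (?k x t) \<le> norm (\<bar>f t\<bar> * (1 / y))" for x t
  proof -
    have "\<bar>f t\<bar> * \<bar>y / ((x - t)\<^sup>2 + y\<^sup>2)\<bar> \<le> \<bar>f t\<bar> * (1 / y)"
      using kb[of x t] by (intro mult_left_mono) (simp_all only: abs_of_nonneg abs_ge_zero)
    then show ?thesis using y by (simp only: real_norm_def abs_mult) simp
  qed
  have kb3: "norm (?k x t) \<le> \<bar>f t\<bar> * (1 / y)" for x t
    using kb2[of t x] y by simp
  have ki: "integrable lborel (\<lambda>t. ?k x t)" for x
    by (rule Bochner_Integration.integrable_bound[of _ "\<lambda>t. \<bar>f t\<bar> * (1 / y)"])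
      (use fi kb2 in \<open>auto intro!: AE_I2\<close>)
  have km: "(\<lambda>p. ?k (fst p) (snd p)) \<in> borel_measurable (\<mu> \<Otimes>\<^sub>M lborel)" by measurable
  have pi: "integrable (\<mu> \<Otimes>\<^sub>M lborel) (case_prod ?k)"
  proof (rule Fubini_integrable)
    show "case_prod ?k \<in> borel_measurable (\<mu> \<Otimes>\<^sub>M lborel)" using km by (simp add: case_prod_beta')
    show "AE x in \<mu>. integrable lborel (\<lambda>t. case_prod ?k (x, t))" using ki by simp
    show "integrable \<mu> (\<lambda>x. LINT t|lborel. norm (case_prod ?k (x, t)))"
    proof (rule integrable_const_bound[where B = "LINT t|lborel. \<bar>f t\<bar> * (1 / y)"])
      show "AE x in \<mu>. norm (LINT t|lborel. norm (case_prod ?k (x, t))) \<le> (LINT t|lborel. \<bar>f t\<bar> * (1 / y))"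
      proof (rule AE_I2)
        fix x
        have "norm (LINT t|lborel. norm (?k x t)) = (LINT t|lborel. norm (?k x t))" by simp
        also have "\<dots> \<le> (LINT t|lborel. \<bar>f t\<bar> * (1 / y))"
          by (rule integral_mono[OF integrable_norm[OF ki]]) (use fi kb3 in auto)
        finally show "norm (LINT t|lborel. norm (case_prod ?k (x, t))) \<le> (LINT t|lborel. \<bar>f t\<bar> * (1 / y))" by simp
      qed
      show "(\<lambda>x. LINT t|lborel. norm (case_prod ?k (x, t))) \<in> borel_measurable \<mu>"
        using km by (intro lborel.borel_measurable_lebesgue_integral) (simp add: case_prod_beta')
    qed
  qed
  have "(LINT s|lborel. f (x + y * s) * cauchy s) = (LINT t|lborel. ?k x t)" for x
  proof -
    have "(LINT t|lborel. ?k x t) = \<bar>y\<bar> *\<^sub>R (LINT s|lborel. ?k x (x + y * s))"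
      by (rule lborel_integral_real_affine) (use y in simp)
    also have "\<dots> = (LINT s|lborel. f (x + y * s) * cauchy s)"
    proof -
      have "\<bar>y\<bar> * ?k x (x + y * s) = f (x + y * s) * cauchy s" for s
      proof -
        have "(x - (x + y * s))\<^sup>2 + y\<^sup>2 = y\<^sup>2 * (1 + s\<^sup>2)" by (simp add: power2_eq_square algebra_simps)
        then show ?thesis unfolding cauchy_def using y by (simp add: power2_eq_square divide_simps)
      qed
      then show ?thesis by (simp flip: integral_mult_right_zero)
    qed
    finally show ?thesis ..
  qed
  then have "(LINT x|\<mu>. (LINT s|lborel. f (x + y * s) * cauchy s)) = (LINT x|\<mu>. (LINT t|lborel. ?k x t))"
    by simp
  also have "\<dots> = (LINT t|lborel. (LINT x|\<mu>. ?k x t))"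
    by (rule Fubini_integral[OF pi, symmetric])
  also have "\<dots> = (LINT t|lborel. f t * Im (stieltjes_transform \<mu> (Complex t y)))"
  proof (rule Bochner_Integration.integral_cong[OF refl])
    fix t
    have i: "integrable \<mu> (\<lambda>x. 1 / (complex_of_real x - Complex t y))"
      by (rule resolvent_kernel_integrable) (use y in simp)
    have "Im (stieltjes_transform \<mu> (Complex t y)) = (LINT x|\<mu>. y / ((x - t)\<^sup>2 + y\<^sup>2))"
      unfolding stieltjes_transform_def integral_Im[OF i, symmetric] Im_resolvent_kernel ..
    then show "(LINT x|\<mu>. ?k x t) = f t * Im (stieltjes_transform \<mu> (Complex t y))"
      by (simp only: integral_mult_right_zero)
  qed
  finally show ?thesis .
qed

lemma smoothing_error:
  assumes \<mu>: "real_distribution \<mu>" and f: "bump K f" and y: "y > 0"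
  shows "\<bar>(LINT x|\<mu>. (LINT s|lborel. f (x + y * s) * cauchy s)) - cauchy_mass * (LINT x|\<mu>. f x)\<bar> \<le> 2 * cauchy_defect y"
proof -
  interpret real_distribution \<mu> by fact
  note [measurable] = bump_measurable[OF f]
  have [measurable]: "cauchy \<in> borel_measurable borel" using cauchy_integrable by simp
  have fb: "\<bar>f x\<bar> \<le> 1" for x using f by (simp add: bump_def)
  have si: "integrable lborel (\<lambda>s. f (x + y * s) * cauchy s)" for x
    by (rule Bochner_Integration.integrable_bound[OF cauchy_integrable])
      (use fb cauchy_pos in \<open>auto simp: abs_mult less_imp_le intro!: AE_I2 mult_left_le_one_le\<close>)
  have ci: "integrable lborel (\<lambda>s. f x * cauchy s)" for x using cauchy_integrable by simp
  have pw: "\<bar>(LINT s|lborel. f (x + y * s) * cauchy s) - cauchy_mass * f x\<bar> \<le> 2 * cauchy_defect y" for x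
  proof -
    have "(LINT s|lborel. f (x + y * s) * cauchy s) - cauchy_mass * f x =
        (LINT s|lborel. f (x + y * s) * cauchy s - f x * cauchy s)"
      unfolding cauchy_mass_def using si ci by (simp add: mult.commute)
    also have "\<bar>\<dots>\<bar> \<le> (LINT s|lborel. \<bar>f (x + y * s) * cauchy s - f x * cauchy s\<bar>)"
      by (rule integral_abs_bound)
    also have "\<dots> \<le> (LINT s|lborel. 2 * (min 1 (y * \<bar>s\<bar>) * cauchy s))"
    proof (rule integral_mono)
      fix s :: real
      have "\<bar>f (x + y * s) - f x\<bar> \<le> \<bar>y * s\<bar>"
        using f unfolding bump_def by (metis add_diff_cancel_left')
      moreover have "\<bar>f (x + y * s) - f x\<bar> \<le> 2" using fb[of "x + y * s"] fb[of x] by linarith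
      moreover have "\<bar>y * s\<bar> = y * \<bar>s\<bar>" "y * \<bar>s\<bar> \<ge> 0" using y by (auto simp: abs_mult)
      ultimately have "\<bar>f (x + y * s) - f x\<bar> \<le> 2 * min 1 (y * \<bar>s\<bar>)" by (simp add: min_def)
      then have "\<bar>f (x + y * s) - f x\<bar> * cauchy s \<le> 2 * min 1 (y * \<bar>s\<bar>) * cauchy s"
        using cauchy_pos[of s] by (intro mult_right_mono) auto
      then show "\<bar>f (x + y * s) * cauchy s - f x * cauchy s\<bar> \<le> 2 * (min 1 (y * \<bar>s\<bar>) * cauchy s)"
        using cauchy_pos[of s] unfolding left_diff_distrib[symmetric] abs_mult by simp
    qed (use si ci cauchy_defect_integrable[OF y] in auto)
    finally show ?thesis by (simp add: cauchy_defect_def)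
  qed
  have m: "(\<lambda>x. LINT s|lborel. f (x + y * s) * cauchy s) \<in> borel_measurable \<mu>"
    by (rule lborel.borel_measurable_lebesgue_integral) measurable
  have fi: "integrable \<mu> f"
    by (rule integrable_const_bound[where B = 1]) (use fb in auto)
  have di: "integrable \<mu> (\<lambda>x. (LINT s|lborel. f (x + y * s) * cauchy s) - cauchy_mass * f x)"
    by (rule integrable_const_bound[where B = "2 * cauchy_defect y"]) (use m pw in auto)
  have li: "integrable \<mu> (\<lambda>x. LINT s|lborel. f (x + y * s) * cauchy s)"
    using Bochner_Integration.integrable_add[OF di integrable_mult_right[OF fi, of cauchy_mass]] by simp
  have "(LINT x|\<mu>. (LINT s|lborel. f (x + y * s) * cauchy s)) - cauchy_mass * (LINT x|\<mu>. f x) =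
      (LINT x|\<mu>. (LINT s|lborel. f (x + y * s) * cauchy s) - cauchy_mass * f x)"
    using li fi by simp
  also have "\<bar>\<dots>\<bar> \<le> (LINT x|\<mu>. \<bar>(LINT s|lborel. f (x + y * s) * cauchy s) - cauchy_mass * f x\<bar>)"
    by (rule integral_abs_bound)
  also have "\<dots> \<le> (LINT x|\<mu>. 2 * cauchy_defect y)"
    by (rule integral_mono) (use di pw in auto)
  finally show ?thesis using prob_space by simp
qed

lemma smoothed_measurable:
  assumes \<rho>: "real_distribution \<rho>" and f: "bump K f"
  shows "(\<lambda>t. f t * Im (stieltjes_transform \<rho> (Complex t y))) \<in> borel_measurable lborel"
proof -
  interpret real_distribution \<rho> by fact
  note [measurable] = bump_measurable[OF f]
  have [measurable]: "(\<lambda>t. LINT x|\<rho>. 1 / (complex_of_real x - Complex t y)) \<in> borel_measurable lborel"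
    by (rule borel_measurable_lebesgue_integral) (simp add: Complex_eq split_beta')
  show ?thesis unfolding stieltjes_transform_def by measurable
qed

text \<open>Smoothing costs twice the defect for each measure, and the smoothed integrals are integrals of the transforms over a line.\<close>
lemma bump_difference_bound:
  assumes \<mu>: "real_distribution \<mu>" and \<nu>: "real_distribution \<nu>" and f: "bump K f" and y: "y > 0"
  shows "cauchy_mass * \<bar>(LINT x|\<mu>. f x) - (LINT x|\<nu>. f x)\<bar> \<le> 4 * cauchy_defect y +
    \<bar>LINT t|lborel. f t * Im (stieltjes_transform \<mu> (Complex t y)) - f t * Im (stieltjes_transform \<nu> (Complex t y))\<bar>"
proof -
  note [measurable] = bump_measurable[OF f]
  have sm: "(\<lambda>t. f t * Im (stieltjes_transform \<rho> (Complex t y))) \<in> borel_measurable lborel"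
    if "real_distribution \<rho>" for \<rho>
    by (rule smoothed_measurable[OF that f])
  have si: "integrable lborel (\<lambda>t. f t * Im (stieltjes_transform \<rho> (Complex t y)))"
    if \<rho>: "real_distribution \<rho>" for \<rho>
  proof (rule Bochner_Integration.integrable_bound[of _ "\<lambda>t. \<bar>f t\<bar> * (1 / y)"])
    show "integrable lborel (\<lambda>t. \<bar>f t\<bar> * (1 / y))" using bump_integrable[OF f] by simp
    have "\<bar>Im (stieltjes_transform \<rho> (Complex t y))\<bar> \<le> 1 / y" for t
      using abs_Im_le_cmod[of "stieltjes_transform \<rho> (Complex t y)"] stieltjes_bound[OF \<rho>, of "Complex t y"] y by simp
    then have "\<bar>f t\<bar> * \<bar>Im (stieltjes_transform \<rho> (Complex t y))\<bar> \<le> \<bar>f t\<bar> * (1 / y)" for t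
      by (intro mult_left_mono) auto
    then show "AE t in lborel. norm (f t * Im (stieltjes_transform \<rho> (Complex t y))) \<le> norm (\<bar>f t\<bar> * (1 / y))"
      using y by (auto simp: abs_mult)
  qed (rule sm[OF \<rho>])
  have "(LINT t|lborel. f t * Im (stieltjes_transform \<mu> (Complex t y)) - f t * Im (stieltjes_transform \<nu> (Complex t y))) =
    (LINT x|\<mu>. (LINT s|lborel. f (x + y * s) * cauchy s)) - (LINT x|\<nu>. (LINT s|lborel. f (x + y * s) * cauchy s))"
    unfolding smoothing_identity[OF \<mu> f y] smoothing_identity[OF \<nu> f y]
    by (rule Bochner_Integration.integral_diff[OF si[OF \<mu>] si[OF \<nu>]])
  moreover have "cauchy_mass * \<bar>(LINT x|\<mu>. f x) - (LINT x|\<nu>. f x)\<bar> = \<bar>cauchy_mass * (LINT x|\<mu>. f x) - cauchy_mass * (LINT x|\<nu>. f x)\<bar>"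
    using cauchy_mass_pos by (simp add: right_diff_distrib[symmetric] abs_mult)
  ultimately show ?thesis
    using smoothing_error[OF \<mu> f y] smoothing_error[OF \<nu> f y] by linarith
qed

lemma bump_difference_le:
  assumes \<mu>: "real_distribution \<mu>" and \<nu>: "real_distribution \<nu>" and f: "bump K f" and y: "y > 0" and K: "K \<ge> 0"
    and S: "\<And>t. cmod (stieltjes_transform \<mu> (Complex t y) - stieltjes_transform \<nu> (Complex t y)) \<le> S"
  shows "cauchy_mass * \<bar>(LINT x|\<mu>. f x) - (LINT x|\<nu>. f x)\<bar> \<le> 4 * cauchy_defect y + 2 * K * S"
proof -
  let ?g = "\<lambda>t. f t * Im (stieltjes_transform \<mu> (Complex t y)) - f t * Im (stieltjes_transform \<nu> (Complex t y))"
  have S0: "S \<ge> 0" using S[of 0] norm_ge_zero order_trans by blast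
  have "\<bar>LINT t|lborel. ?g t\<bar> \<le> (LINT t|lborel. \<bar>?g t\<bar>)" by (rule integral_abs_bound)
  also have "\<dots> \<le> (LINT t|lborel. S * indicator {- K..K} t)"
  proof (rule Bochner_Integration.integral_mono')
    fix t :: real
    have "\<bar>?g t\<bar> = \<bar>f t\<bar> * \<bar>Im (stieltjes_transform \<mu> (Complex t y) - stieltjes_transform \<nu> (Complex t y))\<bar>"
      by (simp add: right_diff_distrib[symmetric] abs_mult)
    also have "\<dots> \<le> \<bar>f t\<bar> * S"
      using order_trans[OF abs_Im_le_cmod S] by (intro mult_left_mono) auto
    also have "\<dots> \<le> S * indicator {- K..K} t"
      using f S0 by (auto simp: bump_def indicator_def abs_le_iff intro!: mult_left_le_one_le)
    finally show "\<bar>?g t\<bar> \<le> S * indicator {- K..K} t" .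
  next
    show "integrable lborel (\<lambda>t. S * indicator {- K..K} t)"
      by (intro integrable_mult_right integrable_real_indicator) (auto simp: emeasure_lborel_Icc_eq)
  qed (use S0 in auto)
  also have "\<dots> = S * (2 * K)"
    using K by (simp add: measure_lborel_Icc)
  finally show ?thesis using bump_difference_bound[OF \<mu> \<nu> f y] by (simp add: mult_ac)
qed

lemma cauchy_defect_small: "\<delta> > 0 \<Longrightarrow> \<exists>y>0. cauchy_defect y < \<delta>"
proof -
  assume "\<delta> > 0"
  then have "eventually (\<lambda>k. cauchy_defect (1 / real (Suc k)) < \<delta>) sequentially"
    using cauchy_defect_tendsto by (auto intro: order_tendstoD)
  then obtain k where "cauchy_defect (1 / real (Suc k)) < \<delta>" by (auto simp: eventually_sequentially)
  then show ?thesis by (intro exI[of _ "1 / real (Suc k)"]) auto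
qed

text \<open>The threshold depends on \<open>K\<close> and \<open>\<delta>\<close> alone: the smoothing error fixes a height \<open>y\<close>,
  and \<open>\<kappa>\<close> is small compared with \<open>y\<close>.\<close>
lemma bump_difference_uniform:
  assumes K: "K \<ge> 0" and \<delta>: "\<delta> > 0"
  shows "\<exists>\<kappa>>0. \<forall>\<mu> \<nu> f. real_distribution \<mu> \<longrightarrow> real_distribution \<nu> \<longrightarrow> bump K f \<longrightarrow>
    (\<forall>z. Im z > 0 \<longrightarrow> cmod (stieltjes_transform \<mu> z - stieltjes_transform \<nu> z) \<le> \<kappa> / Im z) \<longrightarrow>
    \<bar>(LINT x|\<mu>. f x) - (LINT x|\<nu>. f x)\<bar> < \<delta>"
proof -
  let ?c = "cauchy_mass"
  have "?c * \<delta> / 8 > 0" using \<delta> cauchy_mass_pos by simp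
  then obtain y where y: "y > 0" "cauchy_defect y < ?c * \<delta> / 8" using cauchy_defect_small by blast
  (* so that 2 * K * \<kappa> / y is at most half of ?c * \<delta> *)
  define \<kappa> where "\<kappa> = ?c * \<delta> * y / (4 * (K + 1))"
  have \<kappa>: "\<kappa> > 0" unfolding \<kappa>_def using \<delta> cauchy_mass_pos y K by simp
  have "\<bar>(LINT x|\<mu>. f x) - (LINT x|\<nu>. f x)\<bar> < \<delta>"
    if "real_distribution \<mu>" "real_distribution \<nu>" "bump K f"
      and S: "\<forall>z. Im z > 0 \<longrightarrow> cmod (stieltjes_transform \<mu> z - stieltjes_transform \<nu> z) \<le> \<kappa> / Im z" for \<mu> \<nu> f
  proof -
    have "?c * \<bar>(LINT x|\<mu>. f x) - (LINT x|\<nu>. f x)\<bar> \<le> 4 * cauchy_defect y + 2 * K * (\<kappa> / y)"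
      proof (rule bump_difference_le[OF that(1,2,3) y(1) K])
      show "cmod (stieltjes_transform \<mu> (Complex t y) - stieltjes_transform \<nu> (Complex t y)) \<le> \<kappa> / y" for t
        using S[rule_format, of "Complex t y"] y by simp
    qed
    also have "2 * K * (\<kappa> / y) \<le> ?c * \<delta> / 2"
    proof -
      have "2 * K * (\<kappa> / y) = (K / (K + 1)) * (?c * \<delta> / 2)"
      proof -
        have "\<kappa> / y = ?c * \<delta> / (4 * (K + 1))" unfolding \<kappa>_def using y by simp
        then show ?thesis using K by (simp only:) (simp add: frac_eq_eq algebra_simps)
      qed
      also have "\<dots> \<le> 1 * (?c * \<delta> / 2)"
        using K \<delta> cauchy_mass_pos by (intro mult_right_mono) auto
      finally show ?thesis by simp
    qed
    finally have "?c * \<bar>(LINT x|\<mu>. f x) - (LINT x|\<nu>. f x)\<bar> < ?c * \<delta>" using y(2) by simp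
    then show ?thesis using cauchy_mass_pos by simp
  qed
  with \<kappa> show ?thesis by blast
qed

lemma bump_convergence:
  fixes \<mu> \<nu> :: "nat \<Rightarrow> real measure"
  assumes \<mu>: "\<And>k. real_distribution (\<mu> k)" and \<nu>: "\<And>k. real_distribution (\<nu> k)" and f: "bump K f"
    and lim: "\<And>z. Im z > 0 \<Longrightarrow> (\<lambda>k. stieltjes_transform (\<mu> k) z - stieltjes_transform (\<nu> k) z) \<longlonglongrightarrow> 0"
  shows "(\<lambda>k. (LINT x|\<mu> k. f x) - (LINT x|\<nu> k. f x)) \<longlonglongrightarrow> 0"
proof (rule LIMSEQ_I)
  fix \<delta> :: real assume \<delta>: "\<delta> > 0"
  let ?c = "cauchy_mass"
  have "?c * \<delta> / 8 > 0" using \<delta> cauchy_mass_pos by simp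
  then obtain y where y: "y > 0" "cauchy_defect y < ?c * \<delta> / 8" using cauchy_defect_small by blast
  note [measurable] = bump_measurable[OF f]
  let ?h = "\<lambda>k t. f t * Im (stieltjes_transform (\<mu> k) (Complex t y)) - f t * Im (stieltjes_transform (\<nu> k) (Complex t y))"
  have sm: "(\<lambda>t. f t * Im (stieltjes_transform \<rho> (Complex t y))) \<in> borel_measurable lborel"
    if "real_distribution \<rho>" for \<rho>
    by (rule smoothed_measurable[OF that f])
  have "(\<lambda>k. LINT t|lborel. ?h k t) \<longlonglongrightarrow> (LINT t|(lborel :: real measure). 0)"
  proof (rule integral_dominated_convergence[where w = "\<lambda>t. \<bar>f t\<bar> * (2 / y)"])
    show "integrable lborel (\<lambda>t. \<bar>f t\<bar> * (2 / y))" using bump_integrable[OF f] by simp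
    show "?h k \<in> borel_measurable lborel" for k
      using sm[OF \<mu>] sm[OF \<nu>] by measurable
    show "AE t in lborel. (\<lambda>k. ?h k t) \<longlonglongrightarrow> 0"
    proof (rule AE_I2)
      fix t
      have "(\<lambda>k. f t * Im (stieltjes_transform (\<mu> k) (Complex t y) - stieltjes_transform (\<nu> k) (Complex t y))) \<longlonglongrightarrow> f t * Im 0"
        by (intro tendsto_mult tendsto_const tendsto_Im lim) (use y in simp)
      then show "(\<lambda>k. ?h k t) \<longlonglongrightarrow> 0" by (simp add: right_diff_distrib)
    qed
    show "AE t in lborel. norm (?h k t) \<le> \<bar>f t\<bar> * (2 / y)" for k
    proof (rule AE_I2)
      fix t
      have b: "\<bar>Im (stieltjes_transform \<rho> (Complex t y))\<bar> \<le> 1 / y" if "real_distribution \<rho>" for \<rho>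
        using abs_Im_le_cmod[of "stieltjes_transform \<rho> (Complex t y)"] stieltjes_bound[OF that, of "Complex t y"] y by simp
      have "norm (?h k t) = \<bar>f t\<bar> * \<bar>Im (stieltjes_transform (\<mu> k) (Complex t y)) - Im (stieltjes_transform (\<nu> k) (Complex t y))\<bar>"
        by (simp add: right_diff_distrib[symmetric] abs_mult)
      also have "\<dots> \<le> \<bar>f t\<bar> * (2 / y)"
        using b[OF \<mu>[of k]] b[OF \<nu>[of k]] by (intro mult_left_mono) (simp_all add: abs_le_iff)
      finally show "norm (?h k t) \<le> \<bar>f t\<bar> * (2 / y)" .
    qed
  qed simp
  then have "(\<lambda>k. LINT t|lborel. ?h k t) \<longlonglongrightarrow> 0" by simp
  from LIMSEQ_D[OF this, of "?c * \<delta> / 2"] \<delta> cauchy_mass_pos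
  obtain k0 where k0: "\<And>k. k \<ge> k0 \<Longrightarrow> \<bar>LINT t|lborel. ?h k t\<bar> < ?c * \<delta> / 2"
    by auto
  have "norm ((LINT x|\<mu> k. f x) - (LINT x|\<nu> k. f x) - 0) < \<delta>" if "k \<ge> k0" for k
  proof -
    have "?c * \<bar>(LINT x|\<mu> k. f x) - (LINT x|\<nu> k. f x)\<bar> < ?c * \<delta>"
      using bump_difference_bound[OF \<mu> \<nu> f y(1), of k k] k0[OF that] y(2) by linarith
    then show ?thesis using cauchy_mass_pos by simp
  qed
  then show "\<exists>k0. \<forall>k\<ge>k0. norm ((LINT x|\<mu> k. f x) - (LINT x|\<nu> k. f x) - 0) < \<delta>" by blast
qed

lemma trapezoid_bump:
  assumes "0 \<le> e" "e \<le> 1" "a \<le> b"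
  shows "bump (\<bar>a\<bar> + \<bar>b\<bar> + 1) (\<lambda>x. max 0 (e - max 0 (max (a - x) (x - b))))"
proof -
  have "\<bar>max 0 (e - u) - max 0 (e - v)\<bar> \<le> \<bar>u - v\<bar>" for u v :: real
    by (auto simp: max_def abs_if)
  moreover have "\<bar>max 0 (max (a - x) (x - b)) - max 0 (max (a - y) (y - b))\<bar> \<le> \<bar>x - y\<bar>" for x y :: real
    using assms(3) by (auto simp: max_def abs_if)
  ultimately have "\<bar>max 0 (e - max 0 (max (a - x) (x - b))) - max 0 (e - max 0 (max (a - y) (y - b)))\<bar> \<le> \<bar>x - y\<bar>" for x y
    by (rule order_trans)
  moreover have "\<bar>max 0 (e - max 0 (max (a - x) (x - b)))\<bar> \<le> 1" for x
    using assms by (auto simp: max_def)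
  moreover have "max 0 (e - max 0 (max (a - x) (x - b))) = 0" if "\<bar>x\<bar> > \<bar>a\<bar> + \<bar>b\<bar> + 1" for x
  proof -
    have "a - x \<ge> 1 \<or> x - b \<ge> 1" using that by linarith
    then have "max 0 (max (a - x) (x - b)) \<ge> 1" by (auto simp: le_max_iff_disj)
    then show ?thesis using assms by simp
  qed
  ultimately show ?thesis unfolding bump_def by blast
qed

text \<open>Integrals of bumps agree, and steeper and steeper trapezoids converge to the indicator of an interval.\<close>
lemma stieltjes_unique:
  assumes \<mu>: "real_distribution \<mu>" and \<nu>: "real_distribution \<nu>"
    and eq: "\<And>z. Im z > 0 \<Longrightarrow> stieltjes_transform \<mu> z = stieltjes_transform \<nu> z"
  shows "\<mu> = \<nu>"
proof -
  interpret A: real_distribution \<mu> by fact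
  interpret B: real_distribution \<nu> by fact
  have bump_eq: "(LINT x|\<mu>. f x) = (LINT x|\<nu>. f x)" if f: "bump K f" for K f
  proof -
    have "(\<lambda>k::nat. (LINT x|\<mu>. f x) - (LINT x|\<nu>. f x)) \<longlonglongrightarrow> 0"
      by (rule bump_convergence[OF \<mu> \<nu> f]) (simp add: eq)
    then show ?thesis by (simp add: LIMSEQ_const_iff)
  qed
  have Icc: "measure \<mu> {a..b} = measure \<nu> {a..b}" if ab: "a \<le> b" for a b
  proof -
    define g where "g k x = max 0 (1 - real (Suc k) * max 0 (max (a - x) (x - b)))" for k x
    have gb: "0 \<le> g k x" "g k x \<le> 1" for k x
      unfolding g_def by (auto simp: max_def)
    have gm: "g k \<in> borel_measurable borel" for k unfolding g_def by measurable
    have geq: "(LINT x|\<mu>. g k x) = (LINT x|\<nu>. g k x)" for k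
    proof -
      define f where "f x = max 0 (1 / real (Suc k) - max 0 (max (a - x) (x - b)))" for x
      have gf: "g k x = real (Suc k) * f x" for x
      proof -
        have "real (Suc k) * max 0 u = max 0 (real (Suc k) * u)" for u by (simp add: max_mult_distrib_left)
        then show ?thesis unfolding g_def f_def by (simp add: right_diff_distrib)
      qed
      have "bump (\<bar>a\<bar> + \<bar>b\<bar> + 1) f"
        unfolding f_def by (rule trapezoid_bump) (use ab in auto)
      then show ?thesis unfolding gf using bump_eq by simp
    qed
    have glim: "(\<lambda>k. g k x) \<longlonglongrightarrow> indicator {a..b} x" for x
    proof (cases "x \<in> {a..b}")
      case True
      then have "g k x = 1" for k unfolding g_def by (auto simp: max_def)
      then show ?thesis using True by simp
    next
      case False
      define d where "d = max 0 (max (a - x) (x - b))"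
      have d: "d > 0" unfolding d_def using False by (auto simp: max_def)
      obtain m :: nat where m: "1 / d < real m" using reals_Archimedean2 by blast
      have "g k x = 0" if "k \<ge> m" for k
      proof -
        have "1 / d < real (Suc k)" using m that by linarith
        then have "1 < real (Suc k) * d" using d by (simp add: divide_less_eq)
        then show ?thesis unfolding g_def d_def[symmetric] by simp
      qed
      then have "(\<lambda>k. g k x) \<longlonglongrightarrow> 0"
        by (intro tendsto_eventually) (auto simp: eventually_sequentially)
      then show ?thesis using False by simp
    qed
    have lim: "(\<lambda>k. LINT x|\<rho>. g k x) \<longlonglongrightarrow> measure \<rho> {a..b}" if "real_distribution \<rho>" for \<rho>
    proof -
      interpret real_distribution \<rho> by fact
      have "(\<lambda>k. LINT x|\<rho>. g k x) \<longlonglongrightarrow> (LINT x|\<rho>. indicator {a..b} x)"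
        by (rule integral_dominated_convergence[where w = "\<lambda>_. 1"]) (use gm gb glim in auto)
      then show ?thesis by simp
    qed
    show ?thesis using lim[OF \<mu>] lim[OF \<nu>] unfolding geq by (rule LIMSEQ_unique)
  qed
  have "cdf \<mu> x = cdf \<nu> x" for x
  proof -
    have lim: "(\<lambda>k. measure \<rho> {x - real k..x}) \<longlonglongrightarrow> cdf \<rho> x" if "real_distribution \<rho>" for \<rho>
    proof -
      interpret real_distribution \<rho> by fact
      have "(\<lambda>k. measure \<rho> {x - real k..x}) \<longlonglongrightarrow> measure \<rho> (\<Union>k. {x - real k..x})"
        by (rule finite_Lim_measure_incseq) (auto simp: incseq_def)
      also have "(\<Union>k. {x - real k..x}) = {..x}"
      proof (intro equalityI subsetI)
        fix u assume "u \<in> {..x}"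
        obtain k :: nat where "x - u < real k" using reals_Archimedean2 by blast
        with \<open>u \<in> {..x}\<close> show "u \<in> (\<Union>k. {x - real k..x})" by (auto intro!: exI[of _ k])
      qed auto
      finally show ?thesis by (simp add: cdf_def)
    qed
    have "measure \<mu> {x - real k..x} = measure \<nu> {x - real k..x}" for k by (rule Icc) simp
    then show ?thesis using LIMSEQ_unique[OF lim[OF \<mu>]] lim[OF \<nu>] by simp
  qed
  then show ?thesis by (intro cdf_unique[OF \<mu> \<nu>]) auto
qed

section \<open>Convergence of Stieltjes transforms\<close>

lemma not_tendsto_subseq:
  fixes X :: "nat \<Rightarrow> 'a::metric_space"
  assumes "\<not> X \<longlonglongrightarrow> l"
  obtains e s where "e > 0" "strict_mono (s :: nat \<Rightarrow> nat)" "\<And>k. dist (X (s k)) l \<ge> e"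
proof -
  obtain e where e: "e > 0" "\<And>N. \<exists>n\<ge>N. \<not> dist (X n) l < e"
    using assms unfolding lim_sequentially by blast
  then have "infinite {n. \<not> dist (X n) l < e}"
    unfolding infinite_nat_iff_unbounded_le by auto
  then obtain s where s: "strict_mono (s :: nat \<Rightarrow> nat)" "\<And>k. s k \<in> {n. \<not> dist (X n) l < e}"
    using infinite_enumerate by blast
  show ?thesis by (rule that[OF e(1) s(1)]) (use s(2) in \<open>auto simp: not_less\<close>)
qed

lemma stieltjes_holomorphic:
  assumes "real_distribution \<mu>"
  shows "stieltjes_transform \<mu> holomorphic_on {z. Im z > 0}"
proof -
  interpret real_distribution \<mu> by fact
  have "(stieltjes_transform \<mu> has_field_derivative (LINT x|\<mu>. 1 / (complex_of_real x - z)\<^sup>2)) (at z)" if z: "Im z > 0" for z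
  proof -
    let ?D = "LINT x|\<mu>. 1 / (complex_of_real x - z)\<^sup>2"
    have Di: "integrable \<mu> (\<lambda>x. 1 / (complex_of_real x - z)\<^sup>2)"
    proof (rule integrable_const_bound[where B = "(1 / Im z)\<^sup>2"])
      show "AE x in \<mu>. cmod (1 / (complex_of_real x - z)\<^sup>2) \<le> (1 / Im z)\<^sup>2"
      proof (rule AE_I2)
        fix x
        have "cmod (1 / (complex_of_real x - z)\<^sup>2) = (cmod (1 / (complex_of_real x - z)))\<^sup>2"
          by (simp add: norm_divide norm_power power_divide)
        also have "\<dots> \<le> (1 / Im z)\<^sup>2" by (intro power_mono resolvent_kernel_bound z) auto
        finally show "cmod (1 / (complex_of_real x - z)\<^sup>2) \<le> (1 / Im z)\<^sup>2" .
      qed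
    qed measurable
    have est: "norm ((stieltjes_transform \<mu> w - stieltjes_transform \<mu> z) / (w - z) - ?D) \<le> 2 / (Im z) ^ 3 * cmod (w - z)"
      if w: "w \<noteq> z" "cmod (w - z) < Im z / 2" for w
    proof -
      have Iw: "Im w > Im z / 2"
        using abs_Im_le_cmod[of "w - z"] w(2) by simp
      then have Iw0: "Im w > 0" using z by simp
      have nz: "complex_of_real x - w \<noteq> 0" "complex_of_real x - z \<noteq> 0" for x using Iw0 z by (auto simp: complex_eq_iff)
      let ?q = "\<lambda>x. 1 / (complex_of_real x - w) * (1 / (complex_of_real x - z)) * (1 / (complex_of_real x - z))"
      have qb: "cmod (?q x) \<le> 2 / (Im z) ^ 3" for x
      proof -
        have "cmod (1 / (complex_of_real x - w)) \<le> 2 / Im z"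
        proof -
          have "1 / Im w \<le> 1 / (Im z / 2)" using Iw Iw0 z by (intro divide_left_mono) auto
          then show ?thesis using resolvent_kernel_bound[OF Iw0, of x] by simp
        qed
        then have "cmod (?q x) \<le> 2 / Im z * (1 / Im z) * (1 / Im z)"
          unfolding norm_mult using resolvent_kernel_bound[OF z, of x] z by (intro mult_mono) auto
        then show ?thesis by (simp add: power3_eq_cube)
      qed
      have qi: "integrable \<mu> ?q" by (rule integrable_const_bound[where B = "2 / (Im z) ^ 3"]) (use qb in auto)
      have "(stieltjes_transform \<mu> w - stieltjes_transform \<mu> z) / (w - z) - ?D =
          (LINT x|\<mu>. (1 / (complex_of_real x - w) - 1 / (complex_of_real x - z)) / (w - z) - 1 / (complex_of_real x - z)\<^sup>2)"
        unfolding stieltjes_transform_def using resolvent_kernel_integrable[OF z] resolvent_kernel_integrable[OF Iw0] Di by simp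
      also have "\<dots> = (LINT x|\<mu>. (w - z) * ?q x)"
      proof (rule Bochner_Integration.integral_cong[OF refl])
        fix x
        have "(1 / a - 1 / b) / (b - a) - 1 / b\<^sup>2 = (b - a) * (1 / a * (1 / b) * (1 / b))"
          if "a \<noteq> 0" "b \<noteq> 0" "b - a \<noteq> 0" for a b :: complex
        proof -
          have "1 / a - 1 / b = (b - a) * (1 / (a * b))" using that by (simp add: field_simps)
          then have 1: "(1 / a - 1 / b) / (b - a) = 1 / (a * b)" using that by simp
          show ?thesis unfolding 1 using that by (simp add: field_simps power2_eq_square)
        qed
        from this[of "complex_of_real x - w" "complex_of_real x - z"] nz[of x] w(1)
        show "(1 / (complex_of_real x - w) - 1 / (complex_of_real x - z)) / (w - z) - 1 / (complex_of_real x - z)\<^sup>2 = (w - z) * ?q x"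
          by simp
      qed
      also have "\<dots> = (w - z) * (LINT x|\<mu>. ?q x)" by (rule integral_mult_right_zero)
      also have "cmod \<dots> \<le> cmod (w - z) * (2 / (Im z) ^ 3)"
      proof -
        have "cmod (LINT x|\<mu>. ?q x) \<le> (LINT x|\<mu>. cmod (?q x))" by (rule integral_norm_bound)
        also have "\<dots> \<le> (LINT x|\<mu>. 2 / (Im z) ^ 3)" by (rule integral_mono) (use qi qb in auto)
        also have "(LINT x|\<mu>. 2 / (Im z) ^ 3) = 2 / (Im z) ^ 3" using prob_space by simp
        finally show ?thesis unfolding norm_mult by (rule mult_left_mono) simp
      qed
      finally show ?thesis by (simp add: mult.commute)
    qed
    have "((\<lambda>w. (stieltjes_transform \<mu> w - stieltjes_transform \<mu> z) / (w - z) - ?D) \<longlongrightarrow> 0) (at z)"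
    proof (rule Lim_null_comparison)
      show "\<forall>\<^sub>F w in at z. norm ((stieltjes_transform \<mu> w - stieltjes_transform \<mu> z) / (w - z) - ?D) \<le> 2 / (Im z) ^ 3 * cmod (w - z)"
        unfolding eventually_at using z est by (intro exI[of _ "Im z / 2"]) (auto simp: dist_norm)
      show "((\<lambda>w. 2 / (Im z) ^ 3 * cmod (w - z)) \<longlongrightarrow> 0) (at z)"
        by (intro tendsto_mult_right_zero tendsto_norm_zero LIM_zero tendsto_ident_at)
    qed
    then show ?thesis unfolding has_field_derivative_iff by (rule LIM_zero_cancel)
  qed
  then show ?thesis
    using open_halfspace_Im_gt by (auto simp: holomorphic_on_open)
qed

text \<open>The theorem of Vitali: the differences are uniformly bounded on compact subsets of the upper half plane, and the points
  \<open>z\<close> accumulate at \<open>Complex 0 v\<close> inside it, so every limit function vanishes. Countably many points are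
  asked for so that almost sure convergence at each of them suffices.\<close>
lemma stieltjes_convergence_extends:
  fixes \<mu> \<nu> :: "nat \<Rightarrow> real measure"
  assumes \<mu>: "\<And>k. real_distribution (\<mu> k)" and \<nu>: "\<And>k. real_distribution (\<nu> k)"
    and v: "v > 0"
    and lim: "\<And>j z. z = Complex 0 (v + 1 / real (Suc j)) \<Longrightarrow> (\<lambda>k. stieltjes_transform (\<mu> k) z - stieltjes_transform (\<nu> k) z) \<longlonglongrightarrow> 0"
    and z: "Im z > 0"
  shows "(\<lambda>k. stieltjes_transform (\<mu> k) z - stieltjes_transform (\<nu> k) z) \<longlonglongrightarrow> 0"
proof (rule ccontr)
  let ?F = "\<lambda>k z. stieltjes_transform (\<mu> k) z - stieltjes_transform (\<nu> k) z"
  let ?S = "{z. Im z > 0}"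
  assume "\<not> ?thesis"
  then obtain e s where s: "e > 0" "strict_mono (s :: nat \<Rightarrow> nat)" "\<And>k. dist (?F (s k) z) 0 \<ge> e"
    by (rule not_tendsto_subseq) blast
  have hol: "?F k holomorphic_on ?S" for k
    by (intro holomorphic_on_diff stieltjes_holomorphic \<mu> \<nu>)
  have bnd: "\<exists>B. \<forall>h \<in> range ?F. \<forall>z \<in> K. norm (h z) \<le> B" if K: "compact K" "K \<subseteq> ?S" for K
  proof (cases "K = {}")
    case False
    have "continuous_on K Im" by (intro continuous_intros)
    then obtain w where w: "w \<in> K" "\<And>u. u \<in> K \<Longrightarrow> Im w \<le> Im u"
      using continuous_attains_inf[OF K(1) False] by blast
    have w0: "Im w > 0" using w(1) K(2) by auto
    have "norm (?F k u) \<le> 1 / Im w + 1 / Im w" if "u \<in> K" for k u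
    proof -
      have u: "Im u > 0" using that K(2) by auto
      have "norm (?F k u) \<le> 1 / Im u + 1 / Im u"
        by (rule order_trans[OF norm_triangle_ineq4 add_mono[OF stieltjes_bound[OF \<mu> u] stieltjes_bound[OF \<nu> u]]])
      also have "\<dots> \<le> 1 / Im w + 1 / Im w"
        using w(2)[OF that] w0 by (intro add_mono divide_left_mono) auto
      finally show ?thesis .
    qed
    then show ?thesis by blast
  qed auto
  obtain g r where gr: "g holomorphic_on ?S" "strict_mono (r :: nat \<Rightarrow> nat)"
      "\<And>x. x \<in> ?S \<Longrightarrow> ((\<lambda>n. ?F (s (r n)) x) \<longlongrightarrow> g x) sequentially"
    by (rule Montel[of ?S "range ?F" "\<lambda>k. ?F (s k)"]) (use hol bnd open_halfspace_Im_gt in auto)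
  have sr: "strict_mono (\<lambda>n. s (r n))" using s(2) gr(2) by (simp add: strict_mono_def)
  have g0: "g x = 0" if x: "x = Complex 0 (v + 1 / real (Suc j))" for x j
  proof -
    have "(\<lambda>n. ?F (s (r n)) x) \<longlonglongrightarrow> 0"
      using LIMSEQ_subseq_LIMSEQ[OF lim[OF x] sr] by (simp add: comp_def)
    moreover have "(\<lambda>n. ?F (s (r n)) x) \<longlonglongrightarrow> g x"
    proof (rule gr(3))
      have "v + 1 / real (Suc j) > 0" using v by (intro add_pos_pos) auto
      then show "x \<in> ?S" unfolding x by simp
    qed
    ultimately show ?thesis by (rule LIMSEQ_unique[symmetric])
  qed
  have "g z = 0"
  proof (rule analytic_continuation[OF gr(1)])
    let ?w = "\<lambda>j. Complex 0 (v + 1 / real (Suc j))"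
    show "connected ?S" by (intro convex_connected convex_halfspace_Im_gt)
    show "range ?w \<subseteq> ?S" using v by (auto intro!: add_pos_pos)
    show "Complex 0 v islimpt range ?w"
      unfolding islimpt_sequential
    proof (intro exI[of _ ?w] conjI allI)
      have "(\<lambda>j. 1 / real (Suc j)) \<longlonglongrightarrow> 0"
        using LIMSEQ_inverse_real_of_nat by (simp add: inverse_eq_divide)
      then have "?w \<longlonglongrightarrow> Complex 0 (v + 0)" by (intro tendsto_intros)
      then show "?w \<longlonglongrightarrow> Complex 0 v" by simp
      show "?w j \<in> range ?w - {Complex 0 v}" for j by auto
    qed
    show "g x = 0" if "x \<in> range ?w" for x using that g0 by blast
  qed (use v z open_halfspace_Im_gt in auto)
  then have "(\<lambda>n. ?F (s (r n)) z) \<longlonglongrightarrow> 0" using gr(3)[of z] z by (simp only: mem_Collect_eq)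
  then have "eventually (\<lambda>n. dist (?F (s (r n)) z) 0 < e) sequentially" using s(1) by (rule tendstoD)
  then show False using s(3) by (auto simp: eventually_sequentially not_less[symmetric])
qed

text \<open>The right hand side is twice the integral of \<open>x\<^sup>2 / (x\<^sup>2 + y\<^sup>2)\<close>, which is at least
  \<open>1/2\<close> for \<open>|x| \<ge> y\<close>.\<close>
lemma tail_bound:
  assumes "real_distribution \<mu>" "y > 0"
  shows "measure \<mu> {x. y \<le> \<bar>x\<bar>} \<le> 2 * Re (1 + \<i> * y * stieltjes_transform \<mu> (\<i> * y))"
proof -
  interpret real_distribution \<mu> by fact
  have ki: "integrable \<mu> (\<lambda>x. 1 / (complex_of_real x - \<i> * y))"
    using resolvent_kernel_integrable[of "\<i> * y"] assms(2) by simp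
  have ki2: "integrable \<mu> (\<lambda>x. 1 + \<i> * y * (1 / (complex_of_real x - \<i> * y)))"
    by (intro Bochner_Integration.integrable_add integrable_const integrable_mult_right ki)
  have one: "(LINT x|\<mu>. (1::complex)) = 1" using prob_space by simp
  define q where "q x = x\<^sup>2 / (x\<^sup>2 + y\<^sup>2)" for x
  have [measurable]: "q \<in> borel_measurable borel" unfolding q_def by measurable
  have "1 + \<i> * y * stieltjes_transform \<mu> (\<i> * y) = (LINT x|\<mu>. 1 + \<i> * y * (1 / (complex_of_real x - \<i> * y)))"
    unfolding stieltjes_transform_def
    by (subst Bochner_Integration.integral_add[OF integrable_const integrable_mult_right[OF ki]])
      (simp only: one integral_mult_right_zero)
  then have "Re (1 + \<i> * y * stieltjes_transform \<mu> (\<i> * y)) = (LINT x|\<mu>. Re (1 + \<i> * y * (1 / (complex_of_real x - \<i> * y))))"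
    using integral_Re[OF ki2] by simp
  also have "\<dots> = (LINT x|\<mu>. q x)"
  proof (rule Bochner_Integration.integral_cong[OF refl])
    fix x
    have "complex_of_real x - \<i> * y \<noteq> 0" using assms(2) by (auto simp: complex_eq_iff)
    then have "1 + \<i> * y * (1 / (complex_of_real x - \<i> * y)) = complex_of_real x / (complex_of_real x - \<i> * y)"
      by (simp add: field_simps)
    then show "Re (1 + \<i> * y * (1 / (complex_of_real x - \<i> * y))) = q x"
      unfolding q_def by (simp only:) (simp add: Re_divide power2_eq_square)
  qed
  finally have eq: "Re (1 + \<i> * y * stieltjes_transform \<mu> (\<i> * y)) = (LINT x|\<mu>. q x)" .
  have b: "0 \<le> q x" "q x \<le> 1" for x
    unfolding q_def using assms(2) by (auto simp: divide_le_eq add_nonneg_pos)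
  have "measure \<mu> {x. y \<le> \<bar>x\<bar>} = (LINT x|\<mu>. indicator {x. y \<le> \<bar>x\<bar>} x)" by simp
  also have "\<dots> \<le> (LINT x|\<mu>. 2 * q x)"
  proof (rule Bochner_Integration.integral_mono')
    show "integrable \<mu> (\<lambda>x. 2 * q x)"
      by (rule integrable_const_bound[where B = 2]) (use b in auto)
    fix x
    show "indicator {x. y \<le> \<bar>x\<bar>} x \<le> 2 * q x"
    proof (cases "y \<le> \<bar>x\<bar>")
      case True
      then have "y\<^sup>2 \<le> x\<^sup>2" using assms(2) by (intro abs_le_square_iff[THEN iffD1]) simp
      moreover have "x\<^sup>2 + y\<^sup>2 > 0" using assms(2) by (simp add: add_nonneg_pos)
      ultimately show ?thesis by (simp add: indicator_def q_def le_divide_eq)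
    qed (use b in simp)
    show "0 \<le> 2 * q x" using b by simp
  qed
  finally show ?thesis unfolding eq by simp
qed

text \<open>The assumption on \<open>G\<close> far up on the imaginary axis says that no mass escapes to infinity; by
  \<open>tail_bound\<close> the sequence is tight, and the transform of any weak limit is \<open>G\<close>.\<close>
lemma stieltjes_continuity:
  fixes \<mu> :: "nat \<Rightarrow> real measure"
  assumes \<mu>: "\<And>k. real_distribution (\<mu> k)"
    and lim: "\<And>z. Im z > 0 \<Longrightarrow> (\<lambda>k. stieltjes_transform (\<mu> k) z) \<longlonglongrightarrow> G z"
    and G: "\<And>\<epsilon>. \<epsilon> > 0 \<Longrightarrow> \<exists>y. (0::real) < y \<and> cmod (1 + \<i> * y * G (\<i> * y)) < \<epsilon>"
  shows "\<exists>\<rho>. real_distribution \<rho> \<and> (\<forall>z. Im z > 0 \<longrightarrow> stieltjes_transform \<rho> z = G z)"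
proof -
  interpret real_distribution "\<mu> k" for k by (rule \<mu>)
  have tight: "tight \<mu>"
    unfolding tight_def
  proof (intro conjI allI impI)
    fix \<epsilon> :: real assume \<epsilon>: "\<epsilon> > 0"
    then obtain y where y: "(0::real) < y" "cmod (1 + \<i> * y * G (\<i> * y)) < \<epsilon> / 4" using G[of "\<epsilon> / 4"] by auto
    have "(\<lambda>k. Re (1 + \<i> * y * stieltjes_transform (\<mu> k) (\<i> * y))) \<longlonglongrightarrow> Re (1 + \<i> * y * G (\<i> * y))"
      by (intro tendsto_intros lim) (use y in simp)
    moreover have "Re (1 + \<i> * y * G (\<i> * y)) < \<epsilon> / 2"
      using complex_Re_le_cmod[of "1 + \<i> * y * G (\<i> * y)"] y \<epsilon> by simp
    ultimately have "eventually (\<lambda>k. Re (1 + \<i> * y * stieltjes_transform (\<mu> k) (\<i> * y)) < \<epsilon> / 2) sequentially"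
      by (rule order_tendstoD)
    then obtain k0 where k0': "\<And>k. k \<ge> k0 \<Longrightarrow> Re (1 + \<i> * y * stieltjes_transform (\<mu> k) (\<i> * y)) < \<epsilon> / 2"
      unfolding eventually_sequentially by blast
    have k0: "measure (\<mu> k) {x. y \<le> \<bar>x\<bar>} < \<epsilon>" if "k \<ge> k0" for k
      using tail_bound[OF \<mu> y(1), of k] k0'[OF that] by linarith
    have "\<exists>j::nat. measure (\<mu> k) {x. real j \<le> \<bar>x\<bar>} < \<epsilon>" for k
    proof -
      have "(\<lambda>j. measure (\<mu> k) {x. real j \<le> \<bar>x\<bar>}) \<longlonglongrightarrow> measure (\<mu> k) (\<Inter>j. {x. real j \<le> \<bar>x\<bar>})"
        by (rule finite_Lim_measure_decseq) (auto simp: decseq_def)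
      also have "(\<Inter>j. {x. real j \<le> \<bar>x\<bar>}) = {}"
      proof -
        have "\<exists>j::nat. \<not> real j \<le> \<bar>x\<bar>" for x :: real
          using reals_Archimedean2[of "\<bar>x\<bar>"] by (auto simp: not_le)
        then show ?thesis by auto
      qed
      finally have "eventually (\<lambda>j. measure (\<mu> k) {x. real j \<le> \<bar>x\<bar>} < \<epsilon>) sequentially"
        using \<epsilon> by (auto dest: order_tendstoD)
      then show ?thesis by (auto simp: eventually_sequentially)
    qed
    then obtain j where j: "\<And>k. measure (\<mu> k) {x. real (j k) \<le> \<bar>x\<bar>} < \<epsilon>" by metis
    (* y serves all but finitely many measures, j k those with k < k0 *)
    define Y where "Y = y + (\<Sum>k<k0. real (j k))"
    have Y0: "Y > 0" unfolding Y_def using y by (simp add: add_pos_nonneg sum_nonneg)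
    have Y: "measure (\<mu> k) {x. Y \<le> \<bar>x\<bar>} < \<epsilon>" for k
    proof (cases "k < k0")
      case True
      have "real (j k) \<le> (\<Sum>k<k0. real (j k))" using True by (intro member_le_sum) auto
      then have "real (j k) \<le> Y" unfolding Y_def using y by simp
      then have "measure (\<mu> k) {x. Y \<le> \<bar>x\<bar>} \<le> measure (\<mu> k) {x. real (j k) \<le> \<bar>x\<bar>}"
        by (intro finite_measure_mono) auto
      then show ?thesis using j[of k] by linarith
    next
      case False
      have "y \<le> Y" unfolding Y_def by (simp add: sum_nonneg)
      then have "measure (\<mu> k) {x. Y \<le> \<bar>x\<bar>} \<le> measure (\<mu> k) {x. y \<le> \<bar>x\<bar>}"
        by (intro finite_measure_mono) auto
      then show ?thesis using k0[of k] False by linarith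
    qed
    have "measure (\<mu> k) {- Y<..Y} > 1 - \<epsilon>" for k
    proof -
      have "measure (\<mu> k) (UNIV - {x. Y \<le> \<bar>x\<bar>}) = 1 - measure (\<mu> k) {x. Y \<le> \<bar>x\<bar>}"
        using prob_compl[of "{x. Y \<le> \<bar>x\<bar>}" k] by simp
      moreover have "measure (\<mu> k) (UNIV - {x. Y \<le> \<bar>x\<bar>}) \<le> measure (\<mu> k) {- Y<..Y}"
        by (intro finite_measure_mono) auto
      ultimately show ?thesis using Y[of k] by linarith
    qed
    then show "\<exists>a b. a < b \<and> (\<forall>k. 1 - \<epsilon> < measure (\<mu> k) {a<..b})"
      using Y0 by (intro exI[of _ "- Y"] exI[of _ Y]) auto
  qed (rule \<mu>)
  then obtain r \<rho> where r: "strict_mono (r :: nat \<Rightarrow> nat)" "real_distribution \<rho>" "weak_conv_m (\<mu> \<circ> id \<circ> r) \<rho>"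
    using tight_imp_convergent_subsubsequence[OF _ strict_mono_id] by blast
  have "stieltjes_transform \<rho> z = G z" if z: "Im z > 0" for z
  proof (rule LIMSEQ_unique)
    have nz: "complex_of_real x - z \<noteq> 0" for x using z by (auto simp: complex_eq_iff)
    have "(\<lambda>n. LINT x|(\<mu> \<circ> id \<circ> r) n. 1 / (complex_of_real x - z)) \<longlonglongrightarrow> (LINT x|\<rho>. 1 / (complex_of_real x - z))"
    proof (rule weak_conv_imp_integral_bdd_continuous_conv[OF _ r(2,3)])
      show "isCont (\<lambda>x. 1 / (complex_of_real x - z)) x" for x
        by (intro continuous_intros) (use nz in auto)
    qed (use \<mu> resolvent_kernel_bound[OF z] in auto)
    then show "(\<lambda>n. stieltjes_transform (\<mu> (r n)) z) \<longlonglongrightarrow> stieltjes_transform \<rho> z"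
      by (simp add: stieltjes_transform_def)
    show "(\<lambda>n. stieltjes_transform (\<mu> (r n)) z) \<longlonglongrightarrow> G z"
      using LIMSEQ_subseq_LIMSEQ[OF lim[OF z] r(1)] by (simp add: comp_def)
  qed
  with r(2) show ?thesis by blast
qed

section \<open>The metric on distribution functions and spectral measures\<close>

text \<open>A test function rises by \<open>1/m\<close> on an interval of length \<open>1/m\<close>: its slopes are at most one in absolute
  value.\<close>
lemma test_function_bump:
  assumes "f \<in> test_functions"
  shows "\<exists>K\<ge>0. bump K f"
proof -
  from assms obtain m :: nat and a b where m: "m \<ge> 1" and ab: "a < b"
    and top: "\<And>x. x \<in> {a..b} \<Longrightarrow> f x = 1 / real m"
    and out: "\<And>x. x \<in> {..a - 1 / real m} \<union> {b + 1 / real m..} \<Longrightarrow> f x = 0"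
    and aff: "affine_on {a - 1 / real m..a} f" "affine_on {b..b + 1 / real m} f"
    unfolding test_functions_def by blast
  define e where "e = 1 / real m"
  have e: "e > 0" "e \<le> 1" unfolding e_def using m by auto
  note top = top[folded e_def] and out = out[folded e_def] and aff = aff[folded e_def]
  obtain p q where pq: "\<And>x. x \<in> {a - e..a} \<Longrightarrow> f x = p * x + q" using aff(1) unfolding affine_on_def by blast
  obtain p' q' where pq': "\<And>x. x \<in> {b..b + e} \<Longrightarrow> f x = p' * x + q'" using aff(2) unfolding affine_on_def by blast
  have left: "f x = e - (a - x)" if "x \<in> {a - e..a}" for x
  proof -
    have 1: "p * a + q = e" using pq[of a] top[of a] e ab by simp
    have 2: "p * (a - e) + q = 0" using pq[of "a - e"] out[of "a - e"] e by simp
    have "p * e = e" using 1 2 unfolding right_diff_distrib by linarith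
    then have "p = 1" using e by simp
    then show ?thesis using 1 pq[OF that] by simp
  qed
  have right: "f x = e - (x - b)" if "x \<in> {b..b + e}" for x
  proof -
    have 1: "p' * b + q' = e" using pq'[of b] top[of b] e ab by simp
    have 2: "p' * (b + e) + q' = 0" using pq'[of "b + e"] out[of "b + e"] e by simp
    have "p' * e = - e" using 1 2 unfolding distrib_left by linarith
    then have "p' = - 1" using e by (metis mult_minus1 mult_right_cancel less_irrefl)
    then show ?thesis using 1 pq'[OF that] by simp
  qed
  have "f x = max 0 (e - max 0 (max (a - x) (x - b)))" for x
  proof -
    consider "x \<le> a - e" | "x \<in> {a - e..a}" | "x \<in> {a..b}" | "x \<in> {b..b + e}" | "x \<ge> b + e" by fastforce
    then show ?thesis
    proof cases
      case 1 then show ?thesis using out[of x] e ab by simp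
    next
      case 2 then show ?thesis using left[of x] e ab by (simp add: max_def)
    next
      case 3 then show ?thesis using top[of x] e ab by (simp add: max_def)
    next
      case 4 then show ?thesis using right[of x] e ab by (simp add: max_def)
    next
      case 5 then show ?thesis using out[of x] e ab by simp
    qed
  qed
  then have "f = (\<lambda>x. max 0 (e - max 0 (max (a - x) (x - b))))" by (rule ext)
  then have "bump (\<bar>a\<bar> + \<bar>b\<bar> + 1) f" using trapezoid_bump[of e a b] e ab by simp
  then show ?thesis by (intro exI[of _ "\<bar>a\<bar> + \<bar>b\<bar> + 1"]) simp
qed

lemma interval_measure_cdf:
  assumes "real_distribution \<mu>"
  shows "interval_measure (cdf \<mu>) = \<mu>"
proof -
  interpret real_distribution \<mu> by fact
  have m: "\<And>x y. x \<le> y \<Longrightarrow> cdf \<mu> x \<le> cdf \<mu> y" by (rule cdf_nondecreasing)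
  have "real_distribution (interval_measure (cdf \<mu>))"
    by (rule real_distribution_interval_measure[OF m cdf_is_right_cont cdf_lim_at_bot cdf_lim_at_top_prob])
  then show ?thesis
    by (intro cdf_unique assms cdf_interval_measure m cdf_is_right_cont cdf_lim_at_bot)
qed

definition test_diff :: "(nat \<Rightarrow> real \<Rightarrow> real) \<Rightarrow> real measure \<Rightarrow> real measure \<Rightarrow> nat \<Rightarrow> real" where
  "test_diff f \<mu> \<nu> i = \<bar>(LINT x|\<mu>. f (Suc i) x) - (LINT x|\<nu>. f (Suc i) x)\<bar>"

lemma df_metric_cdf:
  assumes "real_distribution \<mu>" "real_distribution \<nu>"
  shows "df_metric f (cdf \<mu>) (cdf \<nu>) = (\<Sum>i. test_diff f \<mu> \<nu> i * (1 / 2) ^ Suc i)"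
  unfolding df_metric_def interval_measure_cdf[OF assms(1)] interval_measure_cdf[OF assms(2)] test_diff_def ..

lemma bump_integral_le_1:
  assumes "real_distribution \<mu>" "bump K g"
  shows "\<bar>LINT x|\<mu>. g x\<bar> \<le> 1"
proof -
  interpret real_distribution \<mu> by fact
  note [measurable] = bump_measurable[OF assms(2)]
  have b: "\<bar>g x\<bar> \<le> 1" for x using assms(2) by (simp add: bump_def)
  have gi: "integrable \<mu> g" by (rule integrable_const_bound[where B = 1]) (use b in auto)
  have "\<bar>LINT x|\<mu>. g x\<bar> \<le> (LINT x|\<mu>. \<bar>g x\<bar>)" by (rule integral_abs_bound)
  also have "\<dots> \<le> (LINT x|\<mu>. 1)" by (rule integral_mono) (use gi b in auto)
  finally show ?thesis using prob_space by simp
qed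

lemma test_diff_bounds:
  assumes "real_distribution \<mu>" "real_distribution \<nu>" and f: "f ` {1..} = test_functions"
  shows "0 \<le> test_diff f \<mu> \<nu> i" "test_diff f \<mu> \<nu> i \<le> 2"
proof -
  have "f (Suc i) \<in> test_functions" using f by auto
  then obtain K where "bump K (f (Suc i))" using test_function_bump by blast
  with bump_integral_le_1[OF assms(1) this] bump_integral_le_1[OF assms(2) this]
  show "0 \<le> test_diff f \<mu> \<nu> i" "test_diff f \<mu> \<nu> i \<le> 2" unfolding test_diff_def by auto
qed

lemma test_diff_summable:
  assumes "real_distribution \<mu>" "real_distribution \<nu>" and f: "f ` {1..} = test_functions"
  shows "summable (\<lambda>i. test_diff f \<mu> \<nu> i * (1 / 2) ^ Suc i)"
proof (rule summable_comparison_test'[where N = 0])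
  show "summable (\<lambda>i. (1 / 2 :: real) ^ i)" by (rule summable_geometric) simp
  fix i :: nat
  show "norm (test_diff f \<mu> \<nu> i * (1 / 2) ^ Suc i) \<le> (1 / 2) ^ i"
    using test_diff_bounds[OF assms, of i] by (simp add: abs_mult)
qed

lemma df_metric_nonneg:
  assumes "real_distribution \<mu>" "real_distribution \<nu>" and f: "f ` {1..} = test_functions"
  shows "0 \<le> df_metric f (cdf \<mu>) (cdf \<nu>)"
  unfolding df_metric_cdf[OF assms(1,2)]
  by (intro suminf_nonneg test_diff_summable assms mult_nonneg_nonneg test_diff_bounds) auto

lemma df_metric_triangle:
  assumes "real_distribution \<mu>" "real_distribution \<nu>" "real_distribution \<rho>" and f: "f ` {1..} = test_functions"
  shows "df_metric f (cdf \<mu>) (cdf \<rho>) \<le> df_metric f (cdf \<mu>) (cdf \<nu>) + df_metric f (cdf \<nu>) (cdf \<rho>)"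
proof -
  note s1 = test_diff_summable[OF assms(1,2) f] and s2 = test_diff_summable[OF assms(2,3) f] and s3 = test_diff_summable[OF assms(1,3) f]
  have "(\<Sum>i. test_diff f \<mu> \<rho> i * (1 / 2) ^ Suc i) \<le>
      (\<Sum>i. test_diff f \<mu> \<nu> i * (1 / 2) ^ Suc i + test_diff f \<nu> \<rho> i * (1 / 2) ^ Suc i)"
  proof (rule suminf_le[OF _ s3 summable_add[OF s1 s2]])
    fix i
    have "test_diff f \<mu> \<rho> i \<le> test_diff f \<mu> \<nu> i + test_diff f \<nu> \<rho> i"
      unfolding test_diff_def by linarith
    then have "test_diff f \<mu> \<rho> i * (1 / 2) ^ Suc i \<le> (test_diff f \<mu> \<nu> i + test_diff f \<nu> \<rho> i) * (1 / 2) ^ Suc i"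
      by (rule mult_right_mono) simp
    then show "test_diff f \<mu> \<rho> i * (1 / 2) ^ Suc i \<le> test_diff f \<mu> \<nu> i * (1 / 2) ^ Suc i + test_diff f \<nu> \<rho> i * (1 / 2) ^ Suc i"
      by (simp only: distrib_right)
  qed
  also have "\<dots> = (\<Sum>i. test_diff f \<mu> \<nu> i * (1 / 2) ^ Suc i) + (\<Sum>i. test_diff f \<nu> \<rho> i * (1 / 2) ^ Suc i)"
    by (rule suminf_add[OF s1 s2, symmetric])
  finally show ?thesis unfolding df_metric_cdf[OF assms(1,2)] df_metric_cdf[OF assms(2,3)] df_metric_cdf[OF assms(1,3)] .
qed

text \<open>Integrals of test functions are at most one, so the terms from \<open>I\<close> on sum up to at most \<open>2 / 2\<^sup>I\<close>.\<close>
lemma df_metric_head: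
  assumes "real_distribution \<mu>" "real_distribution \<nu>" and f: "f ` {1..} = test_functions"
    and head: "\<And>i. i < I \<Longrightarrow> test_diff f \<mu> \<nu> i \<le> \<delta>" and "\<delta> \<ge> 0"
  shows "df_metric f (cdf \<mu>) (cdf \<nu>) \<le> \<delta> + 2 * (1 / 2) ^ I"
proof -
  let ?t = "\<lambda>i. test_diff f \<mu> \<nu> i * (1 / 2) ^ Suc i"
  note s = test_diff_summable[OF assms(1,2) f]
  have geo: "(\<lambda>i. (1 / 2 :: real) ^ Suc i) sums 1" by (rule power_half_series)
  have "(\<Sum>i. ?t i) = (\<Sum>i. ?t (i + I)) + (\<Sum>i<I. ?t i)" by (rule suminf_split_initial_segment[OF s])
  also have "(\<Sum>i. ?t (i + I)) \<le> (\<Sum>i. 2 * (1 / 2) ^ I * (1 / 2) ^ Suc i)"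
  proof (rule suminf_le)
    show "summable (\<lambda>i. ?t (i + I))" using s by (rule summable_ignore_initial_segment)
    show "summable (\<lambda>i. 2 * (1 / 2 :: real) ^ I * (1 / 2) ^ Suc i)" using geo by (intro summable_mult) (rule sums_summable)
    fix i
    have "?t (i + I) \<le> 2 * (1 / 2) ^ Suc (i + I)"
      by (rule mult_right_mono[OF test_diff_bounds(2)[OF assms(1,2) f]]) simp
    then show "?t (i + I) \<le> 2 * (1 / 2) ^ I * (1 / 2) ^ Suc i" by (simp add: power_add mult_ac)
  qed
  also have "(\<Sum>i. 2 * (1 / 2) ^ I * (1 / 2) ^ Suc i) = (2 * (1 / 2 :: real) ^ I)"
    by (rule sums_unique[symmetric]) (use sums_mult[OF geo, of "2 * (1 / 2) ^ I"] in \<open>simp only: mult_1_right\<close>)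
  also have "(\<Sum>i<I. ?t i) \<le> \<delta>"
  proof -
    have "(\<Sum>i<I. ?t i) \<le> (\<Sum>i<I. \<delta> * (1 / 2) ^ Suc i)" by (intro sum_mono mult_right_mono head) auto
    also have "\<dots> = \<delta> * (\<Sum>i<I. (1 / 2) ^ Suc i)" by (simp only: sum_distrib_left)
    also have "\<dots> \<le> \<delta> * 1"
      using sum_le_suminf[OF sums_summable[OF geo], of "{..<I}"] sums_unique[OF geo] assms(5) by (intro mult_left_mono) auto
    finally show ?thesis by simp
  qed
  finally show ?thesis unfolding df_metric_cdf[OF assms(1,2)] by simp
qed

lemma small_tail: "\<delta> > 0 \<Longrightarrow> \<exists>I. 2 * (1 / 2 :: real) ^ I < \<delta>"
proof -
  assume "\<delta> > 0"
  then obtain I where "(1 / 2 :: real) ^ I < \<delta> / 2" using real_arch_pow_inv[of "\<delta> / 2" "1 / 2"] by auto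
  then show ?thesis by (intro exI[of _ I]) simp
qed

lemma df_metric_tendsto:
  fixes \<mu> \<nu> :: "nat \<Rightarrow> real measure"
  assumes \<mu>: "\<And>k. real_distribution (\<mu> k)" and \<nu>: "\<And>k. real_distribution (\<nu> k)" and f: "f ` {1..} = test_functions"
    and lim: "\<And>z. Im z > 0 \<Longrightarrow> (\<lambda>k. stieltjes_transform (\<mu> k) z - stieltjes_transform (\<nu> k) z) \<longlonglongrightarrow> 0"
  shows "(\<lambda>k. df_metric f (cdf (\<mu> k)) (cdf (\<nu> k))) \<longlonglongrightarrow> 0"
proof (rule LIMSEQ_I)
  fix \<delta> :: real assume \<delta>: "\<delta> > 0"
  then obtain I where I: "2 * (1 / 2 :: real) ^ I < \<delta> / 2" using small_tail[of "\<delta> / 2"] by auto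
  have "eventually (\<lambda>k. test_diff f (\<mu> k) (\<nu> k) i < \<delta> / 2) sequentially" for i
  proof -
    have "f (Suc i) \<in> test_functions" using f by auto
    then obtain K where K: "bump K (f (Suc i))" using test_function_bump by blast
    have "(\<lambda>k. test_diff f (\<mu> k) (\<nu> k) i) \<longlonglongrightarrow> 0"
      unfolding test_diff_def by (rule tendsto_rabs_zero[OF bump_convergence[OF \<mu> \<nu> K lim]])
    then show ?thesis using \<delta> by (intro order_tendstoD) auto
  qed
  then have "eventually (\<lambda>k. \<forall>i\<in>{..<I}. test_diff f (\<mu> k) (\<nu> k) i < \<delta> / 2) sequentially"
    by (intro eventually_ball_finite) auto
  then obtain k0 where k0: "\<And>k i. k \<ge> k0 \<Longrightarrow> i < I \<Longrightarrow> test_diff f (\<mu> k) (\<nu> k) i < \<delta> / 2"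
    unfolding eventually_sequentially by (auto simp: Ball_def)
  have "norm (df_metric f (cdf (\<mu> k)) (cdf (\<nu> k)) - 0) < \<delta>" if "k \<ge> k0" for k
  proof -
    have "df_metric f (cdf (\<mu> k)) (cdf (\<nu> k)) \<le> \<delta> / 2 + 2 * (1 / 2) ^ I"
      by (rule df_metric_head[OF \<mu> \<nu> f]) (use k0[OF that] \<delta> in \<open>auto intro: less_imp_le\<close>)
    then show ?thesis using I df_metric_nonneg[OF \<mu> \<nu> f, of k k] by simp
  qed
  then show "\<exists>k0. \<forall>k\<ge>k0. norm (df_metric f (cdf (\<mu> k)) (cdf (\<nu> k)) - 0) < \<delta>" by blast
qed

text \<open>The bound on the transforms is the one that the rank inequality supplies.\<close>
lemma df_metric_uniform:
  assumes f: "f ` {1..} = test_functions" and \<delta>: "\<delta> > 0"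
  shows "\<exists>\<kappa>>0. \<forall>\<mu> \<nu>. real_distribution \<mu> \<longrightarrow> real_distribution \<nu> \<longrightarrow>
    (\<forall>z. Im z > 0 \<longrightarrow> cmod (stieltjes_transform \<mu> z - stieltjes_transform \<nu> z) \<le> \<kappa> / Im z) \<longrightarrow>
    df_metric f (cdf \<mu>) (cdf \<nu>) < \<delta>"
proof -
  obtain I where I: "2 * (1 / 2 :: real) ^ I < \<delta> / 2" using small_tail[of "\<delta> / 2"] \<delta> by auto
  have "\<exists>\<kappa>>0. \<forall>\<mu> \<nu>. real_distribution \<mu> \<longrightarrow> real_distribution \<nu> \<longrightarrow>
    (\<forall>z. Im z > 0 \<longrightarrow> cmod (stieltjes_transform \<mu> z - stieltjes_transform \<nu> z) \<le> \<kappa> / Im z) \<longrightarrow>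
    test_diff f \<mu> \<nu> i < \<delta> / 2" for i
  proof -
    have "f (Suc i) \<in> test_functions" using f by auto
    then obtain K where K: "K \<ge> 0" "bump K (f (Suc i))" using test_function_bump by blast
    have "\<delta> / 2 > 0" using \<delta> by simp
    from bump_difference_uniform[OF K(1) this] K(2) show ?thesis unfolding test_diff_def by meson
  qed
  then obtain \<kappa> where \<kappa>: "\<And>i. \<kappa> i > 0" "\<And>i \<mu> \<nu>. real_distribution \<mu> \<Longrightarrow> real_distribution \<nu> \<Longrightarrow>
    (\<forall>z. Im z > 0 \<longrightarrow> cmod (stieltjes_transform \<mu> z - stieltjes_transform \<nu> z) \<le> \<kappa> i / Im z) \<Longrightarrow>
    test_diff f \<mu> \<nu> i < \<delta> / 2" by metis
  define m where "m = Min (insert 1 (\<kappa> ` {..<I}))"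
  have m: "m > 0" "\<And>i. i < I \<Longrightarrow> m \<le> \<kappa> i" unfolding m_def using \<kappa>(1) by auto
  have "df_metric f (cdf \<mu>) (cdf \<nu>) < \<delta>"
    if *: "real_distribution \<mu>" "real_distribution \<nu>"
      "\<forall>z. Im z > 0 \<longrightarrow> cmod (stieltjes_transform \<mu> z - stieltjes_transform \<nu> z) \<le> m / Im z" for \<mu> \<nu>
  proof -
    have "test_diff f \<mu> \<nu> i \<le> \<delta> / 2" if "i < I" for i
    proof (rule less_imp_le, rule \<kappa>(2)[OF *(1,2)], intro allI impI)
      fix z assume z: "Im z > 0"
      have "m / Im z \<le> \<kappa> i / Im z" using m(2)[OF that] z by (intro divide_right_mono) auto
      then show "cmod (stieltjes_transform \<mu> z - stieltjes_transform \<nu> z) \<le> \<kappa> i / Im z"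
        using *(3) z by (meson order_trans)
    qed
    then have "df_metric f (cdf \<mu>) (cdf \<nu>) \<le> \<delta> / 2 + 2 * (1 / 2) ^ I"
      by (rule df_metric_head[OF *(1,2) f]) (use \<delta> in auto)
    then show ?thesis using I by simp
  qed
  with m(1) show ?thesis by blast
qed

text \<open>The empirical distribution of the eigenvalues. Being a discrete distribution, it can be averaged over a random matrix by the
  monadic bind.\<close>
definition spectral_pmf :: "complex mat \<Rightarrow> real pmf" where
  "spectral_pmf A = map_pmf Re (pmf_of_multiset (proots (char_poly A)))"

definition spectral_measure :: "complex mat \<Rightarrow> real measure" where
  "spectral_measure A = distr (measure_pmf (spectral_pmf A)) borel (\<lambda>x. x)"

lemma real_distribution_pmf: "real_distribution (distr (measure_pmf p) borel (\<lambda>x::real. x))"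
  by (rule prob_space.real_distribution_distr[OF prob_space_measure_pmf]) simp

lemma real_distribution_spectral: "real_distribution (spectral_measure A)"
  unfolding spectral_measure_def by (rule real_distribution_pmf)

lemma sum_mset_count: "(\<Sum>x\<in>#A. (f x :: 'b::real_vector)) = (\<Sum>x\<in>set_mset A. real (count A x) *\<^sub>R f x)"
proof (induction A)
  case (add a A)
  have "(\<Sum>x\<in>set_mset (add_mset a A). real (count (add_mset a A) x) *\<^sub>R f x) =
      (\<Sum>x\<in>insert a (set_mset A). real (count A x) *\<^sub>R f x + (if x = a then f x else 0))"
    by (intro sum.cong) (auto simp: scaleR_left_distrib)
  also have "\<dots> = (\<Sum>x\<in>insert a (set_mset A). real (count A x) *\<^sub>R f x) + f a"
    by (simp add: sum.distrib)
  also have "(\<Sum>x\<in>insert a (set_mset A). real (count A x) *\<^sub>R f x) = (\<Sum>x\<in>set_mset A. real (count A x) *\<^sub>R f x)"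
    by (rule sum.mono_neutral_right) (auto simp: not_in_iff)
  finally show ?case using add by simp
qed simp

lemma integral_pmf_of_multiset:
  fixes f :: "'a \<Rightarrow> 'b::{banach, second_countable_topology}"
  assumes "A \<noteq> {#}"
  shows "(LINT x|measure_pmf (pmf_of_multiset A). f x) = (\<Sum>x\<in>#A. f x) /\<^sub>R real (size A)"
  using assms by (subst integral_measure_pmf[of "set_mset A"])
    (auto simp: sum_mset_count scaleR_sum_right divide_inverse mult.commute)

lemma char_poly_proots_size: "A \<in> carrier_mat n n \<Longrightarrow> size (proots (char_poly (A :: complex mat))) = n"
  using degree_monic_char_poly[of A n] by (simp add: size_proots_complex)

lemma cdf_spectral:
  assumes A: "A \<in> carrier_mat n n" and n: "n > 0"
  shows "cdf (spectral_measure A) = spectral_df A"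
proof
  fix x
  let ?S = "proots (char_poly A)"
  have S: "size ?S = n" using char_poly_proots_size[OF A] .
  then have ne: "?S \<noteq> {#}" using n by auto
  have "cdf (spectral_measure A) x = measure (measure_pmf (spectral_pmf A)) {..x}"
    unfolding cdf_def spectral_measure_def by (subst measure_distr) auto
  also have "\<dots> = (LINT t|measure_pmf (spectral_pmf A). indicator {..x} t)" by simp
  also have "\<dots> = (LINT l|measure_pmf (pmf_of_multiset ?S). indicator {..x} (Re l))"
    unfolding spectral_pmf_def integral_map_pmf ..
  also have "\<dots> = (\<Sum>l\<in>#?S. indicator {..x} (Re l)) / real n"
    unfolding integral_pmf_of_multiset[OF ne] S by (simp add: divide_inverse mult.commute)
  also have "(\<Sum>l\<in>#?S. indicator {..x} (Re l)) = real (size {#l \<in># ?S. Re l \<le> x#})"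
  proof -
    have "(\<Sum>l\<in>#B. indicator {..x} (Re l)) = real (size {#l \<in># B. Re l \<le> x#})" for B
      by (induction B) (auto simp: indicator_def)
    then show ?thesis .
  qed
  finally show "cdf (spectral_measure A) x = spectral_df A x"
    unfolding spectral_df_def using A by simp
qed

lemma stieltjes_spectral:
  assumes H: "hermitian n H" and n: "n > 0" and z: "Im z > 0"
  defines "A \<equiv> Matrix.mat n n (\<lambda>(i, j). H i j)"
  shows "stieltjes_transform (spectral_measure A) z = (\<Sum>i<n. resolvent n H z i i) / of_nat n"
proof -
  let ?S = "proots (char_poly A)"
  have A: "A \<in> carrier_mat n n" by (simp add: A_def)
  have S: "size ?S = n" using char_poly_proots_size[OF A] .
  then have ne: "?S \<noteq> {#}" using n by auto
  have "stieltjes_transform (spectral_measure A) z = (LINT t|measure_pmf (spectral_pmf A). 1 / (complex_of_real t - z))"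
    unfolding stieltjes_transform_def spectral_measure_def by (subst integral_distr) auto
  also have "\<dots> = (LINT l|measure_pmf (pmf_of_multiset ?S). 1 / (complex_of_real (Re l) - z))"
    unfolding spectral_pmf_def integral_map_pmf ..
  also have "\<dots> = (\<Sum>l\<in>#?S. 1 / (complex_of_real (Re l) - z)) / of_nat n"
    unfolding integral_pmf_of_multiset[OF ne] S by (simp add: divide_inverse scaleR_conv_of_real mult.commute)
  also have "(\<Sum>l\<in>#?S. 1 / (complex_of_real (Re l) - z)) = (\<Sum>l\<in>#?S. 1 / (l - z))"
  proof (rule arg_cong[where f = sum_mset], rule image_mset_cong)
    fix l assume "l \<in># ?S"
    then have "Im l = 0" using hermitian_proots_real[OF H] unfolding A_def by blast
    then have "complex_of_real (Re l) = l" by (simp add: complex_eq_iff)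
    then show "1 / (complex_of_real (Re l) - z) = 1 / (l - z)" by simp
  qed
  also have "\<dots> = (\<Sum>i<n. resolvent n H z i i)"
    unfolding A_def using resolvent_trace[OF H] z by simp
  finally show ?thesis .
qed

section \<open>Uniqueness for the system of equations\<close>

lemma Im_inverse_nonpos: "Im w \<ge> 0 \<Longrightarrow> Im (1 / w) \<le> 0"
  by (simp add: Im_divide divide_nonneg_nonneg)

lemma Im_inverse_eq: "Im (1 / w) = - Im w * (cmod (1 / w))\<^sup>2"
  by (simp add: Im_divide norm_divide power_divide cmod_power2)

lemma row_term_eq:
  "row_term A e z i = 1 / of_nat (dim_col A) * (\<Sum>k<dim_col A. complex_of_real ((A $$ (i, k))\<^sup>2) *
    (1 / (1 + of_nat (dim_row A) / of_nat (dim_col A) * e $ k))) - z"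
  unfolding row_term_def Let_def by simp

lemma Im_row_term:
  "Im (row_term A e z i) = - Im z + 1 / real (dim_col A) * (\<Sum>k<dim_col A. (A $$ (i, k))\<^sup>2 *
    Im (1 / (1 + of_nat (dim_row A) / of_nat (dim_col A) * e $ k)))"
proof -
  have 1: "1 / of_nat (dim_col A) = complex_of_real (1 / real (dim_col A))" by simp
  show ?thesis
    unfolding row_term_eq 1 by (simp only: minus_complex.simps times_complex.simps Re_complex_of_real Im_complex_of_real Im_sum) simp
qed

lemma Im_row_term_le:
  assumes "\<And>k. k < dim_col A \<Longrightarrow> Im (e $ k) \<ge> 0"
  shows "Im (row_term A e z i) \<le> - Im z"
proof -
  have "Im (1 / (1 + of_nat (dim_row A) / of_nat (dim_col A) * e $ k)) \<le> 0" if "k < dim_col A" for k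
  proof (rule Im_inverse_nonpos)
    have "of_nat (dim_row A) / of_nat (dim_col A) = complex_of_real (real (dim_row A) / real (dim_col A))" by simp
    then have "Im (1 + of_nat (dim_row A) / of_nat (dim_col A) * e $ k) = real (dim_row A) / real (dim_col A) * Im (e $ k)"
      by (simp only: plus_complex.simps one_complex.simps times_complex.simps Re_complex_of_real Im_complex_of_real)
    then show "0 \<le> Im (1 + of_nat (dim_row A) / of_nat (dim_col A) * e $ k)"
      using assms[OF that] by simp
  qed
  then have "(\<Sum>k<dim_col A. (A $$ (i, k))\<^sup>2 * Im (1 / (1 + of_nat (dim_row A) / of_nat (dim_col A) * e $ k))) \<le> 0"
    by (intro sum_nonpos mult_nonneg_nonpos) auto
  then show ?thesis unfolding Im_row_term by (simp add: divide_nonpos_nonneg)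
qed

lemma row_term_inverse_bound:
  assumes "\<And>k. k < dim_col A \<Longrightarrow> Im (e $ k) \<ge> 0" and z: "Im z > 0"
  shows "row_term A e z i \<noteq> 0" "cmod (1 / row_term A e z i) \<le> 1 / Im z"
proof -
  have "Im z \<le> \<bar>Im (row_term A e z i)\<bar>" proof -
    have "Im (row_term A e z i) \<le> - Im z" by (rule Im_row_term_le[OF assms(1)])
    then show ?thesis by linarith
  qed
  also have "\<dots> \<le> cmod (row_term A e z i)" by (rule abs_Im_le_cmod)
  finally have *: "Im z \<le> cmod (row_term A e z i)" .
  then show "row_term A e z i \<noteq> 0" using z by auto
  show "cmod (1 / row_term A e z i) \<le> 1 / Im z" using * z by (simp add: norm_divide frac_le)
qed

lemma zero_column_solution:
  assumes s: "system_solution A z e" and j: "j < dim_col A" and c: "col A j = 0\<^sub>v (dim_row A)"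
  shows "e $ j = 0"
proof -
  have "A $$ (i, j) = 0" if "i < dim_row A" for i
  proof -
    have "col A j $ i = 0" using c that by simp
    then show ?thesis using that j by simp
  qed
  then show ?thesis using s j unfolding system_solution_def by simp
qed

lemma solution_Im_nonneg:
  assumes s: "system_solution A z e" and k: "k < dim_col A"
  shows "Im (e $ k) \<ge> 0"
proof (cases "col A k = 0\<^sub>v (dim_row A)")
  case True then show ?thesis using zero_column_solution[OF s k] by simp
next
  case False
  then have "Im (e $ k) > 0" using s k unfolding system_solution_def by blast
  then show ?thesis by simp
qed

lemma sum_sqrt_cauchy_schwarz:
  assumes "\<And>i. i \<in> I \<Longrightarrow> x i \<ge> 0" "\<And>i. i \<in> I \<Longrightarrow> y i \<ge> (0::real)"
  shows "(\<Sum>i\<in>I. sqrt (x i) * sqrt (y i)) \<le> sqrt (\<Sum>i\<in>I. x i) * sqrt (\<Sum>i\<in>I. y i)"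
proof -
  have "(\<Sum>i\<in>I. sqrt (x i) * sqrt (y i)) = (\<Sum>i\<in>I. \<bar>sqrt (x i)\<bar> * \<bar>sqrt (y i)\<bar>)"
    using assms by (intro sum.cong) auto
  also have "\<dots> \<le> L2_set (\<lambda>i. sqrt (x i)) I * L2_set (\<lambda>i. sqrt (y i)) I" by (rule L2_set_mult_ineq)
  also have "\<dots> = sqrt (\<Sum>i\<in>I. x i) * sqrt (\<Sum>i\<in>I. y i)"
    unfolding L2_set_def using assms by simp
  finally show ?thesis .
qed

definition factor :: "real mat \<Rightarrow> complex vec \<Rightarrow> nat \<Rightarrow> complex" where
  "factor A e k = 1 / (1 + of_nat (dim_row A) / of_nat (dim_col A) * e $ k)"

lemma factor_denominator:
  assumes "Im (e $ k) \<ge> 0" "Im (e $ k) > 0 \<or> e $ k = 0" "dim_row A > 0" "dim_col A > 0"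
  shows "1 + of_nat (dim_row A) / of_nat (dim_col A) * e $ k \<noteq> 0"
proof -
  have eq: "of_nat (dim_row A) / of_nat (dim_col A) = complex_of_real (real (dim_row A) / real (dim_col A))" by simp
  show ?thesis
  proof (cases "e $ k = 0")
    case False
    then have "Im (1 + of_nat (dim_row A) / of_nat (dim_col A) * e $ k) > 0"
      unfolding eq using assms
      by (simp only: plus_complex.simps one_complex.simps times_complex.simps Re_complex_of_real Im_complex_of_real) simp
    then show ?thesis by (metis less_irrefl zero_complex.simps(2))
  qed simp
qed

lemma row_term_difference:
  assumes nz: "\<And>k. k < dim_col A \<Longrightarrow> 1 + of_nat (dim_row A) / of_nat (dim_col A) * e $ k \<noteq> 0"
    "\<And>k. k < dim_col A \<Longrightarrow> 1 + of_nat (dim_row A) / of_nat (dim_col A) * e' $ k \<noteq> 0"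
  shows "row_term A e' z i - row_term A e z i = 1 / of_nat (dim_col A) * (\<Sum>k<dim_col A.
    complex_of_real ((A $$ (i, k))\<^sup>2) * (of_nat (dim_row A) / of_nat (dim_col A) * factor A e k * factor A e' k * (e $ k - e' $ k)))"
proof -
  have "factor A e' k - factor A e k = of_nat (dim_row A) / of_nat (dim_col A) * factor A e k * factor A e' k * (e $ k - e' $ k)"
    if "k < dim_col A" for k
  proof -
    have "1 / (1 + c * y) - 1 / (1 + c * x) = c * (1 / (1 + c * x)) * (1 / (1 + c * y)) * (x - y)"
      if "1 + c * x \<noteq> 0" "1 + c * y \<noteq> 0" for c x y :: complex
      using that by (simp add: divide_simps) (simp add: algebra_simps)
    from this[OF nz(1)[OF that] nz(2)[OF that]] show ?thesis unfolding factor_def .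
  qed
  note fd = this
  have "row_term A e' z i - row_term A e z i = 1 / of_nat (dim_col A) *
      ((\<Sum>k<dim_col A. complex_of_real ((A $$ (i, k))\<^sup>2) * factor A e' k) -
       (\<Sum>k<dim_col A. complex_of_real ((A $$ (i, k))\<^sup>2) * factor A e k))"
    unfolding row_term_eq factor_def[symmetric] right_diff_distrib by simp
  also have "(\<Sum>k<dim_col A. complex_of_real ((A $$ (i, k))\<^sup>2) * factor A e' k) -
       (\<Sum>k<dim_col A. complex_of_real ((A $$ (i, k))\<^sup>2) * factor A e k) =
      (\<Sum>k<dim_col A. complex_of_real ((A $$ (i, k))\<^sup>2) * (factor A e' k - factor A e k))"
    by (simp only: right_diff_distrib sum_subtractf)
  also have "\<dots> = (\<Sum>k<dim_col A. complex_of_real ((A $$ (i, k))\<^sup>2) *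
      (of_nat (dim_row A) / of_nat (dim_col A) * factor A e k * factor A e' k * (e $ k - e' $ k)))"
    by (intro sum.cong refl) (simp only: lessThan_iff fd)
  finally show ?thesis .
qed

text \<open>
For a solution \<open>e\<close> the imaginary parts \<open>u\<close> satisfy \<open>u = Y + Im z * b\<close>, where \<open>Y\<close> is a nonnegative linear image of \<open>u\<close>
and \<open>b > 0\<close> on the nonzero columns; so \<open>Y < u\<close> there. The difference of two solutions is a linear image of itself
whose coefficients are, by Cauchy-Schwarz, dominated by the geometric means of the coefficients belonging to the two
solutions. If \<open>\<delta> \<le> m * g\<close> with \<open>g = sqrt (u * u')\<close>, then even \<open>\<delta> \<le> m * sqrt (Y * Y')\<close>, which is strictly less than
\<open>m * g\<close> unless \<open>m = 0\<close>. At a column where \<open>\<delta> / g\<close> attains its maximum \<open>m\<close> this forces \<open>m = 0\<close>.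
\<close>
lemma system_solution_unique:
  assumes A: "dim_row A > 0" "dim_col A > 0" and z: "Im z > 0"
    and s: "system_solution A z e" and s': "system_solution A z e'"
  shows "e = e'"
proof -
  let ?n = "dim_row A" and ?N = "dim_col A"
  define c where "c = real ?n / real ?N"
  have c: "c > 0" using A by (simp add: c_def)
  have cc: "of_nat ?n / of_nat ?N = complex_of_real c" by (simp add: c_def)
  define a where "a i k = (A $$ (i, k))\<^sup>2" for i k
  have a0: "a i k \<ge> 0" for i k by (simp add: a_def)
  (* On zero columns both solutions vanish; the argument takes place on J. *)
  define J where "J = {j. j < ?N \<and> col A j \<noteq> 0\<^sub>v ?n}"
  define q where "q e i = cmod (1 / row_term A e z i)" for e i
  (* X is the loss of imaginary part in row i, and q the modulus of the inverse row term. *)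
  define X where "X e i = 1 / real ?N * (\<Sum>k<?N. a i k * (c * (cmod (factor A e k))\<^sup>2 * Im (e $ k)))" for e i
  define Y where "Y e j = 1 / real ?n * (\<Sum>i<?n. a i j * (q e i)\<^sup>2 * X e i)" for e j
  define b where "b e j = 1 / real ?n * (\<Sum>i<?n. a i j * (q e i)\<^sup>2)" for e j
  have Imr: "Im (row_term A e z i) = - (Im z + X e i)" for e i
  proof -
    have "Im (1 / (1 + of_nat ?n / of_nat ?N * e $ k)) = - (c * (cmod (factor A e k))\<^sup>2 * Im (e $ k))" for k
      unfolding Im_inverse_eq factor_def cc
      by (simp only: plus_complex.simps one_complex.simps times_complex.simps Re_complex_of_real Im_complex_of_real) simp
    then show ?thesis unfolding Im_row_term X_def a_def by (simp add: sum_negf)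
  qed
  have props: "(\<forall>k<?N. Im (e $ k) \<ge> 0) \<and> (\<forall>j\<in>J. Im (e $ j) > 0 \<and> Im (e $ j) = Y e j + Im z * b e j \<and> b e j > 0) \<and>
      (\<forall>i. X e i \<ge> 0) \<and> (\<forall>j. Y e j \<ge> 0) \<and> (\<forall>k<?N. 1 + of_nat ?n / of_nat ?N * e $ k \<noteq> 0)"
    if s: "system_solution A z e" for e
  proof (intro conjI allI ballI impI)
    show im: "Im (e $ k) \<ge> 0" if "k < ?N" for k by (rule solution_Im_nonneg[OF s that])
    show X0: "X e i \<ge> 0" for i
      unfolding X_def using im c a0 by (intro mult_nonneg_nonneg sum_nonneg) auto
    show "Y e j \<ge> 0" for j
      unfolding Y_def using X0 a0 by (intro mult_nonneg_nonneg sum_nonneg) auto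
    show "1 + of_nat ?n / of_nat ?N * e $ k \<noteq> 0" if "k < ?N" for k
      by (rule factor_denominator[OF im[OF that] _ A])
        (use s zero_column_solution[OF s that] that in \<open>auto simp: system_solution_def\<close>)
  next
    fix j assume j: "j \<in> J"
    then show "Im (e $ j) > 0" using s unfolding J_def system_solution_def by auto
    have jN: "j < ?N" using j by (simp add: J_def)
    have "e $ j = 1 / of_nat ?n * (\<Sum>i<?n. complex_of_real (a i j) * (1 / row_term A e z i))"
      using s jN unfolding system_solution_def a_def by simp
    also have "1 / of_nat ?n = complex_of_real (1 / real ?n)" by simp
    finally have "Im (e $ j) = 1 / real ?n * (\<Sum>i<?n. a i j * Im (1 / row_term A e z i))"
      by (simp only: times_complex.simps Re_complex_of_real Im_complex_of_real Im_sum) simp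
    also have "\<dots> = 1 / real ?n * (\<Sum>i<?n. a i j * ((Im z + X e i) * (q e i)\<^sup>2))"
      unfolding Im_inverse_eq Imr q_def by (simp add: add.commute)
    also have "(\<Sum>i<?n. a i j * ((Im z + X e i) * (q e i)\<^sup>2)) =
        (\<Sum>i<?n. a i j * (q e i)\<^sup>2 * X e i) + Im z * (\<Sum>i<?n. a i j * (q e i)\<^sup>2)"
      unfolding sum_distrib_left sum.distrib[symmetric] by (intro sum.cong refl) (simp add: algebra_simps)
    finally show "Im (e $ j) = Y e j + Im z * b e j"
      unfolding Y_def b_def by (simp add: distrib_left)
    have "\<exists>i<?n. A $$ (i, j) \<noteq> 0"
    proof (rule ccontr)
      assume "\<not> ?thesis"
      then have "col A j = 0\<^sub>v ?n" using jN by (intro eq_vecI) auto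
      then show False using j by (simp add: J_def)
    qed
    then obtain i where i: "i < ?n" "A $$ (i, j) \<noteq> 0" by blast
    have "row_term A e z i \<noteq> 0"
      by (rule row_term_inverse_bound(1)[OF solution_Im_nonneg[OF s] z])
    then have "0 < a i j * (q e i)\<^sup>2" using i by (simp add: a_def q_def)
    also have "\<dots> \<le> (\<Sum>i<?n. a i j * (q e i)\<^sup>2)"
      using i a0 by (intro member_le_sum) auto
    finally show "b e j > 0" unfolding b_def using A by simp
  qed
  note P = props[OF s] and P' = props[OF s']
  define \<delta> where "\<delta> j = cmod (e $ j - e' $ j)" for j
  define g where "g k = sqrt (Im (e $ k)) * sqrt (Im (e' $ k))" for k
  have outside: "\<delta> k = 0" if "k < ?N" "k \<notin> J" for k
    using zero_column_solution[OF s that(1)] zero_column_solution[OF s' that(1)] that by (simp add: \<delta>_def J_def)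
  have gpos: "g j > 0" if "j \<in> J" for j
  proof -
    have "Im (e $ j) > 0" "Im (e' $ j) > 0" using P P' that by blast+
    then show ?thesis by (simp add: g_def)
  qed
  have step: "\<delta> j \<le> m * (sqrt (Y e j) * sqrt (Y e' j))" if j: "j < ?N" and m: "m \<ge> 0" "\<And>k. k < ?N \<Longrightarrow> \<delta> k \<le> m * g k" for j m
  proof -
    have diff: "cmod (row_term A e' z i - row_term A e z i) \<le> m * (sqrt (X e i) * sqrt (X e' i))" for i
    proof -
      have nz: "\<And>k. k < ?N \<Longrightarrow> 1 + of_nat ?n / of_nat ?N * e $ k \<noteq> 0"
        "\<And>k. k < ?N \<Longrightarrow> 1 + of_nat ?n / of_nat ?N * e' $ k \<noteq> 0" using P P' by auto
      have "cmod (row_term A e' z i - row_term A e z i) \<le> 1 / real ?N * (\<Sum>k<?N. a i k * (c * cmod (factor A e k) * cmod (factor A e' k) * \<delta> k))"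
      proof -
        have eqn: "row_term A e' z i - row_term A e z i = 1 / of_nat ?N * (\<Sum>k<?N. complex_of_real (a i k) *
            (complex_of_real c * factor A e k * factor A e' k * (e $ k - e' $ k)))"
          unfolding a_def cc[symmetric] by (rule row_term_difference[OF nz])
        have "cmod (row_term A e' z i - row_term A e z i) = 1 / real ?N * cmod (\<Sum>k<?N. complex_of_real (a i k) *
            (complex_of_real c * factor A e k * factor A e' k * (e $ k - e' $ k)))"
          unfolding eqn norm_mult by (simp add: norm_divide)
        also have "\<dots> \<le> 1 / real ?N * (\<Sum>k<?N. a i k * (c * cmod (factor A e k) * cmod (factor A e' k) * \<delta> k))"
          by (intro mult_left_mono sum_norm_le) (use a0 c in \<open>auto simp: norm_mult \<delta>_def\<close>)
        finally show ?thesis .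
      qed
      also have "\<dots> \<le> 1 / real ?N * (\<Sum>k<?N. a i k * (c * cmod (factor A e k) * cmod (factor A e' k) * (m * g k)))"
        by (intro mult_left_mono sum_mono) (use m a0 c in \<open>auto intro!: mult_nonneg_nonneg\<close>)
      also have "\<dots> = m * (\<Sum>k<?N. sqrt (1 / real ?N * (a i k * (c * (cmod (factor A e k))\<^sup>2 * Im (e $ k)))) *
            sqrt (1 / real ?N * (a i k * (c * (cmod (factor A e' k))\<^sup>2 * Im (e' $ k)))))"
        unfolding sum_distrib_left
      proof (intro sum.cong refl)
        fix k
        have "sqrt (1 / real ?N * (a i k * (c * (cmod (factor A e k))\<^sup>2 * Im (e $ k)))) *
            sqrt (1 / real ?N * (a i k * (c * (cmod (factor A e' k))\<^sup>2 * Im (e' $ k)))) =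
          (sqrt (1 / real ?N) * sqrt (1 / real ?N)) * (sqrt (a i k) * sqrt (a i k)) * (sqrt c * sqrt c) *
            (cmod (factor A e k) * cmod (factor A e' k)) * g k"
          by (simp only: real_sqrt_mult real_sqrt_abs abs_norm_cancel g_def mult_ac)
        also have "\<dots> = 1 / real ?N * a i k * c * (cmod (factor A e k) * cmod (factor A e' k)) * g k"
          using a0[of i k] c A by (simp only: real_sqrt_mult_self abs_of_nonneg abs_of_pos zero_le_divide_1_iff of_nat_0_le_iff less_imp_le)
        finally show "1 / real ?N * (a i k * (c * cmod (factor A e k) * cmod (factor A e' k) * (m * g k))) =
          m * (sqrt (1 / real ?N * (a i k * (c * (cmod (factor A e k))\<^sup>2 * Im (e $ k)))) *
            sqrt (1 / real ?N * (a i k * (c * (cmod (factor A e' k))\<^sup>2 * Im (e' $ k)))))"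
          by (simp only: mult_ac)
      qed
      also have "\<dots> \<le> m * (sqrt (X e i) * sqrt (X e' i))"
        unfolding X_def sum_distrib_left[of "1 / real ?N"]
        by (intro mult_left_mono sum_sqrt_cauchy_schwarz m(1)) (use P P' a0 c in \<open>auto intro!: mult_nonneg_nonneg divide_nonneg_nonneg\<close>)
      finally show ?thesis .
    qed
    have sol: "e $ j = 1 / of_nat ?n * (\<Sum>i<?n. complex_of_real (a i j) * (1 / row_term A e z i))" if "system_solution A z e" for e
      using that j unfolding system_solution_def a_def by simp
    have nzr: "row_term A e z i \<noteq> 0" "row_term A e' z i \<noteq> 0" for i
      using row_term_inverse_bound(1)[OF solution_Im_nonneg[OF s] z] row_term_inverse_bound(1)[OF solution_Im_nonneg[OF s'] z] by auto
    have "e $ j - e' $ j = 1 / of_nat ?n * (\<Sum>i<?n. complex_of_real (a i j) *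
        (1 / row_term A e z i * (1 / row_term A e' z i) * (row_term A e' z i - row_term A e z i)))"
    proof -
      have d: "1 / x - 1 / y = 1 / x * (1 / y) * (y - x)" if "x \<noteq> 0" "y \<noteq> 0" for x y :: complex
        using that by (simp add: field_simps)
      show ?thesis
        unfolding sol[OF s] sol[OF s'] right_diff_distrib[symmetric] sum_subtractf[symmetric] d[OF nzr] ..
    qed
    then have "\<delta> j \<le> 1 / real ?n * (\<Sum>i<?n. a i j * (q e i * q e' i * (m * (sqrt (X e i) * sqrt (X e' i)))))"
      unfolding \<delta>_def
    proof (simp only: norm_mult, intro mult_mono sum_norm_le)
      fix i
      show "cmod (complex_of_real (a i j) * (1 / row_term A e z i * (1 / row_term A e' z i) * (row_term A e' z i - row_term A e z i)))
        \<le> a i j * (q e i * q e' i * (m * (sqrt (X e i) * sqrt (X e' i))))"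
        unfolding norm_mult q_def[symmetric] norm_of_real abs_of_nonneg[OF a0]
        by (intro mult_left_mono diff a0) (simp add: q_def)
    qed (auto simp: norm_divide intro!: sum_nonneg)
    also have "\<dots> = m * (\<Sum>i<?n. sqrt (1 / real ?n * (a i j * (q e i)\<^sup>2 * X e i)) * sqrt (1 / real ?n * (a i j * (q e' i)\<^sup>2 * X e' i)))"
      unfolding sum_distrib_left
    proof (intro sum.cong refl)
      fix i
      have q0: "q e i \<ge> 0" for e by (simp add: q_def)
      have "sqrt (1 / real ?n * (a i j * (q e i)\<^sup>2 * X e i)) * sqrt (1 / real ?n * (a i j * (q e' i)\<^sup>2 * X e' i)) =
        (sqrt (1 / real ?n) * sqrt (1 / real ?n)) * (sqrt (a i j) * sqrt (a i j)) * (\<bar>q e i\<bar> * \<bar>q e' i\<bar>) * (sqrt (X e i) * sqrt (X e' i))"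
        by (simp only: real_sqrt_mult real_sqrt_abs mult_ac)
      also have "\<dots> = 1 / real ?n * a i j * (q e i * q e' i) * (sqrt (X e i) * sqrt (X e' i))"
        using a0[of i j] q0 by (simp only: real_sqrt_mult_self abs_of_nonneg zero_le_divide_1_iff of_nat_0_le_iff)
      finally show "1 / real ?n * (a i j * (q e i * q e' i * (m * (sqrt (X e i) * sqrt (X e' i))))) =
        m * (sqrt (1 / real ?n * (a i j * (q e i)\<^sup>2 * X e i)) * sqrt (1 / real ?n * (a i j * (q e' i)\<^sup>2 * X e' i)))"
        by (simp only: mult_ac)
    qed
    also have "\<dots> \<le> m * (sqrt (Y e j) * sqrt (Y e' j))"
      unfolding Y_def sum_distrib_left[of "1 / real ?n"]
      by (intro mult_left_mono sum_sqrt_cauchy_schwarz m(1)) (use P P' a0 in \<open>auto intro!: mult_nonneg_nonneg divide_nonneg_nonneg\<close>)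
    finally show ?thesis .
  qed
  have J0: "\<delta> j0 = 0" if j0: "j0 \<in> J" for j0
  proof -
    have finJ: "finite J" "J \<noteq> {}" using j0 by (auto simp: J_def)
    define m where "m = Max ((\<lambda>j. \<delta> j / g j) ` J)"
    have mge: "\<delta> k / g k \<le> m" if "k \<in> J" for k unfolding m_def using finJ that by (intro Max_ge) auto
    have m0: "m \<ge> 0"
    proof -
      have "0 \<le> \<delta> j0 / g j0" using gpos[OF j0] by (simp add: \<delta>_def)
      then show ?thesis using mge[OF j0] by linarith
    qed
    have mall: "\<delta> k \<le> m * g k" if "k < ?N" for k
    proof (cases "k \<in> J")
      case True then show ?thesis using mge[OF True] gpos[OF True] by (simp add: divide_le_eq)
    next
      case False
      have "g k \<ge> 0" unfolding g_def using P P' that by simp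
      then show ?thesis using outside[OF that False] m0 by simp
    qed
    have "m \<in> (\<lambda>j. \<delta> j / g j) ` J" unfolding m_def using finJ by (intro Max_in) auto
    then obtain j where j: "j \<in> J" "m = \<delta> j / g j" by blast
    have "\<delta> j \<le> m * (sqrt (Y e j) * sqrt (Y e' j))"
      by (rule step) (use j m0 mall in \<open>auto simp: J_def\<close>)
    moreover have "\<delta> j = m * g j" using j gpos[OF j(1)] by simp
    moreover have "sqrt (Y e j) * sqrt (Y e' j) < g j"
    proof -
      have 1: "Y e j < Im (e $ j)" "Y e' j < Im (e' $ j)" "Y e j \<ge> 0" "Y e' j \<ge> 0"
        using P P' j(1) z by auto
      have "sqrt (Y e j) < sqrt (Im (e $ j))" "sqrt (Y e' j) < sqrt (Im (e' $ j))"
        using 1 by (auto intro: real_sqrt_less_mono)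
      then show ?thesis unfolding g_def using 1 by (intro mult_strict_mono') auto
    qed
    ultimately have "m * g j \<le> m * (sqrt (Y e j) * sqrt (Y e' j))" "sqrt (Y e j) * sqrt (Y e' j) < g j" by auto
    then have "m \<le> 0" using m0 by (smt (verit) mult_less_cancel_left_pos)
    then show ?thesis using mall[of j0] m0 j0 by (simp add: \<delta>_def J_def)
  qed
  show "e = e'"
  proof (rule eq_vecI)
    have dims: "dim_vec e = ?N" "dim_vec e' = ?N" using s s' by (auto simp: system_solution_def)
    then show "dim_vec e = dim_vec e'" by simp
    fix k assume "k < dim_vec e'"
    then have "k < ?N" using dims by simp
    then have "\<delta> k = 0" using J0 outside by blast
    then show "e $ k = e' $ k" by (simp add: \<delta>_def)
  qed
qed

section \<open>Stability of the system of equations\<close>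

text \<open>For such \<open>z\<close> the system is a contraction with factor \<open>1/2\<close> on the vectors bounded by \<open>c\<^sup>2 /
  Im z\<close>, so an approximate solution with defect \<open>\<eta>\<close> is within \<open>2 \<eta>\<close> of the solution.\<close>
lemma stability:
  fixes A :: "real mat"
  defines "n \<equiv> dim_row A" and "N \<equiv> dim_col A"
  defines "\<rho> \<equiv> real n / real N"
  assumes n: "n > 0" and N: "N > 0" and c: "c > 0" and z: "Im z > 0"
    and bound: "\<And>i k. i < n \<Longrightarrow> k < N \<Longrightarrow> (A $$ (i, k))\<^sup>2 \<le> c\<^sup>2"
    and v1: "Im z \<ge> 2 * \<rho> * c\<^sup>2" and v2: "(Im z)\<^sup>2 \<ge> 8 * \<rho> * c ^ 4"
    and s: "system_solution A z e"
    and Im: "\<And>k. k < N \<Longrightarrow> Im (f $ k) \<ge> 0" and norm: "\<And>k. k < N \<Longrightarrow> cmod (f $ k) \<le> c\<^sup>2 / Im z"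
    and err: "\<And>j. j < N \<Longrightarrow> cmod (f $ j - 1 / of_nat n * (\<Sum>i<n. complex_of_real ((A $$ (i, j))\<^sup>2) / row_term A f z i)) \<le> \<eta>"
  shows "cmod (1 / of_nat n * (\<Sum>i<n. 1 / row_term A f z i) - 1 / of_nat n * (\<Sum>i<n. 1 / row_term A e z i)) \<le> \<eta> / c\<^sup>2"
proof -
  let ?v = "Im z"
  have \<rho>: "\<rho> > 0" unfolding \<rho>_def using n N by simp
  have \<rho>c: "of_nat (dim_row A) / of_nat (dim_col A) = complex_of_real \<rho>" unfolding \<rho>_def n_def N_def by simp
  note Ime = solution_Im_nonneg[OF s, folded N_def]
  have inv_e: "row_term A e z i \<noteq> 0" "cmod (1 / row_term A e z i) \<le> 1 / ?v" for i
    using row_term_inverse_bound[OF _ z, of A e i] Ime unfolding N_def by auto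
  have inv_f: "row_term A f z i \<noteq> 0" "cmod (1 / row_term A f z i) \<le> 1 / ?v" for i
    using row_term_inverse_bound[OF _ z, of A f i] Im unfolding N_def by auto
  have avg: "cmod (1 / of_nat n * (\<Sum>i<n. g i)) \<le> B" if "\<And>i. i < n \<Longrightarrow> cmod (g i) \<le> B" for g B
  proof -
    have "cmod (1 / of_nat n * (\<Sum>i<n. g i)) = 1 / real n * cmod (\<Sum>i<n. g i)"
      by (simp add: norm_mult norm_divide)
    also have "\<dots> \<le> 1 / real n * (\<Sum>i<n. B)"
      by (intro mult_left_mono sum_norm_le) (use that in auto)
    finally show ?thesis using n by simp
  qed
  have e_eq: "e $ j = 1 / of_nat n * (\<Sum>i<n. complex_of_real ((A $$ (i, j))\<^sup>2) * (1 / row_term A e z i))" if "j < N" for j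
    using s that unfolding system_solution_def n_def N_def by simp
  have norm_e: "cmod (e $ j) \<le> c\<^sup>2 / ?v" if j: "j < N" for j
    unfolding e_eq[OF j]
  proof (rule avg)
    fix i assume i: "i < n"
    have "cmod (complex_of_real ((A $$ (i, j))\<^sup>2) * (1 / row_term A e z i)) \<le> c\<^sup>2 * (1 / ?v)"
      unfolding norm_mult norm_of_real using bound[OF i j] inv_e(2) by (intro mult_mono) auto
    then show "cmod (complex_of_real ((A $$ (i, j))\<^sup>2) * (1 / row_term A e z i)) \<le> c\<^sup>2 / ?v" by simp
  qed
  have half: "cmod (1 + complex_of_real \<rho> * x) \<ge> 1 / 2" if "cmod x \<le> c\<^sup>2 / ?v" for x
  proof -
    have "cmod (complex_of_real \<rho> * x) \<le> \<rho> * (c\<^sup>2 / ?v)"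
      unfolding norm_mult norm_of_real using that \<rho> by (intro mult_mono) auto
    also have "\<dots> \<le> 1 / 2" using v1 z by (simp add: pos_divide_le_eq)
    finally show ?thesis using norm_diff_ineq[of 1 "complex_of_real \<rho> * x"] by simp
  qed
  have fac: "cmod (factor A g k) \<le> 2" "1 + of_nat (dim_row A) / of_nat (dim_col A) * g $ k \<noteq> 0"
    if "cmod (g $ k) \<le> c\<^sup>2 / ?v" for g k
  proof -
    have h: "cmod (1 + of_nat (dim_row A) / of_nat (dim_col A) * g $ k) \<ge> 1 / 2"
      unfolding \<rho>c by (rule half[OF that])
    then show "1 + of_nat (dim_row A) / of_nat (dim_col A) * g $ k \<noteq> 0" by auto
    have "cmod (factor A g k) \<le> 1 / (1 / 2)"
      unfolding factor_def norm_divide norm_one using h by (intro frac_le) auto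
    then show "cmod (factor A g k) \<le> 2" by simp
  qed
  (* D is the distance of f from the solution; the aim is D <= \<eta> + D / 2. *)
  define \<delta> where "\<delta> j = cmod (f $ j - e $ j)" for j
  define D where "D = Max (\<delta> ` {..<N})"
  have D: "\<delta> j \<le> D" if "j < N" for j unfolding D_def using that by (intro Max_ge) auto
  have D0: "D \<ge> 0" using D[OF N] norm_ge_zero[of "f $ 0 - e $ 0"] unfolding \<delta>_def by linarith
  have rdiff: "cmod (row_term A e z i - row_term A f z i) \<le> 4 * \<rho> * c\<^sup>2 * D" if i: "i < n" for i
  proof -
    have "cmod (row_term A e z i - row_term A f z i) = 1 / real N * cmod (\<Sum>k<N.
      complex_of_real ((A $$ (i, k))\<^sup>2) * (complex_of_real \<rho> * factor A f k * factor A e k * (f $ k - e $ k)))"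
      unfolding N_def
      by (subst row_term_difference) (use fac norm norm_e in \<open>auto simp: N_def norm_mult norm_divide \<rho>c simp del: of_real_power\<close>)
    also have "\<dots> \<le> 1 / real N * (\<Sum>k<N. c\<^sup>2 * (\<rho> * 2 * 2 * D))"
    proof (intro mult_left_mono sum_norm_le)
      fix k assume "k \<in> {..<N}"
      then have k: "k < N" by simp
      show "cmod (complex_of_real ((A $$ (i, k))\<^sup>2) * (complex_of_real \<rho> * factor A f k * factor A e k * (f $ k - e $ k))) \<le> c\<^sup>2 * (\<rho> * 2 * 2 * D)"
        unfolding norm_mult norm_of_real \<delta>_def[symmetric]
        using bound[OF i k] fac(1)[OF norm[OF k]] fac(1)[OF norm_e[OF k]] D[OF k] \<rho> D0
        by (intro mult_mono) (auto simp: \<delta>_def)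
    qed simp
    finally show ?thesis using N by (simp add: mult_ac)
  qed
  have qdiff: "cmod (1 / row_term A f z i - 1 / row_term A e z i) \<le> 4 * \<rho> * c\<^sup>2 * D / ?v\<^sup>2" if i: "i < n" for i
  proof -
    have "1 / row_term A f z i - 1 / row_term A e z i = 1 / row_term A f z i * (1 / row_term A e z i) * (row_term A e z i - row_term A f z i)"
      using inv_e(1)[of i] inv_f(1)[of i] by (simp add: field_simps)
    then have "cmod (1 / row_term A f z i - 1 / row_term A e z i) = cmod (1 / row_term A f z i) * cmod (1 / row_term A e z i) * cmod (row_term A e z i - row_term A f z i)"
      by (simp only: norm_mult)
    also have "\<dots> \<le> 1 / ?v * (1 / ?v) * (4 * \<rho> * c\<^sup>2 * D)"
      using inv_e(2)[of i] inv_f(2)[of i] rdiff[OF i] z by (intro mult_mono) auto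
    finally show ?thesis by (simp add: power2_eq_square)
  qed
  have small: "4 * \<rho> * c\<^sup>2 * D / ?v\<^sup>2 * c\<^sup>2 \<le> D / 2"
  proof -
    have "8 * \<rho> * c ^ 4 * D \<le> ?v\<^sup>2 * D" using v2 D0 by (rule mult_right_mono)
    then have "(8 * \<rho> * c ^ 4 * D) / (2 * ?v\<^sup>2) \<le> (?v\<^sup>2 * D) / (2 * ?v\<^sup>2)"
      by (rule divide_right_mono) simp
    moreover have "(8 * \<rho> * c ^ 4 * D) / (2 * ?v\<^sup>2) = 4 * \<rho> * c\<^sup>2 * D / ?v\<^sup>2 * c\<^sup>2"
      by (simp add: power2_eq_square power4_eq_xxxx)
    moreover have "(?v\<^sup>2 * D) / (2 * ?v\<^sup>2) = D / 2" using z by simp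
    ultimately show ?thesis by simp
  qed
  (* ?F is the right hand side of the system at f: near f by assumption, near e by contraction. *)
  have "\<delta> j \<le> \<eta> + D / 2" if j: "j < N" for j
  proof -
    let ?F = "1 / of_nat n * (\<Sum>i<n. complex_of_real ((A $$ (i, j))\<^sup>2) / row_term A f z i)"
    have "?F - e $ j = 1 / of_nat n * (\<Sum>i<n. complex_of_real ((A $$ (i, j))\<^sup>2) * (1 / row_term A f z i - 1 / row_term A e z i))"
      unfolding e_eq[OF j] right_diff_distrib[symmetric] sum_subtractf[symmetric] by (simp add: right_diff_distrib)
    also have "cmod \<dots> \<le> 4 * \<rho> * c\<^sup>2 * D / ?v\<^sup>2 * c\<^sup>2"
    proof (rule avg)
      fix i assume i: "i < n"
      show "cmod (complex_of_real ((A $$ (i, j))\<^sup>2) * (1 / row_term A f z i - 1 / row_term A e z i)) \<le> 4 * \<rho> * c\<^sup>2 * D / ?v\<^sup>2 * c\<^sup>2"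
        unfolding norm_mult norm_of_real using bound[OF i j] qdiff[OF i] \<rho> D0 by (subst mult.commute) (intro mult_mono, auto)
    qed
    finally have "cmod (?F - e $ j) \<le> D / 2" using small by simp
    then show ?thesis
      unfolding \<delta>_def using err[OF j] norm_triangle_ineq[of "f $ j - ?F" "?F - e $ j"] by simp
  qed
  moreover have "D \<in> \<delta> ` {..<N}" unfolding D_def using N by (intro Max_in) auto
  ultimately have "D \<le> \<eta> + D / 2" by auto
  then have D2: "D \<le> 2 * \<eta>" by simp
  have "1 / of_nat n * (\<Sum>i<n. 1 / row_term A f z i) - 1 / of_nat n * (\<Sum>i<n. 1 / row_term A e z i) =
      1 / of_nat n * (\<Sum>i<n. 1 / row_term A f z i - 1 / row_term A e z i)"
    by (simp only: right_diff_distrib sum_subtractf)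
  also have "cmod \<dots> \<le> 4 * \<rho> * c\<^sup>2 * D / ?v\<^sup>2" by (rule avg) (rule qdiff)
  also have "\<dots> \<le> \<eta> / c\<^sup>2"
    using small D2 c by (simp add: pos_le_divide_eq)
  finally show ?thesis .
qed

text \<open>The self-consistent equation in the language of the system: \<open>\<theta> k\<close> is \<open>n / N\<close> times \<open>f $
  k\<close>, and \<open>r i\<close> is the row term. Its weights are \<open>a i\<close> divided by the row term, with \<open>a
  i\<close> the squared entries of one column for the system, and \<open>a i = 1\<close> for the trace.\<close>
lemma (in centred_column_model) model_equations:
  fixes A :: "real mat"
  assumes A: "A \<in> carrier_mat n N" and wA: "\<And>k i. w k i = A $$ (i, k) / sqrt N" and Wc: "W = c / sqrt N" and c: "c > 0"
  defines "f \<equiv> Matrix.vec N (\<lambda>k. 1 / of_nat n * (\<Sum>i<n. complex_of_real ((A $$ (i, k))\<^sup>2) * mq i))"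
  defines "E \<equiv> c\<^sup>2 / Im z * (cmod z / Im z + real n / real N * c\<^sup>2 / Im z * (cmod z / Im z)\<^sup>2) * ((\<Sum>k<N. err k) / (real n * real N))"
  shows "\<And>k. k < N \<Longrightarrow> Im (f $ k) \<ge> 0"
    and "\<And>k. k < N \<Longrightarrow> cmod (f $ k) \<le> c\<^sup>2 / Im z"
    and "\<And>k. k < N \<Longrightarrow> cmod (1 + of_nat n / of_nat N * f $ k) \<ge> Im z / cmod z"
    and "\<And>j. j < N \<Longrightarrow> cmod (f $ j - 1 / of_nat n * (\<Sum>i<n. complex_of_real ((A $$ (i, j))\<^sup>2) / row_term A f z i)) \<le> c\<^sup>2 / Im z * E"
    and "cmod (1 / of_nat n * (\<Sum>i<n. mq i) - 1 / of_nat n * (\<Sum>i<n. 1 / row_term A f z i)) \<le> 1 / Im z * E"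
proof -
  have dims: "dim_row A = n" "dim_col A = N" using A by auto
  have w2: "(w k i)\<^sup>2 = (A $$ (i, k))\<^sup>2 / real N" for k i
    unfolding wA by (simp add: power_divide)
  have W2: "W\<^sup>2 = c\<^sup>2 / real N" unfolding Wc by (simp add: power_divide)
  have A2: "(A $$ (i, k))\<^sup>2 \<le> c\<^sup>2" if "i < n" "k < N" for i k
  proof -
    have "\<bar>w k i\<bar> \<le> \<bar>W\<bar>" using W(2)[OF that(2,1)] W(1) by simp
    then have "(w k i)\<^sup>2 \<le> W\<^sup>2" by (rule abs_le_square_iff[THEN iffD1])
    then show ?thesis unfolding w2 W2 using N by (simp add: divide_le_cancel)
  qed
  have fk: "f $ k = 1 / of_nat n * (\<Sum>i<n. complex_of_real ((A $$ (i, k))\<^sup>2) * mq i)" if "k < N" for k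
    unfolding f_def using that by simp
  have \<theta>f: "\<theta> k = of_nat n / of_nat N * f $ k" if "k < N" for k
    unfolding \<theta>_def fk[OF that] w2 sum_distrib_left using n by (intro sum.cong refl) (simp add: field_simps)
  have rf: "r i = row_term A f z i" for i
    unfolding r_def row_term_eq dims sum_distrib_left w2
    by (intro arg_cong2[where f = minus] sum.cong refl) (simp add: \<theta>f)
  have Immq: "Im (mq i) \<ge> 0" if i: "i < n" for i
  proof -
    have "Im (mq i) = (LINT c|P. Im (Q c i i))" unfolding mq_def using integral_Im[OF Q_integrable[OF i i]] by simp
    also have "\<dots> \<ge> 0"
    proof (rule integral_nonneg_AE, rule AE_I2)
      fix c
      show "0 \<le> Im (Q c i i)"
        unfolding Q_def rform_unit[OF i, symmetric] using Im_rform[OF hermitian_gram, of z] z by simp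
    qed
    finally show ?thesis .
  qed
  show Imf: "Im (f $ k) \<ge> 0" if k: "k < N" for k
  proof -
    have 1: "1 / of_nat n = complex_of_real (1 / real n)" by simp
    have "Im (f $ k) = 1 / real n * (\<Sum>i<n. (A $$ (i, k))\<^sup>2 * Im (mq i))"
      unfolding fk[OF k] 1 by (simp only: times_complex.simps Re_complex_of_real Im_complex_of_real Im_sum) simp
    then show ?thesis using Immq by (simp only:) (intro mult_nonneg_nonneg sum_nonneg, auto)
  qed
  show "cmod (f $ k) \<le> c\<^sup>2 / Im z" if k: "k < N" for k
  proof -
    have "cmod (f $ k) = 1 / real n * cmod (\<Sum>i<n. complex_of_real ((A $$ (i, k))\<^sup>2) * mq i)"
      unfolding fk[OF k] by (simp add: norm_mult norm_divide)
    also have "\<dots> \<le> 1 / real n * (\<Sum>i<n. c\<^sup>2 * (1 / Im z))"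
    proof (intro mult_left_mono sum_norm_le)
      fix i assume "i \<in> {..<n}"
      then show "cmod (complex_of_real ((A $$ (i, k))\<^sup>2) * mq i) \<le> c\<^sup>2 * (1 / Im z)"
        unfolding norm_mult norm_of_real using A2[OF _ k, of i] mq_bound[of i] by (intro mult_mono) auto
    qed simp
    finally show ?thesis using n by simp
  qed
  show "cmod (1 + of_nat n / of_nat N * f $ k) \<ge> Im z / cmod z" if "k < N" for k
    using one_plus_\<theta>[of k] unfolding \<theta>f[OF that] .
  have inv: "row_term A f z i \<noteq> 0" "cmod (1 / row_term A f z i) \<le> 1 / Im z" for i
    using row_term_inverse_bound[OF _ z, of A f i] Imf unfolding dims by auto
  have main: "cmod (1 / of_nat n * (\<Sum>i<n. a i * (mq i - 1 / row_term A f z i))) \<le> U / Im z * E"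
    if a: "\<And>i. i < n \<Longrightarrow> cmod (a i) \<le> U" and U: "U > 0" for a :: "nat \<Rightarrow> complex" and U
  proof -
    have "cmod (\<Sum>i<n. (a i * (1 / row_term A f z i)) * (r i * mq i - 1)) \<le>
      (U * (1 / Im z)) * (W\<^sup>2 / Im z) * (cmod z / Im z + n * W\<^sup>2 / Im z * (cmod z / Im z)\<^sup>2) * (\<Sum>k<N. err k)"
    proof (rule self_consistent_equation)
      show "cmod (a i * (1 / row_term A f z i)) \<le> U * (1 / Im z)" if "i < n" for i
        unfolding norm_mult using a[OF that] inv(2) U by (intro mult_mono) auto
    qed (use U z in simp)
    also have "(\<Sum>i<n. (a i * (1 / row_term A f z i)) * (r i * mq i - 1)) = (\<Sum>i<n. a i * (mq i - 1 / row_term A f z i))"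
      unfolding rf using inv(1) by (intro sum.cong refl) (simp add: field_simps)
    finally have *: "cmod (\<Sum>i<n. a i * (mq i - 1 / row_term A f z i)) \<le>
      (U * (1 / Im z)) * (W\<^sup>2 / Im z) * (cmod z / Im z + n * W\<^sup>2 / Im z * (cmod z / Im z)\<^sup>2) * (\<Sum>k<N. err k)" .
    have "cmod (1 / of_nat n * (\<Sum>i<n. a i * (mq i - 1 / row_term A f z i))) = 1 / real n * cmod (\<Sum>i<n. a i * (mq i - 1 / row_term A f z i))"
      by (simp add: norm_mult norm_divide)
    also have "\<dots> \<le> 1 / real n * ((U * (1 / Im z)) * (W\<^sup>2 / Im z) * (cmod z / Im z + n * W\<^sup>2 / Im z * (cmod z / Im z)\<^sup>2) * (\<Sum>k<N. err k))"
      by (intro mult_left_mono *) simp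
    also have "\<dots> = U / Im z * E"
      unfolding E_def W2 by (simp only: divide_inverse inverse_mult_distrib mult_ac mult_1_left)
    finally show ?thesis .
  qed
  show "cmod (f $ j - 1 / of_nat n * (\<Sum>i<n. complex_of_real ((A $$ (i, j))\<^sup>2) / row_term A f z i)) \<le> c\<^sup>2 / Im z * E" if j: "j < N" for j
  proof -
    have "f $ j - 1 / of_nat n * (\<Sum>i<n. complex_of_real ((A $$ (i, j))\<^sup>2) / row_term A f z i) =
      1 / of_nat n * (\<Sum>i<n. complex_of_real ((A $$ (i, j))\<^sup>2) * (mq i - 1 / row_term A f z i))"
      unfolding fk[OF j] by (simp add: right_diff_distrib sum_subtractf)
    also have "cmod \<dots> \<le> c\<^sup>2 / Im z * E"
    proof (rule main)
      show "cmod (complex_of_real ((A $$ (i, j))\<^sup>2)) \<le> c\<^sup>2" if "i < n" for i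
        unfolding norm_of_real using A2[OF that j] by simp
    qed (use c in simp)
    finally show ?thesis .
  qed
  have "1 / of_nat n * (\<Sum>i<n. mq i) - 1 / of_nat n * (\<Sum>i<n. 1 / row_term A f z i) = 1 / of_nat n * (\<Sum>i<n. 1 * (mq i - 1 / row_term A f z i))"
    by (simp add: right_diff_distrib sum_subtractf)
  also have "cmod \<dots> \<le> 1 / Im z * E" by (rule main) auto
  finally show "cmod (1 / of_nat n * (\<Sum>i<n. mq i) - 1 / of_nat n * (\<Sum>i<n. 1 / row_term A f z i)) \<le> 1 / Im z * E" .
qed

section \<open>Random matrices with a bounded profile\<close>

lemma sample_mat_gram:
  assumes A: "A \<in> carrier_mat n N" and X: "X \<in> carrier_mat n N" and N: "N > 0"
  shows "sample_mat A X = Matrix.mat n n (\<lambda>(i, j). gram {..<N} (\<lambda>k i. complex_of_real (A $$ (i, k) / sqrt N) * X $$ (i, k)) i j)"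
proof (rule eq_matI)
  let ?Y = "hadamard_mat (map_mat complex_of_real A) X"
  have Y: "?Y \<in> carrier_mat n N" using A by (simp add: hadamard_mat_def)
  have Yij: "?Y $$ (i, k) = complex_of_real (A $$ (i, k)) * X $$ (i, k)" if "i < n" "k < N" for i k
    using A that by (simp add: hadamard_mat_def)
  have adj: "mat_adjoint ?Y \<in> carrier_mat N n"
    using carrier_matD[OF Y] by (intro carrier_matI) (simp_all add: mat_adjoint_def)
  have adjk: "mat_adjoint ?Y $$ (k, j) = cnj (?Y $$ (j, k))" if "k < N" "j < n" for k j
    using Y that by (simp add: mat_adjoint_def mat_of_rows_def)
  fix i j
  assume "i < dim_row (Matrix.mat n n (\<lambda>(i, j). gram {..<N} (\<lambda>k i. complex_of_real (A $$ (i, k) / sqrt N) * X $$ (i, k)) i j))"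
    "j < dim_col (Matrix.mat n n (\<lambda>(i, j). gram {..<N} (\<lambda>k i. complex_of_real (A $$ (i, k) / sqrt N) * X $$ (i, k)) i j))"
  then have i: "i < n" and j: "j < n" by auto
  have "sample_mat A X $$ (i, j) = 1 / of_nat N * (\<Sum>k<N. ?Y $$ (i, k) * mat_adjoint ?Y $$ (k, j))"
    unfolding sample_mat_def Let_def using A Y adj i j
    by (simp add: scalar_prod_def atLeast0LessThan)
  also have "\<dots> = (\<Sum>k<N. complex_of_real (A $$ (i, k) / sqrt N) * X $$ (i, k) *
      cnj (complex_of_real (A $$ (j, k) / sqrt N) * X $$ (j, k)))"
    unfolding sum_distrib_left
  proof (intro sum.cong refl)
    fix k assume "k \<in> {..<N}"
    then have k: "k < N" by simp
    have sq: "complex_of_real (sqrt N) * complex_of_real (sqrt N) = of_nat N"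
      by (simp flip: of_real_mult)
    have e: "complex_of_real (A $$ (i, k) / sqrt N) * X $$ (i, k) * cnj (complex_of_real (A $$ (j, k) / sqrt N) * X $$ (j, k)) =
      (complex_of_real (A $$ (i, k)) * X $$ (i, k) * (complex_of_real (A $$ (j, k)) * cnj (X $$ (j, k)))) /
        (complex_of_real (sqrt N) * complex_of_real (sqrt N))"
      by simp
    show "1 / of_nat N * (?Y $$ (i, k) * mat_adjoint ?Y $$ (k, j)) = complex_of_real (A $$ (i, k) / sqrt N) * X $$ (i, k) *
      cnj (complex_of_real (A $$ (j, k) / sqrt N) * X $$ (j, k))"
      unfolding e sq adjk[OF k j] Yij[OF i k] Yij[OF j k] by simp
  qed
  also have "\<dots> = Matrix.mat n n (\<lambda>(i, j). gram {..<N} (\<lambda>k i. complex_of_real (A $$ (i, k) / sqrt N) * X $$ (i, k)) i j) $$ (i, j)"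
    using i j by (simp add: gram_def)
  finally show "sample_mat A X $$ (i, j) = Matrix.mat n n (\<lambda>(i, j). gram {..<N} (\<lambda>k i. complex_of_real (A $$ (i, k) / sqrt N) * X $$ (i, k)) i j) $$ (i, j)" .
next
  show "dim_row (sample_mat A X) = dim_row (Matrix.mat n n (\<lambda>(i, j). gram {..<N} (\<lambda>k i. complex_of_real (A $$ (i, k) / sqrt N) * X $$ (i, k)) i j))"
    using A by (simp add: sample_mat_def Let_def hadamard_mat_def)
  show "dim_col (sample_mat A X) = dim_col (Matrix.mat n n (\<lambda>(i, j). gram {..<N} (\<lambda>k i. complex_of_real (A $$ (i, k) / sqrt N) * X $$ (i, k)) i j))"
    using A by (simp add: sample_mat_def Let_def hadamard_mat_def mat_adjoint_def)
qed

lemma sample_mat_carrier: "A \<in> carrier_mat n N \<Longrightarrow> sample_mat A X \<in> carrier_mat n n"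
  by (auto simp: sample_mat_def Let_def hadamard_mat_def mat_adjoint_def)

lemma stieltjes_sample:
  assumes A: "A \<in> carrier_mat n N" and X: "X \<in> carrier_mat n N" and N: "N > 0" and n: "n > 0" and z: "Im z > 0"
  shows "stieltjes_transform (spectral_measure (sample_mat A X)) z =
    (\<Sum>i<n. resolvent n (gram {..<N} (\<lambda>k i. complex_of_real (A $$ (i, k) / sqrt N) * X $$ (i, k))) z i i) / of_nat n"
  unfolding sample_mat_gram[OF A X N] by (rule stieltjes_spectral[OF hermitian_gram n z])

text \<open>Outside the matrix a point mass, so that all laws are probability measures.\<close>
definition entry_law :: "'a measure \<Rightarrow> ('a \<Rightarrow> complex mat) \<Rightarrow> nat \<Rightarrow> nat \<Rightarrow> nat \<Rightarrow> nat \<Rightarrow> complex measure" where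
  "entry_law M X n N k i = (if i < n \<and> k < N then distr M borel (\<lambda>\<omega>. X \<omega> $$ (i, k)) else return borel 0)"

definition columns :: "('a \<Rightarrow> complex mat) \<Rightarrow> nat \<Rightarrow> nat \<Rightarrow> 'a \<Rightarrow> nat \<Rightarrow> nat \<Rightarrow> complex" where
  "columns X n N \<omega> = (\<lambda>k\<in>{..<N}. \<lambda>i\<in>{..<n}. X \<omega> $$ (i, k))"

lemma (in prob_space) indep_vars_inj_reindex:
  assumes inj: "inj_on g I" and ind: "indep_vars M' X (g ` I)"
  shows "indep_vars (\<lambda>i. M' (g i)) (\<lambda>i. X (g i)) I"
proof -
  let ?S = "\<lambda>j. {X j -` A \<inter> space M |A. A \<in> sets (M' j)}"
  have ind': "indep_sets ?S (g ` I)" and rv: "\<And>i. i \<in> I \<Longrightarrow> random_variable (M' (g i)) (X (g i))"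
    using ind unfolding indep_vars_def2 by auto
  have "indep_sets (\<lambda>i. ?S (g i)) I"
  proof (rule indep_setsI)
    fix i assume "i \<in> I"
    then show "?S (g i) \<subseteq> events" using ind' unfolding indep_sets_def by blast
  next
    fix B J assume J: "J \<noteq> {}" "J \<subseteq> I" "finite J" and B: "\<forall>j\<in>J. B j \<in> ?S (g j)"
    have injJ: "inj_on g J" using inj J(2) by (rule inj_on_subset)
    let ?C = "\<lambda>k. B (the_inv_into J g k)"
    have Cg: "?C (g j) = B j" if "j \<in> J" for j using the_inv_into_f_f[OF injJ that] by simp
    have "\<forall>j\<in>g ` J. ?C j \<in> ?S j" using B Cg by auto
    then have "prob (\<Inter>j\<in>g ` J. ?C j) = (\<Prod>j\<in>g ` J. prob (?C j))"
      by (intro indep_setsD[OF ind']) (use J in auto)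
    then show "prob (\<Inter>j\<in>J. B j) = (\<Prod>j\<in>J. prob (B j))"
      using Cg by (simp add: prod.reindex[OF injJ])
  qed
  then show ?thesis unfolding indep_vars_def2 using rv by auto
qed

text \<open>The law of the matrix, read as a family of columns, is an iterated product measure. This connects a random matrix on an arbitrary
  probability space with the coordinate spaces on which the concentration bounds are proved.\<close>
lemma distr_columns:
  assumes M: "prob_space M" and n: "n > 0" and N: "N > 0"
    and ind: "prob_space.indep_vars M (\<lambda>_. borel) (\<lambda>jk \<omega>. X \<omega> $$ jk) ({..<n} \<times> {..<N})"
  shows "columns X n N \<in> measurable M (Pi\<^sub>M {..<N} (\<lambda>k. Pi\<^sub>M {..<n} (entry_law M X n N k)))"
    and "distr M (Pi\<^sub>M {..<N} (\<lambda>k. Pi\<^sub>M {..<n} (entry_law M X n N k))) (columns X n N) =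
      Pi\<^sub>M {..<N} (\<lambda>k. Pi\<^sub>M {..<n} (entry_law M X n N k))"
proof -
  interpret prob_space M by fact
  let ?B = "\<lambda>_::nat. borel :: complex measure"
  let ?CB = "\<lambda>_::nat. Pi\<^sub>M {..<n} ?B"
  define Col where "Col k \<omega> = (\<lambda>i\<in>{..<n}. X \<omega> $$ (i, k))" for k \<omega>
  have rv: "random_variable borel (\<lambda>\<omega>. X \<omega> $$ (i, k))" if "i < n" "k < N" for i k
    using ind that unfolding indep_vars_def by auto
  have "indep_vars (\<lambda>k. Pi\<^sub>M ({..<n} \<times> {k}) (\<lambda>_. borel)) (\<lambda>k \<omega>. restrict (\<lambda>jk. X \<omega> $$ jk) ({..<n} \<times> {k})) {..<N}"
    by (rule indep_vars_restrict[OF ind]) (auto simp: disjoint_family_on_def)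
  then have "indep_vars ?CB (\<lambda>k \<omega>. (\<lambda>f. \<lambda>i\<in>{..<n}. f (i, k)) (restrict (\<lambda>jk. X \<omega> $$ jk) ({..<n} \<times> {k}))) {..<N}"
  proof (rule indep_vars_compose2)
    show "(\<lambda>f. \<lambda>i\<in>{..<n}. f (i, k)) \<in> measurable (Pi\<^sub>M ({..<n} \<times> {k}) (\<lambda>_. borel)) (?CB k)" for k
      by (intro measurable_restrict measurable_component_singleton) auto
  qed
  moreover have "(\<lambda>k \<omega>. (\<lambda>f. \<lambda>i\<in>{..<n}. f (i, k)) (restrict (\<lambda>jk. X \<omega> $$ jk) ({..<n} \<times> {k}))) = Col"
    by (auto simp: Col_def fun_eq_iff restrict_def)
  ultimately have indC: "indep_vars ?CB Col {..<N}" by (simp only:)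
  have rvC: "random_variable (?CB k) (Col k)" if "k < N" for k
    using indC that unfolding indep_vars_def by auto
  have neN: "{..<N} \<noteq> {}" "{..<n} \<noteq> {}" using n N by auto
  have law: "distr M (Pi\<^sub>M {..<N} ?CB) (\<lambda>\<omega>. \<lambda>k\<in>{..<N}. Col k \<omega>) = Pi\<^sub>M {..<N} (\<lambda>k. distr M (?CB k) (Col k))"
    using indep_vars_iff_distr_eq_PiM'[OF neN(1), where M' = ?CB and X = Col] rvC indC by auto
  have colk: "distr M (?CB k) (Col k) = Pi\<^sub>M {..<n} (entry_law M X n N k)" if k: "k < N" for k
  proof -
    have inj: "inj_on (\<lambda>i. (i, k)) {..<n}" by (auto simp: inj_on_def)
    have "indep_vars (\<lambda>_. borel) (\<lambda>jk \<omega>. X \<omega> $$ jk) ((\<lambda>i. (i, k)) ` {..<n})"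
      by (rule indep_vars_subset[OF ind]) (use k in auto)
    from indep_vars_inj_reindex[OF inj this]
    have "indep_vars ?B (\<lambda>i \<omega>. X \<omega> $$ (i, k)) {..<n}" .
    then have "distr M (Pi\<^sub>M {..<n} ?B) (\<lambda>\<omega>. \<lambda>i\<in>{..<n}. X \<omega> $$ (i, k)) = Pi\<^sub>M {..<n} (\<lambda>i. distr M borel (\<lambda>\<omega>. X \<omega> $$ (i, k)))"
      using indep_vars_iff_distr_eq_PiM'[OF neN(2), where M' = ?B and X = "\<lambda>i \<omega>. X \<omega> $$ (i, k)"] rv k by auto
    also have "\<dots> = Pi\<^sub>M {..<n} (entry_law M X n N k)"
      by (intro PiM_cong) (auto simp: entry_law_def k)
    finally show ?thesis unfolding Col_def .
  qed
  have "Pi\<^sub>M {..<N} (\<lambda>k. distr M (?CB k) (Col k)) = Pi\<^sub>M {..<N} (\<lambda>k. Pi\<^sub>M {..<n} (entry_law M X n N k))"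
    by (intro PiM_cong) (auto simp: colk)
  note law = law[unfolded this]
  have sets: "sets (Pi\<^sub>M {..<N} (\<lambda>k. Pi\<^sub>M {..<n} (entry_law M X n N k))) = sets (Pi\<^sub>M {..<N} ?CB)"
    by (intro sets_PiM_cong refl) (auto simp: entry_law_def)
  have cols: "columns X n N = (\<lambda>\<omega>. \<lambda>k\<in>{..<N}. Col k \<omega>)" unfolding columns_def Col_def ..
  have "(\<lambda>\<omega>. \<lambda>k\<in>{..<N}. Col k \<omega>) \<in> measurable M (Pi\<^sub>M {..<N} ?CB)"
    by (rule measurable_restrict) (use rvC in auto)
  then show "columns X n N \<in> measurable M (Pi\<^sub>M {..<N} (\<lambda>k. Pi\<^sub>M {..<n} (entry_law M X n N k)))"
    unfolding cols by (simp only: measurable_cong_sets[OF refl sets])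
  show "distr M (Pi\<^sub>M {..<N} (\<lambda>k. Pi\<^sub>M {..<n} (entry_law M X n N k))) (columns X n N) =
      Pi\<^sub>M {..<N} (\<lambda>k. Pi\<^sub>M {..<n} (entry_law M X n N k))"
    unfolding cols law[symmetric] by (rule distr_cong[OF refl _ refl]) (simp only: sets law)
qed

text \<open>All bounds for a fixed matrix size and a fixed \<open>z\<close> are explicit in \<open>n\<close>, \<open>N\<close> and
  \<open>c\<close>; the limits are taken afterwards.\<close>
locale sample_model = prob_space M for M :: "'a measure" +
  fixes n N :: nat and X :: "'a \<Rightarrow> complex mat" and A :: "real mat" and c :: real and z :: complex
  assumes n: "n > 0" and N: "N > 0" and z: "Im z > 0" and c: "c > 0"
    and X_dim: "\<And>\<omega>. \<omega> \<in> space M \<Longrightarrow> X \<omega> \<in> carrier_mat n N"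
    and X_indep: "indep_vars (\<lambda>_. borel) (\<lambda>jk \<omega>. X \<omega> $$ jk) ({..<n} \<times> {..<N})"
    and X_mean: "\<And>j k. j < n \<Longrightarrow> k < N \<Longrightarrow> (LINT \<omega>|M. X \<omega> $$ (j, k)) = 0"
    and X_var: "\<And>j k. j < n \<Longrightarrow> k < N \<Longrightarrow> (LINT \<omega>|M. (cmod (X \<omega> $$ (j, k)))\<^sup>2) = 1"
    and A_dim: "A \<in> carrier_mat n N"
    and A_bound: "\<And>j k. j < n \<Longrightarrow> k < N \<Longrightarrow> \<bar>A $$ (j, k)\<bar> \<le> c"
begin

definition m :: "'a \<Rightarrow> complex" where
  "m \<omega> = stieltjes_transform (spectral_measure (sample_mat A (X \<omega>))) z"

lemma X_measurable: "i < n \<Longrightarrow> k < N \<Longrightarrow> random_variable borel (\<lambda>\<omega>. X \<omega> $$ (i, k))"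
  using X_indep unfolding indep_vars_def by auto

lemma entry_law_prob: "prob_space (entry_law M X n N k i)"
  unfolding entry_law_def using X_measurable by (auto intro: prob_space_distr prob_space_return)

lemma model_axioms: "column_model n N (\<lambda>k i. A $$ (i, k) / sqrt N) (entry_law M X n N) (c / sqrt N) z"
proof (rule column_model.intro)
  show "prob_space (entry_law M X n N k i)" for k i by (rule entry_law_prob)
  show "sets (entry_law M X n N k i) = sets borel" for k i by (simp add: entry_law_def)
  show "0 < c / sqrt N" using c N by simp
  show "\<bar>A $$ (i, k) / sqrt N\<bar> \<le> c / sqrt N" if "k < N" "i < n" for k i
    using A_bound[OF that(2,1)] N by (simp add: abs_divide divide_right_mono)
qed (rule n N z)+

lemma centred:
  assumes \<tau>: "\<tau> > 0"
  shows "centred_column_model n N (\<lambda>k i. A $$ (i, k) / sqrt N) (entry_law M X n N) (c / sqrt N) z \<tau>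
    (\<lambda>k i. LINT \<omega>|M. (cmod (X \<omega> $$ (i, k)))\<^sup>2 * of_bool (cmod (X \<omega> $$ (i, k)) \<ge> \<tau>))"
proof (rule centred_column_model.intro[OF model_axioms centred_column_model_axioms.intro])
  fix k i assume k: "k < N" and i: "i < n"
  note [measurable] = X_measurable[OF i k]
  have law: "entry_law M X n N k i = distr M borel (\<lambda>\<omega>. X \<omega> $$ (i, k))" using i k by (simp add: entry_law_def)
  have sqi: "integrable M (\<lambda>\<omega>. (cmod (X \<omega> $$ (i, k)))\<^sup>2)"
  proof (rule ccontr)
    assume "\<not> integrable M (\<lambda>\<omega>. (cmod (X \<omega> $$ (i, k)))\<^sup>2)"
    from not_integrable_integral_eq[OF this] show False using X_var[OF i k] by simp
  qed
  have Xi: "integrable M (\<lambda>\<omega>. X \<omega> $$ (i, k))"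
  proof (rule Bochner_Integration.integrable_bound[of M "\<lambda>\<omega>. 1 + (cmod (X \<omega> $$ (i, k)))\<^sup>2"])
    show "AE \<omega> in M. norm (X \<omega> $$ (i, k)) \<le> norm (1 + (cmod (X \<omega> $$ (i, k)))\<^sup>2)"
    proof (rule AE_I2)
      fix \<omega>
      have "2 * cmod (X \<omega> $$ (i, k)) * 1 \<le> (cmod (X \<omega> $$ (i, k)))\<^sup>2 + 1\<^sup>2" by (rule sum_squares_bound)
      then show "norm (X \<omega> $$ (i, k)) \<le> norm (1 + (cmod (X \<omega> $$ (i, k)))\<^sup>2)"
        using norm_ge_zero[of "X \<omega> $$ (i, k)"] unfolding real_norm_def power_one mult_1_right by arith
    qed
  qed (use sqi in auto)
  show "integrable (entry_law M X n N k i) (\<lambda>x. x)" unfolding law using Xi by (simp add: integrable_distr_eq)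
  show "(LINT x|entry_law M X n N k i. x) = 0" unfolding law using X_mean[OF i k] by (simp add: integral_distr)
  show "(\<integral>\<^sup>+x. ennreal ((cmod x)\<^sup>2) \<partial>entry_law M X n N k i) = ennreal 1"
    unfolding law using nn_integral_eq_integral[OF sqi] X_var[OF i k] by (simp add: nn_integral_distr)
  show "(LINT x|entry_law M X n N k i. (cmod x)\<^sup>2 * of_bool (cmod x \<ge> \<tau>)) =
      (LINT \<omega>|M. (cmod (X \<omega> $$ (i, k)))\<^sup>2 * of_bool (cmod (X \<omega> $$ (i, k)) \<ge> \<tau>))"
    unfolding law by (simp add: integral_distr)
qed (rule \<tau>)

interpretation model: column_model n N "\<lambda>k i. A $$ (i, k) / sqrt N" "entry_law M X n N" "c / sqrt N" z
  by (rule model_axioms)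

lemma P_eq: "model.P = Pi\<^sub>M {..<N} (\<lambda>k. Pi\<^sub>M {..<n} (entry_law M X n N k))"
  unfolding model.P_def model.C_def ..

lemma columns_measurable: "columns X n N \<in> measurable M model.P"
  unfolding P_eq by (rule distr_columns(1)[OF prob_space_axioms n N X_indep])

lemma columns_law: "distr M model.P (columns X n N) = model.P"
  unfolding P_eq by (rule distr_columns(2)[OF prob_space_axioms n N X_indep])

lemma m_eq: "\<omega> \<in> space M \<Longrightarrow> m \<omega> = (\<Sum>i<n. 1 / of_nat n * model.Q (columns X n N \<omega>) i i)"
proof -
  assume w: "\<omega> \<in> space M"
  have "model.Q (columns X n N \<omega>) i i = resolvent n (gram {..<N} (\<lambda>k i. complex_of_real (A $$ (i, k) / sqrt N) * X \<omega> $$ (i, k))) z i i" for i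
    unfolding model.Q_def by (rule resolvent_gram_cong) (simp add: model.yv_def columns_def)
  then show ?thesis
    unfolding m_def stieltjes_sample[OF A_dim X_dim[OF w] N n z] by (simp add: sum_divide_distrib)
qed

lemma expectation_m: "(LINT \<omega>|M. m \<omega>) = 1 / of_nat n * (\<Sum>i<n. model.mq i)"
proof -
  have g: "(\<lambda>cc. \<Sum>i<n. 1 / of_nat n * model.Q cc i i) \<in> borel_measurable model.P"
    by (intro borel_measurable_sum borel_measurable_times borel_measurable_const model.Q_measurable) auto
  have "(LINT \<omega>|M. m \<omega>) = (LINT \<omega>|M. (\<Sum>i<n. 1 / of_nat n * model.Q (columns X n N \<omega>) i i))"
    by (rule Bochner_Integration.integral_cong[OF refl m_eq])
  also have "\<dots> = (LINT cc|distr M model.P (columns X n N). (\<Sum>i<n. 1 / of_nat n * model.Q cc i i))"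
    by (rule integral_distr[OF columns_measurable g, symmetric])
  also have "\<dots> = (LINT cc|model.P. (\<Sum>i<n. 1 / of_nat n * model.Q cc i i))" unfolding columns_law ..
  also have "\<dots> = (\<Sum>i<n. LINT cc|model.P. 1 / of_nat n * model.Q cc i i)"
    by (rule Bochner_Integration.integral_sum) (auto intro: model.Q_integrable)
  also have "\<dots> = (\<Sum>i<n. 1 / of_nat n * model.mq i)"
    unfolding model.mq_def integral_mult_right_zero ..
  finally show ?thesis by (simp only: sum_distrib_left)
qed

text \<open>With \<open>n / N\<close> bounded below this is \<open>O(n\<^sup>-\<^sup>2)\<close>, hence summable.\<close>
lemma fourth_moment_m:
  "(\<integral>\<^sup>+\<omega>. ennreal (cmod (m \<omega> - (LINT \<omega>|M. m \<omega>)) ^ 4) \<partial>M) \<le> ennreal (65536 / (Im z) ^ 4 * (real N / real n ^ 2)\<^sup>2)"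
proof -
  let ?g = "\<lambda>cc. \<Sum>i<n. 1 / of_nat n * model.Q cc i i" and ?e = "\<Sum>i<n. 1 / of_nat n * model.mq i"
  have g: "?g \<in> borel_measurable model.P"
    by (intro borel_measurable_sum borel_measurable_times borel_measurable_const model.Q_measurable) auto
  have g4: "(\<lambda>cc. ennreal (cmod (?g cc - ?e) ^ 4)) \<in> borel_measurable model.P" using g by measurable
  have E: "(LINT \<omega>|M. m \<omega>) = ?e" unfolding expectation_m by (simp only: sum_distrib_left)
  have "(\<integral>\<^sup>+\<omega>. ennreal (cmod (m \<omega> - (LINT \<omega>|M. m \<omega>)) ^ 4) \<partial>M) = (\<integral>\<^sup>+\<omega>. ennreal (cmod (?g (columns X n N \<omega>) - ?e) ^ 4) \<partial>M)"
    unfolding E by (rule nn_integral_cong) (simp only: m_eq)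
  also have "\<dots> = (\<integral>\<^sup>+cc. ennreal (cmod (?g cc - ?e) ^ 4) \<partial>distr M model.P (columns X n N))"
    using g4 by (subst nn_integral_distr[OF columns_measurable]) auto
  also have "\<dots> = (\<integral>\<^sup>+cc. ennreal (cmod (?g cc - ?e) ^ 4) \<partial>model.P)" unfolding columns_law ..
  also have "\<dots> \<le> ennreal (4096 * (2 * (1 / real n) / Im z) ^ 4 * N\<^sup>2)"
    by (rule model.trace_moments(2)) (use n in \<open>auto simp: norm_divide\<close>)
  also have "4096 * (2 * (1 / real n) / Im z) ^ 4 * N\<^sup>2 = 65536 / (Im z) ^ 4 * (real N / real n ^ 2)\<^sup>2"
    by (simp add: power_divide power_mult_distrib)
  finally show ?thesis .
qed

text \<open>The approximate solution of the system furnished by the mean resolvent.\<close>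
definition approx :: "complex vec" where
  "approx = Matrix.vec N (\<lambda>k. 1 / of_nat n * (\<Sum>i<n. complex_of_real ((A $$ (i, k))\<^sup>2) * model.mq i))"

definition lindeberg_sum :: "real \<Rightarrow> real" where
  "lindeberg_sum h = 1 / (real n * real N) * (\<Sum>j<n. \<Sum>k<N. LINT \<omega>|M. (cmod (X \<omega> $$ (j, k)))\<^sup>2 *
     of_bool (cmod (X \<omega> $$ (j, k)) \<ge> h * sqrt (real n)))"

text \<open>The average of the errors in the self-consistent equation for the truncation level \<open>h sqrt n\<close>.\<close>
definition defect :: "real \<Rightarrow> real" where
  "defect h = sqrt 2 / sqrt n + h + 1 / n + 16 * sqrt N / n + 2 * lindeberg_sum h"

text \<open>The constant with which the average error enters the system and the trace. It stays bounded as long as \<open>n / N\<close> does.\<close>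
definition err_factor :: real where
  "err_factor = c\<^sup>2 / Im z * (cmod z / Im z + real n / real N * c\<^sup>2 / Im z * (cmod z / Im z)\<^sup>2)"

lemma approx_properties:
  assumes h: "h > 0"
  shows "\<And>k. k < N \<Longrightarrow> Im (approx $ k) \<ge> 0"
    and "\<And>k. k < N \<Longrightarrow> cmod (approx $ k) \<le> c\<^sup>2 / Im z"
    and "\<And>k. k < N \<Longrightarrow> cmod (1 + of_nat n / of_nat N * approx $ k) \<ge> Im z / cmod z"
    and "\<And>j. j < N \<Longrightarrow> cmod (approx $ j - 1 / of_nat n * (\<Sum>i<n. complex_of_real ((A $$ (i, j))\<^sup>2) / row_term A approx z i)) \<le>
      c\<^sup>2 / Im z * (err_factor * defect h)"
    and "cmod ((LINT \<omega>|M. m \<omega>) - 1 / of_nat n * (\<Sum>i<n. 1 / row_term A approx z i)) \<le> 1 / Im z * (err_factor * defect h)"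
proof -
  define \<tau> where "\<tau> = h * sqrt n"
  have \<tau>: "\<tau> > 0" using h n by (simp add: \<tau>_def)
  interpret cm: centred_column_model n N "\<lambda>k i. A $$ (i, k) / sqrt N" "entry_law M X n N" "c / sqrt N" z \<tau>
    "\<lambda>k i. LINT \<omega>|M. (cmod (X \<omega> $$ (i, k)))\<^sup>2 * of_bool (cmod (X \<omega> $$ (i, k)) \<ge> \<tau>)"
    by (rule centred[OF \<tau>])
  define S where "S = (\<Sum>k<N. \<Sum>i<n. LINT \<omega>|M. (cmod (X \<omega> $$ (i, k)))\<^sup>2 * of_bool (cmod (X \<omega> $$ (i, k)) \<ge> \<tau>))"
  have S: "lindeberg_sum h = S / (real n * real N)"
    unfolding lindeberg_sum_def S_def \<tau>_def by (subst sum.swap) simp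
  have "(\<Sum>k<N. cm.err k) = real N * (sqrt (2 * n) + \<tau> * sqrt n + 1 + 16 * sqrt N) + 2 * S"
    unfolding cm.err_def S_def by (simp add: sum.distrib sum_distrib_left algebra_simps)
  also have "sqrt (2 * n) + \<tau> * sqrt n + 1 + 16 * sqrt N = real n * (sqrt 2 / sqrt n + h + 1 / n + 16 * sqrt N / n)"
  proof -
    have s: "sqrt n * sqrt n = n" by simp
    have "real n * (sqrt 2 / sqrt n) = sqrt 2 * (sqrt n * sqrt n) / sqrt n" unfolding s by simp
    also have "\<dots> = sqrt 2 * sqrt n" using n by (simp del: real_sqrt_mult_self add: mult.assoc)
    finally have "real n * (sqrt 2 / sqrt n) = sqrt (2 * n)" by (simp add: real_sqrt_mult)
    moreover have "\<tau> * sqrt n = real n * h" unfolding \<tau>_def using s by (simp add: algebra_simps)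
    ultimately show ?thesis using n by (simp add: distrib_left)
  qed
  finally have "(\<Sum>k<N. cm.err k) / (real n * real N) = defect h"
    unfolding defect_def S using n N by (simp add: add_divide_distrib)
  note eqs = cm.model_equations[OF A_dim refl refl c, folded approx_def, unfolded this, folded err_factor_def]
  show "Im (approx $ k) \<ge> 0" if "k < N" for k by (rule eqs(1)[OF that])
  show "cmod (approx $ k) \<le> c\<^sup>2 / Im z" if "k < N" for k by (rule eqs(2)[OF that])
  show "cmod (1 + of_nat n / of_nat N * approx $ k) \<ge> Im z / cmod z" if "k < N" for k by (rule eqs(3)[OF that])
  show "cmod (approx $ j - 1 / of_nat n * (\<Sum>i<n. complex_of_real ((A $$ (i, j))\<^sup>2) / row_term A approx z i)) \<le>
      c\<^sup>2 / Im z * (err_factor * defect h)" if "j < N" for j by (rule eqs(4)[OF that])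
  show "cmod ((LINT \<omega>|M. m \<omega>) - 1 / of_nat n * (\<Sum>i<n. 1 / row_term A approx z i)) \<le> 1 / Im z * (err_factor * defect h)"
    unfolding expectation_m by (rule eqs(5))
qed

lemma m_measurable: "m \<in> borel_measurable M"
proof (subst measurable_cong[OF m_eq])
  have "(\<lambda>cc. \<Sum>i<n. 1 / of_nat n * model.Q cc i i) \<in> borel_measurable model.P"
    by (intro borel_measurable_sum borel_measurable_times borel_measurable_const model.Q_measurable) auto
  from measurable_compose[OF columns_measurable this]
  show "(\<lambda>\<omega>. \<Sum>i<n. 1 / of_nat n * model.Q (columns X n N \<omega>) i i) \<in> borel_measurable M" .
qed

end

section \<open>Existence of the deterministic equivalent\<close>

lemma finite_vector_convergent_subsequence:
  fixes g :: "nat \<Rightarrow> nat \<Rightarrow> complex"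
  assumes "\<And>r k. k < N \<Longrightarrow> cmod (g r k) \<le> B"
  shows "\<exists>s l. strict_mono s \<and> (\<forall>k<N. (\<lambda>r. g (s r) k) \<longlonglongrightarrow> l k)"
  using assms
proof (induction N)
  case 0
  show ?case by (intro exI[of _ "\<lambda>r. r"]) (simp add: strict_mono_def)
next
  case (Suc N)
  then obtain s l where s: "strict_mono s" and l: "\<And>k. k < N \<Longrightarrow> (\<lambda>r. g (s r) k) \<longlonglongrightarrow> l k"
    by (metis less_SucI)
  have "bounded (range (\<lambda>r. g (s r) N))"
    unfolding bounded_iff using Suc.prems by (intro exI[of _ B]) auto
  from bounded_imp_convergent_subsequence[OF this]
  obtain t x where t: "strict_mono t" and x: "((\<lambda>r. g (s r) N) \<circ> t) \<longlonglongrightarrow> x" by blast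
  have "(\<lambda>r. g (s (t r)) k) \<longlonglongrightarrow> (l(N := x)) k" if "k < Suc N" for k
  proof (cases "k = N")
    case True then show ?thesis using x by (simp add: comp_def)
  next
    case False
    then have k: "k < N" using that by simp
    have "((\<lambda>r. g (s r) k) \<circ> t) \<longlonglongrightarrow> l k" by (rule LIMSEQ_subseq_LIMSEQ[OF l[OF k] t])
    then show ?thesis using False by (simp add: comp_def)
  qed
  moreover have "strict_mono (\<lambda>r. s (t r))" using strict_mono_o[OF s t] by (simp add: comp_def)
  ultimately show ?case by (intro exI[of _ "\<lambda>r. s (t r)"] exI[of _ "l(N := x)"]) blast
qed

text \<open>The lower bound on \<open>1 + (n/N) e\<^sub>k\<close> survives in the limit and makes the system continuous there. Strict
  positivity of the imaginary parts is not inherited, but follows from the limit equation, as row terms have imaginary part at most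
  \<open>- Im z\<close>.\<close>
lemma limit_solution:
  fixes A :: "real mat" and g :: "nat \<Rightarrow> complex vec"
  assumes dims: "dim_row A > 0" "dim_col A > 0" and z: "Im z > 0" and \<delta>: "\<delta> > 0"
    and Im: "\<And>r k. k < dim_col A \<Longrightarrow> Im (g r $ k) \<ge> 0"
    and norm: "\<And>r k. k < dim_col A \<Longrightarrow> cmod (g r $ k) \<le> B"
    and low: "\<And>r k. k < dim_col A \<Longrightarrow> cmod (1 + of_nat (dim_row A) / of_nat (dim_col A) * g r $ k) \<ge> \<delta>"
    and err: "\<And>r j. j < dim_col A \<Longrightarrow>
      cmod (g r $ j - 1 / of_nat (dim_row A) * (\<Sum>i<dim_row A. complex_of_real ((A $$ (i, j))\<^sup>2) / row_term A (g r) z i)) \<le> E r"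
    and E: "E \<longlonglongrightarrow> 0"
  shows "\<exists>s e. strict_mono s \<and> system_solution A z e \<and>
    (\<lambda>r. 1 / of_nat (dim_row A) * (\<Sum>i<dim_row A. 1 / row_term A (g (s r)) z i)) \<longlonglongrightarrow>
      1 / of_nat (dim_row A) * (\<Sum>i<dim_row A. 1 / row_term A e z i)"
proof -
  let ?n = "dim_row A" and ?N = "dim_col A"
  let ?\<rho> = "of_nat ?n / of_nat ?N :: complex"
  obtain s l where s: "strict_mono s" and l: "\<And>k. k < ?N \<Longrightarrow> (\<lambda>r. g (s r) $ k) \<longlonglongrightarrow> l k"
    using finite_vector_convergent_subsequence[of ?N "\<lambda>r k. g r $ k" B] norm by blast
  define e where "e = Matrix.vec ?N l"
  have ek: "e $ k = l k" if "k < ?N" for k using that by (simp add: e_def)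
  have lim: "(\<lambda>r. g (s r) $ k) \<longlonglongrightarrow> e $ k" if "k < ?N" for k using l[OF that] ek[OF that] by simp
  have Im_e: "Im (e $ k) \<ge> 0" if "k < ?N" for k
    by (rule LIMSEQ_le_const[OF tendsto_Im[OF lim[OF that]]]) (use Im[OF that] in auto)
  have den: "(\<lambda>r. 1 + ?\<rho> * g (s r) $ k) \<longlonglongrightarrow> 1 + ?\<rho> * e $ k" if "k < ?N" for k
    by (intro tendsto_intros lim that)
  have low_e: "cmod (1 + ?\<rho> * e $ k) \<ge> \<delta>" if "k < ?N" for k
    by (rule LIMSEQ_le_const[OF tendsto_norm[OF den[OF that]]]) (use low[OF that] in auto)
  have row: "(\<lambda>r. row_term A (g (s r)) z i) \<longlonglongrightarrow> row_term A e z i" for i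
    unfolding row_term_eq
  proof (intro tendsto_diff tendsto_mult tendsto_const tendsto_sum tendsto_divide den)
    fix k assume "k \<in> {..<?N}"
    then show "k < ?N" "1 + ?\<rho> * e $ k \<noteq> 0" using low_e[of k] \<delta> by auto
  qed
  have nz: "row_term A e z i \<noteq> 0" for i by (rule row_term_inverse_bound(1)[OF Im_e z])
  have inv: "(\<lambda>r. 1 / row_term A (g (s r)) z i) \<longlonglongrightarrow> 1 / row_term A e z i" for i
    by (intro tendsto_divide tendsto_const row nz)
  have eqn: "e $ j = 1 / of_nat ?n * (\<Sum>i<?n. complex_of_real ((A $$ (i, j))\<^sup>2) / row_term A e z i)" if j: "j < ?N" for j
  proof -
    let ?d = "\<lambda>g. g $ j - 1 / of_nat ?n * (\<Sum>i<?n. complex_of_real ((A $$ (i, j))\<^sup>2) / row_term A g z i)"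
    have "(\<lambda>r. ?d (g (s r))) \<longlonglongrightarrow> ?d e"
      by (intro tendsto_diff lim j tendsto_mult tendsto_const tendsto_sum tendsto_divide row nz)
    moreover have "(\<lambda>r. ?d (g (s r))) \<longlonglongrightarrow> 0"
    proof (rule tendsto_norm_zero_cancel, rule tendsto_sandwich[of "\<lambda>_. 0" _ _ "\<lambda>r. E (s r)"])
      show "(\<lambda>r. E (s r)) \<longlonglongrightarrow> 0" using LIMSEQ_subseq_LIMSEQ[OF E s] by (simp add: comp_def)
    qed (use err[OF j] in auto)
    ultimately have "?d e = 0" by (rule LIMSEQ_unique)
    then show ?thesis by simp
  qed
  have pos: "Im (e $ j) > 0" if j: "j < ?N" and col: "col A j \<noteq> 0\<^sub>v ?n" for j
  proof -
    obtain i0 where i0: "i0 < ?n" "A $$ (i0, j) \<noteq> 0"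
    proof (rule ccontr)
      assume "\<not> thesis"
      then have "A $$ (i, j) = 0" if "i < ?n" for i using \<open>\<And>i0. i0 < ?n \<Longrightarrow> A $$ (i0, j) \<noteq> 0 \<Longrightarrow> thesis\<close> that by blast
      then have "col A j = 0\<^sub>v ?n" using j by (intro eq_vecI) auto
      with col show False ..
    qed
    have I: "Im (1 / row_term A e z i) > 0" for i
    proof -
      have "Im (row_term A e z i) < 0" using Im_row_term_le[of A e z i] Im_e z by fastforce
      moreover have "cmod (1 / row_term A e z i) > 0" using nz[of i] by simp
      ultimately show ?thesis unfolding Im_inverse_eq by (simp add: mult_neg_pos)
    qed
    have "Im (e $ j) = Im (complex_of_real (1 / real ?n) * (\<Sum>i<?n. complex_of_real ((A $$ (i, j))\<^sup>2) * (1 / row_term A e z i)))"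
      by (subst eqn[OF j]) simp
    also have "\<dots> = 1 / real ?n * (\<Sum>i<?n. (A $$ (i, j))\<^sup>2 * Im (1 / row_term A e z i))"
      by (simp only: times_complex.simps Re_complex_of_real Im_complex_of_real Im_sum) simp
    also have "(\<Sum>i<?n. (A $$ (i, j))\<^sup>2 * Im (1 / row_term A e z i)) > 0"
    proof (rule sum_pos2[of _ i0])
      show "0 < (A $$ (i0, j))\<^sup>2 * Im (1 / row_term A e z i0)" using i0(2) I[of i0] by simp
      show "0 \<le> (A $$ (i, j))\<^sup>2 * Im (1 / row_term A e z i)" for i using I[of i] by simp
    qed (use i0 in auto)
    then have "1 / real ?n * (\<Sum>i<?n. (A $$ (i, j))\<^sup>2 * Im (1 / row_term A e z i)) > 0" using dims by simp
    finally show ?thesis .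
  qed
  have "system_solution A z e"
    unfolding system_solution_def using eqn pos by (simp add: e_def)
  moreover have "(\<lambda>r. 1 / of_nat ?n * (\<Sum>i<?n. 1 / row_term A (g (s r)) z i)) \<longlonglongrightarrow>
      1 / of_nat ?n * (\<Sum>i<?n. 1 / row_term A e z i)"
    by (intro tendsto_mult tendsto_const tendsto_sum inv)
  ultimately show ?thesis using s by blast
qed

lemma e0_solution:
  assumes "dim_row A > 0" "dim_col A > 0" "Im z > 0" "system_solution A z e"
  shows "e0 A z = e"
  unfolding e0_def using system_solution_unique[OF assms(1-3)] assms(4) by (intro the_equality) auto

text \<open>The profile repeated in an \<open>r\<close> by \<open>r\<close> array of blocks. The system for the large profile reduces to that
  for \<open>A\<close> on periodic vectors, while the dimension grows with \<open>r\<close>.\<close>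
definition tile :: "nat \<Rightarrow> real mat \<Rightarrow> real mat" where
  "tile r A = Matrix.mat (r * dim_row A) (r * dim_col A) (\<lambda>(i, k). A $$ (i mod dim_row A, k mod dim_col A))"

lemma sum_mod_periodic:
  fixes f :: "nat \<Rightarrow> 'b::comm_semiring_1"
  shows "(\<Sum>i<r * n. f (i mod n)) = of_nat r * (\<Sum>i<n. f i)"
proof -
  have "(\<Sum>i<r * n. f (i mod n)) = (\<Sum>q<r. \<Sum>i = q * n..<q * n + n. f (i mod n))"
    by (rule sum.nat_group[symmetric])
  also have "\<dots> = (\<Sum>q<r. \<Sum>i<n. f i)"
  proof (rule sum.cong[OF refl])
    fix q
    have "(\<Sum>i = q * n..<q * n + n. f (i mod n)) = (\<Sum>i = 0..<n. f ((i + q * n) mod n))"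
      using sum.shift_bounds_nat_ivl[of "\<lambda>i. f (i mod n)" 0 "q * n" n] by (simp add: add.commute)
    also have "\<dots> = (\<Sum>i<n. f i)" by (intro sum.cong) auto
    finally show "(\<Sum>i = q * n..<q * n + n. f (i mod n)) = (\<Sum>i<n. f i)" .
  qed
  finally show ?thesis by simp
qed

lemma tile_index: "i < r * dim_row A \<Longrightarrow> k < r * dim_col A \<Longrightarrow> tile r A $$ (i, k) = A $$ (i mod dim_row A, k mod dim_col A)"
  by (simp add: tile_def)

lemma row_term_tile:
  assumes r: "r > 0" and f: "\<And>k. k < r * dim_col A \<Longrightarrow> f $ k = g $ (k mod dim_col A)" and i: "i < r * dim_row A"
  shows "row_term (tile r A) f z i = row_term A g z (i mod dim_row A)"
proof -
  let ?n = "dim_row A" and ?N = "dim_col A"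
  have d: "dim_row (tile r A) = r * ?n" "dim_col (tile r A) = r * ?N" by (simp_all add: tile_def)
  let ?F = "\<lambda>k. complex_of_real ((A $$ (i mod ?n, k))\<^sup>2) * (1 / (1 + of_nat ?n / of_nat ?N * g $ k))"
  have q: "of_nat (r * ?n) / of_nat (r * ?N) = (of_nat ?n / of_nat ?N :: complex)" using r by simp
  have "(\<Sum>k<r * ?N. complex_of_real ((tile r A $$ (i, k))\<^sup>2) * (1 / (1 + of_nat (r * ?n) / of_nat (r * ?N) * f $ k))) =
      (\<Sum>k<r * ?N. ?F (k mod ?N))"
    unfolding q by (intro sum.cong refl) (use i f in \<open>simp add: tile_index\<close>)
  also have "\<dots> = of_nat r * (\<Sum>k<?N. ?F k)" by (rule sum_mod_periodic)
  finally show ?thesis unfolding row_term_eq d using r by simp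
qed

text \<open>Independent random signs: centred entries of variance one, bounded by one.\<close>
definition signs :: "nat \<Rightarrow> nat \<Rightarrow> (nat \<times> nat \<Rightarrow> complex) pmf" where
  "signs n N = Pi_pmf ({..<n} \<times> {..<N}) 0 (\<lambda>_. pmf_of_set {1, -1})"

lemma expectation_signs:
  assumes "j < n" "k < N"
  shows "(LINT \<omega>|measure_pmf (signs n N). f (\<omega> (j, k))) = (f 1 + f (-1) :: 'b :: {banach, second_countable_topology}) /\<^sub>R 2"
proof -
  have "(LINT \<omega>|measure_pmf (signs n N). f (\<omega> (j, k))) = (LINT x|measure_pmf (map_pmf (\<lambda>\<omega>. \<omega> (j, k)) (signs n N)). f x)"
    by (simp add: integral_map_pmf)
  also have "map_pmf (\<lambda>\<omega>. \<omega> (j, k)) (signs n N) = pmf_of_set {1, -1}"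
    unfolding signs_def using assms by (subst Pi_pmf_component) auto
  also have "(LINT x|measure_pmf (pmf_of_set {1, -1}). f x) = (f 1 + f (-1)) /\<^sub>R 2"
    by (subst integral_measure_pmf[of "{1, -1 :: complex}"]) (auto simp: scaleR_add_right)
  finally show ?thesis .
qed

lemma sign_model:
  assumes n: "n > 0" and N: "N > 0" and z: "Im z > 0" and c: "c > 0" and A: "A \<in> carrier_mat n N"
    and b: "\<And>j k. j < n \<Longrightarrow> k < N \<Longrightarrow> \<bar>A $$ (j, k)\<bar> \<le> c"
  shows "sample_model (measure_pmf (signs n N)) n N (\<lambda>\<omega>. Matrix.mat n N \<omega>) A c z"
proof -
  have "prob_space.indep_vars (measure_pmf (signs n N)) (\<lambda>_. count_space UNIV) (\<lambda>x f. f x) ({..<n} \<times> {..<N})"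
    unfolding signs_def by (rule indep_vars_Pi_pmf) simp
  then have "prob_space.indep_vars (measure_pmf (signs n N)) (\<lambda>_. borel :: complex measure) (\<lambda>x f. f x) ({..<n} \<times> {..<N})"
    by (rule prob_space.indep_vars_compose2[OF prob_space_measure_pmf]) simp
  then have ind: "prob_space.indep_vars (measure_pmf (signs n N)) (\<lambda>_. borel) (\<lambda>jk \<omega>. Matrix.mat n N \<omega> $$ jk) ({..<n} \<times> {..<N})"
    by (subst prob_space.indep_vars_cong[OF prob_space_measure_pmf refl, where Y = "\<lambda>x f. f x" and N' = "\<lambda>_. borel"]) auto
  show ?thesis
  proof (rule sample_model.intro[OF prob_space_measure_pmf sample_model_axioms.intro])
    show "(LINT \<omega>|measure_pmf (signs n N). Matrix.mat n N \<omega> $$ (j, k)) = 0" if "j < n" "k < N" for j k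
      using that expectation_signs[OF that, of "\<lambda>x. x"] by simp
    show "(LINT \<omega>|measure_pmf (signs n N). (cmod (Matrix.mat n N \<omega> $$ (j, k)))\<^sup>2) = 1" if "j < n" "k < N" for j k
      using that expectation_signs[OF that, of "\<lambda>x. (cmod x)\<^sup>2"] by simp
    show "Matrix.mat n N \<omega> \<in> carrier_mat n N" for \<omega> by simp
  qed (fact n N z c ind A b)+
qed

lemma sign_lindeberg:
  assumes m: "sample_model (measure_pmf (signs n N)) n N (\<lambda>\<omega>. Matrix.mat n N \<omega>) A c z" and h: "h * sqrt n > 1"
  shows "sample_model.lindeberg_sum (measure_pmf (signs n N)) n N (\<lambda>\<omega>. Matrix.mat n N \<omega>) h = 0"
proof -
  have "(LINT \<omega>|measure_pmf (signs n N). (cmod (Matrix.mat n N \<omega> $$ (j, k)))\<^sup>2 *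
      of_bool (cmod (Matrix.mat n N \<omega> $$ (j, k)) \<ge> h * sqrt (real n))) = 0" if "j < n" "k < N" for j k
    using that h expectation_signs[of j n k N "\<lambda>x. (cmod x)\<^sup>2 * of_bool (cmod x \<ge> h * sqrt (real n))"] by simp
  then show ?thesis unfolding sample_model.lindeberg_sum_def[OF m] by simp
qed

text \<open>The mean spectral distribution, whose Stieltjes transform is the mean of the Stieltjes transforms.\<close>
definition expected_spectral :: "nat \<Rightarrow> nat \<Rightarrow> real mat \<Rightarrow> real measure" where
  "expected_spectral n N A = distr (measure_pmf (bind_pmf (signs n N) (\<lambda>\<omega>. spectral_pmf (sample_mat A (Matrix.mat n N \<omega>))))) borel (\<lambda>x. x)"

lemma stieltjes_expected_spectral:
  assumes A: "A \<in> carrier_mat n N" and n: "n > 0"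
  shows "stieltjes_transform (expected_spectral n N A) z =
    (LINT \<omega>|measure_pmf (signs n N). stieltjes_transform (spectral_measure (sample_mat A (Matrix.mat n N \<omega>))) z)"
proof -
  let ?k = "\<lambda>x::real. 1 / (complex_of_real x - z)"
  let ?p = "\<lambda>\<omega>. spectral_pmf (sample_mat A (Matrix.mat n N \<omega>))"
  have k: "?k \<in> borel_measurable borel" by measurable
  have fin: "finite (set_pmf (signs n N))"
    unfolding signs_def by (subst set_Pi_pmf) (auto intro!: finite_PiE_dflt)
  have fin2: "finite (set_pmf (?p \<omega>))" for \<omega>
  proof -
    have "size (proots (char_poly (sample_mat A (Matrix.mat n N \<omega>)))) = n"
      by (rule char_poly_proots_size[OF sample_mat_carrier[OF A]])
    then have "proots (char_poly (sample_mat A (Matrix.mat n N \<omega>))) \<noteq> {#}" using n by auto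
    then show ?thesis unfolding spectral_pmf_def by (simp add: set_pmf_of_multiset)
  qed
  have dp: "stieltjes_transform (distr (measure_pmf p) borel (\<lambda>x. x)) z = measure_pmf.expectation p ?k" for p
    unfolding stieltjes_transform_def by (subst integral_distr) (use k in auto)
  have "stieltjes_transform (expected_spectral n N A) z = measure_pmf.expectation (bind_pmf (signs n N) ?p) ?k"
    unfolding expected_spectral_def dp ..
  also have "\<dots> = (\<Sum>\<omega>\<in>set_pmf (signs n N). pmf (signs n N) \<omega> *\<^sub>R measure_pmf.expectation (?p \<omega>) ?k)"
    by (rule pmf_expectation_bind[OF fin fin2 order_refl])
  also have "\<dots> = (LINT \<omega>|measure_pmf (signs n N). measure_pmf.expectation (?p \<omega>) ?k)"
    by (subst integral_measure_pmf[OF fin]) auto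
  finally show ?thesis unfolding spectral_measure_def dp .
qed

text \<open>The vector \<open>approx\<close> of the tiled model is periodic because its components depend on the columns of the profile only;
  one period of it is the approximate solution for \<open>A\<close>.\<close>
lemma tile_approximation:
  assumes A: "A \<in> carrier_mat n N" and n: "n > 0" and N: "N > 0" and z: "Im z > 0" and c: "c > 0"
    and b: "\<And>j k. j < n \<Longrightarrow> k < N \<Longrightarrow> \<bar>A $$ (j, k)\<bar> \<le> c" and r: "r > 0"
  defines "E \<equiv> c\<^sup>2 / Im z * (cmod z / Im z + real n / real N * c\<^sup>2 / Im z * (cmod z / Im z)\<^sup>2) *
    (((sqrt 2 + 2) / sqrt n + 16 * sqrt N / n) * sqrt (inverse (real r)) + 1 / n * inverse (real r))"
  shows "\<exists>g. (\<forall>k<N. Im (g $ k) \<ge> 0 \<and> cmod (g $ k) \<le> c\<^sup>2 / Im z \<and>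
        cmod (1 + of_nat n / of_nat N * g $ k) \<ge> Im z / cmod z \<and>
        cmod (g $ k - 1 / of_nat n * (\<Sum>i<n. complex_of_real ((A $$ (i, k))\<^sup>2) / row_term A g z i)) \<le> c\<^sup>2 / Im z * E) \<and>
      cmod (stieltjes_transform (expected_spectral (r * n) (r * N) (tile r A)) z -
        1 / of_nat n * (\<Sum>i<n. 1 / row_term A g z i)) \<le> 1 / Im z * E"
proof -
  have d: "dim_row A = n" "dim_col A = N" using A by auto
  let ?n = "r * n" and ?N = "r * N" and ?A = "tile r A"
  have A': "?A \<in> carrier_mat ?n ?N" by (simp add: tile_def d)
  have m: "sample_model (measure_pmf (signs ?n ?N)) ?n ?N (\<lambda>\<omega>. Matrix.mat ?n ?N \<omega>) ?A c z"
  proof (rule sign_model)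
    show "\<bar>?A $$ (j, k)\<bar> \<le> c" if "j < ?n" "k < ?N" for j k
      using that b[of "j mod n" "k mod N"] n N by (simp add: tile_index d)
  qed (use A' n N r z c in auto)
  interpret sm: sample_model "measure_pmf (signs ?n ?N)" ?n ?N "\<lambda>\<omega>. Matrix.mat ?n ?N \<omega>" ?A c z by (rule m)
  (* The level h * sqrt n equals 2 and the signs have modulus one, so the Lindeberg sum vanishes. *)
  define h where "h = 2 / sqrt ?n"
  have "0 < ?n" using n r by simp
  then have sq: "sqrt ?n > 0" by (simp only: real_sqrt_gt_0_iff of_nat_0_less_iff)
  have h2: "h * sqrt ?n = 2" by (rule nonzero_eq_divide_eq[THEN iffD1, OF less_imp_neq[OF sq, symmetric] h_def])
  have h: "h > 0" "h * sqrt ?n > 1" unfolding h2 unfolding h_def using sq by (auto intro: divide_pos_pos simp del: of_nat_mult)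
  have ir: "sqrt (inverse (real r)) = 1 / sqrt r" by (simp add: real_sqrt_inverse divide_inverse)
  have "sqrt (real ?N) / real ?n = sqrt N / n * sqrt (inverse (real r))"
  proof -
    have "real ?n = sqrt r * (sqrt r * real n)" by (simp add: mult.assoc[symmetric])
    then have "sqrt (real ?N) / real ?n = sqrt r * sqrt N / (sqrt r * (sqrt r * real n))" by (simp only: of_nat_mult real_sqrt_mult)
    also have "\<dots> = sqrt N / (sqrt r * real n)" using r by (intro nonzero_mult_divide_mult_cancel_left) simp
    finally show ?thesis unfolding ir by (simp add: mult.commute)
  qed
  then have N1: "16 * sqrt (real ?N) / real ?n = 16 * sqrt N / n * sqrt (inverse (real r))" by simp
  have "sm.defect h = ((sqrt 2 + 2) / sqrt n + 16 * sqrt N / n) * sqrt (inverse (real r)) + 1 / n * inverse (real r)"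
    unfolding sm.defect_def sign_lindeberg[OF m h(2)] N1 unfolding h_def ir
    by (simp add: real_sqrt_mult divide_inverse algebra_simps)
  moreover have "sm.err_factor = c\<^sup>2 / Im z * (cmod z / Im z + real n / real N * c\<^sup>2 / Im z * (cmod z / Im z)\<^sup>2)"
    unfolding sm.err_factor_def using r by simp
  ultimately have E: "sm.err_factor * sm.defect h = E" unfolding E_def by simp
  define g where "g = Matrix.vec N (\<lambda>k. sm.approx $ k)"
  have per: "sm.approx $ k = g $ (k mod N)" if "k < ?N" for k
  proof -
    have kN: "k mod N < N" "k mod N < ?N" using N r by (auto intro: less_le_trans[OF mod_less_divisor])
    have "?A $$ (i, k) = ?A $$ (i, k mod N)" if "i < ?n" for i
      using that \<open>k < ?N\<close> kN by (simp add: tile_index d)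
    then show ?thesis using that kN unfolding g_def sm.approx_def by simp
  qed
  note row = row_term_tile[OF r, of A sm.approx g, unfolded d, OF per]
  have gk: "g $ k = sm.approx $ k" "k < ?N" if "k < N" for k
  proof -
    have "1 * N \<le> r * N" using r by (intro mult_le_mono1) simp
    then show "k < ?N" using that by linarith
    show "g $ k = sm.approx $ k" using that by (simp add: g_def)
  qed
  have q: "of_nat ?n / of_nat ?N = (of_nat n / of_nat N :: complex)" using r by simp
  have avg: "1 / of_nat ?n * (\<Sum>i<?n. F (i mod n)) = 1 / of_nat n * (\<Sum>i<n. F i)" for F :: "nat \<Rightarrow> complex"
    unfolding sum_mod_periodic using r by simp
  note props = sm.approx_properties[OF h(1), unfolded E q]
  have eqn: "1 / of_nat ?n * (\<Sum>i<?n. complex_of_real ((?A $$ (i, k))\<^sup>2) / row_term ?A sm.approx z i) =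
      1 / of_nat n * (\<Sum>i<n. complex_of_real ((A $$ (i, k))\<^sup>2) / row_term A g z i)" if k: "k < N" for k
  proof -
    have "(\<Sum>i<?n. complex_of_real ((?A $$ (i, k))\<^sup>2) / row_term ?A sm.approx z i) =
        (\<Sum>i<?n. complex_of_real ((A $$ (i mod n, k))\<^sup>2) / row_term A g z (i mod n))"
      by (intro sum.cong refl) (use gk(2)[OF k] k in \<open>simp add: row tile_index d\<close>)
    then show ?thesis using avg[of "\<lambda>i. complex_of_real ((A $$ (i, k))\<^sup>2) / row_term A g z i"] by simp
  qed
  have tr: "1 / of_nat ?n * (\<Sum>i<?n. 1 / row_term ?A sm.approx z i) = 1 / of_nat n * (\<Sum>i<n. 1 / row_term A g z i)"
  proof -
    have "(\<Sum>i<?n. 1 / row_term ?A sm.approx z i) = (\<Sum>i<?n. 1 / row_term A g z (i mod n))"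
      by (intro sum.cong refl) (simp add: row)
    then show ?thesis using avg[of "\<lambda>i. 1 / row_term A g z i"] by simp
  qed
  have n': "?n > 0" using n r by simp
  have "cmod (stieltjes_transform (expected_spectral ?n ?N ?A) z - 1 / of_nat n * (\<Sum>i<n. 1 / row_term A g z i)) \<le> 1 / Im z * E"
    using props(5) unfolding tr stieltjes_expected_spectral[OF A' n'] sm.m_def .
  moreover have "Im (g $ k) \<ge> 0 \<and> cmod (g $ k) \<le> c\<^sup>2 / Im z \<and> cmod (1 + of_nat n / of_nat N * g $ k) \<ge> Im z / cmod z \<and>
      cmod (g $ k - 1 / of_nat n * (\<Sum>i<n. complex_of_real ((A $$ (i, k))\<^sup>2) / row_term A g z i)) \<le> c\<^sup>2 / Im z * E"
    if k: "k < N" for k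
    using props(1-4)[OF gk(2)[OF k]] unfolding eqn[OF k] gk(1)[OF k] by blast
  ultimately show ?thesis by blast
qed

text \<open>Existence at every \<open>z\<close>, by probability. The mean resolvents of the tiled sign matrices give approximate solutions for
  \<open>A\<close> with vanishing error, and a limit point of these is a solution. By uniqueness all limit points coincide, so the
  mean Stieltjes transforms converge along the whole sequence.\<close>
lemma deterministic_limit:
  assumes A: "A \<in> carrier_mat n N" and n: "n > 0" and N: "N > 0" and z: "Im z > 0"
  shows "\<exists>e. system_solution A z e"
    and "(\<lambda>r. stieltjes_transform (expected_spectral (Suc r * n) (Suc r * N) (tile (Suc r) A)) z) \<longlonglongrightarrow> G0 A z"
proof -
  have d: "dim_row A = n" "dim_col A = N" using A by auto
  define c where "c = 1 + (\<Sum>jk\<in>{..<n} \<times> {..<N}. \<bar>A $$ jk\<bar>)"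
  have c: "c > 0" unfolding c_def by (intro add_pos_nonneg sum_nonneg) auto
  have b: "\<bar>A $$ (j, k)\<bar> \<le> c" if "j < n" "k < N" for j k
    using member_le_sum[of "(j, k)" "{..<n} \<times> {..<N}" "\<lambda>jk. \<bar>A $$ jk\<bar>"] that unfolding c_def by simp
  define E where "E = (\<lambda>r. c\<^sup>2 / Im z * (cmod z / Im z + real n / real N * c\<^sup>2 / Im z * (cmod z / Im z)\<^sup>2) *
    (((sqrt 2 + 2) / sqrt n + 16 * sqrt N / n) * sqrt (inverse (real (Suc r))) + 1 / n * inverse (real (Suc r))))"
  have "E \<longlonglongrightarrow> c\<^sup>2 / Im z * (cmod z / Im z + real n / real N * c\<^sup>2 / Im z * (cmod z / Im z)\<^sup>2) *
    (((sqrt 2 + 2) / sqrt n + 16 * sqrt N / n) * sqrt 0 + 1 / n * 0)"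
    unfolding E_def by (intro tendsto_mult tendsto_add tendsto_const tendsto_real_sqrt LIMSEQ_inverse_real_of_nat)
  then have E: "E \<longlonglongrightarrow> 0" by simp
  let ?m = "\<lambda>r. stieltjes_transform (expected_spectral (Suc r * n) (Suc r * N) (tile (Suc r) A)) z"
  have "\<exists>g. (\<forall>k<N. Im (g $ k) \<ge> 0 \<and> cmod (g $ k) \<le> c\<^sup>2 / Im z \<and>
        cmod (1 + of_nat n / of_nat N * g $ k) \<ge> Im z / cmod z \<and>
        cmod (g $ k - 1 / of_nat n * (\<Sum>i<n. complex_of_real ((A $$ (i, k))\<^sup>2) / row_term A g z i)) \<le> c\<^sup>2 / Im z * E r) \<and>
      cmod (?m r - 1 / of_nat n * (\<Sum>i<n. 1 / row_term A g z i)) \<le> 1 / Im z * E r" for r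
    unfolding E_def by (rule tile_approximation[OF A n N z c b]) auto
  then obtain g where gg: "\<And>r. (\<forall>k<N. Im (g r $ k) \<ge> 0 \<and> cmod (g r $ k) \<le> c\<^sup>2 / Im z \<and>
        cmod (1 + of_nat n / of_nat N * g r $ k) \<ge> Im z / cmod z \<and>
        cmod (g r $ k - 1 / of_nat n * (\<Sum>i<n. complex_of_real ((A $$ (i, k))\<^sup>2) / row_term A (g r) z i)) \<le> c\<^sup>2 / Im z * E r) \<and>
      cmod (?m r - 1 / of_nat n * (\<Sum>i<n. 1 / row_term A (g r) z i)) \<le> 1 / Im z * E r"
    using choice[of "\<lambda>r g. (\<forall>k<N. Im (g $ k) \<ge> 0 \<and> cmod (g $ k) \<le> c\<^sup>2 / Im z \<and>
        cmod (1 + of_nat n / of_nat N * g $ k) \<ge> Im z / cmod z \<and>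
        cmod (g $ k - 1 / of_nat n * (\<Sum>i<n. complex_of_real ((A $$ (i, k))\<^sup>2) / row_term A g z i)) \<le> c\<^sup>2 / Im z * E r) \<and>
      cmod (?m r - 1 / of_nat n * (\<Sum>i<n. 1 / row_term A g z i)) \<le> 1 / Im z * E r"] by blast
  then have g: "\<And>r k. k < N \<Longrightarrow> Im (g r $ k) \<ge> 0" "\<And>r k. k < N \<Longrightarrow> cmod (g r $ k) \<le> c\<^sup>2 / Im z"
      "\<And>r k. k < N \<Longrightarrow> cmod (1 + of_nat n / of_nat N * g r $ k) \<ge> Im z / cmod z"
      "\<And>r k. k < N \<Longrightarrow> cmod (g r $ k - 1 / of_nat n * (\<Sum>i<n. complex_of_real ((A $$ (i, k))\<^sup>2) / row_term A (g r) z i)) \<le> c\<^sup>2 / Im z * E r"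
    and gm: "\<And>r. cmod (?m r - 1 / of_nat n * (\<Sum>i<n. 1 / row_term A (g r) z i)) \<le> 1 / Im z * E r"
    by simp_all
  have E1: "(\<lambda>r. c\<^sup>2 / Im z * E r) \<longlonglongrightarrow> 0" and E2: "(\<lambda>r. 1 / Im z * E r) \<longlonglongrightarrow> 0"
    using tendsto_mult[OF tendsto_const[of "c\<^sup>2 / Im z"] E] tendsto_mult[OF tendsto_const[of "1 / Im z"] E] by simp_all
  have zp: "Im z / cmod z > 0" using z by (intro divide_pos_pos) auto
  have sub: "\<exists>s e. strict_mono s \<and> system_solution A z e \<and>
      (\<lambda>r. 1 / of_nat n * (\<Sum>i<n. 1 / row_term A (g (t (s r))) z i)) \<longlonglongrightarrow> 1 / of_nat n * (\<Sum>i<n. 1 / row_term A e z i)"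
    if t: "strict_mono t" for t :: "nat \<Rightarrow> nat"
    by (rule limit_solution[of A z "Im z / cmod z" "\<lambda>r. g (t r)" "c\<^sup>2 / Im z" "\<lambda>r. c\<^sup>2 / Im z * E (t r)", unfolded d,
      OF n N z zp g LIMSEQ_subseq_LIMSEQ[OF E1 t, unfolded comp_def]])
  show "\<exists>e. system_solution A z e" using sub[of "\<lambda>r. r"] by (auto simp: strict_mono_def)
  show "?m \<longlonglongrightarrow> G0 A z"
  proof (rule ccontr)
    assume "\<not> ?m \<longlonglongrightarrow> G0 A z"
    then obtain \<epsilon> t where \<epsilon>: "\<epsilon> > 0" and t: "strict_mono (t :: nat \<Rightarrow> nat)" and far: "\<And>k. dist (?m (t k)) (G0 A z) \<ge> \<epsilon>"
      by (rule not_tendsto_subseq) blast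
    obtain s e where s: "strict_mono s" and sol: "system_solution A z e"
      and lim: "(\<lambda>r. 1 / of_nat n * (\<Sum>i<n. 1 / row_term A (g (t (s r))) z i)) \<longlonglongrightarrow> 1 / of_nat n * (\<Sum>i<n. 1 / row_term A e z i)"
      using sub[OF t] by blast
    have "e0 A z = e" using e0_solution[of A z e] sol d n N z by simp
    then have G: "G0 A z = 1 / of_nat n * (\<Sum>i<n. 1 / row_term A e z i)" unfolding G0_def d by simp
    have "(\<lambda>r. ?m r - 1 / of_nat n * (\<Sum>i<n. 1 / row_term A (g r) z i)) \<longlonglongrightarrow> 0"
      by (rule tendsto_norm_zero_cancel, rule tendsto_sandwich[OF _ _ tendsto_const E2]) (use gm in auto)
    from LIMSEQ_subseq_LIMSEQ[OF LIMSEQ_subseq_LIMSEQ[OF this t] s]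
    have "(\<lambda>r. ?m (t (s r)) - 1 / of_nat n * (\<Sum>i<n. 1 / row_term A (g (t (s r))) z i)) \<longlonglongrightarrow> 0" unfolding comp_def .
    from tendsto_add[OF this lim] have "(\<lambda>r. ?m (t (s r))) \<longlonglongrightarrow> G0 A z" unfolding G by simp
    then have "eventually (\<lambda>r. dist (?m (t (s r))) (G0 A z) < \<epsilon>) sequentially" using \<epsilon> by (rule tendstoD)
    then obtain r where "dist (?m (t (s r))) (G0 A z) < \<epsilon>" unfolding eventually_sequentially by blast
    with far[of "s r"] show False by linarith
  qed
qed

text \<open>High up on the imaginary axis the components \<open>e\<^sub>k\<close> are small and the row terms differ from \<open>- z\<close>
  by at most \<open>2 c\<^sup>2\<close>.\<close>
lemma G0_at_infinity:
  assumes A: "A \<in> carrier_mat n N" and n: "n > 0" and N: "N > 0" and \<epsilon>: "\<epsilon> > 0"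
  shows "\<exists>y. (0::real) < y \<and> cmod (1 + \<i> * y * G0 A (\<i> * y)) < \<epsilon>"
proof -
  have d: "dim_row A = n" "dim_col A = N" using A by auto
  define c where "c = 1 + (\<Sum>jk\<in>{..<n} \<times> {..<N}. \<bar>A $$ jk\<bar>)"
  have c: "c > 0" unfolding c_def by (intro add_pos_nonneg sum_nonneg) auto
  have b: "(A $$ (j, k))\<^sup>2 \<le> c\<^sup>2" if "j < n" "k < N" for j k
  proof -
    have "\<bar>A $$ (j, k)\<bar> \<le> c"
      using member_le_sum[of "(j, k)" "{..<n} \<times> {..<N}" "\<lambda>jk. \<bar>A $$ jk\<bar>"] that unfolding c_def by simp
    then show ?thesis using c by (intro abs_le_square_iff[THEN iffD1]) simp
  qed
  define \<rho> where "\<rho> = real n / real N"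
  have \<rho>: "\<rho> > 0" using n N by (simp add: \<rho>_def)
  (* the first summand keeps 1 + \<rho> * e k above 1/2, the second makes 2 * c^2 / y less than \<epsilon> *)
  define y where "y = 2 * \<rho> * c\<^sup>2 + 2 * c\<^sup>2 / \<epsilon> + 1"
  have y: "y > 0" "y \<ge> 2 * \<rho> * c\<^sup>2" "y > 2 * c\<^sup>2 / \<epsilon>"
    using \<rho> \<epsilon> zero_le_power2[of c] unfolding y_def by (auto intro!: add_nonneg_pos add_nonneg_nonneg divide_nonneg_pos)
  define z where "z = \<i> * complex_of_real y"
  have z: "Im z = y" "Im z > 0" "cmod z = y" using y by (auto simp: z_def norm_mult)
  obtain e where sol: "system_solution A z e" using deterministic_limit(1)[OF A n N z(2)] by blast
  have "e0 A z = e" using e0_solution[of A z e] sol d n N z by simp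
  then have G: "G0 A z = 1 / of_nat n * (\<Sum>i<n. 1 / row_term A e z i)" unfolding G0_def d by simp
  note Ime = solution_Im_nonneg[OF sol]
  have r: "row_term A e z i \<noteq> 0" "cmod (1 / row_term A e z i) \<le> 1 / y" for i
    using row_term_inverse_bound[OF Ime z(2)] unfolding z(1) by auto
  have ek: "cmod (e $ k) \<le> c\<^sup>2 / y" if k: "k < N" for k
  proof -
    have "cmod (e $ k) = cmod (\<Sum>i<n. complex_of_real ((A $$ (i, k))\<^sup>2) * (1 / row_term A e z i)) / n"
      using sol k unfolding system_solution_def d by (simp add: norm_divide)
    also have "cmod (\<Sum>i<n. complex_of_real ((A $$ (i, k))\<^sup>2) * (1 / row_term A e z i)) \<le> (\<Sum>i<n. c\<^sup>2 * (1 / y))"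
    proof (rule sum_norm_le)
      fix i assume "i \<in> {..<n}"
      then have "(A $$ (i, k))\<^sup>2 * cmod (1 / row_term A e z i) \<le> c\<^sup>2 * (1 / y)"
        using b k r(2) by (intro mult_mono) auto
      then show "cmod (complex_of_real ((A $$ (i, k))\<^sup>2) * (1 / row_term A e z i)) \<le> c\<^sup>2 * (1 / y)"
        by (simp add: norm_mult norm_divide norm_power)
    qed
    finally show ?thesis using n by (simp add: divide_right_mono)
  qed
  have pk: "cmod (1 / (1 + of_nat n / of_nat N * e $ k)) \<le> 2" if k: "k < N" for k
  proof -
    have q: "cmod (of_nat n / of_nat N * e $ k) = \<rho> * cmod (e $ k)" by (simp add: norm_mult norm_divide \<rho>_def)
    have "\<rho> * cmod (e $ k) \<le> \<rho> * (c\<^sup>2 / y)" using ek[OF k] \<rho> by (intro mult_left_mono) auto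
    also have "\<dots> \<le> 1 / 2" using y by (simp add: pos_divide_le_eq)
    finally have "cmod (of_nat n / of_nat N * e $ k) \<le> 1 / 2" unfolding q .
    moreover have "1 \<le> cmod (1 + of_nat n / of_nat N * e $ k) + cmod (of_nat n / of_nat N * e $ k)"
      using norm_triangle_ineq4[of "1 + of_nat n / of_nat N * e $ k" "of_nat n / of_nat N * e $ k"] by simp
    ultimately have "1 / 2 \<le> cmod (1 + of_nat n / of_nat N * e $ k)" by linarith
    then have "1 / cmod (1 + of_nat n / of_nat N * e $ k) \<le> 1 / (1 / 2)" by (intro divide_left_mono) auto
    then show ?thesis by (simp only: norm_divide norm_one) simp
  qed
  have rz: "cmod (row_term A e z i + z) \<le> 2 * c\<^sup>2" if i: "i < n" for i
  proof -
    have "cmod (row_term A e z i + z) = cmod (\<Sum>k<N. complex_of_real ((A $$ (i, k))\<^sup>2) * (1 / (1 + of_nat n / of_nat N * e $ k))) / N"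
      unfolding row_term_eq d by (simp add: norm_divide)
    also have "cmod (\<Sum>k<N. complex_of_real ((A $$ (i, k))\<^sup>2) * (1 / (1 + of_nat n / of_nat N * e $ k))) \<le> (\<Sum>k<N. c\<^sup>2 * 2)"
    proof (rule sum_norm_le)
      fix k assume "k \<in> {..<N}"
      then have k: "k < N" by simp
      have "(A $$ (i, k))\<^sup>2 * cmod (1 / (1 + of_nat n / of_nat N * e $ k)) \<le> c\<^sup>2 * 2"
        using b[OF i k] pk[OF k] by (intro mult_mono) auto
      then show "cmod (complex_of_real ((A $$ (i, k))\<^sup>2) * (1 / (1 + of_nat n / of_nat N * e $ k))) \<le> c\<^sup>2 * 2"
        by (simp only: norm_mult norm_of_real abs_power2)
    qed
    finally show ?thesis using N by (simp add: divide_right_mono)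
  qed
  have "1 + z * G0 A z = (\<Sum>i<n. (row_term A e z i + z) * (1 / row_term A e z i)) / of_nat n"
  proof -
    have "(\<Sum>i<n. (row_term A e z i + z) * (1 / row_term A e z i)) = (\<Sum>i<n. 1 + z * (1 / row_term A e z i))"
      by (intro sum.cong refl) (simp add: distrib_right r(1) add_divide_distrib)
    also have "\<dots> = of_nat n + z * (\<Sum>i<n. 1 / row_term A e z i)" by (simp add: sum.distrib sum_distrib_left)
    finally show ?thesis unfolding G using n by (simp add: add_divide_distrib)
  qed
  also have "cmod \<dots> = cmod (\<Sum>i<n. (row_term A e z i + z) * (1 / row_term A e z i)) / n" by (simp add: norm_divide)
  also have "cmod (\<Sum>i<n. (row_term A e z i + z) * (1 / row_term A e z i)) \<le> (\<Sum>i<n. 2 * c\<^sup>2 * (1 / y))"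
    by (rule sum_norm_le) (use rz r(2) in \<open>auto simp only: norm_mult lessThan_iff intro!: mult_mono norm_ge_zero\<close>, simp)
  finally have "cmod (1 + z * G0 A z) \<le> 2 * c\<^sup>2 / y" using n by (simp add: divide_right_mono)
  also have "\<dots> < \<epsilon>" using y \<epsilon> by (simp add: pos_divide_less_eq mult.commute)
  finally show ?thesis using y(1) unfolding z_def by blast
qed

text \<open>\<open>G0\<close> is a limit of transforms of probability measures along which no mass escapes.\<close>
lemma deterministic_equivalent:
  assumes A: "A \<in> carrier_mat n N" and n: "n > 0" and N: "N > 0"
  obtains \<mu> where "real_distribution \<mu>" "F0 A = cdf \<mu>" "\<And>z. Im z > 0 \<Longrightarrow> stieltjes_transform \<mu> z = G0 A z"
proof -
  have "\<exists>\<mu>. real_distribution \<mu> \<and> (\<forall>z. Im z > 0 \<longrightarrow> stieltjes_transform \<mu> z = G0 A z)"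
  proof (rule stieltjes_continuity)
    show "real_distribution (expected_spectral (Suc r * n) (Suc r * N) (tile (Suc r) A))" for r
      unfolding expected_spectral_def by (rule real_distribution_pmf)
  qed (use deterministic_limit(2)[OF A n N] G0_at_infinity[OF A n N] in auto)
  then obtain \<mu> where \<mu>: "real_distribution \<mu>" "\<forall>z. Im z > 0 \<longrightarrow> stieltjes_transform \<mu> z = G0 A z" by blast
  have "(THE \<mu>. real_distribution \<mu> \<and> (\<forall>z. Im z > 0 \<longrightarrow> stieltjes_transform \<mu> z = G0 A z)) = \<mu>"
    by (rule the_equality) (use \<mu> stieltjes_unique in auto)
  then show ?thesis using \<mu> that unfolding F0_def by blast
qed

section \<open>Almost sure convergence\<close>

text \<open>For each \<open>n\<close> a parameter is chosen that minimises \<open>T \<epsilon> n\<close> up to \<open>1/n\<close>.\<close>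
lemma diagonal_choice:
  fixes T :: "real \<Rightarrow> nat \<Rightarrow> real"
  assumes nonneg: "\<And>\<epsilon> n. \<epsilon> > 0 \<Longrightarrow> n \<ge> 1 \<Longrightarrow> T \<epsilon> n \<ge> 0"
    and small: "\<And>\<delta>. \<delta> > 0 \<Longrightarrow> \<exists>\<epsilon>>0. eventually (\<lambda>n. T \<epsilon> n < \<delta>) sequentially"
  shows "\<exists>\<epsilon>. (\<forall>n. \<epsilon> n > 0) \<and> (\<lambda>n. T (\<epsilon> n) n) \<longlonglongrightarrow> 0"
proof -
  have "\<exists>\<epsilon>>0. n \<ge> 1 \<longrightarrow> (\<forall>\<epsilon>'>0. T \<epsilon> n < T \<epsilon>' n + 1 / real n)" for n
  proof (cases "n \<ge> 1")
    case True
    let ?V = "(\<lambda>\<epsilon>. T \<epsilon> n) ` {0<..}"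
    have bdd: "bdd_below ?V" using nonneg[OF _ True] by (intro bdd_belowI[of _ 0]) auto
    have "Inf ?V < Inf ?V + 1 / real n" using True by simp
    then have "\<exists>x\<in>?V. x < Inf ?V + 1 / real n" by (subst (asm) cInf_less_iff) (use bdd in auto)
    then obtain \<epsilon> where \<epsilon>: "\<epsilon> > 0" "T \<epsilon> n < Inf ?V + 1 / real n" by auto
    have "Inf ?V \<le> T \<epsilon>' n" if "\<epsilon>' > 0" for \<epsilon>' by (rule cInf_lower[OF _ bdd]) (use that in auto)
    with \<epsilon> show ?thesis by (intro exI[of _ \<epsilon>]) fastforce
  qed (auto intro: exI[of _ 1])
  then obtain \<epsilon> where \<epsilon>: "\<And>n. \<epsilon> n > 0" "\<And>n \<epsilon>'. n \<ge> 1 \<Longrightarrow> \<epsilon>' > 0 \<Longrightarrow> T (\<epsilon> n) n < T \<epsilon>' n + 1 / real n"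
    using choice[of "\<lambda>n \<epsilon>. \<epsilon> > 0 \<and> (n \<ge> 1 \<longrightarrow> (\<forall>\<epsilon>'>0. T \<epsilon> n < T \<epsilon>' n + 1 / real n))"] by blast
  have "(\<lambda>n. T (\<epsilon> n) n) \<longlonglongrightarrow> 0"
  proof (rule tendstoI)
    fix \<delta> :: real assume \<delta>: "\<delta> > 0"
    obtain \<epsilon>' where \<epsilon>': "\<epsilon>' > 0" "eventually (\<lambda>n. T \<epsilon>' n < \<delta> / 2) sequentially" using small[of "\<delta> / 2"] \<delta> by auto
    have "eventually (\<lambda>n. 1 / real n < \<delta> / 2) sequentially"
      by (rule order_tendstoD(2)[OF lim_1_over_n]) (use \<delta> in simp)
    then show "eventually (\<lambda>n. dist (T (\<epsilon> n) n) 0 < \<delta>) sequentially"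
      using \<epsilon>'(2) eventually_ge_at_top[of 1]
    proof eventually_elim
      case (elim n)
      then show ?case using \<epsilon>(2)[of n \<epsilon>'] \<epsilon>'(1) nonneg[OF \<epsilon>(1), of n n] by simp
    qed
  qed
  then show ?thesis using \<epsilon>(1) by blast
qed

lemma stieltjes_agree_off_cross:
  assumes A: "A \<in> carrier_mat n N" and A': "A' \<in> carrier_mat n N" and X: "X \<in> carrier_mat n N"
    and n: "n > 0" and N: "N > 0" and z: "Im z > 0"
    and Er: "Er \<subseteq> {..<n}" and Ec: "Ec \<subseteq> {..<N}" and size: "real (card Er + card Ec) \<le> \<epsilon> * real n"
    and agree: "\<And>i k. i \<in> {..<n} - Er \<Longrightarrow> k \<in> {..<N} - Ec \<Longrightarrow> A $$ (i, k) = A' $$ (i, k)"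
  shows "cmod (stieltjes_transform (spectral_measure (sample_mat A X)) z - stieltjes_transform (spectral_measure (sample_mat A' X)) z) \<le> 2 * \<epsilon> / Im z"
proof -
  define y where "y A k i = complex_of_real (A $$ (i, k) / sqrt N) * X $$ (i, k)" for A k i
  define S where "S A = (\<Sum>i<n. resolvent n (gram {..<N} (y A)) z i i)" for A
  have st: "stieltjes_transform (spectral_measure (sample_mat A X)) z = S A / of_nat n" if "A \<in> carrier_mat n N" for A
    unfolding S_def y_def by (rule stieltjes_sample[OF that X N n z])
  have y: "y A k i = y A' k i" if "k \<in> {..<N} - Ec" "i \<in> {..<n} - Er" for k i
    unfolding y_def agree[OF that(2,1)] ..
  have "S A - S A' = (\<Sum>i<n. resolvent n (gram {..<N} (y A)) z i i - resolvent n (gram {..<N} (y A')) z i i)"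
    unfolding S_def by (rule sum_subtractf[symmetric])
  then have "cmod (S A - S A') \<le> 2 * (card Er + card Ec) / Im z"
    using gram_perturbation_trace[OF z finite_lessThan finite_subset[OF Ec finite_lessThan] Er y] by (simp only:)
  also have "\<dots> \<le> 2 * (\<epsilon> * real n) / Im z"
    using size z by (intro divide_right_mono) auto
  finally have "cmod (S A - S A') / real n \<le> 2 * (\<epsilon> * real n) / Im z / real n"
    by (rule divide_right_mono) simp
  also have "\<dots> = 2 * \<epsilon> / Im z" using n by simp
  finally show ?thesis unfolding st[OF A] st[OF A'] diff_divide_distrib[symmetric] by (simp add: norm_divide)
qed

locale sample_sequence = prob_space M for M :: "'a measure" +
  fixes N :: "nat \<Rightarrow> nat" and X :: "nat \<Rightarrow> 'a \<Rightarrow> complex mat" and a b :: real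
  assumes N_pos: "\<And>n. n \<ge> 1 \<Longrightarrow> N n \<ge> 1"
    and a: "a > 0" "eventually (\<lambda>n. a \<le> real n / real (N n)) sequentially"
    and b: "b > 0" "eventually (\<lambda>n. real n / real (N n) \<le> b) sequentially"
    and X_dim: "\<And>n \<omega>. n \<ge> 1 \<Longrightarrow> \<omega> \<in> space M \<Longrightarrow> X n \<omega> \<in> carrier_mat n (N n)"
    and X_indep: "\<And>n. n \<ge> 1 \<Longrightarrow> indep_vars (\<lambda>_. borel) (\<lambda>jk \<omega>. X n \<omega> $$ jk) ({..<n} \<times> {..<N n})"
    and X_mean: "\<And>n j k. n \<ge> 1 \<Longrightarrow> j < n \<Longrightarrow> k < N n \<Longrightarrow> (LINT \<omega>|M. X n \<omega> $$ (j, k)) = 0"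
    and X_var: "\<And>n j k. n \<ge> 1 \<Longrightarrow> j < n \<Longrightarrow> k < N n \<Longrightarrow> (LINT \<omega>|M. (cmod (X n \<omega> $$ (j, k)))\<^sup>2) = 1"
    and lindeberg: "\<And>h. h > 0 \<Longrightarrow>
      (\<lambda>n. 1 / (real n * real (N n)) *
         (\<Sum>j<n. \<Sum>k<N n. LINT \<omega>|M. (cmod (X n \<omega> $$ (j, k)))\<^sup>2 *
            of_bool (cmod (X n \<omega> $$ (j, k)) \<ge> h * sqrt (real n)))) \<longlonglongrightarrow> 0"
begin

definition st :: "(nat \<Rightarrow> real mat) \<Rightarrow> complex \<Rightarrow> nat \<Rightarrow> 'a \<Rightarrow> complex" where
  "st A z n \<omega> = stieltjes_transform (spectral_measure (sample_mat (A n) (X n \<omega>))) z"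

definition bounded_profile :: "real \<Rightarrow> (nat \<Rightarrow> real mat) \<Rightarrow> bool" where
  "bounded_profile c A \<longleftrightarrow> c > 0 \<and> (\<forall>n\<ge>1. A n \<in> carrier_mat n (N n) \<and> (\<forall>j<n. \<forall>k<N n. \<bar>A n $$ (j, k)\<bar> \<le> c))"

lemma profile_model:
  assumes "bounded_profile c A" "n \<ge> 1" "Im z > 0"
  shows "sample_model M n (N n) (X n) (A n) c z"
proof (rule sample_model.intro[OF prob_space_axioms sample_model_axioms.intro])
  show "0 < N n" using N_pos[OF assms(2)] by simp
  show "0 < n" using assms(2) by simp
  show "c > 0" "A n \<in> carrier_mat n (N n)" using assms(1,2) unfolding bounded_profile_def by auto
  show "\<bar>A n $$ (j, k)\<bar> \<le> c" if "j < n" "k < N n" for j k using assms(1,2) that unfolding bounded_profile_def by auto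
qed (use assms X_dim X_indep X_mean X_var in auto)

lemma ratio_N: "eventually (\<lambda>n. real (N n) / real n \<le> 1 / a) sequentially"
  using a(2) eventually_ge_at_top[of 1]
proof eventually_elim
  case (elim n)
  then have "real (N n) > 0" "real n > 0" using N_pos[of n] by auto
  with elim a(1) show ?case by (simp add: field_simps)
qed

text \<open>The fourth moments are summable, so the sum of the fourth powers is integrable and therefore almost surely finite.\<close>
lemma fluctuations_vanish:
  assumes A: "bounded_profile c A" and z: "Im z > 0"
  shows "AE \<omega> in M. (\<lambda>n. st A z n \<omega> - (LINT \<omega>|M. st A z n \<omega>)) \<longlonglongrightarrow> 0"
proof -
  let ?F = "\<lambda>n \<omega>. cmod (st A z n \<omega> - (LINT \<omega>|M. st A z n \<omega>))"
  obtain n0 where n0: "n0 \<ge> 1" "\<And>n. n \<ge> n0 \<Longrightarrow> real (N n) / real n \<le> 1 / a"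
    using eventually_conj[OF ratio_N eventually_ge_at_top[of 1]] unfolding eventually_sequentially by (meson order_refl order_trans)
  note model = profile_model[OF A _ z]
  have st_m: "st A z n = sample_model.m (X n) (A n) z" if "n \<ge> 1" for n
    using sample_model.m_def[OF model[OF that]] by (auto simp: st_def fun_eq_iff)
  have meas: "st A z n \<in> borel_measurable M" if "n \<ge> 1" for n
    unfolding st_m[OF that] by (rule sample_model.m_measurable[OF model[OF that]])
  have bound: "(\<integral>\<^sup>+\<omega>. ennreal (?F (n + n0) \<omega> ^ 4) \<partial>M) \<le> ennreal (65536 / (Im z) ^ 4 * (1 / a)\<^sup>2 * inverse (real (Suc n) ^ 2))" for n
  proof -
    have n1: "n + n0 \<ge> 1" using n0(1) by simp
    have "(\<integral>\<^sup>+\<omega>. ennreal (?F (n + n0) \<omega> ^ 4) \<partial>M) \<le> ennreal (65536 / (Im z) ^ 4 * (real (N (n + n0)) / real (n + n0) ^ 2)\<^sup>2)"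
      unfolding st_m[OF n1] by (rule sample_model.fourth_moment_m[OF model[OF n1]])
    also have "\<dots> \<le> ennreal (65536 / (Im z) ^ 4 * (1 / a * inverse (real (Suc n)))\<^sup>2)"
    proof (intro ennreal_leI mult_left_mono power_mono)
      have "real (N (n + n0)) / real (n + n0) ^ 2 = (real (N (n + n0)) / real (n + n0)) * inverse (real (n + n0))"
        by (simp add: power2_eq_square divide_inverse)
      also have "\<dots> \<le> 1 / a * inverse (real (Suc n))"
      proof (rule mult_mono)
        show "real (N (n + n0)) / real (n + n0) \<le> 1 / a" by (rule n0(2)) simp
        show "inverse (real (n + n0)) \<le> inverse (real (Suc n))" by (rule le_imp_inverse_le) (use n0(1) in auto)
      qed (use a(1) in auto)
      finally show "real (N (n + n0)) / real (n + n0) ^ 2 \<le> 1 / a * inverse (real (Suc n))" .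
    qed (use z in auto)
    also have "65536 / (Im z) ^ 4 * (1 / a * inverse (real (Suc n)))\<^sup>2 = 65536 / (Im z) ^ 4 * (1 / a)\<^sup>2 * inverse (real (Suc n) ^ 2)"
      by (simp only: power_mult_distrib power_inverse mult.assoc)
    finally show ?thesis .
  qed
  have summ: "summable (\<lambda>n. 65536 / (Im z) ^ 4 * (1 / a)\<^sup>2 * inverse (real (Suc n) ^ 2))"
    by (intro summable_mult) (subst summable_Suc_iff[where f = "\<lambda>n. inverse (real n ^ 2)"], rule inverse_power_summable, simp)
  have m4: "(\<lambda>\<omega>. ennreal (?F (n + n0) \<omega> ^ 4)) \<in> borel_measurable M" for n
  proof -
    have [measurable]: "st A z (n + n0) \<in> borel_measurable M" using n0(1) by (intro meas) simp
    show ?thesis by measurable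
  qed
  have "(\<integral>\<^sup>+\<omega>. (\<Sum>n. ennreal (?F (n + n0) \<omega> ^ 4)) \<partial>M) = (\<Sum>n. \<integral>\<^sup>+\<omega>. ennreal (?F (n + n0) \<omega> ^ 4) \<partial>M)"
    by (rule nn_integral_suminf[OF m4])
  also have "\<dots> \<le> (\<Sum>n. ennreal (65536 / (Im z) ^ 4 * (1 / a)\<^sup>2 * inverse (real (Suc n) ^ 2)))"
    by (intro suminf_le bound summableI)
  also have "\<dots> = ennreal (\<Sum>n. 65536 / (Im z) ^ 4 * (1 / a)\<^sup>2 * inverse (real (Suc n) ^ 2))"
    by (rule suminf_ennreal2[OF _ summ]) simp
  also have "\<dots> < \<infinity>" by simp
  finally have "(\<integral>\<^sup>+\<omega>. (\<Sum>n. ennreal (?F (n + n0) \<omega> ^ 4)) \<partial>M) \<noteq> \<infinity>" by simp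
  then have "AE \<omega> in M. (\<Sum>n. ennreal (?F (n + n0) \<omega> ^ 4)) \<noteq> \<infinity>"
    by (intro nn_integral_noteq_infinite borel_measurable_suminf_order m4)
  then show ?thesis
  proof eventually_elim
    case (elim \<omega>)
    then have "summable (\<lambda>n. ?F (n + n0) \<omega> ^ 4)" by (intro summable_suminf_not_top) auto
    then have lim: "(\<lambda>n. ?F (n + n0) \<omega> ^ 4) \<longlonglongrightarrow> 0" by (rule summable_LIMSEQ_zero)
    have "(\<lambda>n. ?F (n + n0) \<omega>) \<longlonglongrightarrow> 0"
    proof (rule LIMSEQ_I)
      fix \<epsilon> :: real assume \<epsilon>: "\<epsilon> > 0"
      then have "\<epsilon> ^ 4 > 0" by simp
      from order_tendstoD(2)[OF lim this] obtain k where k: "\<And>n. n \<ge> k \<Longrightarrow> ?F (n + n0) \<omega> ^ 4 < \<epsilon> ^ 4"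
        unfolding eventually_sequentially by blast
      have "?F (n + n0) \<omega> < \<epsilon>" if "n \<ge> k" for n
        by (rule power_less_imp_less_base[OF k[OF that]]) (use \<epsilon> in simp)
      then show "\<exists>no. \<forall>n\<ge>no. norm (?F (n + n0) \<omega> - 0) < \<epsilon>" by auto
    qed
    then have "(\<lambda>n. ?F n \<omega>) \<longlonglongrightarrow> 0" by (rule LIMSEQ_offset)
    then show ?case by (rule tendsto_norm_zero_cancel)
  qed
qed

text \<open>The defect tends to \<open>h\<close> by the Lindeberg condition, and \<open>h\<close> is arbitrary.\<close>
lemma expectation_converges:
  assumes A: "bounded_profile c A" and z: "Im z > 0"
    and v1: "Im z \<ge> 2 * b * c\<^sup>2" and v2: "(Im z)\<^sup>2 \<ge> 8 * b * c ^ 4"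
  shows "(\<lambda>n. (LINT \<omega>|M. st A z n \<omega>) - G0 (A n) z) \<longlonglongrightarrow> 0"
proof -
  have c: "c > 0" using A by (simp add: bounded_profile_def)
  define K where "K = c\<^sup>2 / Im z * (cmod z / Im z + b * c\<^sup>2 / Im z * (cmod z / Im z)\<^sup>2)"
  have zz: "cmod z / Im z > 0" using z by (intro divide_pos_pos) auto
  have K: "K > 0" unfolding K_def using c z zz b(1) by (intro mult_pos_pos add_pos_nonneg divide_pos_pos mult_nonneg_nonneg divide_nonneg_pos) auto
  define lind where "lind h n = 1 / (real n * real (N n)) * (\<Sum>j<n. \<Sum>k<N n. LINT \<omega>|M. (cmod (X n \<omega> $$ (j, k)))\<^sup>2 *
            of_bool (cmod (X n \<omega> $$ (j, k)) \<ge> h * sqrt (real n)))" for h n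
  define df where "df h n = sqrt 2 / sqrt n + h + 1 / n + 16 * sqrt (N n) / n + 2 * lind h n" for h and n :: nat
  have main: "eventually (\<lambda>n. cmod ((LINT \<omega>|M. st A z n \<omega>) - G0 (A n) z) \<le> 2 / Im z * (K * (2 * h))) sequentially" if h: "h > 0" for h
  proof -
    have s0: "(\<lambda>n. 1 / sqrt (real n)) \<longlonglongrightarrow> 0"
      using tendsto_real_sqrt[OF lim_1_over_n] by (simp add: real_sqrt_divide)
    have N0: "(\<lambda>n. sqrt (N n) / n) \<longlonglongrightarrow> 0"
    proof (rule tendsto_sandwich[of "\<lambda>_. 0" _ _ "\<lambda>n. sqrt (1 / a) * (1 / sqrt (real n))"])
      show "eventually (\<lambda>n. sqrt (N n) / n \<le> sqrt (1 / a) * (1 / sqrt n)) sequentially"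
        using ratio_N
      proof eventually_elim
        case (elim n)
        have "sqrt (N n) / n = sqrt (real (N n) / n) * (1 / sqrt n)"
          by (simp add: real_sqrt_divide real_div_sqrt divide_divide_eq_left)
        also have "\<dots> \<le> sqrt (1 / a) * (1 / sqrt n)" using elim by (intro mult_right_mono real_sqrt_le_mono) auto
        finally show ?case .
      qed
      show "(\<lambda>n. sqrt (1 / a) * (1 / sqrt n)) \<longlonglongrightarrow> 0" using tendsto_mult[OF tendsto_const s0] by simp
    qed auto
    have "(\<lambda>n. sqrt 2 * (1 / sqrt n) + h + 1 / real n + 16 * (sqrt (N n) / n) + 2 * lind h n) \<longlonglongrightarrow> sqrt 2 * 0 + h + 0 + 16 * 0 + 2 * 0"
      by (intro tendsto_add tendsto_mult tendsto_const s0 N0 lim_1_over_n lindeberg[OF h, folded lind_def])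
    then have "df h \<longlonglongrightarrow> h" unfolding df_def by simp
    from order_tendstoD(2)[OF this, of "2 * h"] have "eventually (\<lambda>n. df h n < 2 * h) sequentially" using h by simp
    with b(2) eventually_ge_at_top[of 1] show ?thesis
    proof eventually_elim
      case (elim n)
      note model = profile_model[OF A elim(2) z]
      interpret sm: sample_model M n "N n" "X n" "A n" c z by (rule model)
      have d: "dim_row (A n) = n" "dim_col (A n) = N n" using sm.A_dim by auto
      have st_m: "st A z n = sm.m" by (auto simp: st_def sm.m_def fun_eq_iff)
      have df: "sm.defect h = df h n" unfolding sm.defect_def df_def lind_def sm.lindeberg_sum_def ..
      have ef: "0 \<le> sm.err_factor" "sm.err_factor \<le> K"
      proof -
        show "0 \<le> sm.err_factor" unfolding sm.err_factor_def using c z zz sm.N by (intro mult_nonneg_nonneg add_nonneg_nonneg divide_nonneg_pos) auto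
        show "sm.err_factor \<le> K" unfolding sm.err_factor_def K_def using elim(1) c z
          by (intro mult_left_mono add_left_mono mult_right_mono divide_right_mono) auto
      qed
      have ed: "sm.err_factor * sm.defect h \<le> K * (2 * h)"
        using mult_left_mono[OF less_imp_le[OF elim(3)] ef(1)] mult_right_mono[OF ef(2), of "2 * h"] h unfolding df by linarith
      note props = sm.approx_properties[OF h]
      obtain e where sol: "system_solution (A n) z e" using deterministic_limit(1)[OF sm.A_dim sm.n sm.N z] by blast
      have "e0 (A n) z = e" using e0_solution[of "A n" z e] sol d sm.n sm.N z by simp
      then have G: "G0 (A n) z = 1 / of_nat n * (\<Sum>i<n. 1 / row_term (A n) e z i)" unfolding G0_def d by simp
      let ?\<rho> = "real n / real (N n)"
      have A2: "(A n $$ (i, k))\<^sup>2 \<le> c\<^sup>2" if "i < n" "k < N n" for i k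
        using sm.A_bound[OF that] c by (intro abs_le_square_iff[THEN iffD1]) simp
      have "2 * ?\<rho> * c\<^sup>2 \<le> 2 * b * c\<^sup>2" using elim(1) by (intro mult_right_mono mult_left_mono) auto
      then have w1: "2 * ?\<rho> * c\<^sup>2 \<le> Im z" using v1 by linarith
      have "8 * ?\<rho> * c ^ 4 \<le> 8 * b * c ^ 4" using elim(1) by (intro mult_right_mono mult_left_mono) auto
      then have w2: "8 * ?\<rho> * c ^ 4 \<le> (Im z)\<^sup>2" using v2 by linarith
      have "cmod (1 / of_nat n * (\<Sum>i<n. 1 / row_term (A n) sm.approx z i) - G0 (A n) z) \<le> c\<^sup>2 / Im z * (sm.err_factor * sm.defect h) / c\<^sup>2"
        unfolding G by (rule stability[of "A n", unfolded d, OF sm.n sm.N c z A2 w1 w2 sol props(1) props(2) props(4)])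
      also have "\<dots> = 1 / Im z * (sm.err_factor * sm.defect h)" using c by simp
      finally have s: "cmod (1 / of_nat n * (\<Sum>i<n. 1 / row_term (A n) sm.approx z i) - G0 (A n) z) \<le> 1 / Im z * (sm.err_factor * sm.defect h)" .
      have "cmod ((LINT \<omega>|M. st A z n \<omega>) - G0 (A n) z) \<le> 1 / Im z * (sm.err_factor * sm.defect h) + 1 / Im z * (sm.err_factor * sm.defect h)"
        unfolding st_m by (rule norm_diff_triangle_le[OF props(5) s])
      also have "\<dots> = 2 / Im z * (sm.err_factor * sm.defect h)" by simp
      also have "\<dots> \<le> 2 / Im z * (K * (2 * h))" using ed z by (intro mult_left_mono) auto
      finally show ?case .
    qed
  qed
  show ?thesis
  proof (rule tendstoI)
    fix \<epsilon> :: real assume \<epsilon>: "\<epsilon> > 0"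
    (* makes the bound of main equal to \<epsilon> / 2 *)
    define h where "h = \<epsilon> * Im z / (8 * K)"
    have h: "h > 0" using \<epsilon> z K by (simp add: h_def)
    have "2 / Im z * (K * (2 * h)) = \<epsilon> / 2" unfolding h_def using z K by simp
    from main[OF h, unfolded this] show "eventually (\<lambda>n. dist ((LINT \<omega>|M. st A z n \<omega>) - G0 (A n) z) 0 < \<epsilon>) sequentially"
      by eventually_elim (use \<epsilon> in \<open>simp add: dist_norm\<close>)
  qed
qed

text \<open>Almost sure convergence is available at countably many points far from the real axis, and these determine the convergence of the
  measures.\<close>
lemma bounded_profile_converges:
  assumes A: "bounded_profile c A" and f: "f ` {1..} = test_functions"
  shows "AE \<omega> in M. (\<lambda>n. df_metric f (spectral_df (sample_mat (A n) (X n \<omega>))) (F0 (A n))) \<longlonglongrightarrow> 0"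
proof -
  have c: "c > 0" and dim: "\<And>n. n \<ge> 1 \<Longrightarrow> A n \<in> carrier_mat n (N n)" using A by (auto simp: bounded_profile_def)
  (* large enough for stability at every z with Im z >= v; as v >= 1, also v^2 >= 8 * b * c^4 *)
  define v where "v = 2 * b * c\<^sup>2 + 8 * b * c ^ 4 + 1"
  have v: "v > 0" "v \<ge> 2 * b * c\<^sup>2" "v \<ge> 8 * b * c ^ 4" "v \<ge> 1"
    using b(1) c unfolding v_def by (auto intro!: add_nonneg_pos add_nonneg_nonneg)
  have "AE \<omega> in M. \<forall>j. (\<lambda>n. st A (Complex 0 (v + 1 / real (Suc j))) n \<omega> - G0 (A n) (Complex 0 (v + 1 / real (Suc j)))) \<longlonglongrightarrow> 0"
  proof (subst AE_all_countable, rule allI)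
    fix j
    let ?z = "Complex 0 (v + 1 / real (Suc j))"
    have "1 / real (Suc j) > 0" by simp
    moreover have "Im ?z = v + 1 / real (Suc j)" by simp
    ultimately have z: "Im ?z > 0" "Im ?z \<ge> v" using v(1) by linarith+
    have "v \<le> v\<^sup>2" using v(4) by (simp add: power2_eq_square)
    also have "\<dots> \<le> (Im ?z)\<^sup>2" using z v(1) by (intro power_mono) auto
    finally have "8 * b * c ^ 4 \<le> (Im ?z)\<^sup>2" using v(3) by linarith
    moreover have "2 * b * c\<^sup>2 \<le> Im ?z" using v(2) z by linarith
    ultimately have E: "(\<lambda>n. (LINT \<omega>|M. st A ?z n \<omega>) - G0 (A n) ?z) \<longlonglongrightarrow> 0"
      by (intro expectation_converges[OF A z(1)])
    from fluctuations_vanish[OF A z(1)]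
    show "AE \<omega> in M. (\<lambda>n. st A ?z n \<omega> - G0 (A n) ?z) \<longlonglongrightarrow> 0"
    proof eventually_elim
      case (elim \<omega>)
      from tendsto_add[OF elim E] show ?case by simp
    qed
  qed
  then show ?thesis
  proof eventually_elim
    case (elim \<omega>)
    (* sizes start at one, hence the shift of the index *)
    let ?B = "\<lambda>n. sample_mat (A (Suc n)) (X (Suc n) \<omega>)"
    have "\<exists>\<mu>. real_distribution \<mu> \<and> F0 (A (Suc n)) = cdf \<mu> \<and> (\<forall>z. Im z > 0 \<longrightarrow> stieltjes_transform \<mu> z = G0 (A (Suc n)) z)" for n
      by (rule deterministic_equivalent[OF dim[of "Suc n"]]) (use N_pos[of "Suc n"] in auto)
    then obtain \<mu> where \<mu>: "\<And>n. real_distribution (\<mu> n)" "\<And>n. F0 (A (Suc n)) = cdf (\<mu> n)"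
        "\<And>n z. Im z > 0 \<Longrightarrow> stieltjes_transform (\<mu> n) z = G0 (A (Suc n)) z"
      using choice[of "\<lambda>n \<mu>. real_distribution \<mu> \<and> F0 (A (Suc n)) = cdf \<mu> \<and> (\<forall>z. Im z > 0 \<longrightarrow> stieltjes_transform \<mu> z = G0 (A (Suc n)) z)"] by blast
    have lim: "(\<lambda>n. stieltjes_transform (spectral_measure (?B n)) z - stieltjes_transform (\<mu> n) z) \<longlonglongrightarrow> 0"
      if "z = Complex 0 (v + 1 / real (Suc j))" for j z
    proof -
      have "1 / real (Suc j) > 0" by simp
      moreover have "Im z = v + 1 / real (Suc j)" unfolding that by simp
      ultimately have "Im z > 0" using v(1) by linarith
      then show ?thesis using LIMSEQ_Suc[OF elim[rule_format, of j]] unfolding that st_def by (simp add: \<mu>(3))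
    qed
    have "(\<lambda>n. df_metric f (cdf (spectral_measure (?B n))) (cdf (\<mu> n))) \<longlonglongrightarrow> 0"
      by (rule df_metric_tendsto[OF real_distribution_spectral \<mu>(1) f
            stieltjes_convergence_extends[OF real_distribution_spectral \<mu>(1) v(1) lim]])
    moreover have "cdf (spectral_measure (?B n)) = spectral_df (?B n)" for n
      by (rule cdf_spectral[OF sample_mat_carrier[OF dim]]) auto
    ultimately have "(\<lambda>n. df_metric f (spectral_df (?B n)) (F0 (A (Suc n)))) \<longlonglongrightarrow> 0" by (simp add: \<mu>(2))
    then show ?case by (rule LIMSEQ_imp_Suc)
  qed
qed

end

lemma liminf_pos_bound:
  assumes "0 < liminf (\<lambda>n. ereal (f n))"
  shows "\<exists>a>0. eventually (\<lambda>n. a \<le> f n) sequentially"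
proof -
  obtain a where a: "0 < ereal a" "ereal a < liminf (\<lambda>n. ereal (f n))" using ereal_dense2[OF assms] by blast
  from less_LiminfD[OF a(2)] have "eventually (\<lambda>n. a \<le> f n) sequentially" by eventually_elim simp
  with a(1) show ?thesis by auto
qed

lemma limsup_finite_bound:
  assumes "limsup (\<lambda>n. ereal (f n)) < \<infinity>"
  shows "\<exists>b>0. eventually (\<lambda>n. f n \<le> b) sequentially"
proof -
  obtain b where b: "limsup (\<lambda>n. ereal (f n)) < ereal b" using ereal_dense2[OF assms] by blast
  from Limsup_lessD[OF b] have "eventually (\<lambda>n. f n \<le> max b 1) sequentially" by eventually_elim simp
  then show ?thesis by (intro exI[of _ "max b 1"]) simp
qed

theorem corollary1p2:
  fixes M :: "'a measure"
    and N :: "nat \<Rightarrow> nat"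
    and X :: "nat \<Rightarrow> 'a \<Rightarrow> complex mat"
    and D :: "nat \<Rightarrow> real mat"
    and \<eta> :: "nat \<Rightarrow> real"
    and Mb d :: "real \<Rightarrow> real"
    and f :: "nat \<Rightarrow> real \<Rightarrow> real"
  assumes "prob_space M"
    and N_pos: "\<And>n. n \<ge> 1 \<Longrightarrow> N n \<ge> 1"
    and ratio_liminf: "0 < liminf (\<lambda>n. ereal (real n / real (N n)))"
    and ratio_limsup: "limsup (\<lambda>n. ereal (real n / real (N n))) < \<infinity>"
    and X_dim: "\<And>n \<omega>. n \<ge> 1 \<Longrightarrow> \<omega> \<in> space M \<Longrightarrow> X n \<omega> \<in> carrier_mat n (N n)"
    and X_indep: "\<And>n. n \<ge> 1 \<Longrightarrow>
      prob_space.indep_vars M (\<lambda>_. borel) (\<lambda>jk \<omega>. X n \<omega> $$ jk) ({..<n} \<times> {..<N n})"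
    and X_mean: "\<And>n j k. n \<ge> 1 \<Longrightarrow> j < n \<Longrightarrow> k < N n \<Longrightarrow>
      (LINT \<omega>|M. X n \<omega> $$ (j, k)) = 0"
    and X_var: "\<And>n j k. n \<ge> 1 \<Longrightarrow> j < n \<Longrightarrow> k < N n \<Longrightarrow>
      (LINT \<omega>|M. (cmod (X n \<omega> $$ (j, k)))\<^sup>2) = 1"
    and lindeberg: "\<And>h. h > 0 \<Longrightarrow>
      (\<lambda>n. 1 / (real n * real (N n)) *
         (\<Sum>j<n. \<Sum>k<N n. LINT \<omega>|M. (cmod (X n \<omega> $$ (j, k)))\<^sup>2 *
            of_bool (cmod (X n \<omega> $$ (j, k)) \<ge> h * sqrt (real n)))) \<longlonglongrightarrow> 0"
    and \<eta>_pos: "\<And>n. n \<ge> 1 \<Longrightarrow> \<eta> n > 0"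
    and \<eta>_decr: "\<And>m n. 1 \<le> m \<Longrightarrow> m \<le> n \<Longrightarrow> \<eta> n \<le> \<eta> m"
    and \<eta>_lim: "\<eta> \<longlonglongrightarrow> 0"
    and lindeberg_\<eta>:
      "(\<lambda>n. 1 / ((\<eta> n)\<^sup>2 * real n * real (N n)) *
         (\<Sum>j<n. \<Sum>k<N n. LINT \<omega>|M. (cmod (X n \<omega> $$ (j, k)))\<^sup>2 *
            of_bool (cmod (X n \<omega> $$ (j, k)) \<ge> \<eta> n * sqrt (real n)))) \<longlonglongrightarrow> 0"
    and trunc_var: "\<exists>e>0. \<exists>c>0. \<forall>\<^sub>F n in sequentially.
      e < \<eta> n * sqrt (real n) \<and>
      (\<forall>j<n. \<forall>k<N n.
        (LINT \<omega>|M. (cmod (X n \<omega> $$ (j, k) * of_bool (cmod (X n \<omega> $$ (j, k)) \<le> e) -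
           (LINT \<omega>'|M. X n \<omega>' $$ (j, k) * of_bool (cmod (X n \<omega>' $$ (j, k)) \<le> e))))\<^sup>2) > c)"
    and D_dim: "\<And>n. n \<ge> 1 \<Longrightarrow> D n \<in> carrier_mat n (N n)"
    and D_nonneg: "\<And>n j k. n \<ge> 1 \<Longrightarrow> j < n \<Longrightarrow> k < N n \<Longrightarrow> D n $$ (j, k) \<ge> 0"
    and D_col: "\<And>n k. n \<ge> 1 \<Longrightarrow> k < N n \<Longrightarrow> col (D n) k \<noteq> 0\<^sub>v n"
    and Mb_pos: "\<And>\<epsilon>. \<epsilon> > 0 \<Longrightarrow> Mb \<epsilon> > 0"
    and D_bound: "\<And>\<epsilon> n. \<epsilon> > 0 \<Longrightarrow> n \<ge> 1 \<Longrightarrow>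
      \<exists>Er Ec. Er \<subseteq> {..<n} \<and> Ec \<subseteq> {..<N n} \<and>
        real (card Er + card Ec) \<le> \<epsilon> * real n \<and>
        (\<forall>j\<in>{..<n} - Er. \<forall>k\<in>{..<N n} - Ec. D n $$ (j, k) \<le> Mb \<epsilon>)"
    and d_ge: "\<And>\<epsilon>. \<epsilon> > 0 \<Longrightarrow> d \<epsilon> \<ge> Mb \<epsilon>"
    and f_enum: "f ` {1..} = test_functions"
  shows "AE \<omega> in M. \<exists>\<epsilon> :: nat \<Rightarrow> real. (\<forall>n. \<epsilon> n > 0) \<and>
    (\<lambda>n. df_metric f (spectral_df (sample_mat (D n) (X n \<omega>)))
                     (F0 (trunc_mat (d (\<epsilon> n)) (D n)))) \<longlonglongrightarrow> 0"
proof -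
  interpret prob_space M by fact
  obtain a where a: "a > 0" "eventually (\<lambda>n. a \<le> real n / real (N n)) sequentially" using liminf_pos_bound[OF ratio_liminf] by blast
  obtain b where b: "b > 0" "eventually (\<lambda>n. real n / real (N n) \<le> b) sequentially" using limsup_finite_bound[OF ratio_limsup] by blast
  interpret sample_sequence M N X a b
    by (rule sample_sequence.intro[OF prob_space_axioms sample_sequence_axioms.intro])
      (fact N_pos a b X_dim X_indep X_mean X_var lindeberg)+
  let ?A = "\<lambda>\<epsilon> n. trunc_mat (d \<epsilon>) (D n)"
  have d_pos: "d \<epsilon> > 0" if "\<epsilon> > 0" for \<epsilon> using Mb_pos[OF that] d_ge[OF that] by linarith
  have A_dim: "?A \<epsilon> n \<in> carrier_mat n (N n)" if "n \<ge> 1" for \<epsilon> n using D_dim[OF that] by (simp add: trunc_mat_def)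
  have A_entry: "?A \<epsilon> n $$ (j, k) = D n $$ (j, k) * of_bool (D n $$ (j, k) \<le> d \<epsilon>)" if "n \<ge> 1" "j < n" "k < N n" for \<epsilon> n j k
    using D_dim[OF that(1)] that by (simp add: trunc_mat_def)
  have profile: "bounded_profile (d \<epsilon>) (?A \<epsilon>)" if "\<epsilon> > 0" for \<epsilon>
    unfolding bounded_profile_def using d_pos[OF that] A_dim D_nonneg by (auto simp: A_entry)
  have "AE \<omega> in M. \<forall>k. (\<lambda>n. df_metric f (spectral_df (sample_mat (?A (1 / real (Suc k)) n) (X n \<omega>))) (F0 (?A (1 / real (Suc k)) n))) \<longlonglongrightarrow> 0"
    by (subst AE_all_countable, intro allI bounded_profile_converges[OF profile f_enum]) simp
  then show ?thesis
    using AE_space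
  proof eventually_elim
    case (elim \<omega>)
    let ?T = "\<lambda>\<epsilon> n. df_metric f (spectral_df (sample_mat (D n) (X n \<omega>))) (F0 (?A \<epsilon> n))"
    let ?S = "\<lambda>A n. spectral_measure (sample_mat A (X n \<omega>))"
    have cdf: "spectral_df (sample_mat A (X n \<omega>)) = cdf (?S A n)" if "A \<in> carrier_mat n (N n)" "n \<ge> 1" for A n
      by (rule cdf_spectral[OF sample_mat_carrier[OF that(1)], symmetric]) (use that in simp)
    have F0: "\<exists>\<mu>. real_distribution \<mu> \<and> F0 (?A \<epsilon> n) = cdf \<mu>" if "n \<ge> 1" for \<epsilon> n
      by (rule deterministic_equivalent[OF A_dim[OF that]]) (use N_pos[OF that] that in auto)
    have "\<exists>\<epsilon>. (\<forall>n. \<epsilon> n > 0) \<and> (\<lambda>n. ?T (\<epsilon> n) n) \<longlonglongrightarrow> 0"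
    proof (rule diagonal_choice)
      fix \<epsilon> :: real and n :: nat assume n: "n \<ge> 1"
      obtain \<mu> where \<mu>: "real_distribution \<mu>" "F0 (?A \<epsilon> n) = cdf \<mu>" using F0[OF n] by blast
      show "0 \<le> ?T \<epsilon> n" unfolding \<mu>(2) cdf[OF D_dim[OF n] n] by (rule df_metric_nonneg[OF real_distribution_spectral \<mu>(1) f_enum])
    next
      fix \<delta> :: real assume \<delta>: "\<delta> > 0"
      obtain \<kappa> where \<kappa>: "\<kappa> > 0" "\<forall>\<mu> \<nu>. real_distribution \<mu> \<longrightarrow> real_distribution \<nu> \<longrightarrow>
          (\<forall>z. Im z > 0 \<longrightarrow> cmod (stieltjes_transform \<mu> z - stieltjes_transform \<nu> z) \<le> \<kappa> / Im z) \<longrightarrow>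
          df_metric f (cdf \<mu>) (cdf \<nu>) < \<delta> / 2"
        by (rule exE[OF df_metric_uniform[OF f_enum half_gt_zero[OF \<delta>]]], erule conjE, rule that)
      (* only the cut-offs for \<epsilon> = 1 / Suc k are used, so that one null set serves them all *)
      obtain k where k: "inverse (real (Suc k)) < \<kappa> / 2" using reals_Archimedean[of "\<kappa> / 2"] \<kappa>(1) by auto
      define \<epsilon> where "\<epsilon> = 1 / real (Suc k)"
      have "\<epsilon> < \<kappa> / 2" using k unfolding \<epsilon>_def inverse_eq_divide .
      then have \<epsilon>: "\<epsilon> > 0" "2 * \<epsilon> \<le> \<kappa>" by (simp add: \<epsilon>_def, linarith)
      have "eventually (\<lambda>n. df_metric f (spectral_df (sample_mat (?A \<epsilon> n) (X n \<omega>))) (F0 (?A \<epsilon> n)) < \<delta> / 2) sequentially"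
        by (rule order_tendstoD(2)[OF elim(1)[rule_format, of k, folded \<epsilon>_def]]) (use \<delta> in simp)
      then have "eventually (\<lambda>n. ?T \<epsilon> n < \<delta>) sequentially"
        using eventually_ge_at_top[of 1]
      proof eventually_elim
        case n: (elim n)
        obtain \<mu> where \<mu>: "real_distribution \<mu>" "F0 (?A \<epsilon> n) = cdf \<mu>" using F0[OF n(2)] by blast
        obtain Er Ec where E: "Er \<subseteq> {..<n}" "Ec \<subseteq> {..<N n}" "real (card Er + card Ec) \<le> \<epsilon> * real n"
          "\<forall>j\<in>{..<n} - Er. \<forall>k\<in>{..<N n} - Ec. D n $$ (j, k) \<le> Mb \<epsilon>" using D_bound[OF \<epsilon>(1) n(2)] by blast
        have "cmod (stieltjes_transform (?S (D n) n) z - stieltjes_transform (?S (?A \<epsilon> n) n) z) \<le> \<kappa> / Im z" if z: "Im z > 0" for z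
        proof -
          have "cmod (stieltjes_transform (?S (D n) n) z - stieltjes_transform (?S (?A \<epsilon> n) n) z) \<le> 2 * \<epsilon> / Im z"
          proof (rule stieltjes_agree_off_cross[OF D_dim[OF n(2)] A_dim[OF n(2)] X_dim[OF n(2) elim(2)] _ _ z E(1-3)])
            fix i k assume ik: "i \<in> {..<n} - Er" "k \<in> {..<N n} - Ec"
            then have "D n $$ (i, k) \<le> Mb \<epsilon>" using E(4) by blast
            then have "D n $$ (i, k) \<le> d \<epsilon>" using d_ge[OF \<epsilon>(1)] by linarith
            then show "D n $$ (i, k) = ?A \<epsilon> n $$ (i, k)" using ik n(2) by (simp add: A_entry)
          qed (use n(2) N_pos[OF n(2)] in auto)
          also have "\<dots> \<le> \<kappa> / Im z" using \<epsilon>(2) z by (intro divide_right_mono) auto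
          finally show ?thesis .
        qed
        then have "df_metric f (cdf (?S (D n) n)) (cdf (?S (?A \<epsilon> n) n)) < \<delta> / 2"
          by (intro \<kappa>(2)[rule_format] real_distribution_spectral) simp
        moreover have "df_metric f (cdf (?S (D n) n)) (cdf \<mu>) \<le>
            df_metric f (cdf (?S (D n) n)) (cdf (?S (?A \<epsilon> n) n)) + df_metric f (cdf (?S (?A \<epsilon> n) n)) (cdf \<mu>)"
          by (rule df_metric_triangle[OF real_distribution_spectral real_distribution_spectral \<mu>(1) f_enum])
        ultimately show ?case
          using n(1) unfolding \<mu>(2) cdf[OF D_dim[OF n(2)] n(2)] cdf[OF A_dim[OF n(2)] n(2)] by linarith
      qed
      with \<epsilon>(1) show "\<exists>\<epsilon>>0. eventually (\<lambda>n. ?T \<epsilon> n < \<delta>) sequentially" by blast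
    qed
    then show ?case .
  qed
qed

end
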